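(* Let $n\geq 2$ and let $p$ be a prime. Then $$\zeta_{G_n,p}^{\leq}(s)=\zeta_p(s-1)\,\zeta_p(s-2)\cdots\zeta_p(s-n+1)\;\zeta_p(ns-n(n-1))\;W^\leq_{n-1}(\mathbf{X},\mathbf{Y},p),$$ where $$W^\leq_{n-1}(\mathbf{X},\mathbf{Y},p):=\sum_{I\subseteq\{1,\dots,n-2\}}b_{n-1,I}(p^{-1})\,W^\leq_{n-1,I}(\mathbf{X},\mathbf{Y}),$$ with $$W^\leq_{n-1,I}(\mathbf{X},\mathbf{Y}):=\underline{X_0}\prod_{i\in I}\underline{X_i}+\underline{Y_{n-1}}\prod_{i\in I}\underline{Y_i}+\sum_{j\in I}\Big(\prod_{i\in I,\, i\leq j}\underline{Y_i}\Big)\Big(\prod_{i\in I,\, i\geq j}\underline{X_i}\Big)+\sum_{j\in I\cup\{n-1\}}\Big(\prod_{i\in I,\, i< j}\underline{Y_i}\Big)\Big(\prod_{i\in I,\, i\geq j}\underline{X_i}\Big),$$ where $\underline{Z}:=\frac{Z}{1-Z}$, and the numerical data $\mathbf{X}=(X_0,\dots,X_{n-2})$, $\mathbf{Y}=(Y_1,\dots,Y_{n-1})$ is defined by $$Y_i := p^{-(n-i)s+(n+i)(n-1-i)},\quad 1\leq i\leq n-1,$$ $$X_i := \left(p^{-2s+(n+1+i)}\right)^{(n-1-i)},\quad 0\leq i\leq n-2.$$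
   Context: For $n\geq 2$, $G_n$ is the nilpotent group of class $2$ $$G_n := \langle x_1,\dots,x_{n},y_1,\dots,y_{n-1}\mid [x_i,x_n]=y_i,\ 1\leq i\leq n-1,\ \text{all other } [\,,] \text{ trivial}\rangle,$$ i.e. all other commutators of pairs of the generators $x_1,\dots,x_n,y_1,\dots,y_{n-1}$ are trivial. For a prime $p$, the local subgroup zeta function is the Dirichlet series $$\zeta_{G_n,p}^{\leq}(s):=\sum_{H\leq_p G_n}|G_n:H|^{-s},$$ where the sum runs over all subgroups $H$ of $G_n$ of finite $p$-power index (including $H=G_n$). The identity is one of Dirichlet series (power series in $p^{-s}$; equivalently of functions of $s$ for real part of $s$ sufficiently large). $\zeta_p(s)=\sum_{i=0}^\infty p^{-is}$ denotes the $p$-th factor of the Riemann zeta function. For $I\subseteq\{1,\dots,n-2\}$, $b_{n-1,I}(p)$ denotes the polynomial expression in $p$ giving the number of flags of type $I$ in $\mathbb{F}_p^{n-1}$, i.e. flags of subspaces whose set of dimensions is exactly $I$; $b_{n-1,I}(p^{-1})$ is this polynomial evaluated at $p^{-1}$. Empty products equal $1$ and empty sums equal $0$; for $n=2$ the set $\{1,\dots,n-2\}$ is empty. *)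

theory Defs
  imports
    "HOL-Analysis.Analysis"
    "HOL-Algebra.Coset"
    "Jordan_Normal_Form.Missing_VectorSpace"
    "HOL-Number_Theory.Residues"
    "HOL-Computational_Algebra.Polynomial"
begin

section \<open>Groups given by generators and relators\<close>

text \<open>A word is a list of letters; the letter \<open>(x, True)\<close> stands for the generator \<open>x\<close>
  and \<open>(x, False)\<close> for its formal inverse.\<close>

type_synonym 'a gword = "('a \<times> bool) list"

definition words :: "'a set \<Rightarrow> 'a gword set"
  where "words S = lists (S \<times> UNIV)"

inductive pres_eq :: "'a set \<Rightarrow> 'a gword set \<Rightarrow> 'a gword \<Rightarrow> 'a gword \<Rightarrow> bool"
  for S :: "'a set" and R :: "'a gword set"
where
  pres_refl: "w \<in> words S \<Longrightarrow> pres_eq S R w w"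
| pres_sym: "pres_eq S R u v \<Longrightarrow> pres_eq S R v u"
| pres_trans: "pres_eq S R u v \<Longrightarrow> pres_eq S R v w \<Longrightarrow> pres_eq S R u w"
| pres_cancel: "u \<in> words S \<Longrightarrow> v \<in> words S \<Longrightarrow> x \<in> S \<Longrightarrow>
    pres_eq S R (u @ [(x, b), (x, \<not> b)] @ v) (u @ v)"
| pres_relator: "u \<in> words S \<Longrightarrow> v \<in> words S \<Longrightarrow> r \<in> R \<Longrightarrow>
    pres_eq S R (u @ r @ v) (u @ v)"

definition pres_rel :: "'a set \<Rightarrow> 'a gword set \<Rightarrow> ('a gword \<times> 'a gword) set"
  where "pres_rel S R = {(u, v). pres_eq S R u v}"

definition presented_group :: "'a set \<Rightarrow> 'a gword set \<Rightarrow> 'a gword set monoid"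
  where "presented_group S R =
    \<lparr>carrier = words S // pres_rel S R,
     monoid.mult = (\<lambda>A B. \<Union>u\<in>A. \<Union>v\<in>B. pres_rel S R `` {u @ v}),
     one = pres_rel S R `` {[]}\<rparr>"

lemma words_append [simp]: "u @ v \<in> words S \<longleftrightarrow> u \<in> words S \<and> v \<in> words S"
  by (auto simp: words_def)

lemma words_Nil [simp]: "[] \<in> words S"
  by (auto simp: words_def)

lemma words_Cons [simp]: "a # w \<in> words S \<longleftrightarrow> fst a \<in> S \<and> w \<in> words S"
  by (cases a) (auto simp: words_def)

lemma pres_eq_words:
  assumes "R \<subseteq> words S" "pres_eq S R u v"
  shows "u \<in> words S \<and> v \<in> words S"
  using assms(2) by induction (use assms(1) in auto)

lemma pres_eq_context:
  assumes "pres_eq S R u v" "a \<in> words S" "b \<in> words S"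
  shows "pres_eq S R (a @ u @ b) (a @ v @ b)"
  using assms
proof (induction)
  case (pres_cancel u v x c)
  then show ?case
    using pres_eq.pres_cancel[of "a @ u" S "v @ b" x R c] by simp
next
  case (pres_relator u v r)
  then show ?case
    using pres_eq.pres_relator[of "a @ u" S "v @ b" r R] by simp
qed (auto intro: pres_eq.intros)

lemma pres_eq_append:
  assumes "R \<subseteq> words S" "pres_eq S R u u'" "pres_eq S R v v'"
  shows "pres_eq S R (u @ v) (u' @ v')"
proof -
  have "pres_eq S R (u @ v) (u' @ v)"
    using pres_eq_context[OF assms(2), of "[]" v] pres_eq_words[OF assms(1,3)] by simp
  moreover have "pres_eq S R (u' @ v) (u' @ v')"
    using pres_eq_context[OF assms(3), of u' "[]"] pres_eq_words[OF assms(1,2)] by simp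
  ultimately show ?thesis
    by (rule pres_trans)
qed

lemma equiv_pres_rel:
  assumes "R \<subseteq> words S"
  shows "equiv (words S) (pres_rel S R)"
  using pres_eq_words[OF assms]
  by (intro equivI) (auto simp: pres_rel_def refl_on_def sym_def trans_def intro: pres_eq.intros)

lemma presented_group_mult:
  assumes R: "R \<subseteq> words S" and "u \<in> words S" "v \<in> words S"
  shows "(pres_rel S R `` {u}) \<otimes>\<^bsub>presented_group S R\<^esub> (pres_rel S R `` {v})
    = pres_rel S R `` {u @ v}"
proof -
  have "(\<lambda>u v. pres_rel S R `` {u @ v}) respects2 pres_rel S R"
    by (rule congruent2I[OF equiv_pres_rel[OF R] equiv_pres_rel[OF R]];
        rule equiv_class_eq[OF equiv_pres_rel[OF R]])
       (auto simp: pres_rel_def pres_eq_words[OF R] intro: pres_eq_append[OF R] pres_refl)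
  from UN_equiv_class2[OF equiv_pres_rel[OF R] equiv_pres_rel[OF R] this assms(2,3)]
  show ?thesis
    by (simp add: presented_group_def)
qed

lemma presented_group_is_group:
  assumes R: "R \<subseteq> words S"
  shows "group (presented_group S R)"
proof -
  let ?c = "\<lambda>w. pres_rel S R `` {w}"
  let ?G = "presented_group S R"
  have carr: "carrier ?G = ?c ` words S"
    by (auto simp: presented_group_def quotient_def)
  have one: "\<one>\<^bsub>?G\<^esub> = ?c []"
    by (simp add: presented_group_def)
  note mult = presented_group_mult[OF R]
  let ?inv = "\<lambda>w. rev (map (\<lambda>(x, b). (x, \<not> b)) w)"
  have inv_words: "?inv w \<in> words S" if "w \<in> words S" for w
    using that by (induction w) auto
  have inv: "pres_eq S R (?inv w @ w) []" if "w \<in> words S" for w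
    using that
  proof (induction w)
    case Nil
    then show ?case by (simp add: pres_refl)
  next
    case (Cons a w)
    obtain x b where a: "a = (x, b)" by (cases a)
    have "pres_eq S R (?inv w @ [(x, \<not> b), (x, \<not> \<not> b)] @ w) (?inv w @ w)"
      using Cons.prems a by (intro pres_cancel inv_words) auto
    then show ?case
      using Cons a by (auto intro: pres_trans)
  qed
  show ?thesis
  proof (rule groupI)
    fix A assume "A \<in> carrier ?G"
    then obtain w where w: "A = ?c w" "w \<in> words S" by (auto simp: carr)
    have "?c (?inv w) \<otimes>\<^bsub>?G\<^esub> A = \<one>\<^bsub>?G\<^esub>"
      unfolding w(1) mult[OF inv_words[OF w(2)] w(2)] one
      by (rule equiv_class_eq[OF equiv_pres_rel[OF R]]) (simp add: pres_rel_def inv[OF w(2)])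
    then show "\<exists>B\<in>carrier ?G. B \<otimes>\<^bsub>?G\<^esub> A = \<one>\<^bsub>?G\<^esub>"
      using inv_words[OF w(2)] by (auto simp: carr)
  qed (auto simp: carr one mult)
qed


section \<open>The groups \<open>G\<^sub>n\<close>\<close>

datatype gen = Gx nat | Gy nat

definition G_gens :: "nat \<Rightarrow> gen set"
  where "G_gens n = Gx ` {1..n} \<union> Gy ` {1..n-1}"

text \<open>The convention is \<open>[a, b] = a\<^sup>-\<^sup>1 b\<^sup>-\<^sup>1 a b\<close>.\<close>

definition commutator_word :: "'a \<Rightarrow> 'a \<Rightarrow> 'a gword"
  where "commutator_word a b = [(a, False), (b, False), (a, True), (b, True)]"

definition G_relators :: "nat \<Rightarrow> gen gword set"
  where "G_relators n =
    {commutator_word (Gx i) (Gx n) @ [(Gy i, False)] | i. i \<in> {1..n-1}} \<union>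
    {commutator_word a b | a b. a \<in> G_gens n \<and> b \<in> G_gens n \<and>
       (\<forall>i\<in>{1..n-1}. {a, b} \<noteq> {Gx i, Gx n})}"

definition G :: "nat \<Rightarrow> gen gword set monoid"
  where "G n = presented_group (G_gens n) (G_relators n)"

lemma group_G:
  assumes "n \<ge> 1"
  shows "group (G n)"
  unfolding G_def
  by (rule presented_group_is_group)
     (use assms in \<open>auto simp: G_relators_def commutator_word_def G_gens_def\<close>)


section \<open>Local zeta functions\<close>

definition subgroup_index :: "('a, 'b) monoid_scheme \<Rightarrow> 'a set \<Rightarrow> nat"
  where "subgroup_index H K = card (rcosets\<^bsub>H\<^esub> K)"

text \<open>Infinite index gives \<open>subgroup_index H K = 0\<close>, which is not a power of \<open>p\<close>.\<close>

definition p_power_index_subgroups :: "('a, 'b) monoid_scheme \<Rightarrow> nat \<Rightarrow> 'a set set"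
  where "p_power_index_subgroups H p = {K. subgroup K H \<and> (\<exists>k. subgroup_index H K = p ^ k)}"

definition local_subgroup_zeta :: "('a, 'b) monoid_scheme \<Rightarrow> nat \<Rightarrow> complex \<Rightarrow> complex"
  where "local_subgroup_zeta H p s =
    (\<Sum>\<^sub>\<infinity>K\<in>p_power_index_subgroups H p. of_nat (subgroup_index H K) powr (- s))"

definition zeta_p :: "nat \<Rightarrow> complex \<Rightarrow> complex"
  where "zeta_p p s = suminf (\<lambda>i. of_nat p powr (- (of_nat i * s)))"


section \<open>Numbers of flags\<close>

definition Fp_space :: "nat \<Rightarrow> nat \<Rightarrow> (int, nat \<Rightarrow> int) module"
  where "Fp_space q m = ring.func_space (residue_ring (int q)) {..<m}"

lemma vectorspace_Fp_space:
  assumes "prime q"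
  shows "vectorspace (residue_ring (int q)) (Fp_space q m)"
proof -
  interpret residues_prime q "residue_ring (int q)"
    using assms by unfold_locales auto
  have "field (residue_ring (int q))"
    by (rule is_field)
  moreover have "module (residue_ring (int q)) (Fp_space q m)"
    unfolding Fp_space_def by (rule LinearCombinations.cring.func_space_is_module) (rule cring)
  ultimately show ?thesis
    by (simp add: vectorspace_def)
qed

definition Fp_dim :: "nat \<Rightarrow> nat \<Rightarrow> (nat \<Rightarrow> int) set \<Rightarrow> nat"
  where "Fp_dim q m U = vectorspace.dim (residue_ring (int q)) (Fp_space q m\<lparr>carrier := U\<rparr>)"

definition flags :: "nat \<Rightarrow> nat \<Rightarrow> nat set \<Rightarrow> (nat \<Rightarrow> int) set set set"
  where "flags q m I =
    {F. (\<forall>U\<in>F. subspace (residue_ring (int q)) U (Fp_space q m)) \<and>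
        chain\<^sub>\<subseteq> F \<and> Fp_dim q m ` F = I}"

text \<open>\<open>flag_poly m I\<close> is \<open>b\<^bsub>m,I\<^esub>\<close> as a polynomial. It is determined
  by its values at the infinitely many primes.\<close>

definition is_flag_poly :: "nat \<Rightarrow> nat set \<Rightarrow> complex poly \<Rightarrow> bool"
  where "is_flag_poly m I f \<longleftrightarrow>
    (\<forall>q::nat. prime q \<longrightarrow> poly f (of_nat q) = of_nat (card (flags q m I)))"

definition flag_poly :: "nat \<Rightarrow> nat set \<Rightarrow> complex poly"
  where "flag_poly m I = (THE f. is_flag_poly m I f)"

lemma is_flag_poly_unique:
  assumes "is_flag_poly m I f" "is_flag_poly m I g"
  shows "f = g"
proof -
  have "infinite ((of_nat :: nat \<Rightarrow> complex) ` {q. prime q})"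
    by (subst finite_image_iff) (auto simp: inj_on_def primes_infinite)
  moreover have "poly f x = poly g x" if "x \<in> of_nat ` {q::nat. prime q}" for x
    using assms that by (auto simp: is_flag_poly_def)
  ultimately have "infinite {x. poly (f - g) x = 0}"
    by (elim infinite_super[rotated]) auto
  then show ?thesis
    using poly_roots_finite[of "f - g"] by auto
qed


section \<open>The functions \<open>W\<close>\<close>

definition geo :: "complex \<Rightarrow> complex"
  where "geo Z = Z / (1 - Z)"

text \<open>The parameter \<open>m\<close> below is \<open>n - 1\<close>.\<close>

definition W_I :: "nat \<Rightarrow> nat set \<Rightarrow> (nat \<Rightarrow> complex) \<Rightarrow> (nat \<Rightarrow> complex) \<Rightarrow> complex"
  where "W_I m I X Y =
    geo (X 0) * (\<Prod>i\<in>I. geo (X i)) +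
    geo (Y m) * (\<Prod>i\<in>I. geo (Y i)) +
    (\<Sum>j\<in>I. (\<Prod>i\<in>{i\<in>I. i \<le> j}. geo (Y i)) * (\<Prod>i\<in>{i\<in>I. i \<ge> j}. geo (X i))) +
    (\<Sum>j\<in>I \<union> {m}. (\<Prod>i\<in>{i\<in>I. i < j}. geo (Y i)) * (\<Prod>i\<in>{i\<in>I. i \<ge> j}. geo (X i)))"

definition W :: "nat \<Rightarrow> nat \<Rightarrow> (nat \<Rightarrow> complex) \<Rightarrow> (nat \<Rightarrow> complex) \<Rightarrow> complex"
  where "W m p X Y =
    (\<Sum>I\<in>Pow {1..m-1}. poly (flag_poly m I) (inverse (of_nat p)) * W_I m I X Y)"

definition Y_data :: "nat \<Rightarrow> nat \<Rightarrow> complex \<Rightarrow> nat \<Rightarrow> complex"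
  where "Y_data n p s i =
    of_nat p powr (- of_nat (n - i) * s + of_nat ((n + i) * (n - 1 - i)))"

definition X_data :: "nat \<Rightarrow> nat \<Rightarrow> complex \<Rightarrow> nat \<Rightarrow> complex"
  where "X_data n p s i =
    (of_nat p powr (- 2 * s + of_nat (n + 1 + i))) ^ (n - 1 - i)"

end

theory Submission
  imports Defs "HOL-Library.Function_Algebras"
begin

text \<open>Put \<open>m = n - 1\<close> and \<open>L = \<int>\<^sup>m\<close>. Then \<open>G\<^sub>n\<close> is the semidirect product of \<open>L \<times> L\<close> by \<open>\<int>\<close>,
  where \<open>c\<close> acts by \<open>(u, w) \<mapsto> (u, w - c u)\<close>. A subgroup \<open>H\<close> of \<open>p\<close>-power index is given by
  \<open>K = H \<inter> (L \<times> L)\<close>, the exponent \<open>a\<close> for which \<open>H\<close> projects onto \<open>p\<^sup>a\<int>\<close>, and a coset of \<open>K\<close>;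
  the admissible \<open>K\<close> are those stable under \<open>p\<^sup>a\<close>. In turn \<open>K\<close> is given by \<open>M = K \<inter> (0 \<times> L)\<close>, its
  projection \<open>N\<close> to the first factor and a homomorphism from \<open>N\<close> to \<open>L/M\<close>, and stability means
  \<open>N \<subseteq> (M : p\<^sup>a)\<close>. Summing over the sublattices \<open>N\<close> of \<open>(M : p\<^sup>a)\<close> produces the factors
  \<open>\<zeta>\<^sub>p(s-1) \<dots> \<zeta>\<^sub>p(s-n+1)\<close>.

  For the remaining sum over \<open>(M, a)\<close>, attach to \<open>M\<close> the weakly increasing word of the dimensions
  of the images in \<open>L/pL\<close> of \<open>M\<close>, \<open>(M : p)\<close>, \<open>(M : p\<^sup>2)\<close>, and so on until \<open>L\<close> is reached. The number of \<open>M\<close> with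
  a given word is a flag number times a power of \<open>p\<close>, and the word of \<open>(M : p\<^sup>a)\<close> is obtained by
  dropping the first \<open>a\<close> letters. Hence each letter \<open>j\<close> contributes a factor \<open>Y\<^sub>j\<close> if it is among the first
  \<open>a\<close> and \<open>X\<^sub>j\<close> otherwise, and summing geometric series gives
  \<open>1/(1 - Y\<^sub>0)\<close> times \<open>W\<close>.\<close>

section \<open>Subgroups of finite index in abelian groups\<close>

text \<open>The exponents in the data arise as follows, with \<open>z = p^(-s)\<close>. Given
  \<open>(M, N, a)\<close> there are \<open>|L : M|^m\<close> homomorphisms from \<open>N\<close> to
  \<open>L/M\<close> and \<open>|L : M| |L : N|\<close> cosets of \<open>K\<close>. A basis of
  \<open>U = (M : p^a)\<close> identifies its sublattices \<open>N\<close> with those of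
  \<open>L\<close>, so the sum over \<open>N\<close> leaves
  \<open>p^((m+1) l(M) + l(U)) z^(l(M) + l(U) + a)\<close> for \<open>(M, a)\<close>, where
  \<open>l\<close> is the logarithm of the index in \<open>L\<close>. A letter \<open>j\<close> adds
  \<open>m - j\<close> to \<open>l(M)\<close>, again to \<open>l(U)\<close> if it survives, and
  accounts for one unit of \<open>a\<close> otherwise; the number of lattices adds
  \<open>p^(j(m-j))\<close>. This gives \<open>X_j\<close> and \<open>Y_j\<close>. Lattices are
  counted without elementary divisors: the fibres of \<open>M \<mapsto> (M : p)\<close> consist of
  subspaces over \<open>F_p\<close> that avoid a given one, so Gaussian binomials suffice. Their
  values at \<open>p\<close> are exchanged for those at \<open>1/p\<close> because only then does
  the remaining power of \<open>p\<close> split letter by letter. The lattice zeta function comes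
  from the same semidirect product argument, with trivial action and rank one lower.\<close>

definition addsub :: "'a::ab_group_add set \<Rightarrow> bool"
  where "addsub A \<longleftrightarrow> 0 \<in> A \<and> (\<forall>x\<in>A. \<forall>y\<in>A. x - y \<in> A)"

definition cosets :: "'a::ab_group_add set \<Rightarrow> 'a set \<Rightarrow> 'a set set"
  where "cosets A B = (\<lambda>x. (+) x ` B) ` A"

text \<open>An infinite index is 0 under this convention, so a positive index, and in particular a
  power of a prime, certifies finiteness.\<close>

definition idx :: "'a::ab_group_add set \<Rightarrow> 'a set \<Rightarrow> nat"
  where "idx A B = card (cosets A B)"

definition ssum :: "'a::ab_group_add set \<Rightarrow> 'a set \<Rightarrow> 'a set"
  where "ssum A B = (\<lambda>(a, b). a + b) ` (A \<times> B)"

lemma addsub_zero: "addsub A \<Longrightarrow> 0 \<in> A"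
  and addsub_diff: "addsub A \<Longrightarrow> x \<in> A \<Longrightarrow> y \<in> A \<Longrightarrow> x - y \<in> A"
  by (auto simp: addsub_def)

lemma addsub_uminus: "addsub A \<Longrightarrow> x \<in> A \<Longrightarrow> - x \<in> A"
  using addsub_diff[of A 0 x] addsub_zero by auto

lemma addsub_add: "addsub A \<Longrightarrow> x \<in> A \<Longrightarrow> y \<in> A \<Longrightarrow> x + y \<in> A"
  using addsub_diff[of A x "- y"] addsub_uminus by auto

lemma addsub_sum: "addsub A \<Longrightarrow> (\<And>i. i \<in> S \<Longrightarrow> f i \<in> A) \<Longrightarrow> sum f S \<in> A"
  by (induction S rule: infinite_finite_induct) (auto intro: addsub_add addsub_zero)

lemma addsub_minus_iff: "addsub A \<Longrightarrow> x - y \<in> A \<longleftrightarrow> y - x \<in> A"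
  using addsub_uminus[of A "x - y"] addsub_uminus[of A "y - x"] by auto

lemma addsub_Int: "addsub A \<Longrightarrow> addsub B \<Longrightarrow> addsub (A \<inter> B)"
  by (auto simp: addsub_def)

lemma addsub_vimage: "Modules.additive f \<Longrightarrow> addsub A \<Longrightarrow> addsub (f -` A)"
  by (auto simp: addsub_def Modules.additive.zero Modules.additive.diff)

lemma addsub_image:
  assumes "Modules.additive f" "addsub A"
  shows "addsub (f ` A)"
  unfolding addsub_def
proof safe
  show "0 \<in> f ` A" using assms by (metis Modules.additive.zero addsub_zero imageI)
  fix x y assume "x \<in> A" "y \<in> A"
  then show "f x - f y \<in> f ` A"
    using assms by (metis Modules.additive.diff addsub_diff imageI)
qed

lemma in_ssum: "x \<in> ssum A B \<longleftrightarrow> (\<exists>a\<in>A. \<exists>b\<in>B. x = a + b)"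
  by (auto simp: ssum_def)

lemma addsub_ssum:
  assumes "addsub A" "addsub B" shows "addsub (ssum A B)"
  unfolding addsub_def in_ssum
proof (intro conjI ballI)
  show "\<exists>a\<in>A. \<exists>b\<in>B. 0 = a + b" using assms addsub_zero by force
  fix x y assume "x \<in> ssum A B" "y \<in> ssum A B"
  then obtain a b a' b' where "a \<in> A" "a' \<in> A" "b \<in> B" "b' \<in> B" "x = a + b" "y = a' + b'"
    by (auto simp: in_ssum)
  then show "\<exists>a\<in>A. \<exists>b\<in>B. x - y = a + b"
    using assms by (intro bexI[of _ "a - a'"] bexI[of _ "b - b'"]) (auto intro: addsub_diff)
qed

lemma ssum_upper1: "addsub B \<Longrightarrow> A \<subseteq> ssum A B"
  using addsub_zero by (force simp: in_ssum)

lemma ssum_upper2: "addsub A \<Longrightarrow> B \<subseteq> ssum A B"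
  using addsub_zero by (force simp: in_ssum)

lemma ssum_least: "addsub C \<Longrightarrow> A \<subseteq> C \<Longrightarrow> B \<subseteq> C \<Longrightarrow> ssum A B \<subseteq> C"
  by (auto simp: in_ssum subset_iff intro: addsub_add)

lemma ssum_absorb: "addsub A \<Longrightarrow> addsub B \<Longrightarrow> B \<subseteq> A \<Longrightarrow> ssum A B = A"
  by (intro equalityI ssum_least ssum_upper1) auto

lemma coset_mem:
  "x \<in> (+) y ` B \<longleftrightarrow> x - y \<in> (B :: 'a::ab_group_add set)"
  by (force simp: image_iff)

lemma coset_eq_iff:
  assumes "addsub B"
  shows "(+) x ` B = (+) y ` B \<longleftrightarrow> x - y \<in> B"
proof
  assume "(+) x ` B = (+) y ` B"
  moreover have "x \<in> (+) x ` B" using addsub_zero[OF assms] by (force simp: image_iff)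
  ultimately show "x - y \<in> B" by (simp add: coset_mem)
next
  assume *: "x - y \<in> B"
  show "(+) x ` B = (+) y ` B"
  proof (rule Set.set_eqI)
    fix z
    have 1: "(z - x) + (x - y) = z - y" by simp
    have 2: "(z - y) - (x - y) = z - x" by simp
    show "z \<in> (+) x ` B \<longleftrightarrow> z \<in> (+) y ` B"
      using addsub_add[OF assms _ *, of "z - x", unfolded 1]
        addsub_diff[OF assms _ *, of "z - y", unfolded 2]
      unfolding coset_mem by blast
  qed
qed

lemma idx_self: "addsub A \<Longrightarrow> idx A A = 1"
proof -
  assume A: "addsub A"
  have "(+) x ` A = A" if "x \<in> A" for x
    using coset_eq_iff[OF A, of x 0] that by simp
  then have "cosets A A = {A}"
    unfolding cosets_def using addsub_zero[OF A] by (simp cong: image_cong) blast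
  then show ?thesis by (simp add: idx_def)
qed

text \<open>A representative in each coset of \<open>R\<close> splits every coset of
  \<open>P\<close> in a unique way, which is a bijection of coset sets. It also covers infinite
  indices, which both sides count as 0.\<close>

lemma idx_mult:
  assumes P: "addsub P" and R: "addsub R" and Q: "addsub Q" and "P \<subseteq> R" "R \<subseteq> Q"
  shows "idx Q P = idx Q R * idx R P"
proof -
  define s where "s C = (SOME x. x \<in> C)" for C :: "'a set"
  have s: "s C \<in> Q" "(+) (s C) ` R = C" if C: "C \<in> cosets Q R" for C
  proof -
    obtain x where x: "x \<in> Q" "C = (+) x ` R" using C by (auto simp: cosets_def)
    have "x \<in> C" using x addsub_zero[OF R] by (force simp: image_iff)
    then have sC: "s C \<in> C" unfolding s_def by (rule someI)
    then obtain r where "r \<in> R" "s C = x + r" using x by auto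
    then show "s C \<in> Q" using x Q \<open>R \<subseteq> Q\<close> by (auto intro: addsub_add)
    show "(+) (s C) ` R = C" using sC x by (simp add: coset_eq_iff[OF R] coset_mem)
  qed
  have tr: "(+) a ` (+) b ` P = (+) (a + b) ` P" for a b :: 'a
    by (auto simp: image_image add.assoc)
  have "bij_betw (\<lambda>(C, D). (+) (s C) ` D) (cosets Q R \<times> cosets R P) (cosets Q P)"
    unfolding bij_betw_def
  proof safe
    show "inj_on (\<lambda>(C, D). (+) (s C) ` D) (cosets Q R \<times> cosets R P)"
    proof (rule inj_onI, clarify)
      fix C D C' D' assume C: "C \<in> cosets Q R" "C' \<in> cosets Q R"
        and D: "D \<in> cosets R P" "D' \<in> cosets R P" and eq: "(+) (s C) ` D = (+) (s C') ` D'"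
      obtain d d' where d: "d \<in> R" "D = (+) d ` P" "d' \<in> R" "D' = (+) d' ` P"
        using D by (auto simp: cosets_def)
      have *: "s C + d - (s C' + d') \<in> P"
        using eq unfolding d tr by (simp add: coset_eq_iff[OF P])
      have "s C - s C' = (s C + d - (s C' + d')) + (d' - d)" by simp
      then have "s C - s C' \<in> R"
        using * d \<open>P \<subseteq> R\<close> addsub_add[OF R] addsub_diff[OF R] by (metis subsetD)
      then have "C = C'" using s[OF C(1)] s[OF C(2)] coset_eq_iff[OF R] by metis
      then show "C = C' \<and> D = D'" using * d coset_eq_iff[OF P] by simp
    qed
  next
    fix C D assume "C \<in> cosets Q R" "D \<in> cosets R P"
    then show "(+) (s C) ` D \<in> cosets Q P"
      using s \<open>R \<subseteq> Q\<close> Q by (auto simp: cosets_def tr intro!: imageI addsub_add)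
  next
    fix E assume "E \<in> cosets Q P"
    then obtain x where x: "x \<in> Q" "E = (+) x ` P" by (auto simp: cosets_def)
    define C where "C = (+) x ` R"
    have C: "C \<in> cosets Q R" using x by (auto simp: cosets_def C_def)
    have "x - s C \<in> R" using s(2)[OF C] C_def coset_eq_iff[OF R] addsub_minus_iff[OF R] by metis
    then have "(+) (x - s C) ` P \<in> cosets R P" by (auto simp: cosets_def)
    moreover have "E = (+) (s C) ` (+) (x - s C) ` P" by (simp add: tr x)
    ultimately show "E \<in> (\<lambda>(C, D). (+) (s C) ` D) ` (cosets Q R \<times> cosets R P)"
      using C by force
  qed
  from bij_betw_same_card[OF this] show ?thesis
    by (simp add: idx_def card_cartesian_product)
qed

text \<open>Second isomorphism theorem for indices, through the map
  \<open>C \<mapsto> ssum C B\<close> on cosets.\<close>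

lemma idx_ssum:
  assumes A: "addsub A" and B: "addsub B"
  shows "idx (ssum A B) B = idx A (A \<inter> B)"
proof -
  have "bij_betw (\<lambda>C. ssum C B) (cosets A (A \<inter> B)) (cosets (ssum A B) B)"
  proof -
    have 1: "ssum ((+) x ` (A \<inter> B)) B = (+) x ` B" for x
    proof safe
      fix y assume "y \<in> ssum ((+) x ` (A \<inter> B)) B"
      then show "y \<in> (+) x ` B" using B
        by (auto simp: in_ssum add.assoc intro!: imageI addsub_add)
    next
      fix b assume "b \<in> B"
      then show "x + b \<in> ssum ((+) x ` (A \<inter> B)) B"
        using addsub_zero[OF A] addsub_zero[OF B] by (force simp: in_ssum)
    qed
    have "inj_on (\<lambda>C. ssum C B) (cosets A (A \<inter> B))"
      by (auto simp: inj_on_def cosets_def 1 coset_eq_iff B coset_eq_iff[OF addsub_Int[OF A B]]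
          intro: addsub_diff[OF A])
    moreover have "cosets (ssum A B) B = (\<lambda>C. ssum C B) ` cosets A (A \<inter> B)"
    proof -
      have "cosets (ssum A B) B = (\<lambda>x. (+) x ` B) ` A"
      proof (safe, goal_cases)
        case (1 C)
        then obtain a b where "a \<in> A" "b \<in> B" "C = (+) (a + b) ` B"
          by (auto simp: cosets_def in_ssum)
        then show ?case by (auto simp: coset_eq_iff[OF B] image_iff intro!: bexI[of _ a])
      next
        case (2 C x)
        then show ?case using ssum_upper1[OF B, of A] by (auto simp: cosets_def)
      qed
      then show ?thesis by (simp add: cosets_def image_image 1)
    qed
    ultimately show ?thesis by (simp add: bij_betw_def)
  qed
  from bij_betw_same_card[OF this] show ?thesis by (simp add: idx_def)
qed

lemma idx_image:
  assumes f: "Modules.additive f" "inj_on f A" and A: "addsub A" and B: "addsub B" "B \<subseteq> A"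
  shows "idx (f ` A) (f ` B) = idx A B"
proof -
  have eq: "(+) (f x) ` f ` B = f ` (+) x ` B" for x
    by (simp add: image_image Modules.additive.add[OF f(1)])
  have "\<Union> (cosets A B) \<subseteq> A"
    using A B by (auto simp: cosets_def intro!: addsub_add)
  then have inj: "inj_on ((`) f) (cosets A B)"
    using f(2) by (intro inj_on_image) (rule inj_on_subset)
  have "cosets (f ` A) (f ` B) = (`) f ` cosets A B"
    by (simp add: cosets_def image_image eq[unfolded image_image])
  with inj show ?thesis by (simp add: idx_def card_image)
qed

lemma idx_pos_finite: "idx A B > 0 \<Longrightarrow> finite (cosets A B)"
  unfolding idx_def by (rule card_ge_0_finite)

lemma idx_1_imp_eq:
  assumes "addsub A" "addsub B" "B \<subseteq> A" "idx A B = 1"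
  shows "B = A"
proof -
  obtain C where C: "cosets A B = {C}" using assms(4) by (auto simp: idx_def card_1_singleton_iff)
  have "x \<in> B" if "x \<in> A" for x
  proof -
    have "(+) x ` B \<in> cosets A B" "(+) 0 ` B \<in> cosets A B" using that addsub_zero[OF assms(1)]
      unfolding cosets_def by blast+
    then have "(+) x ` B = (+) 0 ` B" using C by simp
    then show ?thesis using coset_eq_iff[OF assms(2), of x 0] by simp
  qed
  then show ?thesis using assms by auto
qed

section \<open>Integer vectors and bases of sublattices\<close>

type_synonym ivec = "nat \<Rightarrow> int"

definition scale :: "int \<Rightarrow> ivec \<Rightarrow> ivec"
  where "scale k f = (\<lambda>i. k * f i)"

text \<open>The index type does not depend on the rank, so that \<open>\<int>\<^sup>m \<subseteq> \<int>\<^sup>m\<^sup>+\<^sup>1\<close>.\<close>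

definition Zpow :: "nat \<Rightarrow> ivec set"
  where "Zpow m = {f. \<forall>i\<ge>m. f i = 0}"

lemma scale_apply: "scale k f i = k * f i" by (simp add: scale_def)

lemma additive_scale: "Modules.additive (scale k)"
  by unfold_locales (auto simp: fun_eq_iff algebra_simps scale_apply)

lemma inj_scale: "k \<noteq> 0 \<Longrightarrow> inj (scale k)"
  by (auto simp: inj_def fun_eq_iff scale_apply)

lemma addsub_Zpow: "addsub (Zpow m)"
  by (auto simp: addsub_def Zpow_def)

lemma scale_0 [simp]: "scale 0 f = 0" and scale_1 [simp]: "scale 1 f = f"
  and scale_zero [simp]: "scale k 0 = 0" 
  and scale_scale: "scale k (scale l f) = scale (k * l) f"
  and scale_add: "scale (k + l) f = scale k f + scale l f"
  and scale_diff: "scale (k - l) f = scale k f - scale l f"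
  and scale_add_right: "scale k (f + g) = scale k f + scale k g"
  and scale_uminus: "scale (- k) f = - scale k f"
  by (auto simp: fun_eq_iff algebra_simps scale_apply)

lemma scale_closed:
  assumes "addsub A" "f \<in> A" shows "scale k f \<in> A"
proof -
  have nat: "scale (int n) f \<in> A" for n
  proof (induction n)
    case 0
    show ?case using addsub_zero[OF assms(1)] by (simp only: of_nat_0 scale_0)
  next
    case (Suc n)
    show ?case using addsub_add[OF assms(1) assms(2) Suc] by (simp only: of_nat_Suc scale_add scale_1)
  qed
  show ?thesis
  proof (cases "k \<ge> 0")
    case True then show ?thesis using nat[of "nat k"] by simp
  next
    case False
    then obtain n where "k = - int n" by (cases k rule: int_cases2) auto
    then show ?thesis using addsub_uminus[OF assms(1) nat[of n]] by (simp only: scale_uminus)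
  qed
qed

text \<open>Division with remainder by the least positive element. The case \<open>d = 0\<close>
  stays possible here and is excluded at each use: by full rank for lattices, by finite index for
  subgroups.\<close>

lemma addsub_int_generator:
  fixes S :: "int set"
  assumes S: "addsub S"
  obtains d where "d \<ge> 0" "S = range ((*) d)"
proof (cases "S = {0}")
  case True
  then show ?thesis by (intro that[of 0]) auto
next
  case False
  then obtain x where x: "x \<in> S" "x \<noteq> 0" using addsub_zero[OF S] by auto
  define P where "P n \<longleftrightarrow> n > 0 \<and> int n \<in> S" for n
  have "P (nat \<bar>x\<bar>)" using x addsub_uminus[OF S, of x] by (auto simp: P_def abs_if)
  define d where "d = (LEAST n. P n)"
  have d: "P d" using \<open>P (nat \<bar>x\<bar>)\<close> unfolding d_def by (rule LeastI)
  have min: "d \<le> n" if "P n" for n using that unfolding d_def by (rule Least_le)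
  have mult: "int d * k \<in> S" for k
  proof -
    have nat: "int d * int n \<in> S" for n
      by (induction n) (use d S in \<open>auto simp: P_def algebra_simps intro: addsub_add addsub_zero\<close>)
    then show ?thesis
      by (cases k rule: int_cases2) (use addsub_uminus[OF S] nat in auto)
  qed
  have "y \<in> range ((*) (int d))" if y: "y \<in> S" for y
  proof -
    have "y mod int d = y - int d * (y div int d)" by (simp add: minus_mult_div_eq_mod)
    then have "y mod int d \<in> S" using addsub_diff[OF S y mult] by simp
    moreover have "0 \<le> y mod int d" "y mod int d < int d" using d by (auto simp: P_def)
    moreover have "d \<le> nat (y mod int d)" if "y mod int d > 0"
      using min[of "nat (y mod int d)"] that \<open>y mod int d \<in> S\<close> by (simp add: P_def)
    ultimately have "y mod int d = 0" by linarith
    then show ?thesis by (metis dvd_eq_mod_eq_0 dvdE rangeI)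
  qed
  with mult show ?thesis by (intro that[of "int d"]) auto
qed

lemma Zpow_Suc: "Zpow m \<subseteq> Zpow (Suc m)"
  by (auto simp: Zpow_def)

text \<open>Induction on the rank as for the Hermite normal form: the last coordinates of
  \<open>N\<close> form an ideal generated by some \<open>d\<close>, and a vector \<open>g\<close>
  of \<open>N\<close> with last coordinate \<open>d\<close> extends a basis of
  \<open>N \<inter> Zpow m\<close>. Containing \<open>q\<close> times the lattice forces
  \<open>d \<noteq> 0\<close>, hence full rank, so the basis can be packaged as an injective
  parametrisation of \<open>N\<close> by the whole of \<open>Zpow m\<close>.\<close>

lemma sublattice_basis:
  assumes "addsub N" "N \<subseteq> Zpow m" "q > 0" "scale q ` Zpow m \<subseteq> N"
  shows "\<exists>F. Modules.additive F \<and> inj_on F (Zpow m) \<and> F ` Zpow m = N"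
  using assms
proof (induction m arbitrary: N)
  case 0
  have LL0: "Zpow 0 = {0}" by (auto simp: Zpow_def zero_fun_def)
  have "N = {0}" using 0(2) addsub_zero[OF 0(1)] unfolding LL0 by blast
  then have "Modules.additive (id :: ivec \<Rightarrow> ivec) \<and> inj_on id (Zpow 0) \<and> id ` Zpow 0 = N"
    by (simp add: LL0 Modules.additive_def)
  then show ?case by blast
next
  case (Suc m)
  note N = Suc.prems(1)
  define N0 where "N0 = N \<inter> Zpow m"
  have "addsub N0" "N0 \<subseteq> Zpow m" unfolding N0_def using N by (auto intro: addsub_Int addsub_Zpow)
  moreover have "scale q ` Zpow m \<subseteq> N0"
  proof
    fix x assume "x \<in> scale q ` Zpow m"
    then obtain f where f: "f \<in> Zpow m" "x = scale q f" by blast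
    show "x \<in> N0" using Suc.prems(4) Zpow_Suc[of m] scale_closed[OF addsub_Zpow f(1)] f
      unfolding N0_def by blast
  qed
  ultimately obtain F0 where F0: "Modules.additive F0" "inj_on F0 (Zpow m)" "F0 ` Zpow m = N0"
    using Suc.IH Suc.prems(3) by metis
  have word_val: "Modules.additive (\<lambda>f::ivec. f m)" by unfold_locales simp
  obtain d where d: "d \<ge> 0" "(\<lambda>f. f m) ` N = range ((*) d)"
    using addsub_int_generator[OF addsub_image[OF word_val N]] by blast
  have "(\<lambda>i. if i = m then 1 else 0) \<in> Zpow (Suc m)" by (auto simp: Zpow_def)
  then have "scale q (\<lambda>i. if i = m then 1 else 0) \<in> N" using Suc.prems(4) by blast
  then have "q \<in> (\<lambda>f. f m) ` N" by (rule rev_image_eqI) (simp add: scale_apply)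
  then have "d \<noteq> 0" using d Suc.prems(3) by auto
  have "d \<in> (\<lambda>f. f m) ` N" unfolding d by (auto simp: image_iff intro: exI[of _ 1])
  then obtain g where g: "g \<in> N" "g m = d" by auto
  \<comment> \<open>Cutting off the coordinates from \<open>m\<close> on keeps the argument of
    \<open>F0\<close> inside \<open>Zpow m\<close>, the only place where \<open>F0\<close> is
    controlled.\<close>
  define res where "res f = (\<lambda>i. if i < m then f i else (0::int))" for f :: ivec
  have res: "res f \<in> Zpow m" for f by (auto simp: res_def Zpow_def)
  have addres: "Modules.additive res" by unfold_locales (auto simp: res_def fun_eq_iff)
  define F where "F f = F0 (res f) + scale (f m) g" for f
  have F: "Modules.additive F"
    by unfold_locales (simp only: F_def Modules.additive.add[OF addres] Modules.additive.add[OF F0(1)] scale_add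
        plus_fun_apply ac_simps)
  have F0m: "F0 (res f) \<in> N0" for f using F0(3) res by blast
  have Fm: "F f m = f m * d" for f
    using F0m[of f] by (auto simp: F_def g N0_def Zpow_def scale_apply)
  have inj: "inj_on F (Zpow (Suc m))"
  proof (rule inj_onI)
    fix f h assume f: "f \<in> Zpow (Suc m)" and h: "h \<in> Zpow (Suc m)" and eq: "F f = F h"
    have m: "f m = h m" using Fm[of f] Fm[of h] eq \<open>d \<noteq> 0\<close> by simp
    then have "F0 (res f) = F0 (res h)" using eq by (simp add: F_def)
    then have r: "res f = res h" using F0(2) res by (auto dest: inj_onD)
    show "f = h"
    proof
      fix i show "f i = h i"
        using fun_cong[OF r, of i] m f h by (cases "i < m"; cases "i = m") (auto simp: res_def Zpow_def)
    qed
  qed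
  have "F ` Zpow (Suc m) = N"
  proof safe
    fix f assume "f \<in> Zpow (Suc m)"
    show "F f \<in> N" unfolding F_def using F0m[of f] scale_closed[OF N g(1)]
      by (auto simp: N0_def intro: addsub_add[OF N])
  next
    fix x assume x: "x \<in> N"
    then have "x m \<in> range ((*) d)" using d(2) by blast
    then obtain k where k: "x m = d * k" by auto
    have y: "x - scale k g \<in> N" using x scale_closed[OF N g(1)] addsub_diff[OF N] by blast
    then have "x - scale k g \<in> N0"
    proof -
      have "(x - scale k g) m = 0" using k g(2) by (simp add: scale_apply)
      moreover have "x - scale k g \<in> Zpow (Suc m)" using y Suc.prems(2) by blast
      ultimately have "x - scale k g \<in> Zpow m"
        unfolding Zpow_def mem_Collect_eq by (metis (no_types) not_less_eq_eq order_antisym)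
      then show ?thesis using y by (simp add: N0_def)
    qed
    then obtain h where h: "h \<in> Zpow m" "F0 h = x - scale k g" using F0(3) by (metis imageE)
    define f where "f = h(m := k)"
    have "res f = h" using h(1) by (auto simp: f_def res_def Zpow_def fun_eq_iff)
    moreover have "f m = k" by (simp add: f_def)
    ultimately have "F f = x" using h(2) by (simp only: F_def diff_add_cancel)
    moreover have "f \<in> Zpow (Suc m)" using h(1) by (auto simp: f_def Zpow_def)
    ultimately show "x \<in> F ` Zpow (Suc m)" by blast
  qed
  with F inj show ?case by blast
qed

section \<open>Gaussian binomials and complements\<close>

text \<open>The \<open>q\<close>-Pascal recursion needs only a semiring, so the same definition
  serves the counts in \<open>nat\<close>, the values at \<open>1/p\<close> and the polynomial in
  \<open>p\<close>.\<close>

fun gauss_binom :: "nat \<Rightarrow> nat \<Rightarrow> 'a::comm_semiring_1 \<Rightarrow> 'a" where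
  "gauss_binom n 0 x = 1"
| "gauss_binom 0 (Suc k) x = 0"
| "gauss_binom (Suc n) (Suc k) x = gauss_binom n k x + x ^ Suc k * gauss_binom n (Suc k) x"

lemma gauss_binom_eq_0: "n < k \<Longrightarrow> gauss_binom n k x = 0"
  by (induction n k x rule: gauss_binom.induct) auto

lemma gauss_binom_self [simp]: "gauss_binom n n x = 1"
  by (induction n) (auto simp: gauss_binom_eq_0)

lemma of_nat_gauss_binom: "of_nat (gauss_binom n k q) = gauss_binom n k (of_nat q)"
  by (induction n k q rule: gauss_binom.induct) auto

lemma poly_gauss_binom: "poly (gauss_binom n k [:0, 1:]) x = gauss_binom n k (x :: 'a::comm_ring_1)"
  by (induction n k x rule: gauss_binom.induct) auto

text \<open>At a prime \<open>x\<close> this is the number of linearly independent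
  \<open>k\<close>-tuples in a space of dimension \<open>n\<close> over the field with
  \<open>x\<close> elements.\<close>

definition gauss_prod :: "nat \<Rightarrow> nat \<Rightarrow> 'a::comm_ring_1 \<Rightarrow> 'a"
  where "gauss_prod n k x = (\<Prod>i<k. x ^ n - x ^ i)"

lemma gauss_prod_Suc: "gauss_prod n (Suc k) x = gauss_prod n k x * (x ^ n - x ^ k)"
  by (simp add: gauss_prod_def)

lemma gauss_prod_Suc_Suc: "gauss_prod (Suc n) (Suc k) x = (x ^ Suc n - 1) * x ^ k * gauss_prod n k x"
proof -
  have "gauss_prod (Suc n) (Suc k) x = (x ^ Suc n - 1) * (\<Prod>i<k. x * (x ^ n - x ^ i))"
    unfolding gauss_prod_def prod.lessThan_Suc_shift by (simp add: right_diff_distrib)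
  then show ?thesis by (simp add: gauss_prod_def prod.distrib mult.assoc)
qed

text \<open>The quotient formula for Gaussian binomials, without division so as to hold in every
  commutative ring. Of the two summands in the \<open>q\<close>-Pascal rule, the first is reduced by
  \<open>gauss_prod_Suc_Suc\<close> and the second by \<open>gauss_prod_Suc\<close>.\<close>

lemma gauss_binom_gauss_prod: "gauss_binom n k x * gauss_prod k k x = gauss_prod n k (x :: 'a::comm_ring_1)"
proof (induction n arbitrary: k)
  case 0
  show ?case
  proof (cases k)
    case (Suc l)
    have "\<exists>i\<in>{..<Suc l}. x ^ 0 - x ^ i = 0" by (intro bexI[of _ 0]) auto
    then have "gauss_prod 0 (Suc l) x = 0" unfolding gauss_prod_def by (intro prod_zero) auto
    then show ?thesis using Suc by simp
  qed (simp add: gauss_prod_def)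
next
  case (Suc n)
  show ?case
  proof (cases k)
    case (Suc l)
    have "gauss_binom n l x * gauss_prod (Suc l) (Suc l) x = (x ^ Suc l - 1) * x ^ l * (gauss_binom n l x * gauss_prod l l x)"
      by (simp only: gauss_prod_Suc_Suc mult_ac)
    then have "gauss_binom (Suc n) (Suc l) x * gauss_prod (Suc l) (Suc l) x
        = (x ^ Suc l - 1) * x ^ l * (gauss_binom n l x * gauss_prod l l x)
          + x ^ Suc l * (gauss_binom n (Suc l) x * gauss_prod (Suc l) (Suc l) x)"
      by (simp only: gauss_binom.simps distrib_right mult.assoc)
    also have "\<dots> = (x ^ Suc l - 1) * x ^ l * gauss_prod n l x + x ^ Suc l * (gauss_prod n l x * (x ^ n - x ^ l))"
      unfolding Suc.IH by (simp only: gauss_prod_Suc)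
    also have "\<dots> = (x ^ Suc n - 1) * x ^ l * gauss_prod n l x"
      by (simp add: algebra_simps)
    also have "\<dots> = gauss_prod (Suc n) (Suc l) x" by (simp only: gauss_prod_Suc_Suc)
    finally show ?thesis using Suc by simp
  qed (simp add: gauss_prod_def)
qed

lemma gauss_prod_self_nonzero:
  fixes x :: "'a::field"
  assumes "x \<noteq> 0" "\<And>i. i > 0 \<Longrightarrow> x ^ i \<noteq> 1"
  shows "gauss_prod k k x \<noteq> 0"
proof -
  have "x ^ k \<noteq> x ^ i" if "i < k" for i
  proof
    assume "x ^ k = x ^ i"
    then have "x ^ i * x ^ (k - i) = x ^ i * 1" using that by (simp add: power_add[symmetric])
    then have "x ^ (k - i) = 1" using assms(1) by simp
    then show False using assms(2)[of "k - i"] that by simp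
  qed
  then show ?thesis by (auto simp: gauss_prod_def)
qed

text \<open>This symmetry is the source of the argument \<open>p^(-1)\<close> in \<open>W\<close>:
  the factor \<open>x^(k(n-k))\<close> passes into the numerical data. Clearing denominators in the
  \<open>i\<close>-th factor of \<open>gauss_prod\<close> at \<open>1/x\<close> costs
  \<open>x^(n+i)\<close> and a sign; the signs cancel in the quotient.\<close>

lemma gauss_binom_inverse:
  fixes x :: "'a::field"
  assumes "x \<noteq> 0" "\<And>i. i > 0 \<Longrightarrow> x ^ i \<noteq> 1" "k \<le> n"
  shows "gauss_binom n k x = x ^ (k * (n - k)) * gauss_binom n k (inverse x)"
proof -
  define E where "E n = (\<Prod>i<k. x ^ (n + i))" for n
  have rev: "gauss_prod n k (inverse x) * E n = (-1) ^ k * gauss_prod n k x" for n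
  proof -
    have "gauss_prod n k (inverse x) * E n = (\<Prod>i<k. (inverse x ^ n - inverse x ^ i) * x ^ (n + i))"
      by (simp add: gauss_prod_def E_def prod.distrib)
    also have "\<dots> = (\<Prod>i<k. (-1) * (x ^ n - x ^ i))"
      by (intro prod.cong refl) (use assms(1) in \<open>simp add: power_inverse field_simps power_add\<close>)
    finally show ?thesis by (simp only: prod.distrib gauss_prod_def prod_constant card_lessThan)
  qed
  have E: "E n = x ^ (k * (n - k)) * E k"
  proof -
    have "E n = (\<Prod>i<k. x ^ (n - k) * x ^ (k + i))"
      unfolding E_def using assms(3) by (intro prod.cong refl) (simp add: power_add[symmetric])
    then show ?thesis by (simp add: prod.distrib E_def power_mult[symmetric] mult.commute)
  qed
  have "gauss_binom n k (inverse x) * ((-1) ^ k * gauss_prod k k x) * x ^ (k * (n - k))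
      = gauss_binom n k (inverse x) * gauss_prod k k (inverse x) * E n"
    unfolding rev[symmetric] E by (simp add: mult_ac)
  also have "\<dots> = (-1) ^ k * (gauss_binom n k x * gauss_prod k k x)"
    by (simp only: gauss_binom_gauss_prod rev)
  finally have "(gauss_binom n k (inverse x) * x ^ (k * (n - k))) * gauss_prod k k x = gauss_binom n k x * gauss_prod k k x"
    by (simp add: mult_ac)
  then show ?thesis using gauss_prod_self_nonzero[of x k] assms by (simp add: mult.commute)
qed

text \<open>Counting in \<open>Q/P\<close> is done with vectors rather than cosets: one
  representative for each coset, chosen once for \<open>Q\<close>, serves all intermediate groups
  \<open>R\<close> simultaneously.\<close>

lemma transversal_exists:
  fixes P Q :: "'a::ab_group_add set"
  assumes P: "addsub P" and Q: "addsub Q" "P \<subseteq> Q" "idx Q P > 0"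
  obtains T where "T \<subseteq> Q" "finite T"
    "\<And>R. addsub R \<Longrightarrow> P \<subseteq> R \<Longrightarrow> R \<subseteq> Q \<Longrightarrow> card (T \<inter> R) = idx R P"
proof -
  define rep where "rep C = (SOME x. x \<in> C)" for C :: "'a set"
  have rep: "rep ((+) x ` P) - x \<in> P" for x
  proof -
    have "x + 0 \<in> (+) x ` P" using addsub_zero[OF P] by blast
    then have "rep ((+) x ` P) \<in> (+) x ` P" unfolding rep_def by (rule someI)
    then show ?thesis by (simp only: coset_mem)
  qed
  have coset_rep: "(+) (rep C) ` P = C" if C: "C \<in> cosets Q P" for C
  proof -
    obtain x where "C = (+) x ` P" using C by (auto simp: cosets_def)
    then show ?thesis using rep[of x] coset_eq_iff[OF P] by simp
  qed
  have rep_in: "rep ((+) x ` P) \<in> R" if "addsub R" "P \<subseteq> R" "x \<in> R" for x R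
    using addsub_add[OF that(1) _ that(3), of "rep ((+) x ` P) - x"] rep[of x] that(2) by auto
  define T where "T = rep ` cosets Q P"
  show thesis
  proof (rule that)
    show "T \<subseteq> Q" using rep_in[OF Q(1,2)] by (auto simp: T_def cosets_def)
    show "finite T" using idx_pos_finite[OF Q(3)] by (simp add: T_def)
    fix R assume R: "addsub R" "P \<subseteq> R" "R \<subseteq> Q"
    have sub: "cosets R P \<subseteq> cosets Q P" using R(3) by (auto simp: cosets_def)
    have inj: "inj_on rep (cosets Q P)"
      by (rule inj_on_inverseI[of _ "\<lambda>x. (+) x ` P"]) (rule coset_rep)
    have "T \<inter> R = rep ` cosets R P"
    proof (intro equalityI subsetI)
      fix t assume "t \<in> T \<inter> R"
      then obtain C where C: "C \<in> cosets Q P" "t = rep C" "t \<in> R" by (auto simp: T_def)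
      then have "C = (+) t ` P" using coset_rep by simp
      then have "C \<in> cosets R P" using C(3) by (auto simp: cosets_def)
      then show "t \<in> rep ` cosets R P" using C(2) by blast
    next
      fix t assume "t \<in> rep ` cosets R P"
      then obtain C where C: "C \<in> cosets R P" "t = rep C" by blast
      then obtain x where "x \<in> R" "C = (+) x ` P" by (auto simp: cosets_def)
      then have "t \<in> R" using rep_in[OF R(1,2)] C(2) by simp
      then show "t \<in> T \<inter> R" using C sub by (auto simp: T_def)
    qed
    then show "card (T \<inter> R) = idx R P"
      using inj_on_subset[OF inj sub] by (simp add: idx_def card_image)
  qed
qed

fun span_over :: "ivec set \<Rightarrow> ivec list \<Rightarrow> ivec set" where
  "span_over P [] = P"
| "span_over P (x # xs) = ssum (range (\<lambda>k. scale k x)) (span_over P xs)"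

lemma addsub_multiples: "addsub (range (\<lambda>k. scale k x))"
  unfolding addsub_def
proof (intro conjI ballI)
  show "0 \<in> range (\<lambda>k. scale k x)" by (rule range_eqI[of _ _ 0]) (simp only: scale_0)
  fix u v assume "u \<in> range (\<lambda>k. scale k x)" "v \<in> range (\<lambda>k. scale k x)"
  then obtain k l where "u = scale k x" "v = scale l x" by blast
  then show "u - v \<in> range (\<lambda>k. scale k x)"
    by (intro range_eqI[of _ _ "k - l"]) (simp only: scale_diff)
qed

lemma addsub_span_over: "addsub P \<Longrightarrow> addsub (span_over P xs)"
  by (induction xs) (auto intro: addsub_ssum addsub_multiples)

lemma span_over_upper: "addsub P \<Longrightarrow> P \<subseteq> span_over P xs"
  by (induction xs) (use ssum_upper2[OF addsub_multiples] in auto)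

lemma span_over_mem: "addsub P \<Longrightarrow> x \<in> set xs \<Longrightarrow> x \<in> span_over P xs"
proof (induction xs)
  case (Cons y ys)
  show ?case
  proof (cases "x = y")
    case True
    have "x \<in> range (\<lambda>k. scale k y)" using True by (intro range_eqI[of _ _ 1]) (simp only: scale_1)
    then show ?thesis
      using ssum_upper1[OF addsub_span_over[OF Cons.prems(1)], of "range (\<lambda>k. scale k y)" ys]
      unfolding span_over.simps by blast
  next
    case False
    then have "x \<in> span_over P ys" using Cons by simp
    then show ?thesis using ssum_upper2[OF addsub_multiples, of "span_over P ys" y]
      unfolding span_over.simps by blast
  qed
qed simp

lemma span_over_least:
  assumes "addsub U" "P \<subseteq> U" "set xs \<subseteq> U" shows "span_over P xs \<subseteq> U"
  using assms(3)
proof (induction xs)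
  case (Cons x xs)
  then show ?case unfolding span_over.simps
    by (intro ssum_least[OF assms(1)]) (auto intro: scale_closed[OF assms(1)])
qed (simp add: assms)

text \<open>The integers \<open>k\<close> with \<open>scale k x \<in> S\<close> form an ideal that
  contains \<open>p\<close> but not 1. Thus \<open>x\<close> adds exactly one dimension over
  \<open>F_p\<close>.\<close>

lemma idx_extend_prime:
  assumes S: "addsub S" and p: "prime (p::nat)" and x: "x \<notin> S" "scale (int p) x \<in> S"
  shows "idx (ssum (range (\<lambda>k. scale k x)) S) S = p"
    and "scale k x \<in> S \<longleftrightarrow> int p dvd k"
proof -
  have iff: "scale k x \<in> S \<longleftrightarrow> int p dvd k" for k
  proof
    assume "int p dvd k"
    then obtain l where "k = l * int p" by (metis dvdE mult.commute)
    then show "scale k x \<in> S" using scale_closed[OF S x(2), of l] by (simp only: scale_scale)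
  next
    assume k: "scale k x \<in> S"
    show "int p dvd k"
    proof (rule ccontr)
      assume "\<not> int p dvd k"
      then have "coprime (int p) k" using p by (simp add: prime_imp_coprime)
      then obtain u v where "u * int p + v * k = 1"
        by (metis bezout_int coprime_imp_gcd_eq_1)
      then have "x = scale u (scale (int p) x) + scale v (scale k x)"
        by (metis scale_scale scale_add scale_1)
      then have "x \<in> S" using addsub_add[OF S scale_closed[OF S x(2), of u] scale_closed[OF S k, of v]] by simp
      then show False using x by simp
    qed
  qed
  then show "scale k x \<in> S \<longleftrightarrow> int p dvd k" .
  let ?M = "ssum (range (\<lambda>k. scale k x)) S"
  have eq: "(+) (scale k x) ` S = (+) (scale l x) ` S \<longleftrightarrow> int p dvd k - l" for k l
    using iff[of "k - l"] by (simp only: coset_eq_iff[OF S] scale_diff)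
  have "cosets ?M S = (\<lambda>k. (+) (scale k x) ` S) ` {0..<int p}"
  proof (intro equalityI subsetI)
    fix C assume "C \<in> cosets ?M S"
    then obtain k s where C: "C = (+) (scale k x + s) ` S" "s \<in> S" by (auto simp: cosets_def in_ssum)
    have "scale k x + s - scale k x = s" by simp
    then have "scale k x + s - scale k x \<in> S" using C(2) by (simp only:)
    then have "C = (+) (scale k x) ` S" using C(1) coset_eq_iff[OF S] by blast
    also have "\<dots> = (+) (scale (k mod int p) x) ` S"
      unfolding eq by (simp add: minus_mod_eq_mult_div)
    finally show "C \<in> (\<lambda>k. (+) (scale k x) ` S) ` {0..<int p}"
      using p prime_gt_0_nat[OF p] by auto
  next
    fix C assume "C \<in> (\<lambda>k. (+) (scale k x) ` S) ` {0..<int p}"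
    then obtain k where C: "C = (+) (scale k x) ` S" by auto
    have "scale k x \<in> ?M" using ssum_upper1[OF S, of "range (\<lambda>k. scale k x)"] by (meson rangeI subsetD)
    then show "C \<in> cosets ?M S" using C by (auto simp: cosets_def)
  qed
  moreover have "inj_on (\<lambda>k. (+) (scale k x) ` S) {0..<int p}"
  proof (rule inj_onI)
    fix k l assume kl: "k \<in> {0..<int p}" "l \<in> {0..<int p}" "(+) (scale k x) ` S = (+) (scale l x) ` S"
    then have "int p dvd k - l" by (simp only: eq)
    then have "k mod int p = l mod int p" by (simp only: mod_eq_dvd_iff)
    then show "k = l" using kl by simp
  qed
  ultimately show "idx ?M S = p" by (simp add: idx_def card_image)
qed

text \<open>When \<open>p\<close> annihilates everything modulo \<open>P\<close>, these are the
  tuples that are linearly independent over \<open>F_p\<close> modulo \<open>K\<close>. Lists grow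
  at the head, each new vector avoiding \<open>K\<close> together with the span of the tail.\<close>

fun indep_lists :: "ivec set \<Rightarrow> ivec set \<Rightarrow> ivec set \<Rightarrow> nat \<Rightarrow> ivec list set" where
  "indep_lists A K P 0 = {[]}"
| "indep_lists A K P (Suc j) = (\<Union>xs\<in>indep_lists A K P j. (\<lambda>x. x # xs) ` (A - ssum K (span_over P xs)))"

lemma finite_indep_lists: "finite A \<Longrightarrow> finite (indep_lists A K P j)"
  by (induction j) auto

lemma indep_lists_props:
  assumes P: "addsub P" and K: "addsub K" "P \<subseteq> K" and p: "prime (p::nat)"
    and A: "\<And>x. x \<in> A \<Longrightarrow> scale (int p) x \<in> P" and xs: "xs \<in> indep_lists A K P j"
  shows "length xs = j \<and> set xs \<subseteq> A \<and> span_over P xs \<inter> K = P \<and> idx (span_over P xs) P = p ^ j"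
  using xs
proof (induction j arbitrary: xs)
  case 0
  then show ?case using K by (auto simp: idx_self[OF P])
next
  case (Suc j)
  then obtain x ys where xs: "xs = x # ys" and ys: "ys \<in> indep_lists A K P j"
    and x: "x \<in> A" "x \<notin> ssum K (span_over P ys)" by auto
  note IH = Suc.IH[OF ys]
  let ?S = "span_over P ys"
  have S: "addsub ?S" by (rule addsub_span_over[OF P])
  have p_sub: "P \<subseteq> ?S" by (rule span_over_upper[OF P])
  have KS: "addsub (ssum K ?S)" by (rule addsub_ssum[OF K(1) S])
  have px: "scale (int p) x \<in> ?S" "scale (int p) x \<in> ssum K ?S"
    using A[OF x(1)] p_sub ssum_upper2[OF K(1), of ?S] by auto
  have xS: "x \<notin> ?S" using x ssum_upper2[OF K(1), of ?S] by auto
  have "idx (span_over P xs) P = idx (span_over P xs) ?S * idx ?S P"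
    using ssum_upper2[OF addsub_multiples, of ?S x]
    by (intro idx_mult P S p_sub addsub_span_over[OF P]) (simp add: xs)
  then have idx: "idx (span_over P xs) P = p ^ Suc j"
    using idx_extend_prime(1)[OF S p xS px(1)] IH by (simp add: xs)
  \<comment> \<open>In a combination that lies in \<open>K\<close> the coefficient of
    \<open>x\<close> is divisible by \<open>p\<close>, since \<open>x\<close> avoids
    \<open>K\<close> plus the earlier span. The term in \<open>x\<close> then falls into the earlier
    span, where the induction hypothesis applies.\<close>
  have "span_over P xs \<inter> K \<subseteq> P"
  proof
    fix y assume y: "y \<in> span_over P xs \<inter> K"
    then obtain k s where ks: "y = scale k x + s" "s \<in> ?S" by (auto simp: xs in_ssum)
    have "scale k x = y + (- s)" using ks by simp
    then have "scale k x \<in> ssum K ?S" using y addsub_uminus[OF S ks(2)] by (auto simp only: in_ssum)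
    then have "int p dvd k" using idx_extend_prime(2)[OF KS p x(2) px(2)] by simp
    then have "scale k x \<in> ?S" using idx_extend_prime(2)[OF S p xS px(1)] by simp
    then have "y \<in> ?S" using addsub_add[OF S _ ks(2)] ks(1) by simp
    then show "y \<in> P" using y IH by blast
  qed
  moreover have "P \<subseteq> span_over P xs \<inter> K" using span_over_upper[OF P] K by blast
  ultimately show ?case using idx IH x by (auto simp: xs)
qed

text \<open>The next head is any representative outside \<open>ssum K (span_over P xs)\<close>. That
  group has index \<open>idx K P * p ^ j\<close> over \<open>P\<close>, because the span meets
  \<open>K\<close> only in \<open>P\<close>.\<close>

lemma card_indep_lists:
  assumes P: "addsub P" and K: "addsub K" "P \<subseteq> K" "K \<subseteq> U" and U: "addsub U"
    and p: "prime (p::nat)" and pU: "\<And>x. x \<in> U \<Longrightarrow> scale (int p) x \<in> P" and T: "finite T"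
    and cT: "\<And>R. addsub R \<Longrightarrow> P \<subseteq> R \<Longrightarrow> R \<subseteq> U \<Longrightarrow> card (T \<inter> R) = idx R P"
  shows "card (indep_lists (T \<inter> U) K P j) = (\<Prod>i<j. idx U P - idx K P * p ^ i)"
proof (induction j)
  case (Suc j)
  have fib: "card ((\<lambda>x. x # xs) ` (T \<inter> U - ssum K (span_over P xs))) = idx U P - idx K P * p ^ j"
    if xs: "xs \<in> indep_lists (T \<inter> U) K P j" for xs
  proof -
    let ?S = "span_over P xs"
    have props: "set xs \<subseteq> T \<inter> U" "?S \<inter> K = P" "idx ?S P = p ^ j"
      using indep_lists_props[OF P K(1,2) p _ xs] pU by auto
    have S: "addsub ?S" by (rule addsub_span_over[OF P])
    have SU: "?S \<subseteq> U" using span_over_least[OF U, of P xs] K props(1) by auto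
    have KS: "addsub (ssum K ?S)" by (rule addsub_ssum[OF K(1) S])
    have KSU: "ssum K ?S \<subseteq> U" by (rule ssum_least[OF U K(3) SU])
    have K_KS: "K \<subseteq> ssum K ?S" by (rule ssum_upper1[OF S])
    have "ssum K ?S = ssum ?S K" by (auto simp: in_ssum) (metis add.commute)+
    then have "idx (ssum K ?S) K = p ^ j" using idx_ssum[OF S K(1)] props by simp
    then have "idx (ssum K ?S) P = idx K P * p ^ j"
      using idx_mult[OF P K(1) KS K(2) K_KS] by simp
    then have "card (T \<inter> ssum K ?S) = idx K P * p ^ j"
      using cT[OF KS _ KSU] K(2) K_KS by auto
    moreover have "card (T \<inter> U) = idx U P" using cT[OF U] K by auto
    moreover have "T \<inter> U - ssum K ?S = T \<inter> U - T \<inter> ssum K ?S" by blast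
    ultimately have "card (T \<inter> U - ssum K ?S) = idx U P - idx K P * p ^ j"
      using card_Diff_subset[of "T \<inter> ssum K ?S" "T \<inter> U"] T KSU by auto
    moreover have "inj_on (\<lambda>x. x # xs) Z" for Z by (simp add: inj_on_def)
    ultimately show ?thesis by (simp only: card_image)
  qed
  have "card (indep_lists (T \<inter> U) K P (Suc j))
      = (\<Sum>xs\<in>indep_lists (T \<inter> U) K P j. card ((\<lambda>x. x # xs) ` (T \<inter> U - ssum K (span_over P xs))))"
    unfolding indep_lists.simps by (rule card_UN_disjoint) (use T in \<open>auto intro: finite_indep_lists\<close>)
  also have "\<dots> = card (indep_lists (T \<inter> U) K P j) * (idx U P - idx K P * p ^ j)"
    using fib by simp
  finally show ?case using Suc by simp
qed simp

text \<open>For elementary abelian \<open>Q/P\<close> these are its subspaces of order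
  \<open>k\<close> that meet \<open>K/P\<close> trivially; the choice \<open>K = P\<close> yields
  all subspaces of that order.\<close>

definition complements :: "ivec set \<Rightarrow> ivec set \<Rightarrow> ivec set \<Rightarrow> nat \<Rightarrow> ivec set set"
  where "complements Q K P k = {U. addsub U \<and> P \<subseteq> U \<and> U \<subseteq> Q \<and> U \<inter> K = P \<and> idx U P = k}"

text \<open>Double counting of the independent lists in \<open>T \<inter> Q\<close>: each spans a
  complement, and a complement \<open>U\<close> is spanned precisely by the lists in
  \<open>indep_lists (T \<inter> U) P P j\<close>, whose number depends only on \<open>p\<close> and
  \<open>j\<close>.\<close>

lemma card_complements_mult:
  assumes P: "addsub P" and K: "addsub K" "P \<subseteq> K" "K \<subseteq> Q" and Q: "addsub Q"
    and p: "prime (p::nat)" and pQ: "\<And>x. x \<in> Q \<Longrightarrow> scale (int p) x \<in> P" and fin: "idx Q P > 0"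
  shows "card (complements Q K P (p ^ j)) * (\<Prod>i<j. p ^ j - p ^ i)
      = (\<Prod>i<j. idx Q P - idx K P * p ^ i)"
    and "finite (complements Q K P (p ^ j))"
proof -
  have PQ: "P \<subseteq> Q" using K by blast
  obtain T where T: "T \<subseteq> Q" "finite T"
    "\<And>R. addsub R \<Longrightarrow> P \<subseteq> R \<Longrightarrow> R \<subseteq> Q \<Longrightarrow> card (T \<inter> R) = idx R P"
    using transversal_exists[OF P Q PQ fin] by blast
  let ?I = "indep_lists (T \<inter> Q) K P j" and ?C = "complements Q K P (p ^ j)"
  have propsI: "length xs = j \<and> set xs \<subseteq> T \<inter> Q \<and> span_over P xs \<inter> K = P \<and> idx (span_over P xs) P = p ^ j"
    if "xs \<in> ?I" for xs
    using indep_lists_props[OF P K(1,2) p _ that] pQ by auto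
  have sub: "span_over P ` ?I \<subseteq> ?C"
  proof (rule image_subsetI)
    fix xs assume xs: "xs \<in> ?I"
    have "span_over P xs \<subseteq> Q" using propsI[OF xs] by (intro span_over_least[OF Q PQ]) auto
    then show "span_over P xs \<in> ?C"
      using propsI[OF xs] span_over_upper[OF P] addsub_span_over[OF P] by (simp add: complements_def)
  qed
  have fibre: "{xs \<in> indep_lists (T \<inter> Q) K P i. span_over P xs \<subseteq> U} = indep_lists (T \<inter> U) P P i" 
    if U: "U \<in> ?C" for U i
  proof (induction i)
    case 0
    then show ?case using U by (auto simp: complements_def)
  next
    case (Suc i)
    have U': "addsub U" "P \<subseteq> U" "U \<subseteq> Q" "U \<inter> K = P" using U by (auto simp: complements_def)
    \<comment> \<open>Inside \<open>U\<close>, avoiding \<open>K\<close> amounts to avoiding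
      \<open>P\<close>, because \<open>U \<inter> K = P\<close>.\<close>
    have iff: "x \<notin> ssum K (span_over P ys) \<longleftrightarrow> x \<notin> ssum P (span_over P ys)"
      if ys: "span_over P ys \<subseteq> U" and x: "x \<in> U" for x ys
    proof -
      have S: "addsub (span_over P ys)" by (rule addsub_span_over[OF P])
      have "x \<in> ssum P (span_over P ys)" if "x \<in> ssum K (span_over P ys)"
      proof -
        obtain k s where ks: "k \<in> K" "s \<in> span_over P ys" "x = k + s" using \<open>x \<in> ssum K (span_over P ys)\<close>
          by (auto simp: in_ssum)
        have "k = x - s" using ks by simp
        then have "k \<in> U" using addsub_diff[OF U'(1) x, of s] ks(2) ys by blast
        then have "k \<in> P" using ks U' by blast
        then show ?thesis using ks by (auto simp: in_ssum)
      qed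
      moreover have "x \<in> ssum K (span_over P ys)" if "x \<in> ssum P (span_over P ys)"
        using that K by (auto simp: in_ssum)
      ultimately show ?thesis by blast
    qed
    have sp: "span_over P (x # ys) \<subseteq> U \<longleftrightarrow> x \<in> U \<and> span_over P ys \<subseteq> U" for x ys
    proof
      assume *: "span_over P (x # ys) \<subseteq> U"
      then show "x \<in> U \<and> span_over P ys \<subseteq> U"
        using span_over_mem[OF P, of x "x # ys"] ssum_upper2[OF addsub_multiples, of "span_over P ys" x] by auto
    next
      assume *: "x \<in> U \<and> span_over P ys \<subseteq> U"
      then show "span_over P (x # ys) \<subseteq> U"
        unfolding span_over.simps by (intro ssum_least[OF U'(1)]) (auto intro: scale_closed[OF U'(1)])
    qed
    show ?case
    proof (intro equalityI subsetI)
      fix xs assume "xs \<in> {xs \<in> indep_lists (T \<inter> Q) K P (Suc i). span_over P xs \<subseteq> U}"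
      then obtain x ys where xs: "xs = x # ys" "ys \<in> indep_lists (T \<inter> Q) K P i" "x \<in> T"
        "x \<notin> ssum K (span_over P ys)" "x \<in> U" "span_over P ys \<subseteq> U" using sp by auto
      then have "ys \<in> indep_lists (T \<inter> U) P P i" using Suc by blast
      then show "xs \<in> indep_lists (T \<inter> U) P P (Suc i)" using xs iff by auto
    next
      fix xs assume "xs \<in> indep_lists (T \<inter> U) P P (Suc i)"
      then obtain x ys where xs: "xs = x # ys" "ys \<in> indep_lists (T \<inter> U) P P i" "x \<in> T" "x \<in> U"
        "x \<notin> ssum P (span_over P ys)" by auto
      then have "ys \<in> indep_lists (T \<inter> Q) K P i" "span_over P ys \<subseteq> U" using Suc by auto
      moreover have "x \<in> T \<inter> Q - ssum K (span_over P ys)"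
        using xs iff[OF calculation(2) xs(4)] U'(3) by blast
      moreover have "span_over P (x # ys) \<subseteq> U" using sp calculation(2) xs(4) by blast
      ultimately show "xs \<in> {xs \<in> indep_lists (T \<inter> Q) K P (Suc i). span_over P xs \<subseteq> U}"
        unfolding indep_lists.simps xs(1) by blast
    qed
  qed
  have fib: "{xs \<in> ?I. span_over P xs = U} = indep_lists (T \<inter> U) P P j" if U: "U \<in> ?C" for U
  proof -
    have U': "addsub U" "idx U P = p ^ j" using U by (auto simp: complements_def)
    \<comment> \<open>A span contained in \<open>U\<close> already has the index of \<open>U\<close>
      over \<open>P\<close>.\<close>
    have "span_over P xs = U" if xs: "xs \<in> ?I" "span_over P xs \<subseteq> U" for xs
    proof (rule idx_1_imp_eq[OF U'(1) addsub_span_over[OF P] xs(2)])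
      have "p ^ j = idx U (span_over P xs) * p ^ j"
        using idx_mult[OF P addsub_span_over[OF P] U'(1) span_over_upper[OF P] xs(2)] propsI[OF xs(1)] U'(2) by simp
      then show "idx U (span_over P xs) = 1" using prime_gt_0_nat[OF p] by simp
    qed
    then show ?thesis using fibre[OF U, of j] by blast
  qed
  have cardU: "card (indep_lists (T \<inter> U) P P j) = (\<Prod>i<j. p ^ j - p ^ i)" if U: "U \<in> ?C" for U
  proof -
    have U': "addsub U" "P \<subseteq> U" "U \<subseteq> Q" "idx U P = p ^ j" using U by (auto simp: complements_def)
    then have "card (indep_lists (T \<inter> U) P P j) = (\<Prod>i<j. idx U P - idx P P * p ^ i)"
      using T(3) pQ by (intro card_indep_lists[OF P P _ _ _ p _ T(2)]) auto
    then show ?thesis by (simp add: U' idx_self[OF P])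
  qed
  have pos: "(\<Prod>i<j. p ^ j - p ^ i) > 0"
    using prime_gt_1_nat[OF p] by (intro prod_pos) auto
  have surj: "span_over P ` ?I = ?C"
  proof (rule equalityI[OF sub], rule subsetI)
    fix U assume U: "U \<in> ?C"
    have "card (indep_lists (T \<inter> U) P P j) \<noteq> 0" unfolding cardU[OF U] using pos by linarith
    then have "indep_lists (T \<inter> U) P P j \<noteq> {}" by (metis card.empty)
    then obtain xs where "xs \<in> {xs \<in> ?I. span_over P xs = U}" unfolding fib[OF U] by blast
    then show "U \<in> span_over P ` ?I" by blast
  qed
  have finI: "finite ?I" using T(2) by (intro finite_indep_lists) blast
  show finC: "finite ?C" using finite_imageI[OF finI, of "span_over P"] unfolding surj .
  have "card ?I = (\<Sum>U\<in>?C. card {xs \<in> ?I. span_over P xs = U})"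
    using sum.group[OF finI finC sub, of "\<lambda>_. 1::nat"] by simp
  also have "\<dots> = card ?C * (\<Prod>i<j. p ^ j - p ^ i)" using fib cardU by simp
  finally show "card ?C * (\<Prod>i<j. p ^ j - p ^ i) = (\<Prod>i<j. idx Q P - idx K P * p ^ i)"
    using card_indep_lists[OF P K Q p pQ T(2,3), of j] by simp
qed

text \<open>A complement maps onto a \<open>j\<close>-dimensional subspace of \<open>Q/K\<close>,
  and each such subspace has \<open>p^(c j)\<close> lifts that avoid \<open>K\<close>. The proof
  extracts these two factors from the double count by dividing \<open>p^c\<close> out of every term
  of the product.\<close>

lemma card_complements:
  assumes P: "addsub P" and K: "addsub K" "P \<subseteq> K" "K \<subseteq> Q" and Q: "addsub Q"
    and p: "prime (p::nat)" and pQ: "\<And>x. x \<in> Q \<Longrightarrow> scale (int p) x \<in> P"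
    and iQ: "idx Q P = p ^ m" and iK: "idx K P = p ^ c"
  shows "card (complements Q K P (p ^ j)) = p ^ (c * j) * gauss_binom (m - c) j p"
proof -
  have p1: "p > 1" using p by (rule prime_gt_1_nat)
  have "p ^ c dvd p ^ m" using idx_mult[OF P K(1) Q K(2,3)] iQ iK by simp
  then have cm: "c \<le> m" using p1 by (simp add: power_dvd_imp_le)
  have "idx Q P > 0" using iQ p1 by simp
  note mult = card_complements_mult(1)[OF P K Q p pQ this, of j]
  define N where "N = card (complements Q K P (p ^ j))"
  show ?thesis
  proof (cases "j \<le> m - c")
    case True
    have le: "p ^ c * p ^ i \<le> p ^ m" if "i < j" for i
      unfolding power_add[symmetric] using True that cm p1 by (intro power_increasing) auto
    have "real N * gauss_prod j j (real p) = real (N * (\<Prod>i<j. p ^ j - p ^ i))"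
      using p1 by (simp add: gauss_prod_def of_nat_diff)
    also have "\<dots> = real (\<Prod>i<j. p ^ m - p ^ c * p ^ i)"
      using mult by (simp add: N_def iQ iK)
    also have "\<dots> = (\<Prod>i<j. real p ^ m - real p ^ c * real p ^ i)"
      unfolding of_nat_prod by (intro prod.cong refl) (use le in \<open>simp add: of_nat_diff\<close>)
    also have "\<dots> = (\<Prod>i<j. real p ^ c * (real p ^ (m - c) - real p ^ i))"
      using cm by (intro prod.cong refl) (simp add: right_diff_distrib power_add[symmetric])
    also have "\<dots> = real p ^ (c * j) * gauss_prod (m - c) j (real p)"
      by (simp add: prod.distrib gauss_prod_def power_mult)
    also have "\<dots> = real p ^ (c * j) * gauss_binom (m - c) j (real p) * gauss_prod j j (real p)"
      by (simp add: gauss_binom_gauss_prod mult.assoc)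
    finally have eq: "real N * gauss_prod j j (real p)
      = real p ^ (c * j) * gauss_binom (m - c) j (real p) * gauss_prod j j (real p)" .
    have "1 < real p ^ i" if "i > 0" for i using p1 that by (intro one_less_power) auto
    then have "real p ^ i \<noteq> 1" if "i > 0" for i using that by (metis less_irrefl)
    then have nz: "gauss_prod j j (real p) \<noteq> 0" using p1 by (intro gauss_prod_self_nonzero) auto
    have "real N = real p ^ (c * j) * gauss_binom (m - c) j (real p)"
      using mult_right_cancel[OF nz, THEN iffD1, OF eq] .
    also have "\<dots> = real (p ^ (c * j) * gauss_binom (m - c) j p)" by (simp add: of_nat_gauss_binom)
    finally show ?thesis unfolding N_def by (simp only: of_nat_eq_iff)
  next
    case False
    \<comment> \<open>The factor with index \<open>m - c\<close> vanishes, in agreement with the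
      Gaussian binomial for \<open>j > m - c\<close>.\<close>
    then have "(\<Prod>i<j. idx Q P - idx K P * p ^ i) = 0"
      using cm by (auto simp: iQ iK power_add[symmetric] intro!: bexI[of _ "m - c"])
    moreover have "(\<Prod>i<j. p ^ j - p ^ i) \<noteq> 0" using p1 by auto
    ultimately have "N = 0" using mult unfolding N_def by (metis mult_eq_0_iff)
    then show ?thesis using False by (simp add: N_def gauss_binom_eq_0)
  qed
qed

section \<open>Sums over weakly increasing words\<close>

text \<open>Fubini in the form used throughout: summability of the inner absolute sums
  \<open>H\<close> supplies the absolute convergence that allows the two summations to be
  merged.\<close>

lemma has_sum_SigmaI_abs:
  fixes f :: "'a \<times> 'b \<Rightarrow> complex"
  assumes F: "\<And>x. x \<in> A \<Longrightarrow> ((\<lambda>y. f (x, y)) has_sum F x) (B x)"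
    and H: "\<And>x. x \<in> A \<Longrightarrow> ((\<lambda>y. norm (f (x, y))) has_sum H x) (B x)"
    and "H summable_on A" and S: "(F has_sum S) A"
  shows "(f has_sum S) (Sigma A B)"
proof -
  have "(\<lambda>z. norm (f z)) summable_on Sigma A B"
    by (rule summable_on_SigmaI[OF H \<open>H summable_on A\<close>]) auto
  then have "f summable_on Sigma A B" by (rule abs_summable_summable)
  from has_sum_SigmaI[OF F S this] show ?thesis .
qed

lemma has_sum_Sigma_finite:
  fixes f :: "'a \<times> 'b \<Rightarrow> complex"
  assumes "finite A" and F: "\<And>x. x \<in> A \<Longrightarrow> ((\<lambda>y. f (x, y)) has_sum F x) (B x)"
  shows "(f has_sum (\<Sum>x\<in>A. F x)) (Sigma A B)"
proof (rule has_sum_SigmaI_abs[OF F])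
  show "((\<lambda>y. norm (f (x, y))) has_sum (\<Sum>\<^sub>\<infinity>y\<in>B x. norm (f (x, y)))) (B x)" if "x \<in> A" for x
    using F[OF that] by (metis has_sum_imp_summable summable_on_iff_abs_summable_on_complex has_sum_infsum)
qed (use assms(1) in auto)

lemma has_sum_times:
  fixes f :: "'a \<Rightarrow> complex" and g :: "'b \<Rightarrow> complex"
  assumes f: "(f has_sum a) A" and g: "(g has_sum b) B"
  shows "((\<lambda>(x, y). f x * g y) has_sum (a * b)) (A \<times> B)"
proof -
  have nf: "(\<lambda>x. norm (f x)) summable_on A" and ng: "(\<lambda>x. norm (g x)) summable_on B"
    using f g by (metis has_sum_imp_summable summable_on_iff_abs_summable_on_complex)+
  show ?thesis
  proof (rule has_sum_SigmaI_abs)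
    fix x
    show "((\<lambda>y. case (x, y) of (x, y) \<Rightarrow> f x * g y) has_sum f x * b) B"
      using has_sum_cmult_right[OF g, of "f x"] by simp
    show "((\<lambda>y. norm (case (x, y) of (x, y) \<Rightarrow> f x * g y)) has_sum
        norm (f x) * (\<Sum>\<^sub>\<infinity>y\<in>B. norm (g y))) B"
      using has_sum_cmult_right[OF has_sum_infsum[OF ng], of "norm (f x)"] by (simp add: norm_mult)
  next
    show "(\<lambda>x. norm (f x) * (\<Sum>\<^sub>\<infinity>y\<in>B. norm (g y))) summable_on A"
      by (rule summable_on_cmult_left[OF nf])
    show "((\<lambda>x. f x * b) has_sum a * b) A" by (rule has_sum_cmult_left[OF f])
  qed
qed

lemma has_sum_geometric:
  fixes z :: complex
  assumes "norm z < 1"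
  shows "((\<lambda>k. z ^ k) has_sum (1 / (1 - z))) UNIV"
proof (rule norm_summable_imp_has_sum)
  show "summable (\<lambda>n. norm (z ^ n))" using assms by (simp add: norm_power summable_geometric)
  show "(\<lambda>k. z ^ k) sums (1 / (1 - z))" using assms by (rule geometric_sums)
qed

lemma has_sum_geo:
  assumes "norm z < 1"
  shows "((\<lambda>k. z ^ Suc k) has_sum geo z) UNIV"
  using has_sum_cmult_right[OF has_sum_geometric[OF assms], of z] by (simp add: geo_def)

text \<open>Such a word amounts to a positive multiplicity for each letter of \<open>A\<close>,
  whence a product of the series \<open>geo\<close>.\<close>

definition slists :: "nat set \<Rightarrow> nat list set"
  where "slists A = {us. sorted us \<and> set us = A}"

text \<open>A new least letter fills an initial block. The block is nonempty because the letter
  belongs to the prescribed set, hence \<open>Suc k\<close>.\<close>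

lemma slists_insert:
  assumes b: "\<And>a. a \<in> A \<Longrightarrow> b < a"
  shows "bij_betw (\<lambda>(k, us). replicate (Suc k) b @ us) (UNIV \<times> slists A) (slists (insert b A))"
  unfolding bij_betw_def
proof
  have bA: "b \<notin> A" using b by blast
  have len: "length (filter (\<lambda>x. x = b) (replicate (Suc k) b @ us)) = Suc k"
    and fil: "filter (\<lambda>x. x \<noteq> b) (replicate (Suc k) b @ us) = us" if "us \<in> slists A" for k us
    using that bA by (auto simp: slists_def filter_empty_conv filter_id_conv)
  show "inj_on (\<lambda>(k, us). replicate (Suc k) b @ us) (UNIV \<times> slists A)"
  proof (rule inj_onI, clarify)
    fix k us l vs assume "us \<in> slists A" "vs \<in> slists A"
      and eq: "replicate (Suc k) b @ us = replicate (Suc l) b @ vs"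
    then show "k = l \<and> us = vs"
      using len[of us k] len[of vs l] fil[of us k] fil[of vs l] by (metis nat.inject)
  qed
  show "(\<lambda>(k, us). replicate (Suc k) b @ us) ` (UNIV \<times> slists A) = slists (insert b A)"
  proof (intro equalityI subsetI)
    fix ws assume "ws \<in> (\<lambda>(k, us). replicate (Suc k) b @ us) ` (UNIV \<times> slists A)"
    then show "ws \<in> slists (insert b A)" using b
      by (auto simp: slists_def sorted_append less_imp_le)
  next
    fix ws assume ws: "ws \<in> slists (insert b A)"
    have split: "ws = replicate (length (takeWhile (\<lambda>x. x = b) ws)) b @ dropWhile (\<lambda>x. x = b) ws"
      by (metis (mono_tags, lifting) replicate_eqI set_takeWhileD takeWhile_dropWhile_id)
    let ?us = "dropWhile (\<lambda>x. x = b) ws" and ?k = "length (takeWhile (\<lambda>x. x = b) ws)"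
    have sorted: "sorted ?us" using ws by (simp add: slists_def sorted_dropWhile)
    have nb: "b \<notin> set ?us"
    proof
      assume "b \<in> set ?us"
      then have ne: "?us \<noteq> []" by (metis empty_iff empty_set)
      then have hd: "hd ?us \<noteq> b" using hd_dropWhile[of "\<lambda>x. x = b" ws] by blast
      have "hd ?us \<in> set ?us" using ne by simp
      then have "hd ?us \<in> insert b A" using ws by (auto simp: slists_def dest: set_dropWhileD)
      then have "b < hd ?us" using hd b by auto
      moreover have "hd ?us \<le> b" using sorted \<open>b \<in> set ?us\<close> by (cases ?us) auto
      ultimately show False by simp
    qed
    have un: "set ws = set (replicate ?k b) \<union> set ?us" by (subst (1) split) (rule set_append)
    have "?k \<noteq> 0"
    proof
      assume "?k = 0"
      then have "set ws = set ?us" using un by simp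
      then show False using nb ws by (auto simp: slists_def)
    qed
    then obtain k where k: "?k = Suc k" using not0_implies_Suc by blast
    have "insert b A = set (replicate ?k b) \<union> set ?us" using un ws by (simp only: slists_def mem_Collect_eq)
    also have "set (replicate ?k b) = {b}" using k by (simp only: set_replicate_Suc)
    finally have "insert b A = insert b (set ?us)" by simp
    then have "set ?us = A" using nb bA by (metis insert_ident)
    then have "?us \<in> slists A" using sorted by (simp add: slists_def)
    moreover have "ws = (\<lambda>(k, us). replicate (Suc k) b @ us) (k, ?us)" using split k by simp
    ultimately show "ws \<in> (\<lambda>(k, us). replicate (Suc k) b @ us) ` (UNIV \<times> slists A)" by blast
  qed
qed

lemma has_sum_slists:
  fixes f :: "nat \<Rightarrow> complex"
  assumes "finite A" "\<And>i. i \<in> A \<Longrightarrow> norm (f i) < 1"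
  shows "((\<lambda>us. prod_list (map f us)) has_sum (\<Prod>i\<in>A. geo (f i))) (slists A)"
  using assms
proof (induction A rule: finite_linorder_min_induct)
  case empty
  have "slists {} = {[]}" by (auto simp: slists_def)
  then show ?case by (simp add: has_sum_finite_iff)
next
  case (insert b A)
  have "((\<lambda>(k, us). f b ^ Suc k * prod_list (map f us)) has_sum (geo (f b) * (\<Prod>i\<in>A. geo (f i))))
      (UNIV \<times> slists A)"
    by (rule has_sum_times[OF has_sum_geo insert.IH]) (use insert.prems in auto)
  then have "((\<lambda>x. prod_list (map f ((\<lambda>(k, us). replicate (Suc k) b @ us) x)))
      has_sum (geo (f b) * (\<Prod>i\<in>A. geo (f i)))) (UNIV \<times> slists A)"
    by (rule has_sum_cong[THEN iffD1, rotated]) auto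
  then have "((\<lambda>us. prod_list (map f us)) has_sum (geo (f b) * (\<Prod>i\<in>A. geo (f i)))) (slists (insert b A))"
    using has_sum_reindex_bij_betw[OF slists_insert[of A b], of "\<lambda>us. prod_list (map f us)"] insert.hyps
    by blast
  then show ?case using insert.hyps by auto
qed

definition words_idx :: "nat \<Rightarrow> (nat list \<times> nat) set"
  where "words_idx m = {(js, a). sorted js \<and> set js \<subseteq> {..<m}}"

text \<open>The last factor covers the exponents \<open>a\<close> beyond the length of the word, where
  \<open>(M : p\<^sup>a)\<close> is the whole lattice.\<close>

definition word_wt :: "nat \<Rightarrow> (nat set \<Rightarrow> complex) \<Rightarrow> (nat \<Rightarrow> complex) \<Rightarrow> (nat \<Rightarrow> complex)
    \<Rightarrow> nat list \<times> nat \<Rightarrow> complex"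
  where "word_wt m \<beta> X Y = (\<lambda>(js, a). \<beta> (set js) * prod_list (map Y (take a js))
    * prod_list (map X (drop a js)) * Y m ^ (a - length js))"

text \<open>The letter sets of an initial and of a final segment of a weakly increasing word. They
  share at most one letter, namely the one whose block is cut.\<close>

definition cuts :: "nat set \<Rightarrow> (nat set \<times> nat set) set"
  where "cuts I = {(A, B). A \<subseteq> I \<and> B \<subseteq> I \<and> (\<forall>a\<in>A. \<forall>b\<in>B. a \<le> b)}"

lemma finite_cuts: "finite I \<Longrightarrow> finite (cuts I)"
  by (rule finite_subset[of _ "Pow I \<times> Pow I"]) (auto simp: cuts_def)

text \<open>Pairs with \<open>a \<le> length js\<close> are cut after \<open>a\<close> letters and
  grouped by the letter sets of the two segments. The others are grouped by the letter set of the
  word; their surplus \<open>a - length js\<close> is positive and sums to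
  \<open>geo (Y m)\<close>.\<close>

lemma has_sum_words:
  assumes Y: "\<And>j. j \<le> m \<Longrightarrow> norm (Y j) < 1" and X: "\<And>j. j < m \<Longrightarrow> norm (X j) < 1"
  shows "(word_wt m \<beta> X Y has_sum
     ((\<Sum>(A, B)\<in>cuts {..<m}. \<beta> (A \<union> B) * ((\<Prod>i\<in>A. geo (Y i)) * (\<Prod>i\<in>B. geo (X i))))
      + (\<Sum>A\<in>Pow {..<m}. \<beta> A * ((\<Prod>i\<in>A. geo (Y i)) * geo (Y m))))) (words_idx m)"
proof -
  define W1 where "W1 = {(js, a). sorted js \<and> set js \<subseteq> {..<m} \<and> a \<le> length js}"
  define W2 where "W2 = {(js, a). sorted js \<and> set js \<subseteq> {..<m} \<and> length js < a}"
  have split: "words_idx m = W1 \<union> W2" "W1 \<inter> W2 = {}"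
    by (auto simp: words_idx_def W1_def W2_def)
  have fin: "finite A" if "A \<subseteq> {..<m}" for A using that finite_subset by blast
  have td: "x \<le> y" if "sorted js" "x \<in> set (take a js)" "y \<in> set (drop a js)" for x y :: nat and js a
    using that by (metis append_take_drop_id sorted_append)
  have b1: "bij_betw (\<lambda>((A, B), (us, vs)). (us @ vs, length us))
      (Sigma (cuts {..<m}) (\<lambda>(A, B). slists A \<times> slists B)) W1"
    by (rule bij_betwI[where g = "\<lambda>(js, a). ((set (take a js), set (drop a js)), (take a js, drop a js))"])
       (auto simp: W1_def cuts_def slists_def sorted_append sorted_wrt_take sorted_wrt_drop
         dest: in_set_takeD in_set_dropD intro: td)
  have s1: "((\<lambda>((A, B), (us, vs)). word_wt m \<beta> X Y (us @ vs, length us)) has_sum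
      (\<Sum>(A, B)\<in>cuts {..<m}. \<beta> (A \<union> B) * ((\<Prod>i\<in>A. geo (Y i)) * (\<Prod>i\<in>B. geo (X i)))))
      (Sigma (cuts {..<m}) (\<lambda>(A, B). slists A \<times> slists B))"
  proof (rule has_sum_Sigma_finite)
    show "finite (cuts {..<m})" by (simp add: finite_cuts)
    fix x assume "x \<in> cuts {..<m}"
    then obtain A B where x: "x = (A, B)" "A \<subseteq> {..<m}" "B \<subseteq> {..<m}" by (auto simp: cuts_def)
    have "((\<lambda>(us, vs). prod_list (map Y us) * prod_list (map X vs)) has_sum
        ((\<Prod>i\<in>A. geo (Y i)) * (\<Prod>i\<in>B. geo (X i)))) (slists A \<times> slists B)"
      by (rule has_sum_times[OF has_sum_slists has_sum_slists])
         (use x X Y fin in \<open>auto simp: subset_iff less_imp_le\<close>)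
    from has_sum_cmult_right[OF this, of "\<beta> (A \<union> B)"]
    show "((\<lambda>y. (\<lambda>((A, B), (us, vs)). word_wt m \<beta> X Y (us @ vs, length us)) (x, y)) has_sum
        (\<lambda>(A, B). \<beta> (A \<union> B) * ((\<Prod>i\<in>A. geo (Y i)) * (\<Prod>i\<in>B. geo (X i)))) x)
        ((\<lambda>(A, B). slists A \<times> slists B) x)"
      unfolding x prod.case by (rule has_sum_cong[THEN iffD1, rotated]) (auto simp: word_wt_def slists_def)
  qed
  have h1: "(word_wt m \<beta> X Y has_sum
      (\<Sum>(A, B)\<in>cuts {..<m}. \<beta> (A \<union> B) * ((\<Prod>i\<in>A. geo (Y i)) * (\<Prod>i\<in>B. geo (X i))))) W1"
    unfolding has_sum_reindex_bij_betw[OF b1, symmetric]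
    by (rule has_sum_cong[THEN iffD1, OF _ s1]) auto
  have b2: "bij_betw (\<lambda>(A, (us, k)). (us, length us + Suc k))
      (Sigma (Pow {..<m}) (\<lambda>A. slists A \<times> UNIV)) W2"
    by (rule bij_betwI[where g = "\<lambda>(js, a). (set js, (js, a - length js - 1))"])
       (auto simp: W2_def slists_def)
  have s2: "((\<lambda>(A, (us, k)). word_wt m \<beta> X Y (us, length us + Suc k)) has_sum
      (\<Sum>A\<in>Pow {..<m}. \<beta> A * ((\<Prod>i\<in>A. geo (Y i)) * geo (Y m))))
      (Sigma (Pow {..<m}) (\<lambda>A. slists A \<times> UNIV))"
  proof (rule has_sum_Sigma_finite)
    fix A assume A: "A \<in> Pow {..<m}"
    have "((\<lambda>(us, k). prod_list (map Y us) * Y m ^ Suc k) has_sum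
        ((\<Prod>i\<in>A. geo (Y i)) * geo (Y m))) (slists A \<times> UNIV)"
      by (rule has_sum_times[OF has_sum_slists has_sum_geo])
         (use A Y fin in \<open>auto simp: subset_iff less_imp_le\<close>)
    from has_sum_cmult_right[OF this, of "\<beta> A"]
    show "((\<lambda>y. (\<lambda>(A, (us, k)). word_wt m \<beta> X Y (us, length us + Suc k)) (A, y)) has_sum
        (\<beta> A * ((\<Prod>i\<in>A. geo (Y i)) * geo (Y m)))) (slists A \<times> UNIV)"
      unfolding prod.case by (rule has_sum_cong[THEN iffD1, rotated]) (auto simp: word_wt_def slists_def)
  qed simp
  have h2: "(word_wt m \<beta> X Y has_sum
      (\<Sum>A\<in>Pow {..<m}. \<beta> A * ((\<Prod>i\<in>A. geo (Y i)) * geo (Y m)))) W2"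
    unfolding has_sum_reindex_bij_betw[OF b2, symmetric]
    by (rule has_sum_cong[THEN iffD1, OF _ s2]) auto
  show ?thesis unfolding split(1) by (rule has_sum_Un_disjoint[OF h1 h2 split(2)])
qed

text \<open>Either a block of equal letters \<open>j\<close> is cut, and both sides contain
  \<open>j\<close>; or the cut falls between blocks, and \<open>j\<close> is the least letter on the
  right, with \<open>j = m\<close> standing for an empty right side. These families index the last
  two sums of \<open>W_I\<close>.\<close>

lemma cuts_with_union:
  assumes I: "I \<subseteq> {1..m-1}" "m \<ge> 1"
  shows "{(A, B) \<in> cuts I. A \<union> B = I} =
     (\<lambda>j. ({i\<in>I. i \<le> j}, {i\<in>I. i \<ge> j})) ` I \<union>
     (\<lambda>j. ({i\<in>I. i < j}, {i\<in>I. i \<ge> j})) ` (I \<union> {m})" (is "?L = ?R1 \<union> ?R2")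
proof
  have fI: "finite I" using I finite_subset by blast
  have Im: "i < m" if "i \<in> I" for i using I that by (auto simp: subset_iff)
  show "?R1 \<union> ?R2 \<subseteq> ?L"
  proof (intro Un_least image_subsetI)
    show "({i\<in>I. i \<le> j}, {i\<in>I. i \<ge> j}) \<in> ?L" for j by (auto simp: cuts_def)
    show "({i\<in>I. i < j}, {i\<in>I. i \<ge> j}) \<in> ?L" for j by (auto simp: cuts_def)
  qed
  show "?L \<subseteq> ?R1 \<union> ?R2"
  proof
    fix x assume "x \<in> ?L"
    then obtain A B where x: "x = (A, B)" and AB: "A \<union> B = I" and le: "\<And>a b. a \<in> A \<Longrightarrow> b \<in> B \<Longrightarrow> a \<le> b"
      by (auto simp: cuts_def)
    consider j where "j \<in> A" "j \<in> B" | "A \<inter> B = {}" "B = {}" | "A \<inter> B = {}" "B \<noteq> {}" by blast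
    then show "x \<in> ?R1 \<union> ?R2"
    proof cases
      case 1
      have "i \<in> A \<longleftrightarrow> i \<in> I \<and> i \<le> j" "i \<in> B \<longleftrightarrow> i \<in> I \<and> j \<le> i" for i
        unfolding AB[symmetric] using 1 le[of i j] le[of j i] order_antisym[of i j] by blast+
      then have "A = {i\<in>I. i \<le> j}" "B = {i\<in>I. i \<ge> j}" by blast+
      moreover have "j \<in> I" using AB 1 by blast
      ultimately show ?thesis unfolding x by blast
    next
      case 2
      have "A = {i\<in>I. i < m}" "B = {i\<in>I. i \<ge> m}"
        using AB 2 Im by fastforce+
      then show ?thesis unfolding x by blast
    next
      case 3
      have fB: "finite B" using fI AB by (metis finite_Un)
      define j where "j = Min B"
      have j: "j \<in> B" "\<And>b. b \<in> B \<Longrightarrow> j \<le> b" using 3 fB by (auto simp: j_def)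
      have "i < j" if "i \<in> A" for i using le[OF that j(1)] that j(1) 3 by (metis disjoint_iff le_neq_implies_less)
      then have "A = {i\<in>I. i < j}" "B = {i\<in>I. i \<ge> j}"
        using AB j by (auto simp: not_less[symmetric])
      moreover have "j \<in> I" using AB j by blast
      ultimately show ?thesis unfolding x by blast
    qed
  qed
qed

lemma sum_cuts_with_union:
  fixes X Y :: "nat \<Rightarrow> complex"
  assumes I: "I \<subseteq> {1..m-1}" "m \<ge> 1"
  shows "(\<Sum>(A, B)\<in>{(A, B) \<in> cuts I. A \<union> B = I}. (\<Prod>i\<in>A. geo (Y i)) * (\<Prod>i\<in>B. geo (X i))) =
    (\<Sum>j\<in>I. (\<Prod>i\<in>{i\<in>I. i \<le> j}. geo (Y i)) * (\<Prod>i\<in>{i\<in>I. i \<ge> j}. geo (X i))) +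
    (\<Sum>j\<in>I \<union> {m}. (\<Prod>i\<in>{i\<in>I. i < j}. geo (Y i)) * (\<Prod>i\<in>{i\<in>I. i \<ge> j}. geo (X i)))"
proof -
  have fI: "finite I" using I finite_subset by blast
  have inj1: "inj_on (\<lambda>j. ({i\<in>I. i \<le> j}, {i\<in>I. i \<ge> j})) I"
    by (rule inj_onI) (auto simp: set_eq_iff intro: order_antisym)
  have inj2: "inj_on (\<lambda>j. ({i\<in>I. i < j}, {i\<in>I. i \<ge> j})) (I \<union> {m})"
  proof (rule inj_onI)
    fix j k assume jk: "j \<in> I \<union> {m}" "k \<in> I \<union> {m}"
      and "({i\<in>I. i < j}, {i\<in>I. i \<ge> j}) = ({i\<in>I. i < k}, {i\<in>I. i \<ge> k})"
    then have eq: "i \<ge> j \<longleftrightarrow> i \<ge> k" if "i \<in> I" for i using that by (auto simp: set_eq_iff)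
    have Im: "\<not> m \<le> i" if "i \<in> I" for i using I that by (auto simp: subset_iff)
    show "j = k" using jk eq[of j] eq[of k] Im by auto
  qed
  have disj: "(\<lambda>j. ({i\<in>I. i \<le> j}, {i\<in>I. i \<ge> j})) ` I \<inter>
     (\<lambda>j. ({i\<in>I. i < j}, {i\<in>I. i \<ge> j})) ` (I \<union> {m}) = {}"
  proof -
    have "({i\<in>I. i \<le> j}, {i\<in>I. i \<ge> j}) \<noteq> ({i\<in>I. i < k}, {i\<in>I. i \<ge> k})" if "j \<in> I" for j k
    proof
      assume "({i\<in>I. i \<le> j}, {i\<in>I. i \<ge> j}) = ({i\<in>I. i < k}, {i\<in>I. i \<ge> k})"
      then have "j \<in> {i\<in>I. i < k}" "j \<in> {i\<in>I. i \<ge> k}" using that by blast+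
      then show False by simp
    qed
    then show ?thesis by blast
  qed
  define g where "g = (\<lambda>(A, B). (\<Prod>i\<in>A. geo (Y i)) * (\<Prod>i\<in>B. geo (X i)))"
  have "sum g {(A, B) \<in> cuts I. A \<union> B = I}
      = sum g ((\<lambda>j. ({i\<in>I. i \<le> j}, {i\<in>I. i \<ge> j})) ` I)
        + sum g ((\<lambda>j. ({i\<in>I. i < j}, {i\<in>I. i \<ge> j})) ` (I \<union> {m}))"
    unfolding cuts_with_union[OF I] using fI by (intro sum.union_disjoint disj finite_imageI) auto
  then show ?thesis
    unfolding sum.reindex[OF inj1] sum.reindex[OF inj2] by (simp only: g_def o_def prod.case)
qed

text \<open>The weight \<open>\<beta>\<close> does not see the letter 0. As the least letter, 0 can
  be added to the left side of every cut, which multiplies the sum by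
  \<open>1 + geo (Y 0) = 1 / (1 - Y 0)\<close>. In what remains, a 0 on the right forces an empty
  left side and gives the \<open>X 0\<close> term of \<open>W_I\<close>; cuts inside
  \<open>{1..m-1}\<close> give its last two sums, and the words with surplus its \<open>Y m\<close>
  term.\<close>

lemma sum_words_eq_W:
  fixes X Y :: "nat \<Rightarrow> complex"
  assumes m: "m \<ge> 1" and \<beta>: "\<And>J. J \<subseteq> {1..m-1} \<Longrightarrow> \<beta> (insert 0 J) = \<beta> J"
    and Y0: "norm (Y 0) < 1"
  shows "(\<Sum>(A, B)\<in>cuts {..<m}. \<beta> (A \<union> B) * ((\<Prod>i\<in>A. geo (Y i)) * (\<Prod>i\<in>B. geo (X i))))
      + (\<Sum>A\<in>Pow {..<m}. \<beta> A * ((\<Prod>i\<in>A. geo (Y i)) * geo (Y m)))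
    = 1 / (1 - Y 0) * (\<Sum>I\<in>Pow {1..m-1}. \<beta> I * W_I m I X Y)"
proof -
  define J where "J = {1..m-1}"
  have mJ: "{..<m} = insert 0 J" "0 \<notin> J" "finite J" using m by (auto simp: J_def)
  have finJ: "finite A" if "A \<subseteq> J" for A using that mJ(3) finite_subset by blast
  have "1 - Y 0 \<noteq> 0" using Y0 by auto
  then have g0: "1 + geo (Y 0) = 1 / (1 - Y 0)" by (simp add: geo_def field_simps)
  define x y where "x B = (\<Prod>i\<in>B. geo (X i))" and "y A = (\<Prod>i\<in>A. geo (Y i))" for A B
  have y0: "y (insert 0 A) = geo (Y 0) * y A" and x0: "x (insert 0 A) = geo (X 0) * x A"
    if A: "A \<subseteq> J" for A
  proof -
    have "0 \<notin> A" using A mJ(2) by blast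
    then show "y (insert 0 A) = geo (Y 0) * y A" "x (insert 0 A) = geo (X 0) * x A"
      unfolding y_def x_def using finJ[OF A] by simp_all
  qed
  have \<beta>': "\<beta> (insert 0 A) = \<beta> A" if "A \<subseteq> J" for A using \<beta> that by (simp add: J_def)
  define S2 where "S2 = (\<Sum>A\<in>Pow J. \<beta> A * (y A * geo (Y m)))"
  have inj0: "inj_on (insert 0) (Pow J)"
  proof (rule inj_onI)
    fix A C assume A: "A \<in> Pow J" "C \<in> Pow J" and eq: "insert 0 A = insert 0 C"
    have "0 \<notin> A" "0 \<notin> C" using A mJ(2) by blast+
    then show "A = C" using eq by (metis insert_ident)
  qed
  have "Pow J \<inter> insert 0 ` Pow J = {}" using mJ(2) by blast
  note PowJ = Pow_insert[of 0 J] this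
  have s2: "(\<Sum>A\<in>Pow {..<m}. \<beta> A * (y A * geo (Y m))) = (1 + geo (Y 0)) * S2"
  proof -
    have "(\<Sum>A\<in>Pow {..<m}. \<beta> A * (y A * geo (Y m)))
        = S2 + (\<Sum>A\<in>Pow J. \<beta> (insert 0 A) * (y (insert 0 A) * geo (Y m)))"
      unfolding mJ(1) PowJ(1) S2_def using mJ(3) PowJ(2) inj0
      by (subst sum.union_disjoint) (auto simp: sum.reindex)
    also have "(\<Sum>A\<in>Pow J. \<beta> (insert 0 A) * (y (insert 0 A) * geo (Y m))) = geo (Y 0) * S2"
      unfolding S2_def sum_distrib_left by (intro sum.cong refl) (auto simp: \<beta>' y0)
    finally show ?thesis by (simp add: distrib_right)
  qed
  define g where "g = (\<lambda>(A, B). \<beta> (A \<union> B) * (y A * x B))"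
  \<comment> \<open>The cuts without 0 on the left; \<open>h\<close> below adds it, which never
    violates the order condition.\<close>
  define C where "C = {(A, B) \<in> cuts (insert 0 J). 0 \<notin> A}"
  have finC: "finite C" "finite (cuts J)"
    using finite_cuts[of "insert 0 J"] finite_cuts[of J] mJ by (auto simp: C_def intro: rev_finite_subset)
  have mem: "(A, B) \<in> cuts K \<longleftrightarrow> A \<subseteq> K \<and> B \<subseteq> K \<and> (\<forall>a\<in>A. \<forall>b\<in>B. a \<le> b)" for A B K
    by (simp add: cuts_def)
  have memC: "(A, B) \<in> C \<longleftrightarrow> A \<subseteq> J \<and> B \<subseteq> insert 0 J \<and> (\<forall>a\<in>A. \<forall>b\<in>B. a \<le> b)" for A B
  proof -
    have 1: "A \<subseteq> insert 0 J \<and> 0 \<notin> A \<longleftrightarrow> A \<subseteq> J" using mJ(2) by blast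
    have "(A, B) \<in> C \<longleftrightarrow> (A, B) \<in> cuts (insert 0 J) \<and> 0 \<notin> A"
      unfolding C_def mem_Collect_eq prod.case ..
    then show ?thesis unfolding mem using 1 by argo
  qed
  define h :: "nat set \<times> nat set \<Rightarrow> nat set \<times> nat set" where "h z = (insert 0 (fst z), snd z)" for z
  have eC: "cuts (insert 0 J) = C \<union> h ` C"
  proof (intro equalityI subsetI)
    fix z assume "z \<in> cuts (insert 0 J)"
    moreover obtain A B where z: "z = (A, B)" by (cases z)
    ultimately have AB: "A \<subseteq> insert 0 J" "B \<subseteq> insert 0 J" "\<forall>a\<in>A. \<forall>b\<in>B. a \<le> b"
      by (simp_all add: mem)
    show "z \<in> C \<union> h ` C"
    proof (cases "0 \<in> A")
      case True
      have "(A - {0}, B) \<in> C" unfolding memC using AB by blast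
      moreover have "z = h (A - {0}, B)" unfolding z h_def using True by auto
      ultimately show ?thesis by (metis UnI2 imageI)
    next
      case False
      then have "A \<subseteq> J" using AB(1) by blast
      then have "(A, B) \<in> C" using AB by (simp add: memC)
      then show ?thesis unfolding z by (rule UnI1)
    qed
  next
    fix z assume "z \<in> C \<union> h ` C"
    then consider "z \<in> C" | w where "w \<in> C" "z = h w" by blast
    then show "z \<in> cuts (insert 0 J)"
    proof cases
      case 1
      then show ?thesis by (simp add: C_def split: prod.splits)
    next
      case 2
      obtain A B where w: "w = (A, B)" by (cases w)
      show ?thesis using 2 unfolding w h_def by (auto simp: memC mem)
    qed
  qed
  have dC: "C \<inter> h ` C = {}" by (auto simp: C_def h_def)
  have injC: "inj_on h C"
  proof (rule inj_onI)
    fix z w assume zw: "z \<in> C" "w \<in> C" and eq: "h z = h w"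
    have "0 \<notin> fst z" "0 \<notin> fst w" using zw by (auto simp: C_def)
    then show "z = w" using eq unfolding h_def by (metis insert_ident prod.collapse prod.inject)
  qed
  have s1: "sum g (cuts {..<m}) = (1 + geo (Y 0)) * sum g C"
  proof -
    have "sum g (cuts {..<m}) = sum g C + sum g (h ` C)"
      unfolding mJ(1) eC by (rule sum.union_disjoint[OF finC(1) finite_imageI[OF finC(1)] dC])
    also have "sum g (h ` C) = (\<Sum>(A, B)\<in>C. g (insert 0 A, B))"
      unfolding sum.reindex[OF injC] by (intro sum.cong refl) (auto simp: h_def)
    also have "(\<Sum>(A, B)\<in>C. g (insert 0 A, B)) = geo (Y 0) * sum g C"
      unfolding sum_distrib_left
    proof (intro sum.cong refl, clarify)
      fix A B assume "(A, B) \<in> C"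
      then have A: "A \<subseteq> J" and B: "B \<subseteq> insert 0 J" by (simp_all add: memC)
      have "\<beta> (insert 0 (A \<union> B)) = \<beta> (A \<union> B)"
      proof (cases "0 \<in> B")
        case True
        then have "insert 0 (A \<union> B) = A \<union> B" by blast
        then show ?thesis by simp
      next
        case False
        then have "A \<union> B \<subseteq> J" using A B by blast
        then show ?thesis by (rule \<beta>')
      qed
      then show "g (insert 0 A, B) = geo (Y 0) * g (A, B)" by (simp add: g_def y0[OF A])
    qed
    finally show ?thesis by (simp add: distrib_right)
  qed
  have C_split: "C = cuts J \<union> (\<lambda>I. ({}, insert 0 I)) ` Pow J"
  proof (intro equalityI subsetI)
    fix z assume "z \<in> C"
    moreover obtain A B where z: "z = (A, B)" by (cases z)
    ultimately have AB: "A \<subseteq> J" "B \<subseteq> insert 0 J" "\<forall>a\<in>A. \<forall>b\<in>B. a \<le> b"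
      by (simp_all add: memC)
    show "z \<in> cuts J \<union> (\<lambda>I. ({}, insert 0 I)) ` Pow J"
    proof (cases "0 \<in> B")
      case True
      have "A = {}"
      proof (rule ccontr)
        assume "A \<noteq> {}"
        then obtain a where a: "a \<in> A" by blast
        then have "a = 0" using AB(3) True by force
        then show False using a AB(1) mJ(2) by blast
      qed
      moreover have "B = insert 0 (B - {0})" "B - {0} \<in> Pow J" using True AB(2) by blast+
      ultimately show ?thesis unfolding z by blast
    next
      case False
      then have "B \<subseteq> J" using AB(2) by blast
      then have "(A, B) \<in> cuts J" using AB by (simp add: mem)
      then show ?thesis unfolding z by (rule UnI1)
    qed
  next
    fix z assume "z \<in> cuts J \<union> (\<lambda>I. ({}, insert 0 I)) ` Pow J"
    then consider "z \<in> cuts J" | I where "I \<in> Pow J" "z = ({}, insert 0 I)" by blast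
    then show "z \<in> C"
    proof cases
      case 1
      obtain A B where z: "z = (A, B)" by (cases z)
      show ?thesis using 1 unfolding z memC mem by blast
    next
      case 2
      then show ?thesis by (auto simp: memC)
    qed
  qed
  have C_disj: "cuts J \<inter> (\<lambda>I. ({}, insert 0 I)) ` Pow J = {}"
  proof -
    have "({}, insert 0 I) \<notin> cuts J" for I using mJ(2) by (simp add: mem)
    then show ?thesis by blast
  qed
  have inj0': "inj_on (\<lambda>I. ({} :: nat set, insert 0 I)) (Pow J)"
    using inj0 unfolding inj_on_def by simp
  have sC: "sum g C = sum g (cuts J) + (\<Sum>I\<in>Pow J. \<beta> I * (geo (X 0) * x I))"
  proof -
    have "sum g C = sum g (cuts J) + (\<Sum>I\<in>Pow J. g ({}, insert 0 I))"
    proof -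
      have "finite ((\<lambda>I. ({} :: nat set, insert 0 I)) ` Pow J)" using mJ(3) by simp
      from sum.union_disjoint[OF finC(2) this C_disj, of g] show ?thesis
        unfolding C_split[symmetric] sum.reindex[OF inj0'] by (simp only: o_def)
    qed
    also have "(\<Sum>I\<in>Pow J. g ({}, insert 0 I)) = (\<Sum>I\<in>Pow J. \<beta> I * (geo (X 0) * x I))"
      by (intro sum.cong refl) (auto simp: g_def y_def x0 \<beta>')
    finally show ?thesis .
  qed
  have grp: "sum g (cuts J) = (\<Sum>I\<in>Pow J. \<beta> I * (\<Sum>(A, B)\<in>{(A, B) \<in> cuts I. A \<union> B = I}. y A * x B))"
  proof -
    have "sum g (cuts J) = (\<Sum>I\<in>Pow J. sum g {z \<in> cuts J. (case z of (A, B) \<Rightarrow> A \<union> B) = I})"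
      using finC(2) mJ(3) by (intro sum.group[symmetric]) (auto simp: cuts_def)
    also have "\<dots> = (\<Sum>I\<in>Pow J. \<beta> I * (\<Sum>(A, B)\<in>{(A, B) \<in> cuts I. A \<union> B = I}. y A * x B))"
    proof (intro sum.cong refl)
      fix I assume "I \<in> Pow J"
      then have "{z \<in> cuts J. (case z of (A, B) \<Rightarrow> A \<union> B) = I} = {(A, B) \<in> cuts I. A \<union> B = I}"
        by (auto simp: cuts_def)
      then show "sum g {z \<in> cuts J. (case z of (A, B) \<Rightarrow> A \<union> B) = I}
          = \<beta> I * (\<Sum>(A, B)\<in>{(A, B) \<in> cuts I. A \<union> B = I}. y A * x B)"
        by (simp only: sum_distrib_left) (intro sum.cong refl, auto simp: g_def)
    qed
    finally show ?thesis .
  qed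
  have "sum g C + S2 = (\<Sum>I\<in>Pow J. \<beta> I * W_I m I X Y)"
    unfolding sC grp S2_def sum.distrib[symmetric]
  proof (intro sum.cong refl)
    fix I assume "I \<in> Pow J"
    then have I: "I \<subseteq> {1..m-1}" by (simp add: J_def)
    show "\<beta> I * (\<Sum>(A, B)\<in>{(A, B) \<in> cuts I. A \<union> B = I}. y A * x B) + \<beta> I * (geo (X 0) * x I)
        + \<beta> I * (y I * geo (Y m)) = \<beta> I * W_I m I X Y"
      unfolding y_def x_def sum_cuts_with_union[OF I m] W_I_def by (simp only: distrib_left ac_simps)
  qed
  then have "sum g (cuts {..<m}) + (\<Sum>A\<in>Pow {..<m}. \<beta> A * (y A * geo (Y m)))
     = 1 / (1 - Y 0) * (\<Sum>I\<in>Pow J. \<beta> I * W_I m I X Y)"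
    unfolding s1 s2 g0 by (simp only: distrib_left[symmetric])
  then show ?thesis by (simp only: g_def y_def x_def J_def)
qed

section \<open>Sublattices classified by words\<close>

text \<open>Counts cosets through any complete invariant \<open>g\<close> of them.\<close>

lemma card_image_cong_iff:
  assumes "\<And>x y. x \<in> S \<Longrightarrow> y \<in> S \<Longrightarrow> f x = f y \<longleftrightarrow> g x = g y"
  shows "card (f ` S) = card (g ` S)"
proof (rule bij_betw_same_card)
  show "bij_betw (\<lambda>v. g (inv_into S f v)) (f ` S) (g ` S)"
    unfolding bij_betw_def
  proof
    show "inj_on (\<lambda>v. g (inv_into S f v)) (f ` S)"
    proof (rule inj_onI)
      fix u v assume u: "u \<in> f ` S" and v: "v \<in> f ` S" and "g (inv_into S f u) = g (inv_into S f v)"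
      then have "f (inv_into S f u) = f (inv_into S f v)"
        using assms[OF inv_into_into[OF u] inv_into_into[OF v]] by simp
      then show "u = v" using f_inv_into_f[OF u] f_inv_into_f[OF v] by simp
    qed
    have "g (inv_into S f (f x)) = g x" if "x \<in> S" for x
      using assms[OF inv_into_into[OF imageI[OF that, of f]] that] f_inv_into_f[OF imageI[OF that, of f]]
      by simp
    then show "(\<lambda>v. g (inv_into S f v)) ` f ` S = g ` S"
      by (simp add: image_image cong: image_cong)
  qed
qed

lemma ssum_commute: "ssum A B = ssum B A"
proof (intro equalityI subsetI)
  fix x
  show "x \<in> ssum B A" if "x \<in> ssum A B" using that unfolding in_ssum by (metis add.commute)
  show "x \<in> ssum A B" if "x \<in> ssum B A" using that unfolding in_ssum by (metis add.commute)
qed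

lemma ssum_mono: "A \<subseteq> A' \<Longrightarrow> ssum A B \<subseteq> ssum A' B"
  unfolding ssum_def by (intro image_mono Sigma_mono) auto

lemma inj_on_scale: "p > 0 \<Longrightarrow> inj_on (scale (int p)) A"
  using inj_on_subset[OF inj_scale[of "int p"], of A] by simp

section \<open>Subgroups of \<open>p\<close>-power index\<close>

definition p_sub :: "nat \<Rightarrow> 'a::ab_group_add set \<Rightarrow> 'a set set"
  where "p_sub p B = {K. addsub K \<and> K \<subseteq> B \<and> (\<exists>k. idx B K = p ^ k)}"

definition log_idx :: "nat \<Rightarrow> 'a::ab_group_add set \<Rightarrow> 'a set \<Rightarrow> nat"
  where "log_idx p B K = multiplicity p (idx B K)"

lemma log_idx_eq: "prime p \<Longrightarrow> idx B K = p ^ k \<Longrightarrow> log_idx p B K = k"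
  using prime_gt_1_nat[of p] by (simp add: log_idx_def)

lemma idx_log_idx: "prime p \<Longrightarrow> K \<in> p_sub p B \<Longrightarrow> idx B K = p ^ log_idx p B K"
  using log_idx_eq by (auto simp: p_sub_def)

lemma p_sub_D:
  assumes "K \<in> p_sub p B" shows "addsub K" "K \<subseteq> B" using assms by (auto simp: p_sub_def)

lemma p_sub_self: "addsub B \<Longrightarrow> B \<in> p_sub p B"
  using idx_self[of B] by (auto simp: p_sub_def intro!: exI[of _ 0])

lemma power_prime_factors:
  fixes p :: nat
  assumes "prime p" "a * b = p ^ k"
  shows "\<exists>i. a = p ^ i" "\<exists>i. b = p ^ i"
  using assms by (metis dvd_triv_left dvd_triv_right divides_primepow_nat)+

lemma p_sub_between:
  assumes p: "prime p" and B: "addsub B" and K: "K \<in> p_sub p B" and N: "addsub N" "K \<subseteq> N" "N \<subseteq> B"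
  shows "N \<in> p_sub p B" "K \<in> p_sub p N" "log_idx p B K = log_idx p B N + log_idx p N K"
proof -
  have eq: "idx B K = idx B N * idx N K"
    using idx_mult[OF p_sub_D(1)[OF K] N(1) B N(2,3)] .
  have *: "idx B N * idx N K = p ^ log_idx p B K" using eq idx_log_idx[OF p K] by simp
  show N': "N \<in> p_sub p B" and K': "K \<in> p_sub p N"
    using power_prime_factors[OF p *] N p_sub_D(1)[OF K] by (auto simp: p_sub_def)
  have "p ^ log_idx p B K = p ^ (log_idx p B N + log_idx p N K)"
    using * idx_log_idx[OF p N'] idx_log_idx[OF p K'] by (simp add: power_add)
  then show "log_idx p B K = log_idx p B N + log_idx p N K"
    using prime_gt_1_nat[OF p] by (simp add: power_inject_exp)
qed

lemma p_sub_trans: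
  assumes p: "prime p" and B: "addsub B" and N: "N \<in> p_sub p B" and K: "K \<in> p_sub p N"
  shows "K \<in> p_sub p B"
proof -
  have "idx B K = idx B N * idx N K"
    using idx_mult[OF p_sub_D(1)[OF K] p_sub_D(1)[OF N] B p_sub_D(2)[OF K] p_sub_D(2)[OF N]] .
  then have "idx B K = p ^ (log_idx p B N + log_idx p N K)"
    using idx_log_idx[OF p N] idx_log_idx[OF p K] by (simp add: power_add)
  moreover have "K \<subseteq> B" using p_sub_D(2)[OF K] p_sub_D(2)[OF N] by blast
  ultimately show ?thesis using p_sub_D(1)[OF K] unfolding p_sub_def by blast
qed

lemma p_sub_eq_if_log_idx_0:
  assumes "prime p" "addsub B" "K \<in> p_sub p B" "log_idx p B K = 0"
  shows "K = B"
  using idx_1_imp_eq[of B K] assms idx_log_idx[of p K B] p_sub_D[of K p B] by simp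

lemma sum_const_scale: "finite A \<Longrightarrow> (\<Sum>i\<in>A. x) = scale (int (card A)) x"
proof (induction A rule: finite_induct)
  case empty
  show ?case by (simp only: sum.empty card.empty of_nat_0 scale_0)
next
  case (insert a A)
  have "(\<Sum>i\<in>insert a A. x) = x + scale (int (card A)) x"
    by (simp only: sum.insert[OF insert.hyps] insert.IH)
  also have "\<dots> = scale (int (card (insert a A))) x"
    unfolding card_insert_disjoint[OF insert.hyps] of_nat_Suc scale_add scale_1 ..
  finally show ?case .
qed

lemma scale_idx_mem:
  assumes B: "addsub B" and K: "addsub K" "K \<subseteq> B" "idx B K > 0" and x: "x \<in> B"
  shows "scale (int (idx B K)) x \<in> K"
proof -
  let ?C = "cosets B K"
  have fin: "finite ?C" using idx_pos_finite[OF K(3)] .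
  define rep where "rep C = (SOME y. y \<in> C)" for C :: "ivec set"
  have rep: "rep C \<in> C" if C: "C \<in> ?C" for C
  proof -
    obtain y where "C = (+) y ` K" using C by (auto simp: cosets_def)
    then have "y + 0 \<in> C" using addsub_zero[OF K(1)] by blast
    then show ?thesis unfolding rep_def by (rule someI[of "\<lambda>z. z \<in> C"])
  qed
  have tr: "(+) x ` (+) y ` K = (+) (x + y) ` K" for y
    unfolding image_image by (intro image_cong refl) (simp only: add.assoc)
  have bij: "bij_betw ((`) ((+) x)) ?C ?C"
    unfolding bij_betw_def
  proof
    show "inj_on ((`) ((+) x)) ?C"
      by (rule inj_on_subset[OF inj_on_image[of "(+) x" UNIV]]) (auto intro: inj_onI)
    show "(`) ((+) x) ` ?C = ?C"
    proof (intro equalityI subsetI)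
      fix C assume "C \<in> (`) ((+) x) ` ?C"
      then obtain y where y: "y \<in> B" "C = (+) x ` (+) y ` K" unfolding cosets_def by blast
      then show "C \<in> ?C" unfolding cosets_def tr using addsub_add[OF B x y(1)] by blast
    next
      fix C assume "C \<in> ?C"
      then obtain y where y: "y \<in> B" "C = (+) y ` K" unfolding cosets_def by blast
      have xy: "x + (y - x) = y" by simp
      have "C = (+) x ` (+) (y - x) ` K" unfolding tr xy by (rule y(2))
      then show "C \<in> (`) ((+) x) ` ?C" unfolding cosets_def using addsub_diff[OF B y(1) x] by blast
    qed
  qed
  have mem: "rep C + x - rep ((+) x ` C) \<in> K" if C: "C \<in> ?C" for C
  proof -
    obtain y where y: "y \<in> B" "C = (+) y ` K" using C unfolding cosets_def by blast
    have "(+) x ` C \<in> ?C" using bij C by (auto simp: bij_betw_def)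
    from rep[OF this] have "rep ((+) x ` C) \<in> (+) (x + y) ` K" unfolding y(2) tr .
    then have 1: "rep ((+) x ` C) - (x + y) \<in> K" by (simp only: coset_mem)
    have 2: "rep C - y \<in> K" using rep[OF C] unfolding y(2) coset_mem .
    have "(u - y) - (v - (x + y)) = u + x - v" for u v :: ivec by simp
    from addsub_diff[OF K(1) 2 1, unfolded this] show ?thesis .
  qed
  have "(\<Sum>C\<in>?C. rep ((+) x ` C)) = (\<Sum>C\<in>?C. rep C)"
    using sum.reindex_bij_betw[OF bij, of rep] .
  then have "(\<Sum>C\<in>?C. rep C + x - rep ((+) x ` C)) = (\<Sum>C\<in>?C. x)"
    by (simp only: sum_subtractf sum.distrib add_diff_cancel_left')
  also have "\<dots> = scale (int (idx B K)) x" unfolding sum_const_scale[OF fin] idx_def ..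
  finally have "scale (int (idx B K)) x = (\<Sum>C\<in>?C. rep C + x - rep ((+) x ` C))" ..
  also have "\<dots> \<in> K" by (rule addsub_sum[OF K(1) mem])
  finally show ?thesis .
qed

section \<open>Colon lattices, residue dimensions and the word of a lattice\<close>

definition pZpow :: "nat \<Rightarrow> nat \<Rightarrow> ivec set"
  where "pZpow p m = scale (int p) ` Zpow m"

lemma addsub_pZpow: "addsub (pZpow p m)"
  unfolding pZpow_def by (rule addsub_image[OF additive_scale addsub_Zpow])

lemma pZpow_subset: "pZpow p m \<subseteq> Zpow m"
  unfolding pZpow_def using scale_closed[OF addsub_Zpow] by blast

lemma pZpow_iff: "p > 0 \<Longrightarrow> x \<in> pZpow p m \<longleftrightarrow> x \<in> Zpow m \<and> (\<forall>i<m. int p dvd x i)"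
proof
  assume "x \<in> pZpow p m"
  then obtain y where "y \<in> Zpow m" "x = scale (int p) y" unfolding pZpow_def by blast
  then show "x \<in> Zpow m \<and> (\<forall>i<m. int p dvd x i)" using pZpow_subset[of p m] \<open>x \<in> pZpow p m\<close> by (auto simp: scale_apply)
next
  assume p: "p > 0" and *: "x \<in> Zpow m \<and> (\<forall>i<m. int p dvd x i)"
  define y where "y = (\<lambda>i. x i div int p)"
  have "y \<in> Zpow m" using * by (auto simp: y_def Zpow_def)
  moreover have "x = scale (int p) y"
  proof
    fix i
    have "int p dvd x i" using * by (cases "i < m") (auto simp: Zpow_def)
    then show "x i = scale (int p) y i" by (simp add: scale_apply y_def)
  qed
  ultimately show "x \<in> pZpow p m" unfolding pZpow_def by blast
qed

lemma idx_Zpow_pZpow: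
  assumes "p > 0" shows "idx (Zpow m) (pZpow p m) = p ^ m"
proof -
  define g where "g x = restrict (\<lambda>i. x i mod int p) {..<m}" for x :: ivec
  have "idx (Zpow m) (pZpow p m) = card (g ` Zpow m)"
    unfolding idx_def cosets_def
  proof (rule card_image_cong_iff)
    fix x y assume xy: "x \<in> Zpow m" "y \<in> Zpow m"
    have "(+) x ` pZpow p m = (+) y ` pZpow p m \<longleftrightarrow> x - y \<in> pZpow p m"
      by (rule coset_eq_iff[OF addsub_pZpow])
    also have "\<dots> \<longleftrightarrow> (\<forall>i<m. int p dvd x i - y i)"
      using addsub_diff[OF addsub_Zpow xy] by (simp add: pZpow_iff[OF assms])
    also have "\<dots> \<longleftrightarrow> (\<forall>i<m. x i mod int p = y i mod int p)"
      by (simp only: mod_eq_dvd_iff)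
    also have "\<dots> \<longleftrightarrow> g x = g y"
      unfolding g_def by (auto simp: fun_eq_iff restrict_def)
    finally show "(+) x ` pZpow p m = (+) y ` pZpow p m \<longleftrightarrow> g x = g y" .
  qed
  also have "g ` Zpow m = PiE {..<m} (\<lambda>_. {0..<int p})"
  proof (intro equalityI subsetI)
    fix f assume "f \<in> g ` Zpow m"
    then obtain x where "f = g x" by blast
    then show "f \<in> PiE {..<m} (\<lambda>_. {0..<int p})" using assms by (simp add: g_def restrict_PiE_iff)
  next
    fix f assume f: "f \<in> PiE {..<m} (\<lambda>_. {0..<int p})"
    define x where "x = (\<lambda>i. if i < m then f i else 0)"
    have "x \<in> Zpow m" by (simp add: x_def Zpow_def)
    moreover have "g x = f"
    proof
      fix i show "g x i = f i"
        using f by (cases "i < m") (auto simp: g_def x_def PiE_def extensional_def Pi_def)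
    qed
    ultimately show "f \<in> g ` Zpow m" by blast
  qed
  finally show ?thesis by (simp add: card_PiE)
qed

definition colon :: "nat \<Rightarrow> nat \<Rightarrow> nat \<Rightarrow> ivec set \<Rightarrow> ivec set"
  where "colon p m a M = {u \<in> Zpow m. scale (int (p ^ a)) u \<in> M}"

lemma addsub_colon:
  assumes "addsub M" shows "addsub (colon p m a M)"
proof -
  have "colon p m a M = Zpow m \<inter> scale (int (p ^ a)) -` M" by (auto simp: colon_def)
  then show ?thesis using addsub_Int[OF addsub_Zpow addsub_vimage[OF additive_scale assms]] by (simp only:)
qed

lemma colon_upper: "addsub M \<Longrightarrow> M \<subseteq> Zpow m \<Longrightarrow> M \<subseteq> colon p m a M"
  unfolding colon_def using scale_closed by blast

lemma colon_subset: "colon p m a M \<subseteq> Zpow m" by (auto simp: colon_def)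

lemma colon_p_sub:
  assumes "prime p" "M \<in> p_sub p (Zpow m)" shows "colon p m a M \<in> p_sub p (Zpow m)"
  using p_sub_between(1)[OF assms(1) addsub_Zpow assms(2) addsub_colon colon_upper colon_subset] p_sub_D[OF assms(2)] by blast

lemma colon_colon: "colon p m a (colon p m 1 M) = colon p m (Suc a) M"
  unfolding colon_def using scale_closed[OF addsub_Zpow] by (auto simp: scale_scale mult.commute)

lemma colon_0: "M \<subseteq> Zpow m \<Longrightarrow> colon p m 0 M = M"
  by (auto simp: colon_def)

text \<open>Multiplication by \<open>p\<close> identifies \<open>(M : p)\<close> with the kernel of
  the reduction of \<open>M\<close> modulo \<open>p\<close>. The recursion on lattices rests on this
  identity.\<close>

lemma Int_pZpow: "M \<inter> pZpow p m = scale (int p) ` colon p m 1 M"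
  by (auto simp: pZpow_def colon_def)

text \<open>The dimension over \<open>F\<^sub>p\<close> of the image of \<open>M\<close> in \<open>\<int>\<^sup>m/p\<int>\<^sup>m\<close>.\<close>

definition residue_dim :: "nat \<Rightarrow> nat \<Rightarrow> ivec set \<Rightarrow> nat"
  where "residue_dim p m M = log_idx p (ssum M (pZpow p m)) (pZpow p m)"

text \<open>All parts come from the chain of \<open>M\<close>, \<open>M + pL\<close> and
  \<open>L\<close>. With \<open>d\<close> the residue dimension, the upper index is
  \<open>p^(m-d)\<close>; the lower one equals the index of \<open>M \<inter> pL = p(M : p)\<close>
  in \<open>pL\<close>, which is that of \<open>(M : p)\<close> in \<open>L\<close>.\<close>

lemma lattice_step:
  assumes p: "prime p" and M: "M \<in> p_sub p (Zpow m)"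
  shows "idx (ssum M (pZpow p m)) (pZpow p m) = p ^ residue_dim p m M" "residue_dim p m M \<le> m"
    "log_idx p (Zpow m) M = (m - residue_dim p m M) + log_idx p (Zpow m) (colon p m 1 M)"
    "idx M (scale (int p) ` colon p m 1 M) = p ^ residue_dim p m M"
proof -
  let ?S = "ssum M (pZpow p m)"
  have p0: "p > 0" using prime_gt_0_nat[OF p] .
  note M' = p_sub_D[OF M]
  have S: "addsub ?S" "pZpow p m \<subseteq> ?S" "M \<subseteq> ?S" "?S \<subseteq> Zpow m"
    using addsub_ssum[OF M'(1) addsub_pZpow] ssum_upper2[OF M'(1)] ssum_upper1[OF addsub_pZpow]
      ssum_least[OF addsub_Zpow M'(2) pZpow_subset] by blast+
  have pZpow: "pZpow p m \<in> p_sub p (Zpow m)"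
    using idx_Zpow_pZpow[OF p0] addsub_pZpow pZpow_subset unfolding p_sub_def by blast
  have lPL: "log_idx p (Zpow m) (pZpow p m) = m" by (rule log_idx_eq[OF p idx_Zpow_pZpow[OF p0]])
  note b = p_sub_between[OF p addsub_Zpow pZpow S(1,2,4)]
  show i: "idx ?S (pZpow p m) = p ^ residue_dim p m M" unfolding residue_dim_def by (rule idx_log_idx[OF p b(2)])
  show "residue_dim p m M \<le> m" using b(3) lPL unfolding residue_dim_def by simp
  have c: "log_idx p (Zpow m) ?S = m - residue_dim p m M" using b(3) lPL unfolding residue_dim_def by simp
  have "idx ?S M = idx (pZpow p m) (pZpow p m \<inter> M)"
    unfolding ssum_commute[of M "pZpow p m"] by (rule idx_ssum[OF addsub_pZpow M'(1)])
  also have "pZpow p m \<inter> M = M \<inter> pZpow p m" by (rule Int_commute)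
  also have "idx (pZpow p m) (M \<inter> pZpow p m) = idx (Zpow m) (colon p m 1 M)"
    unfolding Int_pZpow unfolding pZpow_def
    by (rule idx_image[OF additive_scale inj_on_scale[OF p0] addsub_Zpow addsub_colon[OF M'(1)] colon_subset])
  finally have "log_idx p ?S M = log_idx p (Zpow m) (colon p m 1 M)" unfolding log_idx_def by simp
  then show "log_idx p (Zpow m) M = (m - residue_dim p m M) + log_idx p (Zpow m) (colon p m 1 M)"
    using p_sub_between(3)[OF p addsub_Zpow M S(1,3,4)] c by simp
  show "idx M (scale (int p) ` colon p m 1 M) = p ^ residue_dim p m M"
    unfolding Int_pZpow[symmetric] using idx_ssum[OF M'(1) addsub_pZpow] i by simp
qed

text \<open>If \<open>M\<close> maps onto \<open>L/pL\<close>, then \<open>(M : p)\<close> has the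
  same index as \<open>M\<close> and so equals it. Hence \<open>L/M\<close> has no
  \<open>p\<close>-torsion; being of \<open>p\<close>-power order, it is trivial.\<close>

lemma residue_dim_less:
  assumes p: "prime p" and M: "M \<in> p_sub p (Zpow m)" and ne: "M \<noteq> Zpow m"
  shows "residue_dim p m M < m"
proof (rule ccontr)
  assume "\<not> residue_dim p m M < m"
  then have "log_idx p (Zpow m) M = log_idx p (Zpow m) (colon p m 1 M)" using lattice_step(2,3)[OF p M] by simp
  moreover note M' = p_sub_D[OF M]
  moreover note b = p_sub_between[OF p addsub_Zpow M addsub_colon[OF M'(1)] colon_upper[OF M'] colon_subset, of p 1]
  ultimately have "M = colon p m 1 M"
    using p_sub_eq_if_log_idx_0[OF p addsub_colon[OF M'(1)] b(2)] b(3) by simp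
  then have step: "u \<in> M" if "u \<in> Zpow m" "scale (int p) u \<in> M" for u
    using that unfolding colon_def by (simp only: power_one_right) blast
  have it: "u \<in> M" if "u \<in> Zpow m" "scale (int (p ^ k)) u \<in> M" for u k
    using that
  proof (induction k arbitrary: u)
    case 0
    then show ?case by (simp only: power_0 of_nat_1 scale_1)
  next
    case (Suc k)
    have "scale (int (p ^ k)) (scale (int p) u) \<in> M" using Suc.prems(2) by (simp add: scale_scale mult.commute)
    then show ?case using Suc.IH[OF scale_closed[OF addsub_Zpow Suc.prems(1)]] step[OF Suc.prems(1)] by blast
  qed
  have "u \<in> M" if "u \<in> Zpow m" for u
  proof (rule it[OF that])
    have "idx (Zpow m) M > 0" using idx_log_idx[OF p M] prime_gt_0_nat[OF p] by simp
    from scale_idx_mem[OF addsub_Zpow M' this that]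
    show "scale (int (p ^ log_idx p (Zpow m) M)) u \<in> M" unfolding idx_log_idx[OF p M, symmetric] .
  qed
  then show False using ne M'(2) by blast
qed

lemma residue_dim_Zpow:
  assumes p: "prime p" shows "residue_dim p m (Zpow m) = m"
proof -
  have "idx (ssum (Zpow m) (pZpow p m)) (pZpow p m) = p ^ m"
    using idx_Zpow_pZpow[OF prime_gt_0_nat[OF p]] ssum_absorb[OF addsub_Zpow addsub_pZpow pZpow_subset] by (simp only:)
  then show ?thesis unfolding residue_dim_def by (rule log_idx_eq[OF p])
qed

text \<open>The word of the overview, read from its first letter: the residue dimension of
  \<open>M\<close>, followed by the word of \<open>(M : p)\<close>. The condition
  \<open>j < m\<close> keeps \<open>Zpow m\<close>, whose residue dimension is \<open>m\<close>,
  from having further words besides the empty one.\<close>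

fun of_type :: "nat \<Rightarrow> nat \<Rightarrow> nat list \<Rightarrow> ivec set set" where
  "of_type p m [] = {Zpow m}"
| "of_type p m (j # js) = {M \<in> p_sub p (Zpow m). colon p m 1 M \<in> of_type p m js \<and> residue_dim p m M = j \<and> j < m}"

lemma of_type_p_sub: "M \<in> of_type p m js \<Longrightarrow> M \<in> p_sub p (Zpow m)"
  by (cases js) (auto simp: p_sub_self addsub_Zpow)

lemma of_type_hd:
  assumes "prime p" "M \<in> of_type p m js" shows "residue_dim p m M = hd (js @ [m])"
  using assms residue_dim_Zpow by (cases js) auto

lemma of_type_unique:
  assumes p: "prime p" shows "M \<in> of_type p m js \<Longrightarrow> M \<in> of_type p m ks \<Longrightarrow> js = ks"
proof (induction js arbitrary: M ks)
  case Nil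
  then show ?case using residue_dim_Zpow[OF p, of m] by (cases ks) auto
next
  case (Cons j js)
  then obtain k ks' where ks: "ks = k # ks'" using residue_dim_Zpow[OF p, of m] by (cases ks) auto
  then show ?case using Cons.IH[of "colon p m 1 M" ks'] Cons.prems by auto
qed

lemma of_type_exists:
  assumes p: "prime p" shows "M \<in> p_sub p (Zpow m) \<Longrightarrow> \<exists>js. M \<in> of_type p m js"
proof (induction "log_idx p (Zpow m) M" arbitrary: M rule: less_induct)
  case less
  show ?case
  proof (cases "M = Zpow m")
    case True
    then have "M \<in> of_type p m []" by simp
    then show ?thesis by blast
  next
    case False
    have letter_val: "residue_dim p m M < m" by (rule residue_dim_less[OF p less.prems False])
    then have "log_idx p (Zpow m) (colon p m 1 M) < log_idx p (Zpow m) M"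
      using lattice_step(3)[OF p less.prems] by simp
    from less.hyps[OF this colon_p_sub[OF p less.prems]] obtain js where "colon p m 1 M \<in> of_type p m js" by blast
    then have "M \<in> of_type p m (residue_dim p m M # js)" using letter_val less.prems by simp
    then show ?thesis by blast
  qed
qed

text \<open>Since \<open>M \<subseteq> (M : p)\<close>, the image of \<open>M\<close> in
  \<open>L/pL\<close> is contained in that of \<open>(M : p)\<close>; comparing the orders of the
  images compares successive letters.\<close>

lemma of_type_sorted:
  assumes p: "prime p" shows "M \<in> of_type p m js \<Longrightarrow> sorted js \<and> set js \<subseteq> {..<m}"
proof (induction js arbitrary: M)
  case (Cons j js)
  then have M: "M \<in> p_sub p (Zpow m)" and U: "colon p m 1 M \<in> of_type p m js" and j: "residue_dim p m M = j" "j < m" by auto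
  note IH = Cons.IH[OF U]
  note M' = p_sub_D[OF M]
  let ?U = "colon p m 1 M"
  note U' = p_sub_D[OF of_type_p_sub[OF U]]
  have "ssum M (pZpow p m) \<subseteq> ssum ?U (pZpow p m)"
    by (rule ssum_mono[OF colon_upper[OF M']])
  then have "idx (ssum ?U (pZpow p m)) (pZpow p m)
      = idx (ssum ?U (pZpow p m)) (ssum M (pZpow p m)) * idx (ssum M (pZpow p m)) (pZpow p m)"
    using ssum_upper2[OF M'(1)] by (intro idx_mult addsub_pZpow addsub_ssum M' U') auto
  then have "p ^ residue_dim p m ?U = idx (ssum ?U (pZpow p m)) (ssum M (pZpow p m)) * p ^ j"
    using lattice_step(1)[OF p M] lattice_step(1)[OF p of_type_p_sub[OF U]] j by simp
  then have "p ^ j dvd p ^ residue_dim p m ?U" by (metis dvd_triv_right)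
  then have "j \<le> hd (js @ [m])"
    using of_type_hd[OF p U] prime_gt_1_nat[OF p] by (simp add: power_dvd_imp_le)
  then have "sorted (j # js)" using IH by (cases js) auto
  then show ?case using IH j by simp
qed simp

lemma of_type_log_idx:
  assumes p: "prime p" shows "M \<in> of_type p m js \<Longrightarrow> log_idx p (Zpow m) M = (\<Sum>j\<leftarrow>js. m - j)"
proof (induction js arbitrary: M)
  case Nil
  then show ?case using idx_self[OF addsub_Zpow, of m] by (simp add: log_idx_def)
next
  case (Cons j js)
  then show ?case using lattice_step(3)[OF p, of M m] by simp
qed

lemma of_type_colon:
  shows "M \<in> of_type p m js \<Longrightarrow> colon p m a M \<in> of_type p m (drop a js)"
proof (induction a arbitrary: M js)
  case 0
  then show ?case using colon_0[OF p_sub_D(2)[OF of_type_p_sub[OF 0]]] by simp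
next
  case (Suc a)
  show ?case
  proof (cases js)
    case Nil
    then have "M = Zpow m" using Suc.prems by simp
    then have "colon p m (Suc a) M = Zpow m" unfolding colon_def using scale_closed[OF addsub_Zpow] by blast
    then show ?thesis using Nil by simp
  next
    case (Cons j js')
    then have "colon p m 1 M \<in> of_type p m js'" using Suc.prems by simp
    from Suc.IH[OF this] show ?thesis using Cons by (simp only: colon_colon drop_Suc list.sel)
  qed
qed

text \<open>A lattice \<open>M\<close> with \<open>(M : p) = N\<close> lies between
  \<open>pN\<close> and \<open>N\<close>, and \<open>Int_pZpow\<close> turns the condition into
  \<open>M \<inter> pL = pN\<close>. So \<open>M/pN\<close> is a subspace of \<open>N/pN\<close>
  that avoids \<open>(N \<inter> pL)/pN\<close>, and its dimension is the residue dimension of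
  \<open>M\<close>.\<close>

lemma of_type_fibre:
  assumes p: "prime p" and N: "N \<in> of_type p m js" and j: "j < m"
  shows "{M \<in> of_type p m (j # js). colon p m 1 M = N}
    = complements N (N \<inter> pZpow p m) (scale (int p) ` N) (p ^ j)" (is "?L = ?R")
proof (intro equalityI subsetI)
  note N' = p_sub_D[OF of_type_p_sub[OF N]]
  fix M assume "M \<in> ?L"
  then have M: "M \<in> p_sub p (Zpow m)" and u: "colon p m 1 M = N" and d: "residue_dim p m M = j" by auto
  note M' = p_sub_D[OF M]
  have MN: "M \<subseteq> N" using colon_upper[OF M', of p 1] u by simp
  have "M \<inter> pZpow p m = scale (int p) ` N" using Int_pZpow[of M p m] u by simp
  then show "M \<in> ?R" unfolding complements_def
    using MN M' lattice_step(4)[OF p M] u d by auto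
next
  note N' = p_sub_D[OF of_type_p_sub[OF N]]
  have p0: "p > 0" using prime_gt_0_nat[OF p] .
  fix M assume "M \<in> ?R"
  then have M: "addsub M" "scale (int p) ` N \<subseteq> M" "M \<subseteq> N" "M \<inter> (N \<inter> pZpow p m) = scale (int p) ` N"
    "idx M (scale (int p) ` N) = p ^ j" by (auto simp: complements_def)
  have MLL: "M \<subseteq> Zpow m" using M(3) N'(2) by blast
  have "M \<inter> pZpow p m = scale (int p) ` N" using M(3,4) by blast
  then have "scale (int p) ` colon p m 1 M = scale (int p) ` N" unfolding Int_pZpow .
  then have u: "colon p m 1 M = N" using inj_image_eq_iff[OF inj_scale, of "int p"] p0 by simp
  \<comment> \<open>The index of \<open>pN\<close> in \<open>L\<close> is computed through
    \<open>N\<close> and through \<open>pL\<close>; since \<open>pN\<close> has the same index in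
    \<open>pL\<close> as \<open>N\<close> in \<open>L\<close>, this factor cancels.\<close>
  have iN: "idx N (scale (int p) ` N) = p ^ m"
  proof -
    have sN: "addsub (scale (int p) ` N)" by (rule addsub_image[OF additive_scale N'(1)])
    have sub: "scale (int p) ` N \<subseteq> pZpow p m" "scale (int p) ` N \<subseteq> N"
      using N'(2) scale_closed[OF N'(1)] unfolding pZpow_def by blast+
    have "idx (Zpow m) N * idx N (scale (int p) ` N) = idx (Zpow m) (pZpow p m) * idx (pZpow p m) (scale (int p) ` N)"
      using idx_mult[OF sN N'(1) addsub_Zpow sub(2) N'(2)] idx_mult[OF sN addsub_pZpow addsub_Zpow sub(1) pZpow_subset]
      by simp
    also have "idx (pZpow p m) (scale (int p) ` N) = idx (Zpow m) N"
      unfolding pZpow_def by (rule idx_image[OF additive_scale inj_on_scale[OF p0] addsub_Zpow N'])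
    finally show ?thesis using idx_Zpow_pZpow[OF p0, of m] idx_log_idx[OF p of_type_p_sub[OF N]] p0 by simp
  qed
  have "idx N M * p ^ j = p ^ m"
    using idx_mult[OF addsub_image[OF additive_scale N'(1)] M(1) N'(1) M(2,3)] iN M(5) by simp
  then have "M \<in> p_sub p N" using power_prime_factors(1)[OF p] M unfolding p_sub_def by blast
  then have MPS: "M \<in> p_sub p (Zpow m)" by (rule p_sub_trans[OF p addsub_Zpow of_type_p_sub[OF N]])
  have "p ^ residue_dim p m M = p ^ j" using lattice_step(4)[OF p MPS] u M(5) by simp
  then have "residue_dim p m M = j" using prime_gt_1_nat[OF p] by (simp add: power_inject_exp)
  then show "M \<in> ?L" using MPS u N j by simp
qed

text \<open>Here \<open>N/pN\<close> has dimension \<open>m\<close>, and the subspace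
  \<open>(N \<inter> pL)/pN\<close> to be avoided has codimension equal to the residue dimension of
  \<open>N\<close>, that is the first letter of \<open>js\<close>, or \<open>m\<close> if
  \<open>N\<close> is the whole lattice.\<close>

lemma card_of_type_fibre:
  assumes p: "prime p" and N: "N \<in> of_type p m js" and j: "j < m"
  shows "card {M \<in> of_type p m (j # js). colon p m 1 M = N}
      = p ^ (j * (m - hd (js @ [m]))) * gauss_binom (hd (js @ [m])) j p"
    and "finite {M \<in> of_type p m (j # js). colon p m 1 M = N}"
proof -
  note N' = p_sub_D[OF of_type_p_sub[OF N]]
  have p0: "p > 0" using prime_gt_0_nat[OF p] .
  define P where "P = scale (int p) ` N"
  define K where "K = N \<inter> pZpow p m"
  define d where "d = residue_dim p m N"
  have d: "d = hd (js @ [m])" "d \<le> m"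
    using of_type_hd[OF p N] lattice_step(2)[OF p of_type_p_sub[OF N]] by (auto simp: d_def)
  have P: "addsub P" unfolding P_def by (rule addsub_image[OF additive_scale N'(1)])
  have K: "addsub K" unfolding K_def by (rule addsub_Int[OF N'(1) addsub_pZpow])
  have sub: "P \<subseteq> pZpow p m" "P \<subseteq> N" "P \<subseteq> K" "K \<subseteq> N"
    using N'(2) scale_closed[OF N'(1)] unfolding P_def pZpow_def K_def by blast+
  have "idx (Zpow m) N * idx N P = idx (Zpow m) (pZpow p m) * idx (pZpow p m) P"
    using idx_mult[OF P N'(1) addsub_Zpow sub(2) N'(2)] idx_mult[OF P addsub_pZpow addsub_Zpow sub(1) pZpow_subset]
    by simp
  also have "idx (pZpow p m) P = idx (Zpow m) N"
    unfolding pZpow_def P_def by (rule idx_image[OF additive_scale inj_on_scale[OF p0] addsub_Zpow N'])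
  finally have iN: "idx N P = p ^ m" using idx_Zpow_pZpow[OF p0, of m] idx_log_idx[OF p of_type_p_sub[OF N]] p0 by simp
  have "idx N K = p ^ d"
    using idx_ssum[OF N'(1) addsub_pZpow, of p m] lattice_step(1)[OF p of_type_p_sub[OF N]] unfolding K_def d_def by simp
  then have "p ^ d * idx K P = p ^ d * p ^ (m - d)"
    using idx_mult[OF P K N'(1) sub(3,4)] iN d(2) by (simp add: power_add[symmetric])
  then have iK: "idx K P = p ^ (m - d)" using p0 by simp
  have pQ: "scale (int p) x \<in> P" if "x \<in> N" for x using that unfolding P_def by blast
  have "card (complements N K P (p ^ j)) = p ^ ((m - d) * j) * gauss_binom (m - (m - d)) j p"
    by (rule card_complements[OF P K sub(3,4) N'(1) p pQ iN iK])
  then show "card {M \<in> of_type p m (j # js). colon p m 1 M = N}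
      = p ^ (j * (m - hd (js @ [m]))) * gauss_binom (hd (js @ [m])) j p"
    unfolding of_type_fibre[OF p N j] P_def K_def using d by (simp add: mult.commute)
  have "idx N P > 0" using iN p0 by simp
  then show "finite {M \<in> of_type p m (j # js). colon p m 1 M = N}"
    unfolding of_type_fibre[OF p N j] using card_complements_mult(2)[OF P K sub(3,4) N'(1) p pQ]
    unfolding P_def K_def by blast
qed

text \<open>The sentinel in \<open>hd (js @ [m])\<close> is the residue dimension of the whole
  lattice, whose word is empty.\<close>

fun type_count :: "nat \<Rightarrow> nat \<Rightarrow> nat list \<Rightarrow> nat" where
  "type_count p m [] = 1"
| "type_count p m (j # js) = type_count p m js * (p ^ (j * (m - hd (js @ [m]))) * gauss_binom (hd (js @ [m])) j p)"

lemma card_of_type: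
  assumes p: "prime p"
  shows "set js \<subseteq> {..<m} \<Longrightarrow> finite (of_type p m js) \<and> card (of_type p m js) = type_count p m js"
proof (induction js)
  case (Cons j js)
  then have j: "j < m" and IH: "finite (of_type p m js)" "card (of_type p m js) = type_count p m js" by auto
  have eq: "of_type p m (j # js) = (\<Union>N\<in>of_type p m js. {M \<in> of_type p m (j # js). colon p m 1 M = N})" by auto
  have fin: "\<forall>N\<in>of_type p m js. finite {M \<in> of_type p m (j # js). colon p m 1 M = N}"
    using card_of_type_fibre(2)[OF p _ j] by blast
  have disj: "\<forall>N\<in>of_type p m js. \<forall>N'\<in>of_type p m js. N \<noteq> N' \<longrightarrow>
      {M \<in> of_type p m (j # js). colon p m 1 M = N} \<inter> {M \<in> of_type p m (j # js). colon p m 1 M = N'} = {}" by blast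
  have "card (\<Union>N\<in>of_type p m js. {M \<in> of_type p m (j # js). colon p m 1 M = N})
      = (\<Sum>N\<in>of_type p m js. card {M \<in> of_type p m (j # js). colon p m 1 M = N})"
    by (rule card_UN_disjoint[OF IH(1) fin disj])
  also have "\<dots> = (\<Sum>N\<in>of_type p m js. p ^ (j * (m - hd (js @ [m]))) * gauss_binom (hd (js @ [m])) j p)"
    using card_of_type_fibre(1)[OF p _ j] by (intro sum.cong refl)
  finally have "card (\<Union>N\<in>of_type p m js. {M \<in> of_type p m (j # js). colon p m 1 M = N}) = type_count p m (j # js)"
    using IH(2) by simp
  moreover have "finite (\<Union>N\<in>of_type p m js. {M \<in> of_type p m (j # js). colon p m 1 M = N})"
    using IH(1) fin by blast
  ultimately show ?case unfolding eq[symmetric] by blast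
qed simp

section \<open>Subgroups of semidirect products with the integers\<close>

definition addg :: "'a::ab_group_add set \<Rightarrow> 'a monoid"
  where "addg A = \<lparr>carrier = A, monoid.mult = (+), one = 0\<rparr>"

lemma addg_simps [simp]:
  "carrier (addg A) = A" "x \<otimes>\<^bsub>addg A\<^esub> y = x + y" "\<one>\<^bsub>addg A\<^esub> = 0"
  by (simp_all add: addg_def)

lemma group_addg: "addsub A \<Longrightarrow> group (addg A)"
  by (rule groupI) (auto simp: add.assoc intro: addsub_add addsub_zero addsub_uminus
      intro!: bexI[of _ "- _"])

lemma inv_addg: "addsub A \<Longrightarrow> x \<in> A \<Longrightarrow> inv\<^bsub>addg A\<^esub> x = - x"
  by (rule group.inv_equality[OF group_addg]) (auto intro: addsub_uminus)

lemma subgroup_addg: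
  assumes "addsub A" shows "subgroup K (addg A) \<longleftrightarrow> addsub K \<and> K \<subseteq> A"
proof
  assume K: "subgroup K (addg A)"
  then have sub: "K \<subseteq> A" using subgroup.subset by fastforce
  have "x - y \<in> K" if "x \<in> K" "y \<in> K" for x y
    using subgroup.m_closed[OF K that(1) subgroup.m_inv_closed[OF K that(2)]] sub that(2)
      inv_addg[OF assms, of y] by auto
  then show "addsub K \<and> K \<subseteq> A" using subgroup.one_closed[OF K] sub by (auto simp: addsub_def)
next
  assume K: "addsub K \<and> K \<subseteq> A"
  show "subgroup K (addg A)"
  proof (rule group.subgroupI[OF group_addg[OF assms]])
    show "K \<noteq> {}" using K addsub_zero by blast
    show "inv\<^bsub>addg A\<^esub> x \<in> K" if "x \<in> K" for x
      using K that inv_addg[OF assms, of x] addsub_uminus[of K x] by auto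
  qed (use K in \<open>auto intro: addsub_add\<close>)
qed

lemma subgroup_index_addg: "subgroup_index (addg A) K = idx A K"
proof -
  have "rcosets\<^bsub>addg A\<^esub> K = cosets A K"
    by (auto simp: RCOSETS_def r_coset_def cosets_def image_def add.commute)
  then show ?thesis by (simp add: subgroup_index_def idx_def)
qed

lemma PPI_addg: "addsub A \<Longrightarrow> p_power_index_subgroups (addg A) p = p_sub p A"
  by (simp add: p_power_index_subgroups_def p_sub_def subgroup_addg subgroup_index_addg)

lemma iso_subgroup_index:
  assumes \<phi>: "\<phi> \<in> iso \<Gamma> \<Delta>" and "group \<Gamma>" "group \<Delta>" and K: "subgroup K \<Gamma>"
  shows "subgroup (\<phi> ` K) \<Delta>" "subgroup_index \<Delta> (\<phi> ` K) = subgroup_index \<Gamma> K"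
proof -
  interpret \<phi>: group_hom \<Gamma> \<Delta> \<phi>
    using assms by (simp add: group_hom_def group_hom_axioms_def iso_def)
  show "subgroup (\<phi> ` K) \<Delta>" by (rule \<phi>.subgroup_img_is_subgroup[OF K])
  have bij: "bij_betw \<phi> (carrier \<Gamma>) (carrier \<Delta>)" using \<phi> by (simp add: iso_def)
  have Ksub: "K \<subseteq> carrier \<Gamma>" using K by (rule subgroup.subset)
  have coset: "\<phi> ` (K #>\<^bsub>\<Gamma>\<^esub> x) = \<phi> ` K #>\<^bsub>\<Delta>\<^esub> \<phi> x" if x: "x \<in> carrier \<Gamma>" for x
    unfolding r_coset_def using Ksub x by (auto simp: image_iff subset_iff) 
  have "rcosets\<^bsub>\<Delta>\<^esub> (\<phi> ` K) = (`) \<phi> ` (rcosets\<^bsub>\<Gamma>\<^esub> K)"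
  proof -
    have "rcosets\<^bsub>\<Delta>\<^esub> (\<phi> ` K) = (\<lambda>y. \<phi> ` K #>\<^bsub>\<Delta>\<^esub> y) ` carrier \<Delta>" by (auto simp: RCOSETS_def)
    also have "carrier \<Delta> = \<phi> ` carrier \<Gamma>" using bij by (simp add: bij_betw_def)
    also have "(\<lambda>y. \<phi> ` K #>\<^bsub>\<Delta>\<^esub> y) ` \<phi> ` carrier \<Gamma> = (\<lambda>x. \<phi> ` (K #>\<^bsub>\<Gamma>\<^esub> x)) ` carrier \<Gamma>"
      unfolding image_image using coset by (intro image_cong) auto
    also have "\<dots> = (`) \<phi> ` (rcosets\<^bsub>\<Gamma>\<^esub> K)" by (auto simp: RCOSETS_def)
    finally show ?thesis .
  qed
  moreover have "inj_on ((`) \<phi>) (rcosets\<^bsub>\<Gamma>\<^esub> K)"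
  proof (rule inj_on_image)
    have "\<Union> (rcosets\<^bsub>\<Gamma>\<^esub> K) \<subseteq> carrier \<Gamma>"
      using \<phi>.G.rcosets_part_G[OF K] by simp
    then show "inj_on \<phi> (\<Union> (rcosets\<^bsub>\<Gamma>\<^esub> K))"
      using bij unfolding bij_betw_def by (meson inj_on_subset)
  qed
  ultimately show "subgroup_index \<Delta> (\<phi> ` K) = subgroup_index \<Gamma> K"
    by (simp add: subgroup_index_def card_image)
qed

lemma iso_PPI:
  assumes \<phi>: "\<phi> \<in> iso \<Gamma> \<Delta>" and \<Gamma>: "group \<Gamma>" and \<Delta>: "group \<Delta>"
  shows "bij_betw ((`) \<phi>) (p_power_index_subgroups \<Gamma> p) (p_power_index_subgroups \<Delta> p)"
    (is "bij_betw _ ?A ?B")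
  unfolding bij_betw_def
proof
  have bij: "bij_betw \<phi> (carrier \<Gamma>) (carrier \<Delta>)" using \<phi> by (simp add: iso_def)
  have sub: "K \<subseteq> carrier \<Gamma>" if "K \<in> ?A" for K
    using that subgroup.subset by (auto simp: p_power_index_subgroups_def)
  show "inj_on ((`) \<phi>) ?A"
  proof (rule inj_onI)
    fix K L assume "K \<in> ?A" "L \<in> ?A" "\<phi> ` K = \<phi> ` L"
    then show "K = L"
      using inj_on_image_eq_iff[of \<phi> "carrier \<Gamma>" K L] bij sub by (auto simp: bij_betw_def)
  qed
  let ?\<psi> = "inv_into (carrier \<Gamma>) \<phi>"
  have \<psi>: "?\<psi> \<in> iso \<Delta> \<Gamma>" by (rule group.iso_set_sym[OF \<Gamma> \<phi>])
  show "(`) \<phi> ` ?A = ?B"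
  proof (intro equalityI subsetI)
    fix L assume "L \<in> (`) \<phi> ` ?A"
    then show "L \<in> ?B"
      using iso_subgroup_index[OF \<phi> \<Gamma> \<Delta>] by (auto simp: p_power_index_subgroups_def)
  next
    fix L assume L: "L \<in> ?B"
    then have sL: "subgroup L \<Delta>" by (simp add: p_power_index_subgroups_def)
    have "?\<psi> ` L \<in> ?A"
      using L iso_subgroup_index[OF \<psi> \<Delta> \<Gamma> sL] by (simp add: p_power_index_subgroups_def)
    moreover have "\<phi> ` ?\<psi> ` L = L"
      using image_inv_into_cancel[of \<phi> "carrier \<Gamma>" "carrier \<Delta>" L] bij subgroup.subset[OF sL]
      by (simp add: bij_betw_def)
    ultimately show "L \<in> (`) \<phi> ` ?A" by (metis imageI)
  qed
qed

lemma (in monoid) mult_middle_assoc: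
  assumes "a \<in> carrier G" "b \<in> carrier G" "c \<in> carrier G" "d \<in> carrier G"
  shows "(a \<otimes> b) \<otimes> (c \<otimes> d) = a \<otimes> (b \<otimes> c) \<otimes> d"
  using assms by (simp add: m_assoc)

text \<open>The integer \<open>c\<close> acts on \<open>B\<close> by the unipotent automorphism \<open>b \<mapsto> b + D c b\<close>.\<close>

locale twist =
  fixes B :: "'a::ab_group_add set" and D :: "int \<Rightarrow> 'a \<Rightarrow> 'a"
  assumes addsub_B: "addsub B"
    and D_closed: "b \<in> B \<Longrightarrow> D c b \<in> B"
    and D_add: "D c (b + b') = D c b + D c b'"
    and D_add_left: "D (c + c') b = D c b + D c' b"
    and D_D: "D c (D c' b) = 0"
begin

definition TG :: "('a \<times> int) monoid"
  where "TG = \<lparr>carrier = B \<times> UNIV,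
    monoid.mult = (\<lambda>(b, c) (b', c'). (b + b' + D c b', c + c')), one = (0, 0)\<rparr>"

lemma TG_simps [simp]:
  "carrier TG = B \<times> UNIV" "(b, c) \<otimes>\<^bsub>TG\<^esub> (b', c') = (b + b' + D c b', c + c')"
  "\<one>\<^bsub>TG\<^esub> = (0, 0)"
  by (simp_all add: TG_def)

lemma additive_D: "Modules.additive (D c)"
  by unfold_locales (rule D_add)

lemma D_0 [simp]: "D 0 b = 0" using D_add_left[of 0 0 b] by simp

lemma D_zero [simp]: "D c 0 = 0" using D_add[of c 0 0] by simp

lemma D_uminus: "D (- c) b = - D c b"
  using D_add_left[of c "- c" b] by (simp add: eq_neg_iff_add_eq_0 add.commute)

lemma group_TG: "group TG"
proof (rule groupI)
  fix x y z assume "x \<in> carrier TG" "y \<in> carrier TG" "z \<in> carrier TG"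
  then show "x \<otimes>\<^bsub>TG\<^esub> y \<otimes>\<^bsub>TG\<^esub> z = x \<otimes>\<^bsub>TG\<^esub> (y \<otimes>\<^bsub>TG\<^esub> z)"
    by (cases x; cases y; cases z) (simp add: D_add D_add_left D_D add_ac)
next
  fix x y assume "x \<in> carrier TG" "y \<in> carrier TG"
  then show "x \<otimes>\<^bsub>TG\<^esub> y \<in> carrier TG"
    by (cases x; cases y) (simp add: addsub_B addsub_add D_closed)
next
  fix x assume "x \<in> carrier TG"
  then obtain b c where x: "x = (b, c)" "b \<in> B" by (cases x) auto
  have "(- b + D c b, - c) \<otimes>\<^bsub>TG\<^esub> x = \<one>\<^bsub>TG\<^esub>"
    by (simp add: x D_uminus)
  moreover have "(- b + D c b, - c) \<in> carrier TG"
    using x(2) addsub_add[OF addsub_B addsub_uminus[OF addsub_B] D_closed] by simp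
  ultimately show "\<exists>y\<in>carrier TG. y \<otimes>\<^bsub>TG\<^esub> x = \<one>\<^bsub>TG\<^esub>" by blast
qed (auto simp: addsub_B addsub_zero)

sublocale TG: group TG by (rule group_TG)

text \<open>The kernel of the projection of \<open>H\<close> to the integers, identified with a
  subset of \<open>B\<close>; \<open>per\<close> is the image of that projection.\<close>

definition ker :: "('a \<times> int) set \<Rightarrow> 'a set" where "ker H = {b. (b, 0) \<in> H}"

definition per :: "('a \<times> int) set \<Rightarrow> int set" where "per H = snd ` H"

lemma TG_inv_0: "b \<in> B \<Longrightarrow> inv\<^bsub>TG\<^esub> (b, 0) = (- b, 0)"
  by (rule TG.inv_equality) (auto simp: addsub_B addsub_uminus)

lemma hom_snd: "group_hom TG integer_group snd"
  using group_TG group_integer_group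
  by (auto simp: group_hom_def group_hom_axioms_def hom_def integer_group_def)

lemma snd_mult: "snd (x \<otimes>\<^bsub>TG\<^esub> y) = snd x + snd y"
  by (cases x; cases y) simp

lemma snd_inv: "x \<in> carrier TG \<Longrightarrow> snd (inv\<^bsub>TG\<^esub> x) = - snd x"
  using snd_mult[of "inv\<^bsub>TG\<^esub> x" x] TG.l_inv[of x] by simp

lemma snd_int_pow: "x \<in> carrier TG \<Longrightarrow> snd (x [^]\<^bsub>TG\<^esub> (i::int)) = i * snd x"
  using group_hom.hom_int_pow[OF hom_snd, of x i] by (simp add: group_int_pow_integer_group)

lemma addsub_ker:
  assumes "subgroup H TG" shows "addsub (ker H)" "ker H \<subseteq> B"
proof -
  show sub: "ker H \<subseteq> B" using subgroup.subset[OF assms] by (auto simp: ker_def)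
  have "b - b' \<in> ker H" if "b \<in> ker H" "b' \<in> ker H" for b b'
    using subgroup.m_closed[OF assms, of "(b, 0)" "inv\<^bsub>TG\<^esub> (b', 0)"]
      subgroup.m_inv_closed[OF assms, of "(b', 0)"] that TG_inv_0[of b'] sub
    by (auto simp: ker_def)
  then show "addsub (ker H)" using subgroup.one_closed[OF assms] by (auto simp: addsub_def ker_def)
qed

lemma addsub_per:
  assumes "subgroup H TG" shows "addsub (per H)"
  unfolding addsub_def
proof (intro conjI ballI)
  show "0 \<in> per H" using subgroup.one_closed[OF assms] by (force simp: per_def)
  fix c c' assume "c \<in> per H" "c' \<in> per H"
  then obtain x y where xy: "x \<in> H" "y \<in> H" "c = snd x" "c' = snd y" by (auto simp: per_def)
  have "x \<otimes>\<^bsub>TG\<^esub> inv\<^bsub>TG\<^esub> y \<in> H"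
    using subgroup.m_closed[OF assms xy(1) subgroup.m_inv_closed[OF assms xy(2)]] .
  moreover have "snd (x \<otimes>\<^bsub>TG\<^esub> inv\<^bsub>TG\<^esub> y) = c - c'"
    using xy snd_inv[OF subsetD[OF subgroup.subset[OF assms] xy(2)]] by (simp add: snd_mult)
  ultimately show "c - c' \<in> per H" unfolding per_def by (metis imageI)
qed

text \<open>Right multiplication by the inverse of a known element over \<open>c\<close> lands in
  the kernel. Consequently each nonempty fibre of \<open>H\<close> over the integers is a single
  coset of \<open>ker H\<close>.\<close>

lemma mem_iff_ker:
  assumes H: "subgroup H TG" and g: "(b', c) \<in> H" and b: "b \<in> B"
  shows "(b, c) \<in> H \<longleftrightarrow> b - b' \<in> ker H"
proof -
  have gc: "(b', c) \<in> carrier TG" using g subgroup.subset[OF H] by blast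
  have b': "b - b' \<in> B" using b gc by (auto intro: addsub_diff[OF addsub_B])
  have eq: "(b, c) = (b - b', 0) \<otimes>\<^bsub>TG\<^esub> (b', c)" by simp
  show ?thesis
  proof
    assume "(b, c) \<in> H"
    then have "(b, c) \<otimes>\<^bsub>TG\<^esub> inv\<^bsub>TG\<^esub> (b', c) \<in> H"
      using subgroup.m_closed[OF H] subgroup.m_inv_closed[OF H g] by blast
    also have "(b, c) \<otimes>\<^bsub>TG\<^esub> inv\<^bsub>TG\<^esub> (b', c) = (b - b', 0)"
    proof -
      have 1: "(b - b', 0) \<in> carrier TG" using b' by simp
      show ?thesis
        unfolding eq TG.m_assoc[OF 1 gc TG.inv_closed[OF gc]] TG.r_inv[OF gc] by (rule TG.r_one[OF 1])
    qed
    finally show "b - b' \<in> ker H" by (simp add: ker_def)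
  next
    assume "b - b' \<in> ker H"
    then show "(b, c) \<in> H" unfolding eq ker_def using subgroup.m_closed[OF H _ g] by blast
  qed
qed

lemma rcos_eq_iff:
  assumes H: "subgroup H TG" and x: "x \<in> carrier TG" and y: "y \<in> carrier TG"
  shows "H #>\<^bsub>TG\<^esub> x = H #>\<^bsub>TG\<^esub> y \<longleftrightarrow> (\<exists>h\<in>H. x = h \<otimes>\<^bsub>TG\<^esub> y)"
proof
  assume "H #>\<^bsub>TG\<^esub> x = H #>\<^bsub>TG\<^esub> y"
  then have "x \<in> H #>\<^bsub>TG\<^esub> y" using TG.rcos_self[OF x H] by simp
  then show "\<exists>h\<in>H. x = h \<otimes>\<^bsub>TG\<^esub> y" by (auto simp: r_coset_def)
next
  assume "\<exists>h\<in>H. x = h \<otimes>\<^bsub>TG\<^esub> y"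
  then have "x \<in> H #>\<^bsub>TG\<^esub> y" by (auto simp: r_coset_def)
  then show "H #>\<^bsub>TG\<^esub> x = H #>\<^bsub>TG\<^esub> y" using TG.repr_independence[OF _ y H] by simp
qed

text \<open>Left multiplication by \<open>H\<close> reduces the integer component modulo
  \<open>d\<close>, so right cosets have representatives \<open>(b, r)\<close> with
  \<open>0 \<le> r < d\<close>. Two of these are equivalent only through an element of
  \<open>H\<close> over 0, that is through \<open>ker H\<close>.\<close>

lemma subgroup_index_TG:
  assumes H: "subgroup H TG" and per: "per H = range ((*) d)" and d: "d > 0"
  shows "subgroup_index TG H = idx B (ker H) * nat d"
proof -
  let ?S = "B \<times> {0..<d}"
  have sub: "H \<subseteq> carrier TG" by (rule subgroup.subset[OF H])
  have "rcosets\<^bsub>TG\<^esub> H = (\<lambda>x. H #>\<^bsub>TG\<^esub> x) ` ?S"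
  proof (intro equalityI subsetI)
    fix C assume "C \<in> rcosets\<^bsub>TG\<^esub> H"
    then obtain b c where C: "b \<in> B" "C = H #>\<^bsub>TG\<^esub> (b, c)" by (auto simp: RCOSETS_def)
    have "c mod d - c = d * (- (c div d))" by (simp add: minus_mult_div_eq_mod[symmetric])
    then have "c mod d - c \<in> per H" unfolding per by blast
    then obtain \<beta> where \<beta>: "(\<beta>, c mod d - c) \<in> H" by (auto simp: per_def)
    let ?x = "(\<beta>, c mod d - c) \<otimes>\<^bsub>TG\<^esub> (b, c)"
    have "(\<beta>, c mod d - c) \<in> carrier TG" using \<beta> sub by blast
    then have xc: "?x \<in> carrier TG" using C(1) TG.m_closed[of "(\<beta>, c mod d - c)" "(b, c)"] by auto
    then have "?x \<in> ?S" using d by auto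
    moreover have "C = H #>\<^bsub>TG\<^esub> ?x"
    proof -
      have bc: "(b, c) \<in> carrier TG" using C(1) by simp
      show ?thesis unfolding C(2) using rcos_eq_iff[OF H xc bc, THEN iffD2, OF bexI[OF refl \<beta>]] ..
    qed
    ultimately show "C \<in> (\<lambda>x. H #>\<^bsub>TG\<^esub> x) ` ?S" by (rule rev_image_eqI)
  next
    fix C assume "C \<in> (\<lambda>x. H #>\<^bsub>TG\<^esub> x) ` ?S"
    then show "C \<in> rcosets\<^bsub>TG\<^esub> H" unfolding RCOSETS_def TG_simps by blast
  qed
  then have "subgroup_index TG H = card ((\<lambda>x. H #>\<^bsub>TG\<^esub> x) ` ?S)"
    by (simp add: subgroup_index_def)
  also have "\<dots> = card ((\<lambda>(b, r). ((+) b ` ker H, r)) ` ?S)"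
  proof (rule card_image_cong_iff, clarify)
    fix b r b' r' assume b: "b \<in> B" "b' \<in> B" and r: "r \<in> {0..<d}" "r' \<in> {0..<d}"
    have "H #>\<^bsub>TG\<^esub> (b, r) = H #>\<^bsub>TG\<^esub> (b', r') \<longleftrightarrow> (\<exists>h\<in>H. (b, r) = h \<otimes>\<^bsub>TG\<^esub> (b', r'))"
      by (rule rcos_eq_iff[OF H]) (use b in auto)
    also have "\<dots> \<longleftrightarrow> b - b' \<in> ker H \<and> r = r'"
    proof
      assume "\<exists>h\<in>H. (b, r) = h \<otimes>\<^bsub>TG\<^esub> (b', r')"
      then obtain \<beta> \<gamma> where h: "(\<beta>, \<gamma>) \<in> H" "b = \<beta> + b' + D \<gamma> b'" "r = \<gamma> + r'" by auto
      have "\<gamma> \<in> per H" unfolding per_def using imageI[OF h(1), of snd] by (simp only: snd_conv)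
      then have "\<gamma> \<in> range ((*) d)" unfolding per .
      then obtain k where k: "\<gamma> = d * k" by (rule rangeE)
      have "r mod d = r' mod d" unfolding h(3) k by (rule mod_mult_self4)
      moreover have "r mod d = r" "r' mod d = r'" using r by (auto intro: mod_pos_pos_trivial)
      ultimately have rr: "r = r'" by (simp only:)
      then have "\<gamma> = 0" using h(3) by simp
      then have "b - b' = \<beta>" "(\<beta>, 0) \<in> H" using h(1,2) by simp_all
      then show "b - b' \<in> ker H \<and> r = r'" using rr by (simp only: ker_def mem_Collect_eq)
    next
      assume "b - b' \<in> ker H \<and> r = r'"
      then show "\<exists>h\<in>H. (b, r) = h \<otimes>\<^bsub>TG\<^esub> (b', r')"
        by (intro bexI[of _ "(b - b', 0)"]) (auto simp: ker_def)
    qed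
    finally show "H #>\<^bsub>TG\<^esub> (b, r) = H #>\<^bsub>TG\<^esub> (b', r') \<longleftrightarrow>
        ((+) b ` ker H, r) = ((+) b' ` ker H, r')"
      using coset_eq_iff[OF addsub_ker(1)[OF H]] by simp
  qed
  also have "(\<lambda>(b, r). ((+) b ` ker H, r)) ` ?S = cosets B (ker H) \<times> {0..<d}"
    by (auto simp: cosets_def image_iff)
  finally show ?thesis by (simp add: idx_def card_cartesian_product)
qed

text \<open>The elements \<open>(0, c)\<close> lie in pairwise different cosets, so the index is
  infinite and counted as 0. This excludes a trivial projection when the index is a power of
  \<open>p\<close>.\<close>

lemma subgroup_index_TG_0:
  assumes H: "subgroup H TG" and per: "per H = {0}"
  shows "subgroup_index TG H = 0"
proof -
  have "inj (\<lambda>c. H #>\<^bsub>TG\<^esub> (0, c))"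
  proof (rule injI)
    fix c c' :: int assume eq: "H #>\<^bsub>TG\<^esub> (0, c) = H #>\<^bsub>TG\<^esub> (0, c')"
    have "\<exists>h\<in>H. (0, c) = h \<otimes>\<^bsub>TG\<^esub> (0, c')"
      using rcos_eq_iff[OF H, of "(0, c)" "(0, c')"] eq addsub_zero[OF addsub_B] by simp
    then obtain h where h: "h \<in> H" "(0, c) = h \<otimes>\<^bsub>TG\<^esub> (0, c')" by blast
    have "snd h \<in> per H" using h(1) by (simp add: per_def)
    then have "snd h = 0" using per by simp
    then show "c = c'" using arg_cong[OF h(2), of snd] by (simp add: snd_mult)
  qed
  then have "infinite (range (\<lambda>c. H #>\<^bsub>TG\<^esub> (0, c)))"
    using finite_imageD infinite_UNIV_int by blast
  moreover have "range (\<lambda>c. H #>\<^bsub>TG\<^esub> (0, c)) \<subseteq> rcosets\<^bsub>TG\<^esub> H"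
    using addsub_zero[OF addsub_B] by (auto simp: RCOSETS_def)
  ultimately show ?thesis
    unfolding subgroup_index_def by (meson card.infinite finite_subset)
qed

section \<open>Subgroups of \<open>p\<close>-power index in the semidirect product\<close>

abbreviation TGP :: "nat \<Rightarrow> ('a \<times> int) set set"
  where "TGP p \<equiv> p_power_index_subgroups TG p"

definition stable :: "nat \<Rightarrow> 'a set \<Rightarrow> nat \<Rightarrow> bool"
  where "stable p K a \<longleftrightarrow> (\<forall>k\<in>K. D (int (p ^ a)) k \<in> K)"

definition pairs :: "nat \<Rightarrow> ('a set \<times> nat) set"
  where "pairs p = {(K, a). K \<in> p_sub p B \<and> stable p K a}"

definition expo :: "nat \<Rightarrow> ('a \<times> int) set \<Rightarrow> nat"
  where "expo p H = (THE a. per H = range ((*) (int (p ^ a))))"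

lemma range_mult_eq:
  assumes "prime p" "range ((*) (int (p ^ a))) = range ((*) (int (p ^ b)))"
  shows "a = b"
proof -
  have "int (p ^ a) * 1 \<in> range ((*) (int (p ^ a)))" "int (p ^ b) * 1 \<in> range ((*) (int (p ^ b)))"
    by blast+
  then have "int (p ^ a) dvd int (p ^ b)" "int (p ^ b) dvd int (p ^ a)"
    using assms(2) by (metis dvd_triv_left imageE mult.right_neutral)+
  then have "p ^ a = p ^ b" by (meson dvd_antisym int_dvd_int_iff)
  then show ?thesis using prime_gt_1_nat[OF assms(1)] by (simp add: power_inject_exp)
qed

lemma expo_eq:
  assumes "prime p" "per H = range ((*) (int (p ^ a)))"
  shows "expo p H = a"
  unfolding expo_def
proof (rule the_equality)
  show "per H = range ((*) (int (p ^ a)))" by (rule assms(2))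
  fix b assume "per H = range ((*) (int (p ^ b)))"
  then show "b = a" using range_mult_eq[OF assms(1), of b a] assms(2) by (simp only:)
qed

lemma TGP_props:
  assumes p: "prime p" and H: "H \<in> TGP p"
  shows "per H = range ((*) (int (p ^ expo p H)))" "ker H \<in> p_sub p B"
    "subgroup_index TG H = p ^ (log_idx p B (ker H) + expo p H)" "stable p (ker H) (expo p H)"
proof -
  have sH: "subgroup H TG" using H by (simp add: p_power_index_subgroups_def)
  obtain k where k: "subgroup_index TG H = p ^ k" using H by (auto simp: p_power_index_subgroups_def)
  have p0: "p > 0" using prime_gt_0_nat[OF p] .
  obtain d where d: "d \<ge> 0" "per H = range ((*) d)"
    using addsub_int_generator[OF addsub_per[OF sH]] by blast
  have "d \<noteq> 0"
  proof
    assume "d = 0"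
    then have "per H = {0}" using d(2) by auto
    then show False using subgroup_index_TG_0[OF sH] k p0 by simp
  qed
  then have d0: "d > 0" using d(1) by simp
  have idx: "subgroup_index TG H = idx B (ker H) * nat d"
    by (rule subgroup_index_TG[OF sH d(2) d0])
  then have *: "idx B (ker H) * nat d = p ^ k" using k by simp
  obtain a where a: "nat d = p ^ a" using power_prime_factors(2)[OF p *] by blast
  then have "int (nat d) = int (p ^ a)" by (simp only:)
  then have da: "d = int (p ^ a)" using d0 by (simp only: int_nat_eq) simp
  have ea: "expo p H = a" by (rule expo_eq[OF p]) (simp only: d(2) da)
  show per: "per H = range ((*) (int (p ^ expo p H)))" unfolding ea da[symmetric] by (rule d(2))
  show ker: "ker H \<in> p_sub p B"
    using power_prime_factors(1)[OF p *] addsub_ker[OF sH] by (simp add: p_sub_def)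
  show "subgroup_index TG H = p ^ (log_idx p B (ker H) + expo p H)"
    unfolding idx a ea idx_log_idx[OF p ker] by (simp only: power_add)
  show "stable p (ker H) (expo p H)"
    unfolding stable_def
  proof
    fix k assume k: "k \<in> ker H"
    have kB: "k \<in> B" using addsub_ker(2)[OF sH] k by blast
    have "int (p ^ expo p H) * 1 \<in> per H" unfolding per by blast
    then obtain b where b: "(b, int (p ^ expo p H)) \<in> H" by (auto simp: per_def)
    let ?d = "int (p ^ expo p H)"
    have bB: "b \<in> B" using b subgroup.subset[OF sH] by auto
    \<comment> \<open>Multiplying an element of \<open>H\<close> over \<open>p^a\<close> by
      \<open>k\<close> changes its \<open>B\<close>-component by \<open>k + D ?d k\<close>, which
      therefore belongs to the kernel along with \<open>k\<close>.\<close>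
    have "(b, ?d) \<otimes>\<^bsub>TG\<^esub> (k, 0) \<in> H" using subgroup.m_closed[OF sH b] k by (simp only: ker_def mem_Collect_eq)
    then have "(b + k + D ?d k, ?d) \<in> H" by simp
    then have "b + k + D ?d k - b \<in> ker H"
      using mem_iff_ker[OF sH b, of "b + k + D ?d k"] bB kB
        addsub_add[OF addsub_B addsub_add[OF addsub_B bB kB] D_closed[OF kB]] by simp
    then have "(b + k + D ?d k - b) - k \<in> ker H" by (rule addsub_diff[OF addsub_ker(1)[OF sH] _ k])
    then show "D ?d k \<in> ker H" by simp
  qed
qed

text \<open>The subgroup generated by \<open>K\<close> and \<open>g\<close>, provided that
  \<open>K\<close> is stable under \<open>D (snd g)\<close>: powers of \<open>g\<close> can then be
  collected on the right.\<close>

definition gensub :: "'a set \<Rightarrow> 'a \<times> int \<Rightarrow> ('a \<times> int) set"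
  where "gensub K g = (\<lambda>(k, i). (k, 0) \<otimes>\<^bsub>TG\<^esub> g [^]\<^bsub>TG\<^esub> (i::int)) ` (K \<times> UNIV)"

lemma gensubI: "k \<in> K \<Longrightarrow> (k, 0) \<otimes>\<^bsub>TG\<^esub> g [^]\<^bsub>TG\<^esub> (i::int) \<in> gensub K g"
  unfolding gensub_def by (rule image_eqI[of _ _ "(k, i)"]) simp_all

lemma gensubE:
  assumes "x \<in> gensub K g"
  obtains k i where "k \<in> K" "x = (k, 0) \<otimes>\<^bsub>TG\<^esub> g [^]\<^bsub>TG\<^esub> (i::int)"
proof -
  from assms obtain z where z: "z \<in> K \<times> UNIV" "x = (\<lambda>(k, i). (k, 0) \<otimes>\<^bsub>TG\<^esub> g [^]\<^bsub>TG\<^esub> (i::int)) z"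
    unfolding gensub_def by (rule imageE)
  obtain k i where "z = (k, i)" by (cases z)
  then show thesis using that[of k i] z by simp
qed

text \<open>The commutation rule \<open>comm\<close> moves a power of \<open>g\<close> past
  \<open>k\<close> at the price of replacing \<open>k\<close> by \<open>k + D (i * snd g) k\<close>,
  which stability keeps in \<open>K\<close>.\<close>

lemma subgroup_gensub:
  assumes K: "addsub K" "K \<subseteq> B" and g: "g \<in> carrier TG" and st: "\<And>k. k \<in> K \<Longrightarrow> D (snd g) k \<in> K"
  shows "subgroup (gensub K g) TG"
proof -
  have twist_map: "D (i * snd g) k \<in> K" if k: "k \<in> K" for i k
  proof -
    have nat: "D (int n * snd g) k \<in> K" for n
      by (induction n)
         (use st[OF k] in \<open>auto simp: D_add_left distrib_right intro: addsub_add[OF K(1)] addsub_zero[OF K(1)]\<close>)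
    show ?thesis
      by (cases i rule: int_cases2) (use nat addsub_uminus[OF K(1)] in \<open>auto simp: D_uminus\<close>)
  qed
  have gi: "g [^]\<^bsub>TG\<^esub> (i::int) \<in> carrier TG" for i by (rule TG.int_pow_closed[OF g])
  have comm: "g [^]\<^bsub>TG\<^esub> (i::int) \<otimes>\<^bsub>TG\<^esub> (k, 0) = (k + D (i * snd g) k, 0) \<otimes>\<^bsub>TG\<^esub> g [^]\<^bsub>TG\<^esub> i" for i k
  proof -
    obtain a b where ab: "g [^]\<^bsub>TG\<^esub> i = (a, b)" by (cases "g [^]\<^bsub>TG\<^esub> i")
    have *: "snd (g [^]\<^bsub>TG\<^esub> i) = i * snd g" by (rule snd_int_pow[OF g])
    have "b = i * snd g" using * unfolding ab by (metis snd_conv)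
    then show ?thesis unfolding ab by (simp add: add_ac)
  qed
  have kc: "(k, 0) \<in> carrier TG" if "k \<in> K" for k using that K by auto
  have kk: "k + D (i * snd g) k \<in> K" if "k \<in> K" for i k
    using addsub_add[OF K(1) that twist_map[OF that]] .
  show ?thesis
  proof (rule TG.subgroupI)
    show "gensub K g \<subseteq> carrier TG"
    proof
      fix x assume "x \<in> gensub K g"
      then obtain k i where "k \<in> K" "x = (k, 0) \<otimes>\<^bsub>TG\<^esub> g [^]\<^bsub>TG\<^esub> (i::int)" by (rule gensubE)
      then show "x \<in> carrier TG" using TG.m_closed[OF kc gi] by (simp only:)
    qed
    show "gensub K g \<noteq> {}" using gensubI[OF addsub_zero[OF K(1)]] by (metis empty_iff)
  next
    fix x assume "x \<in> gensub K g"
    then obtain k i where x: "k \<in> K" "x = (k, 0) \<otimes>\<^bsub>TG\<^esub> g [^]\<^bsub>TG\<^esub> (i::int)" by (rule gensubE)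
    have "inv\<^bsub>TG\<^esub> x = inv\<^bsub>TG\<^esub> (g [^]\<^bsub>TG\<^esub> i) \<otimes>\<^bsub>TG\<^esub> inv\<^bsub>TG\<^esub> (k, 0)"
      unfolding x(2) by (rule TG.inv_mult_group[OF kc[OF x(1)] gi])
    also have "\<dots> = g [^]\<^bsub>TG\<^esub> (- i) \<otimes>\<^bsub>TG\<^esub> (- k, 0)"
      using x(1) K(2) by (simp only: TG.int_pow_neg[OF g] TG_inv_0 subsetD)
    finally have "inv\<^bsub>TG\<^esub> x = (- k + D (- i * snd g) (- k), 0) \<otimes>\<^bsub>TG\<^esub> g [^]\<^bsub>TG\<^esub> (- i)"
      unfolding comm .
    then show "inv\<^bsub>TG\<^esub> x \<in> gensub K g"
      using gensubI[OF kk[OF addsub_uminus[OF K(1) x(1)]], of "- i" g "- i"] by (simp only:)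
  next
    fix x y assume "x \<in> gensub K g" "y \<in> gensub K g"
    then obtain k i k' j where x: "k \<in> K" "x = (k, 0) \<otimes>\<^bsub>TG\<^esub> g [^]\<^bsub>TG\<^esub> (i::int)"
      and y: "k' \<in> K" "y = (k', 0) \<otimes>\<^bsub>TG\<^esub> g [^]\<^bsub>TG\<^esub> (j::int)" by (elim gensubE)
    let ?k' = "k' + D (i * snd g) k'"
    have "x \<otimes>\<^bsub>TG\<^esub> y = (k, 0) \<otimes>\<^bsub>TG\<^esub> (g [^]\<^bsub>TG\<^esub> i \<otimes>\<^bsub>TG\<^esub> (k', 0)) \<otimes>\<^bsub>TG\<^esub> g [^]\<^bsub>TG\<^esub> j"
      unfolding x(2) y(2) by (rule TG.mult_middle_assoc[OF kc[OF x(1)] gi kc[OF y(1)] gi])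
    also have "\<dots> = ((k, 0) \<otimes>\<^bsub>TG\<^esub> (?k', 0)) \<otimes>\<^bsub>TG\<^esub> (g [^]\<^bsub>TG\<^esub> i \<otimes>\<^bsub>TG\<^esub> g [^]\<^bsub>TG\<^esub> j)"
      unfolding comm by (rule TG.mult_middle_assoc[OF kc[OF x(1)] kc[OF kk[OF y(1)]] gi gi, symmetric])
    also have "\<dots> = (k + ?k', 0) \<otimes>\<^bsub>TG\<^esub> g [^]\<^bsub>TG\<^esub> (i + j)"
    proof -
      have "(k, 0) \<otimes>\<^bsub>TG\<^esub> (?k', 0) = (k + ?k', 0)" by simp
      then show ?thesis unfolding TG.int_pow_mult[OF g] by (simp only:)
    qed
    finally show "x \<otimes>\<^bsub>TG\<^esub> y \<in> gensub K g"
      using gensubI[OF addsub_add[OF K(1) x(1) kk[OF y(1)]]] by (simp only:)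
  qed
qed

text \<open>Because \<open>snd g > 0\<close>, the only power of \<open>g\<close> over 0 is the
  trivial one, so the kernel does not grow.\<close>

lemma gensub_props:
  assumes K: "addsub K" "K \<subseteq> B" and g: "g \<in> carrier TG" and d: "snd g > 0"
  shows "ker (gensub K g) = K" "per (gensub K g) = range ((*) (snd g))" "g \<in> gensub K g"
proof -
  have snd: "snd ((k, 0) \<otimes>\<^bsub>TG\<^esub> g [^]\<^bsub>TG\<^esub> (i::int)) = i * snd g" for k i
    by (simp add: snd_mult snd_int_pow[OF g])
  have 0: "(k, 0) = (k, 0) \<otimes>\<^bsub>TG\<^esub> g [^]\<^bsub>TG\<^esub> (0::int)" for k by simp
  show "ker (gensub K g) = K"
  proof (intro equalityI subsetI)
    fix b assume "b \<in> ker (gensub K g)"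
    then have "(b, 0) \<in> gensub K g" by (simp only: ker_def mem_Collect_eq)
    then obtain k i where k: "k \<in> K" "(b, 0) = (k, 0) \<otimes>\<^bsub>TG\<^esub> g [^]\<^bsub>TG\<^esub> (i::int)"
      by (rule gensubE)
    then have "i * snd g = 0" using snd[of k i] by (metis snd_conv)
    then have "i = 0" using d by simp
    then show "b \<in> K" using k by simp
  next
    fix k assume "k \<in> K"
    then show "k \<in> ker (gensub K g)" using gensubI[of k K g 0] 0[of k] by (simp only: ker_def mem_Collect_eq)
  qed
  show "per (gensub K g) = range ((*) (snd g))"
  proof (intro equalityI subsetI)
    fix c assume "c \<in> per (gensub K g)"
    then obtain x where x: "c = snd x" "x \<in> gensub K g" unfolding per_def by (rule imageE)
    from x(2) obtain k i where "x = (k, 0) \<otimes>\<^bsub>TG\<^esub> g [^]\<^bsub>TG\<^esub> (i::int)" by (rule gensubE)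
    then have "c = snd g * i" using x(1) snd[of k i] by (simp only: mult.commute)
    then show "c \<in> range ((*) (snd g))" by blast
  next
    fix c assume "c \<in> range ((*) (snd g))"
    then obtain i where "c = snd g * i" by blast
    then have "c = snd ((0, 0) \<otimes>\<^bsub>TG\<^esub> g [^]\<^bsub>TG\<^esub> i)" unfolding snd by simp
    then show "c \<in> per (gensub K g)" unfolding per_def
      by (rule image_eqI[OF _ gensubI[OF addsub_zero[OF K(1)]]])
  qed
  have "g = (0, 0) \<otimes>\<^bsub>TG\<^esub> g [^]\<^bsub>TG\<^esub> (1::int)"
    using TG.l_one[OF g] g by (simp add: TG.int_pow_1)
  then show "g \<in> gensub K g" using gensubI[OF addsub_zero[OF K(1)], of g 1] by (simp only:)
qed

text \<open>Dividing an element of \<open>H\<close> by the power of \<open>g\<close> over the same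
  integer leaves an element of the common kernel.\<close>

lemma subgroup_determined:
  assumes H: "subgroup H TG" and H': "subgroup H' TG" and ker: "ker H = ker H'"
    and per: "per H \<subseteq> range ((*) (snd g))" and g: "g \<in> H" "g \<in> H'"
  shows "H \<subseteq> H'"
proof
  fix x assume x: "x \<in> H"
  have xc: "x \<in> carrier TG" and gc: "g \<in> carrier TG" using subgroup.subset[OF H] x g by blast+
  have "snd x \<in> range ((*) (snd g))" using per x by (auto simp: per_def)
  then obtain i where i: "snd x = snd g * i" by blast
  let ?y = "x \<otimes>\<^bsub>TG\<^esub> inv\<^bsub>TG\<^esub> (g [^]\<^bsub>TG\<^esub> i)"
  have gi: "g [^]\<^bsub>TG\<^esub> i \<in> H" "g [^]\<^bsub>TG\<^esub> i \<in> H'"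
    using TG.subgroup_int_pow_closed[OF H g(1)] TG.subgroup_int_pow_closed[OF H' g(2)] .
  have y: "?y \<in> H" using subgroup.m_closed[OF H x subgroup.m_inv_closed[OF H gi(1)]] .
  have gic: "g [^]\<^bsub>TG\<^esub> i \<in> carrier TG" by (rule TG.int_pow_closed[OF gc])
  have "snd ?y = 0" unfolding snd_mult snd_inv[OF gic] snd_int_pow[OF gc] i by simp
  then obtain k where k: "?y = (k, 0)" by (metis prod.collapse)
  then have "k \<in> ker H" using y by (simp only: ker_def mem_Collect_eq)
  then have "k \<in> ker H'" unfolding ker .
  then have "?y \<in> H'" unfolding k by (simp only: ker_def mem_Collect_eq)
  then have "?y \<otimes>\<^bsub>TG\<^esub> g [^]\<^bsub>TG\<^esub> i \<in> H'" using subgroup.m_closed[OF H' _ gi(2)] by blast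
  moreover have "?y \<otimes>\<^bsub>TG\<^esub> g [^]\<^bsub>TG\<^esub> i = x"
    unfolding TG.m_assoc[OF xc TG.inv_closed[OF gic] gic] TG.l_inv[OF gic] by (rule TG.r_one[OF xc])
  ultimately show "x \<in> H'" by simp
qed

text \<open>The fibre of \<open>H\<close> over the generator \<open>p^a\<close> of its projection is
  a coset of \<open>K\<close>. Together with \<open>K\<close> and \<open>a\<close> it determines
  \<open>H\<close>, and \<open>gensub\<close> realises every coset, so each pair
  \<open>(K, a)\<close> comes from \<open>idx B K\<close> subgroups.\<close>

lemma card_fibre:
  assumes p: "prime p" and Ka: "(K, a) \<in> pairs p"
  shows "bij_betw (\<lambda>H. {b. (b, int (p ^ a)) \<in> H})
      {H \<in> TGP p. ker H = K \<and> expo p H = a} (cosets B K)"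
proof -
  let ?d = "int (p ^ a)"
  let ?F = "{H \<in> TGP p. ker H = K \<and> expo p H = a}"
  have K: "K \<in> p_sub p B" "addsub K" "K \<subseteq> B" using Ka p_sub_D[of K p B] by (auto simp: pairs_def)
  have st: "D ?d k \<in> K" if "k \<in> K" for k using Ka that by (simp add: pairs_def stable_def)
  have d0: "?d > 0" using prime_gt_0_nat[OF p] by simp
  have sub: "subgroup H TG" if "H \<in> ?F" for H using that by (simp add: p_power_index_subgroups_def)
  have per: "per H = range ((*) ?d)" if "H \<in> ?F" for H using TGP_props(1)[OF p, of H] that by simp
  have rep: "\<exists>b. (b, ?d) \<in> H" if "H \<in> ?F" for H
  proof -
    have "?d * 1 \<in> per H" unfolding per[OF that] by blast
    then show ?thesis by (auto simp: per_def)
  qed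
  have val: "{b. (b, ?d) \<in> H} = (+) b0 ` K" if H: "H \<in> ?F" and b0: "(b0, ?d) \<in> H" for H b0
  proof (intro equalityI subsetI)
    fix b assume "b \<in> {b. (b, ?d) \<in> H}"
    then have b: "(b, ?d) \<in> H" by simp
    then have "b \<in> B" using subgroup.subset[OF sub[OF H]] by auto
    then have "b - b0 \<in> K" using mem_iff_ker[OF sub[OF H] b0] b H by simp
    then show "b \<in> (+) b0 ` K" by (simp only: coset_mem)
  next
    fix b assume "b \<in> (+) b0 ` K"
    then have k: "b - b0 \<in> K" by (simp only: coset_mem)
    have "b0 \<in> B" using b0 subgroup.subset[OF sub[OF H]] by auto
    then have "b \<in> B" using addsub_add[OF addsub_B _ \<open>b0 \<in> B\<close>, of "b - b0"] k K(3) by auto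
    then show "b \<in> {b. (b, ?d) \<in> H}" using mem_iff_ker[OF sub[OF H] b0] k H by simp
  qed
  show ?thesis
    unfolding bij_betw_def
  proof
    show "inj_on (\<lambda>H. {b. (b, ?d) \<in> H}) ?F"
    proof (rule inj_onI)
      fix H H' assume H: "H \<in> ?F" and H': "H' \<in> ?F" and eq: "{b. (b, ?d) \<in> H} = {b. (b, ?d) \<in> H'}"
      obtain b where b: "(b, ?d) \<in> H" using rep[OF H] by blast
      then have b': "(b, ?d) \<in> H'" using eq by blast
      have "ker H = ker H'" using H H' by simp
      then show "H = H'"
        using subgroup_determined[OF sub[OF H] sub[OF H'] _ _ b b']
          subgroup_determined[OF sub[OF H'] sub[OF H] _ _ b' b] per[OF H] per[OF H'] by simp
    qed
    show "(\<lambda>H. {b. (b, ?d) \<in> H}) ` ?F = cosets B K"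
    proof (intro equalityI subsetI)
      fix C assume "C \<in> (\<lambda>H. {b. (b, ?d) \<in> H}) ` ?F"
      then obtain H where H: "H \<in> ?F" "C = {b. (b, ?d) \<in> H}" by blast
      obtain b0 where b0: "(b0, ?d) \<in> H" using rep[OF H(1)] by blast
      then have "b0 \<in> B" using subgroup.subset[OF sub[OF H(1)]] by auto
      then show "C \<in> cosets B K" unfolding H(2) val[OF H(1) b0] cosets_def by blast
    next
      fix C assume "C \<in> cosets B K"
      then obtain b0 where b0: "b0 \<in> B" "C = (+) b0 ` K" unfolding cosets_def by blast
      let ?g = "(b0, ?d)"
      have g: "?g \<in> carrier TG" using b0 by simp
      let ?H = "gensub K ?g"
      have sH: "subgroup ?H TG" by (rule subgroup_gensub[OF K(2,3) g]) (simp only: snd_conv st)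
      have sg: "snd ?g > 0" using d0 by (simp only: snd_conv)
      note pr = gensub_props[OF K(2,3) g sg, unfolded snd_conv]
      have "subgroup_index TG ?H = idx B K * nat ?d"
        using subgroup_index_TG[OF sH pr(2) d0] unfolding pr(1) .
      also have "\<dots> = p ^ (log_idx p B K + a)" unfolding idx_log_idx[OF p K(1)] by (simp only: nat_int power_add)
      finally have "?H \<in> TGP p" using sH unfolding p_power_index_subgroups_def by blast
      moreover have "expo p ?H = a" by (rule expo_eq[OF p pr(2)])
      ultimately have H: "?H \<in> ?F" using pr(1) by blast
      have "C = {b. (b, ?d) \<in> ?H}" unfolding val[OF H pr(3)] by (rule b0(2))
      then show "C \<in> (\<lambda>H. {b. (b, ?d) \<in> H}) ` ?F" using H by blast
    qed
  qed
qed

end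

section \<open>Normal forms in the presented group\<close>

context group
begin

text \<open>Conjugation respects powers. In the form of an exchange rule the case
  \<open>a' = a\<close> also treats commuting elements.\<close>

lemma conj_int_pow:
  assumes g: "g \<in> carrier G" and a: "a \<in> carrier G" and a': "a' \<in> carrier G"
    and eq: "g \<otimes> a = a' \<otimes> g"
  shows "g \<otimes> a [^] (e::int) = a' [^] e \<otimes> g"
proof -
  have nat: "g \<otimes> a [^] n = a' [^] n \<otimes> g" for n :: nat
  proof (induction n)
    case (Suc n)
    have "g \<otimes> a [^] Suc n = (g \<otimes> a [^] n) \<otimes> a" using g a by (simp add: m_assoc)
    also have "\<dots> = a' [^] n \<otimes> (g \<otimes> a)" using g a a' by (simp add: Suc m_assoc)
    also have "\<dots> = a' [^] Suc n \<otimes> g" using g a' by (simp add: eq m_assoc)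
    finally show ?case .
  qed (use g in simp)
  show ?thesis
  proof (cases e rule: int_cases2)
    case (nonneg n)
    then show ?thesis using nat[of n] by (simp add: int_pow_int)
  next
    case (nonpos n)
    define A where "A = a [^] n"
    define A' where "A' = a' [^] n"
    have A: "A \<in> carrier G" "A' \<in> carrier G" using a a' by (auto simp: A_def A'_def)
    have "inv A' \<otimes> (g \<otimes> A) \<otimes> inv A = inv A' \<otimes> (A' \<otimes> g) \<otimes> inv A"
      using nat[of n] by (simp add: A_def A'_def)
    also have "inv A' \<otimes> (g \<otimes> A) \<otimes> inv A = inv A' \<otimes> g" using g A by (simp add: m_assoc)
    also have "inv A' \<otimes> (A' \<otimes> g) = g" using g A by (simp add: m_assoc[symmetric])
    finally have "g \<otimes> inv A = inv A' \<otimes> g" by simp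
    then show ?thesis using a a' by (simp add: nonpos int_pow_neg_int A_def A'_def)
  qed
qed

primrec pw :: "(nat \<Rightarrow> 'a) \<Rightarrow> (nat \<Rightarrow> int) \<Rightarrow> nat \<Rightarrow> 'a" where
  "pw f u 0 = \<one>"
| "pw f u (Suc k) = pw f u k \<otimes> f k [^] u k"

lemma pw_closed: "(\<And>i. i < k \<Longrightarrow> f i \<in> carrier G) \<Longrightarrow> pw f u k \<in> carrier G"
  by (induction k) auto

lemma pw_commute:
  assumes "g \<in> carrier G" "\<And>i. i < k \<Longrightarrow> f i \<in> carrier G" "\<And>i. i < k \<Longrightarrow> g \<otimes> f i = f i \<otimes> g"
  shows "g \<otimes> pw f u k = pw f u k \<otimes> g"
  using assms(2,3)
proof (induction k)
  case (Suc k)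
  have P: "pw f u k \<in> carrier G" and f: "f k \<in> carrier G" using Suc.prems by (auto intro: pw_closed)
  have "g \<otimes> pw f u (Suc k) = (g \<otimes> pw f u k) \<otimes> f k [^] u k" using assms(1) P f by (simp add: m_assoc)
  also have "g \<otimes> pw f u k = pw f u k \<otimes> g" using Suc by simp
  also have "pw f u k \<otimes> g \<otimes> f k [^] u k = pw f u k \<otimes> (g \<otimes> f k [^] u k)"
    using assms(1) P f by (simp add: m_assoc)
  also have "g \<otimes> f k [^] u k = f k [^] u k \<otimes> g"
    using Suc.prems(2)[of k] by (intro conj_int_pow[OF assms(1) f f]) simp
  finally show ?case using assms(1) P f by (simp add: m_assoc)
qed (use assms(1) in simp)

lemma pw_mult:
  assumes "\<And>i. i < k \<Longrightarrow> f i \<in> carrier G"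
    and "\<And>i j. i < k \<Longrightarrow> j < k \<Longrightarrow> f i \<otimes> f j = f j \<otimes> f i"
  shows "pw f u k \<otimes> pw f v k = pw f (\<lambda>i. u i + v i) k"
  using assms
proof (induction k)
  case (Suc k)
  have P: "pw f u k \<in> carrier G" "pw f v k \<in> carrier G" and f: "f k \<in> carrier G"
    using Suc.prems(1) by (auto intro: pw_closed)
  have fu: "f k [^] u k \<in> carrier G" "f k [^] v k \<in> carrier G" using f by auto
  have com: "f k [^] u k \<otimes> pw f v k = pw f v k \<otimes> f k [^] u k"
  proof (rule pw_commute[OF fu(1)])
    fix i assume i: "i < k"
    then show fi: "f i \<in> carrier G" using Suc.prems(1) by simp
    show "f k [^] u k \<otimes> f i = f i \<otimes> f k [^] u k"
      using conj_int_pow[OF fi f f, of "u k"] Suc.prems(2)[of i k] i by simp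
  qed
  have "pw f u (Suc k) \<otimes> pw f v (Suc k) = pw f u k \<otimes> (f k [^] u k \<otimes> pw f v k) \<otimes> f k [^] v k"
    using P fu by (simp add: m_assoc)
  also have "\<dots> = (pw f u k \<otimes> pw f v k) \<otimes> (f k [^] u k \<otimes> f k [^] v k)"
    unfolding com using P fu by (simp add: m_assoc)
  also have "pw f u k \<otimes> pw f v k = pw f (\<lambda>i. u i + v i) k"
    by (rule Suc.IH) (use Suc.prems in auto)
  also have "f k [^] u k \<otimes> f k [^] v k = f k [^] (u k + v k)" by (rule int_pow_mult[OF f, symmetric])
  finally show ?case by simp
qed simp

lemma pw_single:
  assumes "\<And>i. i < k \<Longrightarrow> f i \<in> carrier G"
  shows "pw f (\<lambda>j. if j = i then e else 0) k = (if i < k then f i [^] e else \<one>)"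
  using assms
proof (induction k)
  case (Suc k)
  have "f k \<in> carrier G" using Suc.prems by simp
  moreover have "pw f (\<lambda>j. if j = i then e else 0) k = (if i < k then f i [^] e else \<one>)"
    by (rule Suc.IH) (use Suc.prems in auto)
  ultimately show ?case using Suc.prems[of i] by (auto simp: less_Suc_eq)
qed simp

end

text \<open>The relations of \<open>G_n\<close> in an arbitrary group, with indices starting at 0
  and \<open>z\<close> in the role of \<open>x_n\<close>. The last one is
  \<open>[x_i, x_n] = y_i\<close> solved for \<open>x_i x_n\<close>.\<close>

locale heis = group G for G (structure) +
  fixes x y :: "nat \<Rightarrow> 'a" and z :: 'a and m :: nat
  assumes x: "i < m \<Longrightarrow> x i \<in> carrier G" and y: "i < m \<Longrightarrow> y i \<in> carrier G" and z: "z \<in> carrier G"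
    and xx: "i < m \<Longrightarrow> j < m \<Longrightarrow> x i \<otimes> x j = x j \<otimes> x i"
    and yy: "i < m \<Longrightarrow> j < m \<Longrightarrow> y i \<otimes> y j = y j \<otimes> y i"
    and yx: "i < m \<Longrightarrow> j < m \<Longrightarrow> y i \<otimes> x j = x j \<otimes> y i"
    and yz: "i < m \<Longrightarrow> y i \<otimes> z = z \<otimes> y i"
    and xz: "i < m \<Longrightarrow> x i \<otimes> z = z \<otimes> x i \<otimes> y i"
begin

definition nf :: "(nat \<Rightarrow> int) \<Rightarrow> (nat \<Rightarrow> int) \<Rightarrow> int \<Rightarrow> 'a"
  where "nf u w c = pw x u m \<otimes> pw y w m \<otimes> z [^] c"

lemma pw_x_closed: "pw x u m \<in> carrier G" by (rule pw_closed) (rule x)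
lemma pw_y_closed: "pw y u m \<in> carrier G" by (rule pw_closed) (rule y)
lemma pow_z_closed: "z [^] (c::int) \<in> carrier G" using z by simp

lemma nf_0: "nf (\<lambda>_. 0) (\<lambda>_. 0) 0 = \<one>"
proof -
  have "pw f (\<lambda>_. 0) k = \<one>" for f k by (induction k) auto
  then show ?thesis by (simp add: nf_def)
qed

lemma nf_x:
  assumes i: "i < m"
  shows "x i [^] e \<otimes> nf u w c = nf (\<lambda>j. (if j = i then e else 0) + u j) w c"
proof -
  have xi: "x i [^] e = pw x (\<lambda>j. if j = i then e else 0) m"
    using pw_single[of m x i e] x i by simp
  have "x i [^] e \<otimes> nf u w c = (x i [^] e \<otimes> pw x u m) \<otimes> pw y w m \<otimes> z [^] c"
    unfolding nf_def using pw_x_closed pw_y_closed pow_z_closed x[OF i] by (simp add: m_assoc)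
  also have "x i [^] e \<otimes> pw x u m = pw x (\<lambda>j. (if j = i then e else 0) + u j) m"
    unfolding xi by (rule pw_mult) (auto intro: x xx)
  finally show ?thesis by (simp add: nf_def)
qed

lemma nf_y:
  assumes i: "i < m"
  shows "y i [^] e \<otimes> nf u w c = nf u (\<lambda>j. (if j = i then e else 0) + w j) c"
proof -
  have yi: "y i [^] e = pw y (\<lambda>j. if j = i then e else 0) m"
    using pw_single[of m y i e] y i by simp
  have yc: "y i [^] e \<in> carrier G" using y[OF i] by simp
  have com: "y i [^] e \<otimes> pw x u m = pw x u m \<otimes> y i [^] e"
  proof (rule pw_commute[OF yc x])
    fix j assume j: "j < m"
    show "y i [^] e \<otimes> x j = x j \<otimes> y i [^] e"
      using conj_int_pow[OF x[OF j] y[OF i] y[OF i], of e] yx[OF i j] by simp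
  qed
  have "y i [^] e \<otimes> nf u w c = (y i [^] e \<otimes> pw x u m) \<otimes> pw y w m \<otimes> z [^] c"
    unfolding nf_def using pw_x_closed pw_y_closed pow_z_closed yc by (simp add: m_assoc)
  also have "\<dots> = pw x u m \<otimes> (y i [^] e \<otimes> pw y w m) \<otimes> z [^] c"
    unfolding com using pw_x_closed pw_y_closed pow_z_closed yc by (simp add: m_assoc)
  also have "y i [^] e \<otimes> pw y w m = pw y (\<lambda>j. (if j = i then e else 0) + w j) m"
    unfolding yi by (rule pw_mult) (auto intro: y yy)
  finally show ?thesis by (simp add: nf_def)
qed

lemma yi_pow_commute_x:
  assumes "i < m" "j < m"
  shows "x j [^] (e::int) \<otimes> y i [^] (d::int) = y i [^] d \<otimes> x j [^] e"
proof -
  have c: "y i [^] d \<in> carrier G" using y assms by simp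
  have "x j \<otimes> y i [^] d = y i [^] d \<otimes> x j"
    using conj_int_pow[OF x[OF assms(2)] y[OF assms(1)] y[OF assms(1)], of d] yx[OF assms] by simp
  then show ?thesis using conj_int_pow[OF c x[OF assms(2)] x[OF assms(2)], of e] by simp
qed

text \<open>Moving \<open>g\<close> past a power of \<open>x i\<close> leaves a power of
  \<open>y i\<close> behind, and this commutes with the remaining \<open>x j\<close>. The parameter
  \<open>\<epsilon>\<close> treats \<open>z\<close> (value 1) and its inverse (value -1)
  together.\<close>

lemma conj_pw_x:
  assumes g: "g \<in> carrier G"
    and gx: "\<And>i. i < m \<Longrightarrow> g \<otimes> x i = x i \<otimes> y i [^] (- \<epsilon>) \<otimes> g"
  shows "k \<le> m \<Longrightarrow> g \<otimes> pw x u k = pw x u k \<otimes> pw y (\<lambda>i. - \<epsilon> * u i) k \<otimes> g"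
proof (induction k)
  case 0
  then show ?case using g by simp
next
  case (Suc k)
  then have k: "k < m" by simp
  define P where "P = pw x u k"
  define Q where "Q = pw y (\<lambda>i. - \<epsilon> * u i) k"
  define a where "a = x k [^] u k"
  define b where "b = y k [^] (- \<epsilon> * u k)"
  have P: "P \<in> carrier G" unfolding P_def using k by (intro pw_closed x) simp
  have Q: "Q \<in> carrier G" unfolding Q_def using k by (intro pw_closed y) simp
  have a: "a \<in> carrier G" and b: "b \<in> carrier G" unfolding a_def b_def using x[OF k] y[OF k] by auto
  have IH: "g \<otimes> P = P \<otimes> Q \<otimes> g" using Suc by (simp add: P_def Q_def)
  have yk: "y k [^] (- \<epsilon>) \<in> carrier G" using y[OF k] by simp
  have "g \<otimes> a = (x k \<otimes> y k [^] (- \<epsilon>)) [^] u k \<otimes> g"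
    unfolding a_def using x[OF k] yk by (intro conj_int_pow[OF g] gx[OF k]) auto
  also have "(x k \<otimes> y k [^] (- \<epsilon>)) [^] u k = x k [^] u k \<otimes> (y k [^] (- \<epsilon>)) [^] u k"
    using yi_pow_commute_x[OF k k, of 1 "- \<epsilon>"] x[OF k]
    by (intro int_pow_mult_distrib[OF _ x[OF k] yk]) simp
  also have "(y k [^] (- \<epsilon>)) [^] u k = b" unfolding b_def by (rule int_pow_pow[OF y[OF k]])
  finally have ga: "g \<otimes> a = a \<otimes> b \<otimes> g" unfolding a_def .
  have aQ: "a \<otimes> Q = Q \<otimes> a"
    unfolding Q_def
  proof (rule pw_commute[OF a])
    fix i assume "i < k"
    then have i: "i < m" using k by simp
    then show "y i \<in> carrier G" by (rule y)
    show "a \<otimes> y i = y i \<otimes> a"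
      unfolding a_def using yi_pow_commute_x[OF i k, of "u k" 1] y[OF i] by simp
  qed
  have "g \<otimes> (P \<otimes> a) = (g \<otimes> P) \<otimes> a" using g P a by (simp add: m_assoc)
  also have "\<dots> = P \<otimes> Q \<otimes> (g \<otimes> a)" unfolding IH using g P Q a by (simp add: m_assoc)
  also have "\<dots> = P \<otimes> (Q \<otimes> a) \<otimes> b \<otimes> g" unfolding ga using g P Q a b by (simp add: m_assoc)
  also have "\<dots> = (P \<otimes> a) \<otimes> (Q \<otimes> b) \<otimes> g" unfolding aQ[symmetric] using g P Q a b by (simp add: m_assoc)
  finally show ?case by (simp add: P_def Q_def a_def b_def)
qed

text \<open>On exponents this is multiplication in the semidirect product: \<open>u\<close> is kept,
  \<open>w\<close> becomes \<open>w - \<epsilon> u\<close> and \<open>c\<close> becomes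
  \<open>\<epsilon> + c\<close>.\<close>

lemma nf_conj:
  assumes g: "g \<in> carrier G" and gy: "\<And>i. i < m \<Longrightarrow> g \<otimes> y i = y i \<otimes> g"
    and gx: "\<And>i. i < m \<Longrightarrow> g \<otimes> x i = x i \<otimes> y i [^] (- \<epsilon>) \<otimes> g"
    and gz: "\<And>c :: int. g \<otimes> z [^] c = z [^] (\<epsilon> + c)"
  shows "g \<otimes> nf u w c = nf u (\<lambda>j. - \<epsilon> * u j + w j) (\<epsilon> + c)"
proof -
  let ?Q = "pw y (\<lambda>i. - \<epsilon> * u i) m"
  have gw: "g \<otimes> pw y w m = pw y w m \<otimes> g" by (rule pw_commute[OF g y gy])
  have gu: "g \<otimes> pw x u m = pw x u m \<otimes> ?Q \<otimes> g" by (rule conj_pw_x[OF g gx order_refl])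
  have "g \<otimes> nf u w c = (g \<otimes> pw x u m) \<otimes> pw y w m \<otimes> z [^] c"
    unfolding nf_def using g pw_x_closed pw_y_closed pow_z_closed by (simp add: m_assoc)
  also have "\<dots> = pw x u m \<otimes> ?Q \<otimes> (g \<otimes> pw y w m) \<otimes> z [^] c"
    unfolding gu using g pw_x_closed pw_y_closed pow_z_closed by (simp add: m_assoc)
  also have "\<dots> = pw x u m \<otimes> (?Q \<otimes> pw y w m) \<otimes> (g \<otimes> z [^] c)"
    unfolding gw using g pw_x_closed pw_y_closed pow_z_closed by (simp add: m_assoc)
  also have "?Q \<otimes> pw y w m = pw y (\<lambda>j. - \<epsilon> * u j + w j) m"
    by (rule pw_mult) (auto intro: y yy)
  finally show ?thesis unfolding gz nf_def .
qed

lemma nf_z: "z \<otimes> nf u w c = nf u (\<lambda>j. - u j + w j) (1 + c)"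
proof -
  have "z \<otimes> nf u w c = nf u (\<lambda>j. - 1 * u j + w j) (1 + c)"
  proof (rule nf_conj[OF z])
    fix i assume i: "i < m"
    show "z \<otimes> y i = y i \<otimes> z" by (rule yz[OF i, symmetric])
    \<comment> \<open>The relation \<open>x z = z x y\<close> is turned into the exchange rule
      \<open>z x = x y^(-1) z\<close>.\<close>
    have "x i \<otimes> inv (y i) \<otimes> z = inv (y i) \<otimes> (x i \<otimes> z)"
      using yi_pow_commute_x[OF i i, of 1 "-1"] x[OF i] y[OF i] z
      by (simp add: int_pow_neg m_assoc)
    also have "x i \<otimes> z = y i \<otimes> (z \<otimes> x i)"
    proof -
      have "x i \<otimes> z = z \<otimes> (y i \<otimes> x i)"
        unfolding xz[OF i] yx[OF i i] by (rule m_assoc[OF z x[OF i] y[OF i]])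
      also have "\<dots> = (y i \<otimes> z) \<otimes> x i"
        unfolding yz[OF i] by (rule m_assoc[OF z y[OF i] x[OF i], symmetric])
      also have "\<dots> = y i \<otimes> (z \<otimes> x i)" by (rule m_assoc[OF y[OF i] z x[OF i]])
      finally show ?thesis .
    qed
    also have "inv (y i) \<otimes> (y i \<otimes> (z \<otimes> x i)) = z \<otimes> x i"
      using x[OF i] y[OF i] z by (simp add: m_assoc[symmetric])
    finally show "z \<otimes> x i = x i \<otimes> y i [^] (- 1 :: int) \<otimes> z" using y[OF i] by (simp add: int_pow_neg)
  next
    fix c :: int show "z \<otimes> z [^] c = z [^] (1 + c)" using int_pow_mult[OF z, of 1 c] z by simp
  qed
  then show ?thesis by simp
qed

lemma nf_inv_z: "inv z \<otimes> nf u w c = nf u (\<lambda>j. u j + w j) (- 1 + c)"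
proof -
  have "inv z \<otimes> nf u w c = nf u (\<lambda>j. - (- 1) * u j + w j) (- 1 + c)"
  proof (rule nf_conj)
    show iz: "inv z \<in> carrier G" using z by simp
    fix i assume i: "i < m"
    have "y i \<otimes> z = z \<otimes> y i" by (rule yz[OF i])
    then show "inv z \<otimes> y i = y i \<otimes> inv z"
      using conj_int_pow[OF y[OF i] z z, of "-1"] z by (simp add: int_pow_neg)
    have "inv z \<otimes> (x i \<otimes> z) \<otimes> inv z = inv z \<otimes> (z \<otimes> x i \<otimes> y i) \<otimes> inv z" unfolding xz[OF i] ..
    also have "inv z \<otimes> (x i \<otimes> z) \<otimes> inv z = inv z \<otimes> x i" using x[OF i] z by (simp add: m_assoc)
    also have "inv z \<otimes> (z \<otimes> x i \<otimes> y i) = x i \<otimes> y i" using x[OF i] y[OF i] z by (simp add: m_assoc[symmetric])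
    finally show "inv z \<otimes> x i = x i \<otimes> y i [^] (- (- 1) :: int) \<otimes> inv z" using y[OF i] by simp
  next
    fix c :: int show "inv z \<otimes> z [^] c = z [^] (- 1 + c)" using int_pow_mult[OF z, of "-1" c] z by (simp add: int_pow_neg)
  qed
  then show ?thesis by simp
qed

end

section \<open>The semidirect product for \<open>\<int>^m \<times> \<int>^m\<close> and its
  isomorphism with \<open>G_n\<close>\<close>

definition Zpow2 :: "nat \<Rightarrow> (ivec \<times> ivec) set" where "Zpow2 m = Zpow m \<times> Zpow m"

text \<open>The nilpotent part of the action in the overview. The sign comes from the commutator
  convention, under which \<open>z x = x y^(-1) z\<close>.\<close>

definition twist_map :: "int \<Rightarrow> ivec \<times> ivec \<Rightarrow> ivec \<times> ivec" where "twist_map c b = (0, - scale c (fst b))"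

lemma addsub_Times: "addsub A \<Longrightarrow> addsub C \<Longrightarrow> addsub (A \<times> C)"
  by (auto simp: addsub_def zero_prod_def)

lemma twist_Zpow2: "twist (Zpow2 m) twist_map"
proof
  show "addsub (Zpow2 m)" unfolding Zpow2_def by (rule addsub_Times[OF addsub_Zpow addsub_Zpow])
  show "twist_map c b \<in> Zpow2 m" if "b \<in> Zpow2 m" for b c
    using that addsub_uminus[OF addsub_Zpow scale_closed[OF addsub_Zpow]] addsub_zero[OF addsub_Zpow]
    by (auto simp: twist_map_def Zpow2_def)
  show "twist_map c (b + b') = twist_map c b + twist_map c b'" for b b' c
    unfolding twist_map_def fst_add scale_add_right by (simp only: add_Pair add_0_left minus_add_distrib)
  show "twist_map (c + c') b = twist_map c b + twist_map c' b" for b c c'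
    unfolding twist_map_def scale_add by (simp only: add_Pair add_0_left minus_add_distrib)
  show "twist_map c (twist_map c' b) = 0" for b c c'
    unfolding twist_map_def fst_conv scale_zero by (simp add: zero_prod_def)
qed

definition std_vec :: "nat \<Rightarrow> ivec" where "std_vec i = (\<lambda>j. if j = i then 1 else 0)"

lemma Zpow2_iff: "(u, w) \<in> Zpow2 m \<longleftrightarrow> u \<in> Zpow m \<and> w \<in> Zpow m"
  by (simp add: Zpow2_def)

lemma std_vec_Zpow: "i < m \<Longrightarrow> std_vec i \<in> Zpow m" by (auto simp: std_vec_def Zpow_def)

lemma Zpow_expand: 
  assumes "u \<in> Zpow m" shows "u = (\<Sum>i<m. scale (u i) (std_vec i))"
proof
  fix j
  have "(\<Sum>i<m. scale (u i) (std_vec i)) j = (\<Sum>i<m. scale (u i) (std_vec i) j)"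
    by (induction m) simp_all
  also have "\<dots> = (\<Sum>i<m. if i = j then u i else 0)"
    by (intro sum.cong refl) (auto simp: scale_apply std_vec_def)
  also have "\<dots> = u j" using assms by (auto simp: Zpow_def)
  finally show "u j = (\<Sum>i<m. scale (u i) (std_vec i)) j" ..
qed

lemma Zpow_subset_if_std_vec:
  assumes "addsub A" "\<And>i. i < m \<Longrightarrow> std_vec i \<in> A" shows "Zpow m \<subseteq> A"
proof
  fix u assume "u \<in> Zpow m"
  then have "u = (\<Sum>i<m. scale (u i) (std_vec i))" by (rule Zpow_expand)
  also have "\<dots> \<in> A" using assms by (intro addsub_sum scale_closed) auto
  finally show "u \<in> A" .
qed

context group
begin

lemma mult_inv_cancel: "a \<in> carrier G \<Longrightarrow> w \<in> carrier G \<Longrightarrow> a \<otimes> (inv a \<otimes> w) = w"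
  by (simp add: m_assoc[symmetric])

lemma inv_mult_cancel: "a \<in> carrier G \<Longrightarrow> w \<in> carrier G \<Longrightarrow> inv a \<otimes> (a \<otimes> w) = w"
  by (simp add: m_assoc[symmetric])

lemma commutator_eqD:
  assumes "a \<in> carrier G" "b \<in> carrier G" "inv a \<otimes> (inv b \<otimes> (a \<otimes> b)) = y"
  shows "a \<otimes> b = b \<otimes> (a \<otimes> y)"
  using assms by (auto simp: mult_inv_cancel)

lemma commutator_eqI:
  assumes "a \<in> carrier G" "b \<in> carrier G" "y \<in> carrier G" "a \<otimes> b = b \<otimes> (a \<otimes> y)"
  shows "inv a \<otimes> (inv b \<otimes> (a \<otimes> b)) = y"
  using assms by (simp add: inv_mult_cancel)

end

locale Gn = twist "Zpow2 m" twist_map for m :: nat +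
  assumes m: "m \<ge> 1"
begin

abbreviation n :: nat where "n \<equiv> Suc m"

lemma n: "n \<ge> 2" using m by simp

lemma relators_words: "G_relators n \<subseteq> words (G_gens n)"
  using n by (auto simp: G_relators_def commutator_word_def G_gens_def)

text \<open>The images of the generators: \<open>x_n\<close> becomes the generator of the acting
  integers, and the indices \<open>1..m\<close> of the presentation are shifted to the coordinates
  from 0 to \<open>m - 1\<close>.\<close>

definition gen_val :: "gen \<Rightarrow> (ivec \<times> ivec) \<times> int" where
  "gen_val g = (case g of Gx i \<Rightarrow> (if i = n then ((0, 0), 1) else ((std_vec (i - 1), 0), 0))
    | Gy i \<Rightarrow> ((0, std_vec (i - 1)), 0))"

lemma gen_val_carrier: "g \<in> G_gens n \<Longrightarrow> gen_val g \<in> carrier TG"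
  using n addsub_zero[OF addsub_Zpow, of m] std_vec_Zpow[of _ m]
  by (auto simp: G_gens_def gen_val_def Zpow2_iff)

definition letter_val :: "gen \<times> bool \<Rightarrow> (ivec \<times> ivec) \<times> int" where
  "letter_val l = (if snd l then gen_val (fst l) else inv\<^bsub>TG\<^esub> gen_val (fst l))"

definition word_val :: "gen gword \<Rightarrow> (ivec \<times> ivec) \<times> int" where
  "word_val w = foldr (\<lambda>l a. letter_val l \<otimes>\<^bsub>TG\<^esub> a) w \<one>\<^bsub>TG\<^esub>"

lemma word_val_Nil: "word_val [] = \<one>\<^bsub>TG\<^esub>" and word_val_Cons: "word_val (l # w) = letter_val l \<otimes>\<^bsub>TG\<^esub> word_val w"
  by (simp_all only: word_val_def foldr.simps id_apply o_apply)

lemma letter_val_carrier: "fst l \<in> G_gens n \<Longrightarrow> letter_val l \<in> carrier TG"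
  unfolding letter_val_def using gen_val_carrier TG.inv_closed by presburger

lemma word_val_carrier: "w \<in> words (G_gens n) \<Longrightarrow> word_val w \<in> carrier TG"
proof (induction w)
  case Nil
  show ?case unfolding word_val_Nil by (rule TG.one_closed)
next
  case (Cons l w)
  then show ?case unfolding word_val_Cons by (intro TG.m_closed letter_val_carrier) auto
qed

lemma word_val_append:
  assumes "u \<in> words (G_gens n)" "v \<in> words (G_gens n)"
  shows "word_val (u @ v) = word_val u \<otimes>\<^bsub>TG\<^esub> word_val v"
  using assms(1)
proof (induction u)
  case Nil
  show ?case unfolding append_Nil word_val_Nil by (rule TG.l_one[OF word_val_carrier[OF assms(2)], symmetric])
next
  case (Cons l u)
  then have "letter_val l \<in> carrier TG" "word_val u \<in> carrier TG" "word_val (u @ v) = word_val u \<otimes>\<^bsub>TG\<^esub> word_val v"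
    using letter_val_carrier word_val_carrier by auto
  then show ?case unfolding append_Cons word_val_Cons
    using TG.m_assoc[OF _ _ word_val_carrier[OF assms(2)]] by (simp only:)
qed

lemma word_val_single: "fst l \<in> G_gens n \<Longrightarrow> word_val [l] = letter_val l"
  unfolding word_val_Cons word_val_Nil by (rule TG.r_one[OF letter_val_carrier])

lemma word_val_commutator:
  assumes "a \<in> G_gens n" "b \<in> G_gens n"
  shows "word_val (commutator_word a b)
    = inv\<^bsub>TG\<^esub> gen_val a \<otimes>\<^bsub>TG\<^esub> (inv\<^bsub>TG\<^esub> gen_val b \<otimes>\<^bsub>TG\<^esub> (gen_val a \<otimes>\<^bsub>TG\<^esub> gen_val b))"
proof -
  have "gen_val b \<otimes>\<^bsub>TG\<^esub> \<one>\<^bsub>TG\<^esub> = gen_val b" by (rule TG.r_one[OF gen_val_carrier[OF assms(2)]])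
  then show ?thesis unfolding commutator_word_def word_val_Cons word_val_Nil letter_val_def fst_conv snd_conv by (simp only: if_True if_False)
qed

lemma gen_val_commute:
  assumes "a \<in> G_gens n" "b \<in> G_gens n" "\<forall>i\<in>{1..n-1}. {a, b} \<noteq> {Gx i, Gx n}"
  shows "gen_val a \<otimes>\<^bsub>TG\<^esub> gen_val b = gen_val b \<otimes>\<^bsub>TG\<^esub> gen_val a"
proof -
  have le: "i \<in> {1..n-1}" if "Gx i \<in> G_gens n" "i \<noteq> n" for i
    using that by (auto simp: G_gens_def)
  have z: "scale c 0 = 0" for c by (rule scale_zero)
  show ?thesis
  proof (cases a)
    case (Gx i)
    note a = this
    show ?thesis
    proof (cases b)
      case (Gx j)
      have "\<not> (i \<noteq> n \<and> j = n)" using assms(1,3) le[of i] a Gx by blast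
      moreover have "\<not> (i = n \<and> j \<noteq> n)"
      proof
        assume ij: "i = n \<and> j \<noteq> n"
        then have "{a, b} = {Gx j, Gx n}" unfolding a Gx by blast
        moreover have "j \<in> {1..n-1}" using le[of j] assms(2) Gx ij by blast
        ultimately show False using assms(3) by blast
      qed
      ultimately show ?thesis by (auto simp: a Gx gen_val_def twist_map_def zero_prod_def add.commute)
    next
      case (Gy j)
      then show ?thesis by (auto simp: a gen_val_def twist_map_def zero_prod_def add.commute)
    qed
  next
    case (Gy i)
    note a = this
    show ?thesis by (cases b) (auto simp: a gen_val_def twist_map_def zero_prod_def add.commute)
  qed
qed

lemma gen_val_xz:
  assumes "i \<in> {1..n-1}"
  shows "gen_val (Gx i) \<otimes>\<^bsub>TG\<^esub> gen_val (Gx n) = gen_val (Gx n) \<otimes>\<^bsub>TG\<^esub> (gen_val (Gx i) \<otimes>\<^bsub>TG\<^esub> gen_val (Gy i))"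
  using assms by (auto simp: gen_val_def twist_map_def zero_prod_def)

lemma gens: "i \<in> {1..n} \<Longrightarrow> Gx i \<in> G_gens n" "i \<in> {1..n-1} \<Longrightarrow> Gy i \<in> G_gens n"
  by (auto simp: G_gens_def)

lemma commutator_words: "a \<in> G_gens n \<Longrightarrow> b \<in> G_gens n \<Longrightarrow> commutator_word a b \<in> words (G_gens n)"
  by (simp add: commutator_word_def)

lemma word_val_relator:
  assumes "r \<in> G_relators n" shows "word_val r = \<one>\<^bsub>TG\<^esub>"
proof -
  consider i where "i \<in> {1..n-1}" "r = commutator_word (Gx i) (Gx n) @ [(Gy i, False)]"
    | a b where "a \<in> G_gens n" "b \<in> G_gens n" "\<forall>i\<in>{1..n-1}. {a, b} \<noteq> {Gx i, Gx n}" "r = commutator_word a b"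
    using assms unfolding G_relators_def by blast
  then show ?thesis
  proof cases
    case 1
    have g: "Gx i \<in> G_gens n" "Gx n \<in> G_gens n" "Gy i \<in> G_gens n"
      using 1(1) n gens[of i] gens(1)[of n] by auto
    have "word_val (commutator_word (Gx i) (Gx n)) = gen_val (Gy i)"
      unfolding word_val_commutator[OF g(1,2)]
      by (rule TG.commutator_eqI[OF gen_val_carrier[OF g(1)] gen_val_carrier[OF g(2)] gen_val_carrier[OF g(3)] gen_val_xz[OF 1(1)]])
    moreover have "word_val [(Gy i, False)] = inv\<^bsub>TG\<^esub> gen_val (Gy i)"
      using word_val_single[of "(Gy i, False)"] g(3) by (simp only: fst_conv letter_val_def snd_conv if_False)
    moreover have "word_val r = word_val (commutator_word (Gx i) (Gx n)) \<otimes>\<^bsub>TG\<^esub> word_val [(Gy i, False)]"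
      unfolding 1(2) using g by (intro word_val_append commutator_words) auto
    ultimately show ?thesis using TG.r_inv[OF gen_val_carrier[OF g(3)]] by (simp only:)
  next
    case 2
    have "gen_val a \<otimes>\<^bsub>TG\<^esub> gen_val b = gen_val b \<otimes>\<^bsub>TG\<^esub> (gen_val a \<otimes>\<^bsub>TG\<^esub> \<one>\<^bsub>TG\<^esub>)"
      unfolding TG.r_one[OF gen_val_carrier[OF 2(1)]] by (rule gen_val_commute[OF 2(1,2,3)])
    then show ?thesis unfolding 2(4) word_val_commutator[OF 2(1,2)]
      by (rule TG.commutator_eqI[OF gen_val_carrier[OF 2(1)] gen_val_carrier[OF 2(2)] TG.one_closed])
  qed
qed

text \<open>Soundness of the presentation: cancelling pairs and relators have trivial value, so
  evaluation descends to \<open>G n\<close>.\<close>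

lemma word_val_pres:
  assumes "pres_eq (G_gens n) (G_relators n) u v" shows "word_val u = word_val v"
  using assms
proof induction
  case (pres_cancel u v x b)
  have l: "letter_val (x, b) \<otimes>\<^bsub>TG\<^esub> letter_val (x, \<not> b) = \<one>\<^bsub>TG\<^esub>"
    using TG.r_inv[OF gen_val_carrier[OF pres_cancel(3)]] TG.l_inv[OF gen_val_carrier[OF pres_cancel(3)]]
    by (cases b) (simp_all only: letter_val_def fst_conv snd_conv if_True if_False not_True_eq_False not_False_eq_True)
  have c: "letter_val (x, b) \<in> carrier TG" for b by (rule letter_val_carrier) (simp only: fst_conv pres_cancel(3))
  have "word_val ([(x, b), (x, \<not> b)] @ v) = (letter_val (x, b) \<otimes>\<^bsub>TG\<^esub> letter_val (x, \<not> b)) \<otimes>\<^bsub>TG\<^esub> word_val v"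
    unfolding append_Cons append_Nil word_val_Cons
    by (rule TG.m_assoc[OF c c word_val_carrier[OF pres_cancel(2)], symmetric])
  also have "\<dots> = word_val v" unfolding l by (rule TG.l_one[OF word_val_carrier[OF pres_cancel(2)]])
  finally show ?case
    using pres_cancel word_val_append[of u v] word_val_append[of u "[(x, b), (x, \<not> b)] @ v"] by simp
next
  case (pres_relator u v r)
  have r: "r \<in> words (G_gens n)" using pres_relator relators_words by blast
  have "word_val (r @ v) = word_val v"
    unfolding word_val_append[OF r pres_relator(2)] word_val_relator[OF pres_relator(3)]
    by (rule TG.l_one[OF word_val_carrier[OF pres_relator(2)]])
  then show ?case using pres_relator r word_val_append[of u v] word_val_append[of u "r @ v"] by simp
qed auto

section \<open>Classes of words and their normal forms\<close>

definition word_class :: "gen gword \<Rightarrow> gen gword set"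
  where "word_class w = pres_rel (G_gens n) (G_relators n) `` {w}"

lemma carrier_G: "carrier (G n) = word_class ` words (G_gens n)"
  by (auto simp: G_def presented_group_def quotient_def word_class_def)

lemma word_class_mult: "u \<in> words (G_gens n) \<Longrightarrow> v \<in> words (G_gens n) \<Longrightarrow> word_class u \<otimes>\<^bsub>G n\<^esub> word_class v = word_class (u @ v)"
  unfolding word_class_def G_def by (rule presented_group_mult[OF relators_words])

lemma word_class_eqI: "pres_eq (G_gens n) (G_relators n) u v \<Longrightarrow> word_class u = word_class v"
  unfolding word_class_def by (rule equiv_class_eq[OF equiv_pres_rel[OF relators_words]]) (simp add: pres_rel_def)

lemma one_G: "\<one>\<^bsub>G n\<^esub> = word_class []"
  by (simp add: G_def presented_group_def word_class_def)

sublocale Gr: group "G n" by (rule group_G) (use n in simp)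

lemma word_class_closed: "w \<in> words (G_gens n) \<Longrightarrow> word_class w \<in> carrier (G n)"
  by (simp add: carrier_G)

lemma word_class_relator: "r \<in> G_relators n \<Longrightarrow> word_class r = \<one>\<^bsub>G n\<^esub>"
  unfolding one_G using pres_relator[of "[]" "G_gens n" "[]" r "G_relators n"] by (intro word_class_eqI) simp

lemma word_class_inv: "g \<in> G_gens n \<Longrightarrow> word_class [(g, False)] = inv\<^bsub>G n\<^esub> word_class [(g, True)]"
proof (rule Gr.inv_equality[symmetric])
  assume g: "g \<in> G_gens n"
  show "word_class [(g, False)] \<otimes>\<^bsub>G n\<^esub> word_class [(g, True)] = \<one>\<^bsub>G n\<^esub>"
    unfolding one_G
  proof -
    have w: "[(g, False)] \<in> words (G_gens n)" "[(g, True)] \<in> words (G_gens n)" using g by simp_all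
    have "pres_eq (G_gens n) (G_relators n) [(g, False), (g, True)] []"
      using pres_cancel[of "[]" "G_gens n" "[]" g "G_relators n" False] g by simp
    from word_class_eqI[OF this] show "word_class [(g, False)] \<otimes>\<^bsub>G n\<^esub> word_class [(g, True)] = word_class []"
      using word_class_mult[OF w] by simp
  qed
  show "word_class [(g, True)] \<in> carrier (G n)" "word_class [(g, False)] \<in> carrier (G n)"
    using g by (auto intro!: word_class_closed)
qed

lemma word_class_commutator:
  assumes "a \<in> G_gens n" "b \<in> G_gens n"
  shows "word_class (commutator_word a b) = inv\<^bsub>G n\<^esub> word_class [(a, True)] \<otimes>\<^bsub>G n\<^esub>
    (inv\<^bsub>G n\<^esub> word_class [(b, True)] \<otimes>\<^bsub>G n\<^esub> (word_class [(a, True)] \<otimes>\<^bsub>G n\<^esub> word_class [(b, True)]))"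
  unfolding commutator_word_def word_class_inv[OF assms(1), symmetric] word_class_inv[OF assms(2), symmetric]
  using assms by (simp add: word_class_mult)

lemma word_class_commute:
  assumes "a \<in> G_gens n" "b \<in> G_gens n" "\<forall>i\<in>{1..n-1}. {a, b} \<noteq> {Gx i, Gx n}"
  shows "word_class [(a, True)] \<otimes>\<^bsub>G n\<^esub> word_class [(b, True)] = word_class [(b, True)] \<otimes>\<^bsub>G n\<^esub> word_class [(a, True)]"
proof -
  have c: "word_class [(a, True)] \<in> carrier (G n)" "word_class [(b, True)] \<in> carrier (G n)"
    using assms by (auto intro!: word_class_closed)
  have "commutator_word a b \<in> G_relators n" using assms unfolding G_relators_def by blast
  from Gr.commutator_eqD[OF c word_class_relator[OF this, unfolded word_class_commutator[OF assms(1,2)]]]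
  show ?thesis using c by simp
qed

definition xs :: "nat \<Rightarrow> gen gword set" where "xs i = word_class [(Gx (Suc i), True)]"
definition ys :: "nat \<Rightarrow> gen gword set" where "ys i = word_class [(Gy (Suc i), True)]"
definition zz :: "gen gword set" where "zz = word_class [(Gx n, True)]"

sublocale h: heis "G n" xs ys zz m
proof unfold_locales
  have gx: "Gx (Suc i) \<in> G_gens n" "Gy (Suc i) \<in> G_gens n" "Suc i \<noteq> n" if "i < m" for i
    using that by (auto simp: G_gens_def)
  have gz: "Gx n \<in> G_gens n" using n by (auto simp: G_gens_def)
  show "xs i \<in> carrier (G n)" if "i < m" for i
    unfolding xs_def using gx[OF that] by (intro word_class_closed) simp
  show yc: "ys i \<in> carrier (G n)" if "i < m" for i
    unfolding ys_def using gx[OF that] by (intro word_class_closed) simp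
  show "zz \<in> carrier (G n)"
    unfolding zz_def using gz by (intro word_class_closed) simp
  show "xs i \<otimes>\<^bsub>G n\<^esub> xs j = xs j \<otimes>\<^bsub>G n\<^esub> xs i" if "i < m" "j < m" for i j
    unfolding xs_def using gx[OF that(1)] gx[OF that(2)] by (intro word_class_commute) (auto simp: doubleton_eq_iff)
  show "ys i \<otimes>\<^bsub>G n\<^esub> ys j = ys j \<otimes>\<^bsub>G n\<^esub> ys i" if "i < m" "j < m" for i j
    unfolding ys_def using gx[OF that(1)] gx[OF that(2)] by (intro word_class_commute) (auto simp: doubleton_eq_iff)
  show "ys i \<otimes>\<^bsub>G n\<^esub> xs j = xs j \<otimes>\<^bsub>G n\<^esub> ys i" if "i < m" "j < m" for i j
    unfolding ys_def xs_def using gx[OF that(1)] gx[OF that(2)] by (intro word_class_commute) (auto simp: doubleton_eq_iff)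
  show "ys i \<otimes>\<^bsub>G n\<^esub> zz = zz \<otimes>\<^bsub>G n\<^esub> ys i" if "i < m" for i
    unfolding ys_def zz_def using gx[OF that] gz by (intro word_class_commute) (auto simp: doubleton_eq_iff)
  show "xs i \<otimes>\<^bsub>G n\<^esub> zz = zz \<otimes>\<^bsub>G n\<^esub> xs i \<otimes>\<^bsub>G n\<^esub> ys i" if i: "i < m" for i
  proof -
    let ?c = "commutator_word (Gx (Suc i)) (Gx n)"
    have xc: "xs i \<in> carrier (G n)" and pow_z_closed: "zz \<in> carrier (G n)"
      unfolding xs_def zz_def using gx[OF i] gz by (auto intro!: word_class_closed)
    have cw: "?c \<in> words (G_gens n)" using gx[OF i] gz by (intro commutator_words)
    have "?c @ [(Gy (Suc i), False)] \<in> G_relators n" unfolding G_relators_def using i by fastforce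
    from word_class_relator[OF this] have "word_class ?c \<otimes>\<^bsub>G n\<^esub> inv\<^bsub>G n\<^esub> ys i = \<one>\<^bsub>G n\<^esub>"
      unfolding ys_def word_class_inv[OF gx(2)[OF i], symmetric] using cw gx[OF i] by (subst word_class_mult) auto
    then have "word_class ?c = ys i"
      using Gr.inv_equality[of "word_class ?c" "inv\<^bsub>G n\<^esub> ys i"] word_class_closed[OF cw] yc[OF i] by simp
    then have "xs i \<otimes>\<^bsub>G n\<^esub> zz = zz \<otimes>\<^bsub>G n\<^esub> (xs i \<otimes>\<^bsub>G n\<^esub> ys i)"
      using Gr.commutator_eqD[OF xc pow_z_closed] unfolding xs_def zz_def word_class_commutator[OF gx(1)[OF i] gz] by blast
    then show ?thesis using Gr.m_assoc[OF pow_z_closed xc yc[OF i]] by simp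
  qed
qed

definition normal_form :: "(ivec \<times> ivec) \<times> int \<Rightarrow> gen gword set"
  where "normal_form t = h.nf (fst (fst t)) (snd (fst t)) (snd t)"

text \<open>The rules \<open>nf_x\<close>, \<open>nf_y\<close>, \<open>nf_z\<close> and
  \<open>nf_inv_z\<close> change exponents in the way multiplication in \<open>TG\<close> does. One
  letter at a time, this brings every word of \<open>G n\<close> into normal form.\<close>

lemma letter_normal_form:
  assumes g: "g \<in> G_gens n"
  shows "word_class [(g, b)] \<otimes>\<^bsub>G n\<^esub> normal_form t = normal_form (letter_val (g, b) \<otimes>\<^bsub>TG\<^esub> t)"
proof -
  obtain u w c where t: "t = ((u, w), c)" by (metis prod.collapse)
  show ?thesis
  proof (cases g)
    case (Gy k)
    then obtain i where i: "i < m" "k = Suc i" using g by (auto simp: G_gens_def gr0_conv_Suc Suc_le_eq)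
    define e :: int where "e = (if b then 1 else -1)"
    have yc: "ys i \<in> carrier (G n)" using h.y[OF i(1)] .
    have word_class: "word_class [(g, b)] = ys i [^]\<^bsub>G n\<^esub> e"
      using word_class_inv[OF g] yc by (cases b) (auto simp: e_def ys_def Gy i(2) Gr.int_pow_neg)
    have B: "(0, std_vec i) \<in> Zpow2 m" using std_vec_Zpow[OF i(1)] addsub_zero[OF addsub_Zpow] by (simp add: Zpow2_iff)
    have letter_val: "letter_val (g, b) = ((0, scale e (std_vec i)), 0)"
    proof (cases b)
      case False
      have "gen_val g = ((0, std_vec i), 0)" by (simp add: gen_val_def Gy i(2))
      then show ?thesis using TG_inv_0[OF B] False by (simp add: letter_val_def e_def scale_uminus)
    qed (simp add: letter_val_def gen_val_def Gy i(2) e_def)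
    have "letter_val (g, b) \<otimes>\<^bsub>TG\<^esub> t = ((u, scale e (std_vec i) + w), c)"
      unfolding letter_val t by (simp add: twist_map_def zero_prod_def)
    moreover have "scale e (std_vec i) + w = (\<lambda>j. (if j = i then e else 0) + w j)"
      by (rule ext) (simp add: scale_apply std_vec_def)
    ultimately show ?thesis unfolding word_class normal_form_def t using h.nf_y[OF i(1), of e u w c]
      by (simp only: fst_conv snd_conv)
  next
    case (Gx k)
    show ?thesis
    proof (cases "k = n")
      case True
      have pow_z_closed: "zz \<in> carrier (G n)" by (rule h.z)
      have gvz: "gen_val g = ((0, 0), 1)" by (simp add: gen_val_def Gx True)
      have gc: "gen_val g \<in> carrier TG" by (rule gen_val_carrier[OF g])
      show ?thesis
      proof (cases b)
        case b: True
        have "letter_val (g, b) \<otimes>\<^bsub>TG\<^esub> t = ((u, w - u), 1 + c)"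
          unfolding letter_val_def t using b by (simp add: gvz twist_map_def)
        moreover have "w - u = (\<lambda>j. - u j + w j)" by (rule ext) simp
        moreover have "word_class [(g, b)] = zz" using b by (simp add: zz_def Gx True)
        ultimately show ?thesis unfolding normal_form_def t using h.nf_z[of u w c] by (simp only: fst_conv snd_conv)
      next
        case b: False
        have z0: "((0, 0), -1) \<in> carrier TG" using addsub_zero[OF addsub_Zpow] by (simp add: Zpow2_iff)
        have "inv\<^bsub>TG\<^esub> gen_val g = ((0, 0), -1)"
          by (rule TG.inv_equality[OF _ gc z0]) (simp add: gvz twist_map_def zero_prod_def)
        then have "letter_val (g, b) \<otimes>\<^bsub>TG\<^esub> t = ((u, w + u), - 1 + c)"
          unfolding letter_val_def t using b by (simp add: twist_map_def scale_uminus)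
        moreover have "w + u = (\<lambda>j. u j + w j)" by (rule ext) simp
        moreover have "word_class [(g, b)] = inv\<^bsub>G n\<^esub> zz" using b word_class_inv[OF g] by (simp add: zz_def Gx True)
        ultimately show ?thesis unfolding normal_form_def t using h.nf_inv_z[of u w c] by (simp only: fst_conv snd_conv)
      qed
    next
      case False
      then obtain i where i: "i < m" "k = Suc i" using g Gx
        by (auto simp: G_gens_def gr0_conv_Suc Suc_le_eq)
      define e :: int where "e = (if b then 1 else -1)"
      have xc: "xs i \<in> carrier (G n)" using h.x[OF i(1)] .
      have word_class: "word_class [(g, b)] = xs i [^]\<^bsub>G n\<^esub> e"
        using word_class_inv[OF g] xc by (cases b) (auto simp: e_def xs_def Gx i(2) Gr.int_pow_neg)
      have B: "(std_vec i, 0) \<in> Zpow2 m" using std_vec_Zpow[OF i(1)] addsub_zero[OF addsub_Zpow] by (simp add: Zpow2_iff)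
      have gvx: "gen_val g = ((std_vec i, 0), 0)" using False by (simp add: gen_val_def Gx i(2))
      have letter_val: "letter_val (g, b) = ((scale e (std_vec i), 0), 0)"
        using TG_inv_0[OF B] by (cases b) (simp_all add: gvx letter_val_def e_def scale_uminus)
      have "letter_val (g, b) \<otimes>\<^bsub>TG\<^esub> t = ((scale e (std_vec i) + u, w), c)"
        unfolding letter_val t by (simp add: twist_map_def zero_prod_def)
      moreover have "scale e (std_vec i) + u = (\<lambda>j. (if j = i then e else 0) + u j)"
        by (rule ext) (simp add: scale_apply std_vec_def)
      ultimately show ?thesis unfolding word_class normal_form_def t using h.nf_x[OF i(1), of e u w c]
        by (simp only: fst_conv snd_conv)
    qed
  qed
qed

text \<open>Completeness of the relations: the class of a word depends only on its value, which
  makes \<open>phi\<close> injective.\<close>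

lemma word_class_eq_normal_form: "w \<in> words (G_gens n) \<Longrightarrow> word_class w = normal_form (word_val w)"
proof (induction w)
  case Nil
  have "normal_form \<one>\<^bsub>TG\<^esub> = h.nf (\<lambda>_. 0) (\<lambda>_. 0) 0" by (simp add: normal_form_def zero_prod_def zero_fun_def)
  then show ?case unfolding word_val_Nil one_G[symmetric] using h.nf_0 by (simp only:)
next
  case (Cons l w)
  then have l: "fst l \<in> G_gens n" and w: "w \<in> words (G_gens n)" "word_class w = normal_form (word_val w)" by auto
  have "word_class (l # w) = word_class [l] \<otimes>\<^bsub>G n\<^esub> word_class w" using word_class_mult[of "[l]" w] l w by simp
  also have "\<dots> = normal_form (letter_val l \<otimes>\<^bsub>TG\<^esub> word_val w)"
    unfolding w(2) using letter_normal_form[OF l, of "snd l"] by (simp only: prod.collapse)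
  finally show ?case unfolding word_val_Cons .
qed

text \<open>An element of the presented group is a class of words; by \<open>word_val_pres\<close>
  the chosen member does not matter.\<close>

definition phi :: "gen gword set \<Rightarrow> (ivec \<times> ivec) \<times> int"
  where "phi A = word_val (SOME w. w \<in> A)"

lemma phi_word_class:
  assumes w: "w \<in> words (G_gens n)" shows "phi (word_class w) = word_val w"
proof -
  have "w \<in> word_class w" using pres_refl[OF w] by (simp add: word_class_def pres_rel_def)
  then have "(SOME v. v \<in> word_class w) \<in> word_class w" by (rule someI[of "\<lambda>v. v \<in> word_class w"])
  then have "pres_eq (G_gens n) (G_relators n) w (SOME v. v \<in> word_class w)"
    by (simp add: word_class_def pres_rel_def)
  then show ?thesis unfolding phi_def using word_val_pres by simp
qed

lemma phi_hom: "phi \<in> hom (G n) TG"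
proof (rule homI)
  fix A assume "A \<in> carrier (G n)"
  then obtain w where w: "w \<in> words (G_gens n)" "A = word_class w" unfolding carrier_G by blast
  show "phi A \<in> carrier TG" unfolding w(2) phi_word_class[OF w(1)] by (rule word_val_carrier[OF w(1)])
  fix C assume "C \<in> carrier (G n)"
  then obtain v where v: "v \<in> words (G_gens n)" "C = word_class v" unfolding carrier_G by blast
  have "w @ v \<in> words (G_gens n)" using w v by simp
  then show "phi (A \<otimes>\<^bsub>G n\<^esub> C) = phi A \<otimes>\<^bsub>TG\<^esub> phi C"
    unfolding w(2) v(2) word_class_mult[OF w(1) v(1)] by (simp only: phi_word_class w(1) v(1) word_val_append)
qed

lemma phi_inj: "inj_on phi (carrier (G n))"
proof (rule inj_onI)
  fix A C assume "A \<in> carrier (G n)" "C \<in> carrier (G n)" and eq: "phi A = phi C"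
  then obtain w v where w: "w \<in> words (G_gens n)" "A = word_class w" and v: "v \<in> words (G_gens n)" "C = word_class v"
    unfolding carrier_G by blast
  have "word_val w = word_val v" using eq unfolding w(2) v(2) phi_word_class[OF w(1)] phi_word_class[OF v(1)] .
  then show "A = C" unfolding w(2) v(2) word_class_eq_normal_form[OF w(1)] word_class_eq_normal_form[OF v(1)] by (simp only:)
qed

text \<open>The image is a subgroup that contains the values of all generators, hence both copies of
  \<open>Zpow m\<close> over 0 and some element over each integer.\<close>

lemma phi_surj: "phi ` carrier (G n) = carrier TG"
proof
  show "phi ` carrier (G n) \<subseteq> carrier TG" by (intro image_subsetI hom_in_carrier[OF phi_hom])
  interpret gh: group_hom "G n" TG phi
    by (intro group_hom.intro Gr.is_group TG.is_group group_hom_axioms.intro phi_hom)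
  define R where "R = phi ` carrier (G n)"
  have R: "subgroup R TG" unfolding R_def by (rule gh.img_is_subgroup)
  have gen: "gen_val g \<in> R" if "g \<in> G_gens n" for g
  proof -
    have w: "[(g, True)] \<in> words (G_gens n)" using that by simp
    have "phi (word_class [(g, True)]) = letter_val (g, True)"
      unfolding phi_word_class[OF w] by (rule word_val_single) (simp only: fst_conv that)
    also have "\<dots> = gen_val g" by (simp add: letter_val_def)
    finally show ?thesis unfolding R_def using imageI[OF word_class_closed[OF w], of phi] by (simp only:)
  qed
  have kR: "addsub (ker R)" by (rule addsub_ker(1)[OF R])
  have ad1: "Modules.additive (\<lambda>u::ivec. (u, 0::ivec))"
    by (rule Modules.additive.intro) (simp only: add_Pair add_0_right)
  have ad2: "Modules.additive (\<lambda>w::ivec. (0::ivec, w))"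
    by (rule Modules.additive.intro) (simp only: add_Pair add_0_right)
  have Lu: "Zpow m \<subseteq> (\<lambda>u. (u, 0)) -` ker R"
  proof (rule Zpow_subset_if_std_vec[OF addsub_vimage[OF ad1 kR]])
    fix i assume i: "i < m"
    have "gen_val (Gx (Suc i)) \<in> R" using i by (intro gen gens(1)) auto
    then have "((std_vec i, 0), 0) \<in> R" using i by (simp add: gen_val_def)
    then show "std_vec i \<in> (\<lambda>u. (u, 0)) -` ker R" unfolding vimage_eq ker_def mem_Collect_eq .
  qed
  have u: "((u, 0), 0) \<in> R" if "u \<in> Zpow m" for u
    using subsetD[OF Lu that] unfolding vimage_eq ker_def mem_Collect_eq .
  have Lw: "Zpow m \<subseteq> (\<lambda>w. (0, w)) -` ker R"
  proof (rule Zpow_subset_if_std_vec[OF addsub_vimage[OF ad2 kR]])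
    fix i assume i: "i < m"
    have "gen_val (Gy (Suc i)) \<in> R" using i by (intro gen gens(2)) auto
    then have "((0, std_vec i), 0) \<in> R" using i by (simp add: gen_val_def)
    then show "std_vec i \<in> (\<lambda>w. (0, w)) -` ker R" unfolding vimage_eq ker_def mem_Collect_eq .
  qed
  have w: "((0, w), 0) \<in> R" if "w \<in> Zpow m" for w
    using subsetD[OF Lw that] unfolding vimage_eq ker_def mem_Collect_eq .
  have z1: "((0, 0), 1) \<in> R" using gen[OF gens(1)[of n]] n by (simp add: gen_val_def)
  have zi: "((0, 0), 1) [^]\<^bsub>TG\<^esub> (c::int) \<in> R" for c by (rule TG.subgroup_int_pow_closed[OF R z1])
  show "carrier TG \<subseteq> R"
  proof
    fix t assume "t \<in> carrier TG"
    then obtain a b c where t: "t = ((a, b), c)" "a \<in> Zpow m" "b \<in> Zpow m"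
      by (auto simp: Zpow2_iff)
    \<comment> \<open>Only the integer component of this power is computed; its difference to
      \<open>(a, b)\<close> in the other components is absorbed by the kernel, which is all of
      \<open>Zpow2 m\<close>.\<close>
    let ?q = "((0, 0), 1) [^]\<^bsub>TG\<^esub> c"
    have z1c: "((0, 0), 1) \<in> carrier TG" using addsub_zero[OF addsub_Zpow] by (simp add: Zpow2_iff)
    obtain k where q: "?q = (k, c)"
      using snd_int_pow[OF z1c, of c] by (metis mult.right_neutral prod.collapse snd_conv)
    have qR: "(k, c) \<in> R" using zi[of c] q by simp
    have kB: "k \<in> Zpow2 m" using subgroup.subset[OF R] qR by auto
    then have "(a, b) - k \<in> Zpow2 m"
      using t addsub_diff[OF addsub_B, of "(a, b)" k] by (simp add: Zpow2_iff)
    then obtain a' b' where ab: "(a, b) - k = (a', b')" "a' \<in> Zpow m" "b' \<in> Zpow m"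
      by (cases "(a, b) - k") (auto simp: Zpow2_iff)
    have "((a', 0), 0) \<otimes>\<^bsub>TG\<^esub> ((0, b'), 0) = ((a', b'), 0)" by simp
    then have "((a', b'), 0) \<in> R" using subgroup.m_closed[OF R u[OF ab(2)] w[OF ab(3)]] by (simp only:)
    then have "(a', b') \<in> ker R" by (simp add: ker_def)
    then have "(a, b) - k \<in> ker R" using ab(1) by simp
    then show "t \<in> R" unfolding t(1)
      using mem_iff_ker[OF R qR, of "(a, b)"] t(2,3) by (simp add: Zpow2_iff)
  qed
qed

lemma phi_iso: "phi \<in> iso (G n) TG"
  using phi_hom phi_inj phi_surj by (simp add: iso_def bij_betw_def)

end

section \<open>Counting flags\<close>

text \<open>The flag number as a product over consecutive dimensions: for \<open>J\<close> below
  \<open>m\<close>, the minimum picks the successor of \<open>j\<close> in \<open>J\<close>, or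
  \<open>m\<close> if \<open>j\<close> is the last one.\<close>

definition flag_binom :: "nat \<Rightarrow> nat set \<Rightarrow> 'a::comm_semiring_1 \<Rightarrow> 'a"
  where "flag_binom m J x = (\<Prod>j\<in>J. gauss_binom (Min (insert m {k\<in>J. j < k})) j x)"

lemma flag_binom_empty [simp]: "flag_binom m {} x = 1" by (simp add: flag_binom_def)

text \<open>The recursion matching flags, whose largest member is chosen first.\<close>

lemma flag_binom_insert_max:
  assumes I: "finite I" "\<And>i. i \<in> I \<Longrightarrow> i < k" and k: "k < m"
  shows "flag_binom m (insert k I) x = gauss_binom m k x * flag_binom k I x"
proof -
  have e: "{l\<in>insert k I. k < l} = {}" using I(2) by (auto dest: less_asym)
  have "Min (insert m {l\<in>insert k I. j < l}) = Min (insert k {l\<in>I. j < l})" if j: "j \<in> I" for j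
  proof -
    have fin: "finite {l\<in>I. j < l}" using I(1) by simp
    have "{l\<in>insert k I. j < l} = insert k {l\<in>I. j < l}" using I(2)[OF j] by auto
    moreover have "Min (insert m (insert k {l\<in>I. j < l})) = min m (Min (insert k {l\<in>I. j < l}))"
      using fin by (intro Min_insert) auto
    moreover have "Min (insert k {l\<in>I. j < l}) \<le> k" using fin by (intro Min_le) auto
    ultimately show ?thesis using k by simp
  qed
  then have "(\<Prod>j\<in>I. gauss_binom (Min (insert m {l\<in>insert k I. j < l})) j x) = flag_binom k I x"
    unfolding flag_binom_def by (intro prod.cong refl) simp
  moreover have "k \<notin> I" using I(2) by blast
  then have "flag_binom m (insert k I) x = gauss_binom (Min (insert m {l\<in>insert k I. k < l})) k x
      * (\<Prod>j\<in>I. gauss_binom (Min (insert m {l\<in>insert k I. j < l})) j x)"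
    unfolding flag_binom_def by (rule prod.insert[OF I(1)])
  ultimately show ?thesis unfolding e by simp
qed

text \<open>The recursion matching words, which grow by a least letter.\<close>

lemma flag_binom_insert_min:
  assumes J: "finite J" "\<And>l. l \<in> J \<Longrightarrow> j < l"
  shows "flag_binom m (insert j J) x = gauss_binom (Min (insert m J)) j x * flag_binom m J x"
proof -
  have e: "{l\<in>insert j J. j < l} = J" using J(2) by auto
  have "{l\<in>insert j J. k < l} = {l\<in>J. k < l}" if "k \<in> J" for k using J(2)[OF that] by auto
  then have "(\<Prod>k\<in>J. gauss_binom (Min (insert m {l\<in>insert j J. k < l})) k x) = flag_binom m J x"
    unfolding flag_binom_def by (intro prod.cong refl) simp
  moreover have "j \<notin> J" using J(2) by blast
  ultimately show ?thesis unfolding flag_binom_def using J(1) e by simp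
qed

text \<open>The zero subspace extends a flag in one way only. Thus letters 0 leave the flag number
  of a word unchanged, and index sets in \<open>{1..m-1}\<close> suffice.\<close>

lemma flag_binom_insert_0: "finite J \<Longrightarrow> flag_binom m (insert 0 J) x = flag_binom m J x"
proof (cases "0 \<in> J")
  case False
  assume "finite J"
  moreover have "0 < l" if "l \<in> J" for l using that False by (metis gr0I)
  ultimately show ?thesis using flag_binom_insert_min[of J 0 m x] by simp
qed (simp add: insert_absorb)

lemma poly_flag_binom: "poly (flag_binom m J [:0, 1:]) x = flag_binom m J (x :: 'a::comm_ring_1)"
  by (simp add: flag_binom_def poly_prod poly_gauss_binom)

lemma of_nat_flag_binom: "of_nat (flag_binom m J q) = flag_binom m J (of_nat q)"
  by (simp add: flag_binom_def of_nat_gauss_binom)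

text \<open>Flags in \<open>Q/P\<close>, kept as chains of intermediate groups, with the dimension
  read off as the exponent of the index over \<open>P\<close>.\<close>

definition lflags :: "nat \<Rightarrow> ivec set \<Rightarrow> ivec set \<Rightarrow> nat set \<Rightarrow> ivec set set set"
  where "lflags q P Q I = {F. (\<forall>U\<in>F. addsub U \<and> P \<subseteq> U \<and> U \<subseteq> Q) \<and> chain\<^sub>\<subseteq> F \<and>
    (\<lambda>U. idx U P) ` F = (\<lambda>i. q ^ i) ` I}"

lemma eq_if_idx_eq:
  assumes "addsub P" "addsub U" "addsub V" "P \<subseteq> U" "U \<subseteq> V" "idx U P = idx V P" "idx V P > 0"
  shows "U = V"
proof (rule idx_1_imp_eq[OF assms(3,2,5)])
  have "idx V P = idx V U * idx V P" using idx_mult[OF assms(1,2,3,4,5)] assms(6) by simp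
  then show "idx V U = 1" using assms(7) by simp
qed

lemma subset_if_idx_le:
  assumes P: "addsub P" and q: "q > 1" and U: "addsub U" "P \<subseteq> U" "idx U P = q ^ k"
    and V: "addsub V" "P \<subseteq> V" "idx V P = q ^ i" and "i \<le> k" and UV: "U \<subseteq> V \<or> V \<subseteq> U"
  shows "V \<subseteq> U"
proof (cases "V \<subseteq> U")
  case False
  then have sub: "U \<subseteq> V" using UV by blast
  have m: "q ^ i = idx V U * q ^ k" using idx_mult[OF P U(1) V(1) U(2) sub] U(3) V(3) by simp
  then have "q ^ k dvd q ^ i" by (metis dvd_triv_right)
  then have "k \<le> i" using q by (simp add: power_dvd_imp_le)
  then have "i = k" using \<open>i \<le> k\<close> by simp
  then have "U = V" using q by (intro eq_if_idx_eq[OF P U(1) V(1) U(2) sub]) (simp_all add: U V)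
  then show ?thesis by blast
qed

text \<open>Induction on the largest dimension \<open>k\<close>: a flag consists of its top member
  \<open>U\<close>, which is counted by \<open>card_complements\<close> with \<open>K = P\<close>,
  and a flag inside \<open>U\<close> with the remaining dimensions.\<close>

lemma card_lflags:
  assumes q: "prime (q::nat)" and P: "addsub P" and "finite I"
  shows "addsub Q \<Longrightarrow> P \<subseteq> Q \<Longrightarrow> idx Q P = q ^ m \<Longrightarrow> (\<And>x. x \<in> Q \<Longrightarrow> scale (int q) x \<in> P)
    \<Longrightarrow> I \<subseteq> {..<m} \<Longrightarrow> finite (lflags q P Q I) \<and> card (lflags q P Q I) = flag_binom m I q"
  using \<open>finite I\<close>
proof (induction I arbitrary: Q m rule: finite_linorder_max_induct)
  case empty
  have "lflags q P Q {} = {{}}" by (auto simp: lflags_def chain_subset_def)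
  then show ?case by simp
next
  case (insert k I)
  note Q = insert.prems(1-4)
  have q1: "q > 1" using prime_gt_1_nat[OF q] .
  have k: "k < m" using insert.prems(5) by simp
  have kI: "\<And>i. i \<in> I \<Longrightarrow> i < k" using insert.hyps by blast
  have inj: "q ^ i = q ^ j \<longleftrightarrow> i = j" for i j using q1 by (simp add: power_inject_exp)
  let ?C = "complements Q P P (q ^ k)"
  have C: "U \<in> ?C \<longleftrightarrow> addsub U \<and> P \<subseteq> U \<and> U \<subseteq> Q \<and> idx U P = q ^ k" for U
    by (auto simp: complements_def)
  have finC: "finite ?C"
    by (rule card_complements_mult(2)[OF P P order_refl Q(2) Q(1) q Q(4)]) (use Q(3) q1 in auto)
  have cardC: "card ?C = gauss_binom m k q"
    using card_complements[OF P P order_refl Q(2) Q(1) q Q(4) Q(3), of 0 k] idx_self[OF P] by simp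
  have IH: "finite (lflags q P U I) \<and> card (lflags q P U I) = flag_binom k I q" if U: "U \<in> ?C" for U
    using U kI Q(4) unfolding C by (intro insert.IH) auto
  have notin: "U \<notin> F" if U: "U \<in> ?C" and F: "F \<in> lflags q P V I" for U V F
  proof
    assume "U \<in> F"
    then have "idx U P \<in> (\<lambda>i. q ^ i) ` I" using F unfolding lflags_def by blast
    then obtain i where "i \<in> I" "q ^ k = q ^ i" using U unfolding C by auto
    then show False using kI[of i] inj by simp
  qed
  have bij: "bij_betw (\<lambda>(U, F). insert U F) (Sigma ?C (\<lambda>U. lflags q P U I)) (lflags q P Q (insert k I))"
    unfolding bij_betw_def
  proof
    show "inj_on (\<lambda>(U, F). insert U F) (Sigma ?C (\<lambda>U. lflags q P U I))"
    proof (rule inj_onI, clarify)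
      fix U F U' F' assume U: "U \<in> ?C" "U' \<in> ?C" and F: "F \<in> lflags q P U I" "F' \<in> lflags q P U' I"
        and eq: "insert U F = insert U' F'"
      note n = notin[OF U(1) F(1)] notin[OF U(1) F(2)] notin[OF U(2) F(1)] notin[OF U(2) F(2)]
      have "U \<in> insert U' F'" "U' \<in> insert U F" using eq by (metis insertI1)+
      then have UU: "U = U'" using n by (metis insertE)
      have "F = insert U F - {U}" "F' = insert U' F' - {U'}" using n by (metis Diff_insert_absorb)+
      then show "U = U' \<and> F = F'" using eq UU by metis
    qed
    show "(\<lambda>(U, F). insert U F) ` Sigma ?C (\<lambda>U. lflags q P U I) = lflags q P Q (insert k I)"
    proof (intro equalityI subsetI)
      fix Z assume "Z \<in> (\<lambda>(U, F). insert U F) ` Sigma ?C (\<lambda>U. lflags q P U I)"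
      then obtain x where x: "x \<in> Sigma ?C (\<lambda>U. lflags q P U I)" "Z = (\<lambda>(U, F). insert U F) x"
        by (elim imageE)
      obtain U F where xUF: "x = (U, F)" by (cases x)
      have U: "U \<in> ?C" and F: "F \<in> lflags q P U I" using x(1) unfolding xUF mem_Sigma_iff by blast+
      have Z: "Z = insert U F" using x(2) unfolding xUF prod.case .
      have F1: "\<And>V. V \<in> F \<Longrightarrow> addsub V \<and> P \<subseteq> V \<and> V \<subseteq> U" and F2: "chain\<^sub>\<subseteq> F"
        and F3: "(\<lambda>U. idx U P) ` F = (\<lambda>i. q ^ i) ` I" using F unfolding lflags_def by blast+
      have "chain\<^sub>\<subseteq> Z" using F1 F2 unfolding Z chain_subset_def by blast
      moreover have "(\<lambda>U. idx U P) ` Z = (\<lambda>i. q ^ i) ` insert k I"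
        using U F3 unfolding Z C by simp
      moreover have "\<forall>V\<in>Z. addsub V \<and> P \<subseteq> V \<and> V \<subseteq> Q" using F1 U unfolding Z C by blast
      ultimately show "Z \<in> lflags q P Q (insert k I)" unfolding lflags_def by blast
    next
      fix Z assume "Z \<in> lflags q P Q (insert k I)"
      then have Z1: "\<And>V. V \<in> Z \<Longrightarrow> addsub V \<and> P \<subseteq> V \<and> V \<subseteq> Q" and Z2: "chain\<^sub>\<subseteq> Z"
        and Z3: "(\<lambda>U. idx U P) ` Z = (\<lambda>i. q ^ i) ` insert k I" unfolding lflags_def by blast+
      have "q ^ k \<in> (\<lambda>U. idx U P) ` Z" unfolding Z3 by blast
      then obtain U where UZ: "U \<in> Z" "idx U P = q ^ k" by (metis imageE)
      have U: "U \<in> ?C" unfolding C using Z1[OF UZ(1)] UZ(2) by blast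
      have V: "V \<subseteq> U \<and> (\<exists>i\<in>I. idx V P = q ^ i)" if V: "V \<in> Z" "V \<noteq> U" for V
      proof -
        have "idx V P \<in> (\<lambda>i. q ^ i) ` insert k I" using V(1) unfolding Z3[symmetric] by blast
        then obtain i where i: "i \<in> insert k I" "idx V P = q ^ i" by blast
        have ik: "i \<le> k" using i(1) kI by (auto simp: less_imp_le)
        have UV: "U \<subseteq> V \<or> V \<subseteq> U" using Z2 V(1) UZ(1) unfolding chain_subset_def by blast
        have VU: "V \<subseteq> U"
          using subset_if_idx_le[OF P q1 _ _ UZ(2) _ _ i(2) ik UV] Z1[OF V(1)] Z1[OF UZ(1)] by blast
        have "i \<noteq> k"
        proof
          assume "i = k"
          then have "V = U" using eq_if_idx_eq[OF P _ _ _ VU] Z1[OF V(1)] Z1[OF UZ(1)] i(2) UZ(2) q1 by simp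
          then show False using V(2) by simp
        qed
        then show ?thesis using VU i by blast
      qed
      have "Z - {U} \<in> lflags q P U I"
      proof -
        have "chain\<^sub>\<subseteq> (Z - {U})" using Z2 unfolding chain_subset_def by blast
        moreover have "\<forall>W\<in>Z - {U}. addsub W \<and> P \<subseteq> W \<and> W \<subseteq> U" using V Z1 by blast
        moreover have "(\<lambda>U. idx U P) ` (Z - {U}) = (\<lambda>i. q ^ i) ` I"
        proof (intro equalityI subsetI)
          fix v assume "v \<in> (\<lambda>U. idx U P) ` (Z - {U})"
          then obtain W where "W \<in> Z" "W \<noteq> U" "v = idx W P" by blast
          then show "v \<in> (\<lambda>i. q ^ i) ` I" using V[of W] by blast
        next
          fix v assume "v \<in> (\<lambda>i. q ^ i) ` I"
          then obtain i where i: "i \<in> I" "v = q ^ i" by blast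
          then have "v \<in> (\<lambda>U. idx U P) ` Z" unfolding Z3 by blast
          then obtain W where W: "W \<in> Z" "v = idx W P" by blast
          have "W \<noteq> U" using W(2) UZ(2) i kI[OF i(1)] inj[of i k] by auto
          then show "v \<in> (\<lambda>U. idx U P) ` (Z - {U})" using W by blast
        qed
        ultimately show ?thesis unfolding lflags_def by blast
      qed
      moreover have "Z = insert U (Z - {U})" using UZ(1) by blast
      ultimately show "Z \<in> (\<lambda>(U, F). insert U F) ` Sigma ?C (\<lambda>U. lflags q P U I)"
        using U by (intro image_eqI[of _ _ "(U, Z - {U})"]) auto
    qed
  qed
  have "card (lflags q P Q (insert k I)) = card (Sigma ?C (\<lambda>U. lflags q P U I))"
    using bij_betw_same_card[OF bij] by simp
  also have "\<dots> = (\<Sum>U\<in>?C. card (lflags q P U I))" using finC IH by (intro card_SigmaI) auto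
  also have "\<dots> = gauss_binom m k q * flag_binom k I q" using IH cardC by simp
  also have "\<dots> = flag_binom m (insert k I) q" using flag_binom_insert_max[OF insert.hyps(1) kI k, of q] by simp
  finally have "card (lflags q P Q (insert k I)) = flag_binom m (insert k I) q" .
  moreover have "finite (lflags q P Q (insert k I))"
    using bij_betw_finite[OF bij] finC IH by blast
  ultimately show ?case by blast
qed

section \<open>Reduction modulo a prime: subspaces as intermediate lattices\<close>

definition red :: "nat \<Rightarrow> nat \<Rightarrow> ivec \<Rightarrow> ivec"
  where "red q m f = restrict (\<lambda>i. f i mod int q) {..<m}"

definition lift :: "nat \<Rightarrow> nat \<Rightarrow> ivec set \<Rightarrow> ivec set"
  where "lift q m U = {f \<in> Zpow m. red q m f \<in> U}"

abbreviation RR :: "nat \<Rightarrow> int ring" where "RR q \<equiv> residue_ring (int q)"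

context
  fixes q m :: nat
  assumes q: "prime q"
begin

lemma q0: "q > 0" using prime_gt_0_nat[OF q] .

lemma ring_RR: "ring (RR q)"
proof -
  interpret residues_prime q "RR q" using q by unfold_locales auto
  show ?thesis using cring by (rule cring.axioms(1))
qed

lemma Fp_simps:
  "carrier (Fp_space q m) = PiE {..<m} (\<lambda>_. {0..int q - 1})"
  "f \<oplus>\<^bsub>Fp_space q m\<^esub> g = restrict (\<lambda>i. (f i + g i) mod int q) {..<m}"
  "c \<odot>\<^bsub>Fp_space q m\<^esub> f = restrict (\<lambda>i. (c * f i) mod int q) {..<m}"
  "\<zero>\<^bsub>Fp_space q m\<^esub> = restrict (\<lambda>i. 0) {..<m}"
  unfolding Fp_space_def ring.func_space_def[OF ring_RR]
  by (simp_all add: residue_ring_def)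

lemma red_carrier: "q > 0 \<Longrightarrow> red q m f \<in> carrier (Fp_space q m)"
  by (simp add: red_def Fp_simps restrict_PiE_iff)

lemma red_add: "red q m (f + g) = red q m f \<oplus>\<^bsub>Fp_space q m\<^esub> red q m g"
  unfolding red_def Fp_simps by (rule ext) (simp add: restrict_def mod_add_eq)

lemma red_scale: "red q m (scale c f) = (c mod int q) \<odot>\<^bsub>Fp_space q m\<^esub> red q m f"
  unfolding red_def Fp_simps by (rule ext) (simp add: restrict_def scale_apply mod_mult_eq)

lemma red_0: "red q m 0 = \<zero>\<^bsub>Fp_space q m\<^esub>"
  unfolding red_def Fp_simps by (rule ext) (simp add: restrict_def)

lemma red_eq_iff:
  assumes q: "q > 0" and "f \<in> Zpow m" "g \<in> Zpow m"
  shows "red q m f = red q m g \<longleftrightarrow> f - g \<in> pZpow q m"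
proof -
  have "red q m f = red q m g \<longleftrightarrow> (\<forall>i<m. f i mod int q = g i mod int q)"
    unfolding red_def by (auto simp: fun_eq_iff restrict_def)
  also have "\<dots> \<longleftrightarrow> f - g \<in> pZpow q m"
    using addsub_diff[OF addsub_Zpow assms(2,3)] by (simp add: pZpow_iff[OF q] mod_eq_dvd_iff)
  finally show ?thesis .
qed

lemma red_surj:
  assumes "v \<in> carrier (Fp_space q m)"
  obtains f where "f \<in> Zpow m" "red q m f = v"
proof (rule that)
  define f where "f = (\<lambda>i. if i < m then v i else 0)"
  show "f \<in> Zpow m" by (simp add: f_def Zpow_def)
  have v: "v i \<in> {0..int q - 1}" if im: "i < m" for i
    using PiE_mem[OF assms[unfolded Fp_simps], of i] im by simp
  show "red q m f = v"
  proof
    fix i show "red q m f i = v i"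
    proof (cases "i < m")
      case True
      then show ?thesis using v[OF True] by (simp add: red_def f_def)
    next
      case False
      then have "v i = undefined" using PiE_arb[OF assms[unfolded Fp_simps], of i] by simp
      then show ?thesis using False by (simp add: red_def)
    qed
  qed
qed


interpretation V: vectorspace "RR q" "Fp_space q m" by (rule vectorspace_Fp_space[OF q])

lemma subspaceI':
  assumes "U \<subseteq> carrier (Fp_space q m)" "\<zero>\<^bsub>Fp_space q m\<^esub> \<in> U"
    "\<And>v w. v \<in> U \<Longrightarrow> w \<in> U \<Longrightarrow> v \<oplus>\<^bsub>Fp_space q m\<^esub> w \<in> U"
    "\<And>c v. c \<in> carrier (RR q) \<Longrightarrow> v \<in> U \<Longrightarrow> c \<odot>\<^bsub>Fp_space q m\<^esub> v \<in> U"
  shows "subspace (RR q) U (Fp_space q m)"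
  using assms V.vectorspace_axioms V.module_axioms
  by (auto simp: subspace_def submodule_def)

lemma subspace_D:
  assumes "subspace (RR q) U (Fp_space q m)"
  shows "U \<subseteq> carrier (Fp_space q m)" "\<zero>\<^bsub>Fp_space q m\<^esub> \<in> U"
    "\<And>v w. v \<in> U \<Longrightarrow> w \<in> U \<Longrightarrow> v \<oplus>\<^bsub>Fp_space q m\<^esub> w \<in> U"
    "\<And>c v. c \<in> carrier (RR q) \<Longrightarrow> v \<in> U \<Longrightarrow> c \<odot>\<^bsub>Fp_space q m\<^esub> v \<in> U"
  using assms by (auto simp: subspace_def submodule_def)

lemma mod_carrier: "c mod int q \<in> carrier (RR q)"
  using q0 by (simp add: residue_ring_def)

lemma lift_props:
  assumes U: "subspace (RR q) U (Fp_space q m)"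
  shows "addsub (lift q m U)" "pZpow q m \<subseteq> lift q m U" "lift q m U \<subseteq> Zpow m" "red q m ` lift q m U = U"
proof -
  note U' = subspace_D[OF U]
  show "lift q m U \<subseteq> Zpow m" by (auto simp: lift_def)
  show "addsub (lift q m U)"
    unfolding addsub_def
  proof (intro conjI ballI)
    show "0 \<in> lift q m U" using U'(2) addsub_zero[OF addsub_Zpow] by (simp add: lift_def red_0)
    fix f g assume "f \<in> lift q m U" "g \<in> lift q m U"
    then have f: "f \<in> Zpow m" "red q m f \<in> U" and g: "g \<in> Zpow m" "red q m g \<in> U" by (auto simp: lift_def)
    have e: "f - g = f + scale (-1) g" by (rule ext) (simp add: scale_apply)
    have "red q m (f + scale (-1) g) \<in> U"
      unfolding red_add red_scale by (intro U'(3,4) f g mod_carrier)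
    then show "f - g \<in> lift q m U" using addsub_diff[OF addsub_Zpow f(1) g(1)] e by (simp only: lift_def mem_Collect_eq)
  qed
  show "pZpow q m \<subseteq> lift q m U"
  proof
    fix f assume f: "f \<in> pZpow q m"
    have fL: "f \<in> Zpow m" using f pZpow_subset by blast
    have "f - 0 \<in> pZpow q m" using f by simp
    then have "red q m f = red q m 0" using red_eq_iff[OF q0 fL addsub_zero[OF addsub_Zpow]] by simp
    then show "f \<in> lift q m U" using U'(2) fL by (simp add: lift_def red_0)
  qed
  show "red q m ` lift q m U = U"
  proof (intro equalityI subsetI)
    fix v assume v: "v \<in> U"
    then obtain f where "f \<in> Zpow m" "red q m f = v" using red_surj U'(1) by blast
    then show "v \<in> red q m ` lift q m U" using v by (force simp: lift_def)
  qed (auto simp: lift_def)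
qed

lemma red_subspace:
  assumes T: "addsub T" "pZpow q m \<subseteq> T" "T \<subseteq> Zpow m"
  shows "subspace (RR q) (red q m ` T) (Fp_space q m)" "lift q m (red q m ` T) = T"
proof -
  show "subspace (RR q) (red q m ` T) (Fp_space q m)"
  proof (rule subspaceI')
    show "red q m ` T \<subseteq> carrier (Fp_space q m)" using red_carrier[OF q0] by blast
    show "\<zero>\<^bsub>Fp_space q m\<^esub> \<in> red q m ` T" unfolding red_0[symmetric] using addsub_zero[OF T(1)] by blast
    fix v assume "v \<in> red q m ` T"
    then obtain f where f: "f \<in> T" "v = red q m f" by blast
    show "c \<odot>\<^bsub>Fp_space q m\<^esub> v \<in> red q m ` T" if "c \<in> carrier (RR q)" for c
    proof -
      have "c mod int q = c" using that q0 by (simp add: residue_ring_def)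
      then have "c \<odot>\<^bsub>Fp_space q m\<^esub> v = red q m (scale c f)" unfolding red_scale f(2) by simp
      then show ?thesis using scale_closed[OF T(1) f(1)] by blast
    qed
    fix w assume "w \<in> red q m ` T"
    then obtain g where g: "g \<in> T" "w = red q m g" by blast
    show "v \<oplus>\<^bsub>Fp_space q m\<^esub> w \<in> red q m ` T"
      unfolding f(2) g(2) red_add[symmetric] using addsub_add[OF T(1) f(1) g(1)] by blast
  qed
  show "lift q m (red q m ` T) = T"
  proof (intro equalityI subsetI)
    fix f assume "f \<in> lift q m (red q m ` T)"
    then obtain g where fg: "f \<in> Zpow m" "g \<in> T" "red q m f = red q m g" by (auto simp: lift_def)
    then have "f - g \<in> T" using red_eq_iff[OF q0 fg(1), of g] T by blast
    then have "(f - g) + g \<in> T" by (rule addsub_add[OF T(1) _ fg(2)])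
    then show "f \<in> T" by simp
  next
    fix f assume "f \<in> T"
    then show "f \<in> lift q m (red q m ` T)" using T(3) by (auto simp: lift_def)
  qed
qed

text \<open>Coordinates with respect to a basis; this converts the dimension in the definition of
  flags into a cardinality, and so into an index of lattices.\<close>

lemma card_subspace:
  assumes U: "subspace (RR q) U (Fp_space q m)"
  shows "card U = q ^ Fp_dim q m U"
proof -
  interpret W: vectorspace "RR q" "Fp_space q m\<lparr>carrier := U\<rparr>" by (rule V.subspace_is_vs[OF U])
  have finV: "finite (carrier (Fp_space q m))" unfolding Fp_simps by (intro finite_PiE) auto
  then have finU: "finite U" using subspace_D(1)[OF U] finite_subset by blast
  have UW: "U \<subseteq> carrier (Fp_space q m\<lparr>carrier := U\<rparr>)" by simp
  have "U \<subseteq> W.span U" by (rule W.in_own_span[OF UW])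
  moreover have "W.span U \<subseteq> carrier (Fp_space q m\<lparr>carrier := U\<rparr>)" by (rule W.span_is_subset2[OF UW])
  ultimately have "W.gen_set U" by simp
  then have "W.fin_dim" unfolding W.fin_dim_def using finU UW by blast
  then obtain B where B: "finite B" "W.basis B" using W.finite_basis_exists by blast
  have BU: "B \<subseteq> carrier (Fp_space q m\<lparr>carrier := U\<rparr>)" using B(2) by (simp add: W.basis_def)
  have ex: "\<forall>v. v \<in> U \<longrightarrow> (\<exists>!a. a \<in> B \<rightarrow>\<^sub>E carrier (RR q) \<and> W.lincomb a B = v)"
    using W.basis_criterion[OF B(1) BU] B(2) by simp
  have "bij_betw (\<lambda>a. W.lincomb a B) (B \<rightarrow>\<^sub>E carrier (RR q)) U"
    unfolding bij_betw_def
  proof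
    have word_class: "W.lincomb a B \<in> U" if "a \<in> B \<rightarrow>\<^sub>E carrier (RR q)" for a
      using W.lincomb_closed[OF BU, of a] that by (auto simp: PiE_def)
    show "inj_on (\<lambda>a. W.lincomb a B) (B \<rightarrow>\<^sub>E carrier (RR q))"
      using ex word_class by (intro inj_onI) blast
    show "(\<lambda>a. W.lincomb a B) ` (B \<rightarrow>\<^sub>E carrier (RR q)) = U"
      using ex word_class by blast
  qed
  then have "card U = card (B \<rightarrow>\<^sub>E carrier (RR q))" by (metis bij_betw_same_card)
  also have "\<dots> = q ^ card B" using B(1) by (simp add: card_PiE residue_ring_def)
  also have "card B = Fp_dim q m U" unfolding Fp_dim_def using W.dim_basis[OF B] ..
  finally show ?thesis .
qed

lemma idx_lift:
  assumes U: "subspace (RR q) U (Fp_space q m)"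
  shows "idx (lift q m U) (pZpow q m) = q ^ Fp_dim q m U"
proof -
  note L = lift_props[OF U]
  have "idx (lift q m U) (pZpow q m) = card (red q m ` lift q m U)"
    unfolding idx_def cosets_def
  proof (rule card_image_cong_iff)
    fix f g assume "f \<in> lift q m U" "g \<in> lift q m U"
    then have fg: "f \<in> Zpow m" "g \<in> Zpow m" using L(3) by blast+
    show "(+) f ` pZpow q m = (+) g ` pZpow q m \<longleftrightarrow> red q m f = red q m g"
      unfolding coset_eq_iff[OF addsub_pZpow] red_eq_iff[OF q0 fg] ..
  qed
  then show ?thesis using L(4) card_subspace[OF U] by simp
qed

lemma lift_mono_iff:
  assumes "subspace (RR q) U (Fp_space q m)" "subspace (RR q) V (Fp_space q m)"
  shows "lift q m U \<subseteq> lift q m V \<longleftrightarrow> U \<subseteq> V"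
proof
  assume "lift q m U \<subseteq> lift q m V"
  then show "U \<subseteq> V" using lift_props(4)[OF assms(1)] lift_props(4)[OF assms(2)] by (metis image_mono)
qed (auto simp: lift_def)

text \<open>Taking preimages under reduction identifies the subspaces of \<open>F_q^m\<close> with
  the lattices between \<open>q\<int>^m\<close> and \<open>\<int>^m\<close>. It preserves
  inclusions, and by \<open>idx_lift\<close> it turns dimensions into exponents of indices.\<close>

lemma flags_bij: "bij_betw ((`) (lift q m)) (flags q m I) (lflags q (pZpow q m) (Zpow m) I)"
  unfolding bij_betw_def
proof
  define SS where "SS = {U. subspace (RR q) U (Fp_space q m)}"
  have SS: "F \<subseteq> SS" if "F \<in> flags q m I" for F using that by (auto simp: flags_def SS_def)
  have injS: "inj_on (lift q m) SS"
    using lift_props(4) by (intro inj_on_inverseI[of _ "(`) (red q m)"]) (auto simp: SS_def)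
  have inj: "q ^ i = q ^ j \<longleftrightarrow> i = j" for i j using prime_gt_1_nat[OF q] by (simp add: power_inject_exp)
  have iff: "lift q m ` F \<in> lflags q (pZpow q m) (Zpow m) I \<longleftrightarrow> F \<in> flags q m I" if F: "F \<subseteq> SS" for F
  proof -
    have aux: "A \<Longrightarrow> (A \<and> C) = C" for A C :: bool by simp
    have c1: "chain\<^sub>\<subseteq> (lift q m ` F) \<longleftrightarrow> chain\<^sub>\<subseteq> F"
    proof -
      have "lift q m U \<subseteq> lift q m V \<longleftrightarrow> U \<subseteq> V" if "U \<in> F" "V \<in> F" for U V
        using F that by (intro lift_mono_iff) (auto simp: SS_def)
      then show ?thesis unfolding chain_subset_def by simp
    qed
    have c2: "(\<lambda>U. idx U (pZpow q m)) ` lift q m ` F = (\<lambda>i. q ^ i) ` Fp_dim q m ` F"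
      unfolding image_image using F idx_lift by (intro image_cong) (auto simp: SS_def)
    have c3: "(\<lambda>i. q ^ i) ` Fp_dim q m ` F = (\<lambda>i. q ^ i) ` I \<longleftrightarrow> Fp_dim q m ` F = I"
      using inj by (intro inj_image_eq_iff) (auto simp: inj_def)
    have c4: "\<forall>V\<in>lift q m ` F. addsub V \<and> pZpow q m \<subseteq> V \<and> V \<subseteq> Zpow m"
    proof -
      have "addsub (lift q m U) \<and> pZpow q m \<subseteq> lift q m U \<and> lift q m U \<subseteq> Zpow m" if "U \<in> F" for U
      proof -
        have "subspace (RR q) U (Fp_space q m)" using F that by (auto simp: SS_def)
        from lift_props[OF this] show ?thesis by blast
      qed
      then show ?thesis by blast
    qed
    have c5: "\<forall>U\<in>F. subspace (RR q) U (Fp_space q m)" using F by (auto simp: SS_def)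
    have "lift q m ` F \<in> lflags q (pZpow q m) (Zpow m) I \<longleftrightarrow>
        chain\<^sub>\<subseteq> (lift q m ` F) \<and> (\<lambda>U. idx U (pZpow q m)) ` lift q m ` F = (\<lambda>i. q ^ i) ` I"
      unfolding lflags_def mem_Collect_eq by (rule aux[OF c4])
    moreover have "F \<in> flags q m I \<longleftrightarrow> chain\<^sub>\<subseteq> F \<and> Fp_dim q m ` F = I"
      unfolding flags_def mem_Collect_eq by (rule aux[OF c5])
    ultimately show ?thesis by (simp only: c1 c2 c3)
  qed
  show "inj_on ((`) (lift q m)) (flags q m I)"
  proof (rule inj_onI)
    fix F F' assume "F \<in> flags q m I" "F' \<in> flags q m I" "lift q m ` F = lift q m ` F'"
    then show "F = F'" using inj_on_image_eq_iff[OF injS SS[of F] SS[of F']] by simp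
  qed
  show "(`) (lift q m) ` flags q m I = lflags q (pZpow q m) (Zpow m) I"
  proof (intro equalityI subsetI)
    fix Z assume "Z \<in> (`) (lift q m) ` flags q m I"
    then obtain F where F: "F \<in> flags q m I" "Z = lift q m ` F" by (rule imageE)
    show "Z \<in> lflags q (pZpow q m) (Zpow m) I" using iff[OF SS[OF F(1)]] F by simp
  next
    fix Z assume Z: "Z \<in> lflags q (pZpow q m) (Zpow m) I"
    define F where "F = (\<lambda>W. red q m ` W) ` Z"
    have W: "addsub W" "pZpow q m \<subseteq> W" "W \<subseteq> Zpow m" if "W \<in> Z" for W
      using Z that unfolding lflags_def by blast+
    have "lift q m ` F = (\<lambda>W. lift q m (red q m ` W)) ` Z" unfolding F_def image_image ..
    also have "\<dots> = (\<lambda>W. W) ` Z" using red_subspace(2)[OF W] by (intro image_cong) auto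
    finally have lF: "lift q m ` F = Z" by simp
    have "F \<subseteq> SS" unfolding F_def SS_def using red_subspace(1)[OF W] by blast
    then have "F \<in> flags q m I" using iff[of F] lF Z by simp
    then show "Z \<in> (`) (lift q m) ` flags q m I" using lF by (metis imageI)
  qed
qed

lemma card_flags:
  assumes "I \<subseteq> {..<m}" shows "card (flags q m I) = flag_binom m I q"
proof -
  have "finite I" using assms finite_subset by blast
  have "scale (int q) x \<in> pZpow q m" if "x \<in> Zpow m" for x using that unfolding pZpow_def by blast
  from card_lflags[OF q addsub_pZpow \<open>finite I\<close> addsub_Zpow pZpow_subset idx_Zpow_pZpow[OF q0] this assms]
  show ?thesis using bij_betw_same_card[OF flags_bij] by simp
qed

end

lemma flag_poly_eq:
  assumes "I \<subseteq> {..<m}" shows "flag_poly m I = flag_binom m I [:0, 1:]"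
proof -
  have "is_flag_poly m I (flag_binom m I [:0, 1:])"
    unfolding is_flag_poly_def using card_flags[OF _ assms] by (simp add: poly_flag_binom of_nat_flag_binom)
  then show ?thesis unfolding flag_poly_def
    by (rule the_equality) (use is_flag_poly_unique \<open>is_flag_poly m I (flag_binom m I [:0, 1:])\<close> in blast)
qed

lemma poly_flag_poly: "I \<subseteq> {..<m} \<Longrightarrow> poly (flag_poly m I) x = flag_binom m I x"
  by (simp only: flag_poly_eq poly_flag_binom)

section \<open>Generating functions\<close>

text \<open>Nonnegative coefficients make convergence at the real points absolute convergence in the
  whole disc, which is what the interchange of summations needs.\<close>

definition gen_fun :: "real \<Rightarrow> 'a set \<Rightarrow> ('a \<Rightarrow> real) \<Rightarrow> ('a \<Rightarrow> nat) \<Rightarrow> (complex \<Rightarrow> complex) \<Rightarrow> bool"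
  where "gen_fun r A c e \<Phi> \<longleftrightarrow> (\<forall>a\<in>A. 0 \<le> c a) \<and>
    (\<forall>z. norm z < r \<longrightarrow> ((\<lambda>a. of_real (c a) * z ^ e a) has_sum \<Phi> z) A)"

lemma gfsD: "gen_fun r A c e \<Phi> \<Longrightarrow> norm z < r \<Longrightarrow> ((\<lambda>a. of_real (c a) * z ^ e a) has_sum \<Phi> z) A"
  and gen_fun_nonneg: "gen_fun r A c e \<Phi> \<Longrightarrow> a \<in> A \<Longrightarrow> 0 \<le> c a"
  by (auto simp: gen_fun_def)

lemma re_of_real_power: "a * b ^ k = Re (of_real a * of_real b ^ k)"
  by (metis Re_complex_of_real of_real_mult of_real_power)

text \<open>The absolute series at \<open>z\<close> is the series itself at the real point
  \<open>norm z\<close>.\<close>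

lemma gen_fun_norm:
  fixes z :: complex
  assumes g: "gen_fun r A c e \<Phi>" and z: "norm z < r"
  shows "((\<lambda>a. norm (of_real (c a) * z ^ e a)) has_sum Re (\<Phi> (of_real (norm z)))) A"
proof -
  have "norm (of_real (norm z) :: complex) < r" using z by simp
  from has_sum_Re[OF gfsD[OF g this]]
  have "((\<lambda>a. Re (of_real (c a) * of_real (norm z) ^ e a)) has_sum Re (\<Phi> (of_real (norm z)))) A" .
  moreover have "Re (of_real (c a) * of_real (norm z) ^ e a) = norm (of_real (c a) * z ^ e a)"
    if "a \<in> A" for a
    unfolding re_of_real_power[of "c a" "norm z", symmetric] norm_mult norm_power
    using gen_fun_nonneg[OF g that] by simp
  ultimately show ?thesis by (rule has_sum_cong[THEN iffD1, rotated])
qed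

text \<open>The inner sums are monomials in \<open>z\<close> times one common factor
  \<open>\<Phi>\<close>, so \<open>\<Phi>\<close> can be pulled out of the outer series in these
  monomials.\<close>

lemma gen_fun_Sigma:
  assumes outer: "gen_fun r A C E \<Psi>"
    and inner: "\<And>x. x \<in> A \<Longrightarrow> gen_fun r (B x) (\<lambda>y. c (x, y)) (\<lambda>y. e (x, y)) (\<lambda>z. of_real (C x) * z ^ E x * \<Phi> z)"
  shows "gen_fun r (Sigma A B) c e (\<lambda>z. \<Psi> z * \<Phi> z)"
  unfolding gen_fun_def
proof (intro conjI ballI allI impI)
  fix a assume "a \<in> Sigma A B"
  then obtain x y where "a = (x, y)" "x \<in> A" "y \<in> B x" by blast
  then show "0 \<le> c a" using gen_fun_nonneg[OF inner] by simp
next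
  fix z :: complex assume z: "norm z < r"
  let ?t = "of_real (norm z) :: complex"
  show "((\<lambda>a. of_real (c a) * z ^ e a) has_sum \<Psi> z * \<Phi> z) (Sigma A B)"
  proof (rule has_sum_SigmaI_abs)
    fix x assume x: "x \<in> A"
    show "((\<lambda>y. of_real (c (x, y)) * z ^ e (x, y)) has_sum of_real (C x) * z ^ E x * \<Phi> z) (B x)"
      by (rule gfsD[OF inner[OF x] z])
    have eq: "Re (of_real (C x) * ?t ^ E x * \<Phi> ?t) = norm (of_real (C x) * z ^ E x) * Re (\<Phi> ?t)"
    proof -
      have 1: "of_real (C x) * ?t ^ E x = of_real (C x * norm z ^ E x)" by simp
      have 2: "norm (of_real (C x) * z ^ E x) = C x * norm z ^ E x"
        unfolding norm_mult norm_power using gen_fun_nonneg[OF outer x] by simp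
      show ?thesis unfolding 1 2 by (simp del: of_real_mult of_real_power)
    qed
    show "((\<lambda>y. norm (of_real (c (x, y)) * z ^ e (x, y))) has_sum
        norm (of_real (C x) * z ^ E x) * Re (\<Phi> ?t)) (B x)"
      using gen_fun_norm[OF inner[OF x] z] unfolding eq .
  next
    show "(\<lambda>x. norm (of_real (C x) * z ^ E x) * Re (\<Phi> ?t)) summable_on A"
      by (rule summable_on_cmult_left[OF has_sum_imp_summable[OF gen_fun_norm[OF outer z]]])
    show "((\<lambda>x. of_real (C x) * z ^ E x * \<Phi> z) has_sum \<Psi> z * \<Phi> z) A"
      by (rule has_sum_cmult_left[OF gfsD[OF outer z]])
  qed
qed

lemma gen_fun_reindex:
  assumes "bij_betw h A B" and g: "gen_fun r A (\<lambda>a. c (h a)) (\<lambda>a. e (h a)) \<Phi>"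
  shows "gen_fun r B c e \<Phi>"
  unfolding gen_fun_def
proof (intro conjI ballI allI impI)
  fix b assume "b \<in> B"
  then obtain a where "a \<in> A" "b = h a" using assms(1) by (auto simp: bij_betw_def)
  then show "0 \<le> c b" using gen_fun_nonneg[OF g, of a] by simp
next
  fix z :: complex assume "norm z < r"
  from gfsD[OF g this] show "((\<lambda>b. of_real (c b) * z ^ e b) has_sum \<Phi> z) B"
    using has_sum_reindex_bij_betw[OF assms(1), of "\<lambda>b. of_real (c b) * z ^ e b"] by simp
qed

lemma gen_fun_cong:
  assumes "gen_fun r A c e \<Phi>" "\<And>a. a \<in> A \<Longrightarrow> c a = c' a" "\<And>a. a \<in> A \<Longrightarrow> e a = e' a"
    "\<And>z. norm z < r \<Longrightarrow> \<Phi> z = \<Phi>' z"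
  shows "gen_fun r A c' e' \<Phi>'"
  unfolding gen_fun_def
proof (intro conjI ballI allI impI)
  show "0 \<le> c' a" if "a \<in> A" for a using gen_fun_nonneg[OF assms(1) that] assms(2)[OF that] by simp
  show "((\<lambda>a. of_real (c' a) * z ^ e' a) has_sum \<Phi>' z) A" if z: "norm z < r" for z
    using gfsD[OF assms(1) z] unfolding assms(4)[OF z]
    by (rule has_sum_cong[THEN iffD1, rotated]) (simp add: assms(2,3))
qed

lemma gen_fun_fibres:
  assumes f: "f ` B \<subseteq> A" and outer: "gen_fun r A C E \<Psi>"
    and inner: "\<And>x. x \<in> A \<Longrightarrow> gen_fun r {y \<in> B. f y = x} c e (\<lambda>z. of_real (C x) * z ^ E x * \<Phi> z)"
  shows "gen_fun r B c e (\<lambda>z. \<Psi> z * \<Phi> z)"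
proof (rule gen_fun_reindex)
  show "bij_betw snd (Sigma A (\<lambda>x. {y \<in> B. f y = x})) B"
  proof (rule bij_betwI[of _ _ _ "\<lambda>y. (f y, y)"])
    show "snd \<in> (SIGMA x:A. {y \<in> B. f y = x}) \<rightarrow> B" by auto
    show "(\<lambda>y. (f y, y)) \<in> B \<rightarrow> (SIGMA x:A. {y \<in> B. f y = x})" using f by auto
  qed auto
  show "gen_fun r (Sigma A (\<lambda>x. {y \<in> B. f y = x})) (\<lambda>a. c (snd a)) (\<lambda>a. e (snd a)) (\<lambda>z. \<Psi> z * \<Phi> z)"
    by (rule gen_fun_Sigma[OF outer]) (use inner in simp)
qed

text \<open>The transfer used for subgroups over pairs \<open>(K, a)\<close>, for these over triples
  \<open>(M, a, N)\<close>, and for lattices over words: weight and exponent are constant on each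
  finite fibre, whose size enters the coefficient.\<close>

lemma gen_fun_finite_fibres:
  assumes f: "f ` B \<subseteq> A" and outer: "gen_fun r A C E \<Psi>"
    and fin: "\<And>x. x \<in> A \<Longrightarrow> finite {y \<in> B. f y = x}"
    and C: "\<And>x. x \<in> A \<Longrightarrow> real (card {y \<in> B. f y = x}) * c' x = C x"
    and c: "\<And>y. y \<in> B \<Longrightarrow> c y = c' (f y)" and c'0: "\<And>x. x \<in> A \<Longrightarrow> 0 \<le> c' x"
    and e: "\<And>y. y \<in> B \<Longrightarrow> e y = E (f y)"
  shows "gen_fun r B c e \<Psi>"
proof -
  have "gen_fun r B c e (\<lambda>z. \<Psi> z * 1)"
  proof (rule gen_fun_fibres[OF f outer])
    fix x assume x: "x \<in> A"
    show "gen_fun r {y \<in> B. f y = x} c e (\<lambda>z. of_real (C x) * z ^ E x * 1)"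
      unfolding gen_fun_def
    proof (intro conjI ballI allI impI)
      show "0 \<le> c y" if "y \<in> {y \<in> B. f y = x}" for y using that c c'0 x by auto
      fix z :: complex
      have "(\<Sum>y\<in>{y \<in> B. f y = x}. of_real (c y) * z ^ e y)
          = (\<Sum>y\<in>{y \<in> B. f y = x}. of_real (c' x) * z ^ E x)"
        by (intro sum.cong refl) (auto simp: c e)
      also have "\<dots> = of_real (C x) * z ^ E x"
        unfolding C[OF x, symmetric] by simp
      finally show "((\<lambda>y. of_real (c y) * z ^ e y) has_sum of_real (C x) * z ^ E x * 1) {y \<in> B. f y = x}"
        using fin[OF x] by (simp add: has_sum_finite_iff)
    qed
  qed
  then show ?thesis by simp
qed

lemma gen_fun_powers:
  assumes "b \<ge> 0" "b * r \<le> 1"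
  shows "gen_fun r UNIV (\<lambda>a. b ^ a) (\<lambda>a. a) (\<lambda>z. 1 / (1 - of_real b * z))"
  unfolding gen_fun_def
proof (intro conjI ballI allI impI)
  show "0 \<le> b ^ a" for a using assms(1) by simp
  fix z :: complex assume z: "norm z < r"
  have "b * norm z < 1"
  proof (cases "b = 0")
    case False
    then have "b * norm z < b * r" using z assms(1) by (intro mult_strict_left_mono) auto
    then show ?thesis using assms(2) by simp
  qed simp
  then have "norm (of_real b * z) < 1" using assms(1) by (simp add: norm_mult)
  from has_sum_geometric[OF this]
  show "((\<lambda>a. of_real (b ^ a) * z ^ a) has_sum 1 / (1 - of_real b * z)) UNIV"
    by (simp add: power_mult_distrib)
qed

context twist
begin

text \<open>The extra factor \<open>p^log_idx\<close> is the number of cosets found in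
  \<open>card_fibre\<close>. The shift \<open>t\<close> is free because the induction on the rank of
  a lattice raises it.\<close>

lemma gen_fun_TG:
  assumes p: "prime p"
    and outer: "gen_fun r (pairs p) (\<lambda>(K, a). real p ^ (t * (log_idx p B K + a)) * real p ^ log_idx p B K)
      (\<lambda>(K, a). log_idx p B K + a) \<Psi>"
  shows "gen_fun r (TGP p) (\<lambda>H. real p ^ (t * multiplicity p (subgroup_index TG H)))
    (\<lambda>H. multiplicity p (subgroup_index TG H)) \<Psi>"
proof (rule gen_fun_finite_fibres[where f = "\<lambda>H. (ker H, expo p H)", OF _ outer])
  show "(\<lambda>H. (ker H, expo p H)) ` TGP p \<subseteq> pairs p"
    using TGP_props(2,4)[OF p] by (auto simp: pairs_def)
  have mult: "multiplicity p (subgroup_index TG H) = log_idx p B (ker H) + expo p H" if "H \<in> TGP p" for H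
    unfolding TGP_props(3)[OF p that] using p prime_gt_1_nat[OF p] by simp
  show "real p ^ (t * multiplicity p (subgroup_index TG H))
      = (\<lambda>(K, a). real p ^ (t * (log_idx p B K + a))) (ker H, expo p H)" if "H \<in> TGP p" for H
    using mult[OF that] by simp
  show "multiplicity p (subgroup_index TG H) = (\<lambda>(K, a). log_idx p B K + a) (ker H, expo p H)"
    if "H \<in> TGP p" for H
    using mult[OF that] by simp
  show "0 \<le> (\<lambda>(K, a). real p ^ (t * (log_idx p B K + a))) x" for x by (cases x) simp
  fix x assume x: "x \<in> pairs p"
  obtain K a where Ka: "x = (K, a)" by (cases x)
  have K: "K \<in> p_sub p B" using x by (simp add: Ka pairs_def)
  have eq: "{H \<in> TGP p. (ker H, expo p H) = x} = {H \<in> TGP p. ker H = K \<and> expo p H = a}"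
    by (auto simp: Ka)
  have "(K, a) \<in> pairs p" using x Ka by simp
  note bij = card_fibre[OF p this]
  have idx: "idx B K = p ^ log_idx p B K" by (rule idx_log_idx[OF p K])
  have "finite (cosets B K)" using idx prime_gt_0_nat[OF p] by (intro idx_pos_finite) simp
  then show "finite {H \<in> TGP p. (ker H, expo p H) = x}"
    unfolding eq using bij_betw_finite[OF bij] by simp
  have "card {H \<in> TGP p. (ker H, expo p H) = x} = p ^ log_idx p B K"
    unfolding eq idx[symmetric] idx_def by (rule bij_betw_same_card[OF bij])
  then show "real (card {H \<in> TGP p. (ker H, expo p H) = x}) * (\<lambda>(K, a). real p ^ (t * (log_idx p B K + a))) x
      = (\<lambda>(K, a). real p ^ (t * (log_idx p B K + a)) * real p ^ log_idx p B K) x"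
    by (simp add: Ka)
qed

end

section \<open>The zeta function of the lattice \<open>\<int>^m\<close>\<close>

definition D0 :: "int \<Rightarrow> 'a::ab_group_add \<Rightarrow> 'a" where "D0 c b = 0"

lemma twist_D0: "addsub B \<Longrightarrow> twist B D0"
  by (rule twist.intro) (simp_all add: D0_def addsub_zero)

lemma Zpow_iff: "f \<in> Zpow m \<longleftrightarrow> (\<forall>i\<ge>m. f i = 0)"
  by (simp add: Zpow_def)

text \<open>With trivial action the semidirect product is \<open>\<int>^(m+1)\<close>, so the count
  of its subgroups also yields the zeta function of a lattice by induction on the rank.\<close>

lemma Zpow_Suc_iso:
  "(\<lambda>(x, c). x(m := c)) \<in> iso (twist.TG (Zpow m) D0) (addg (Zpow (Suc m)))"
proof -
  interpret T: twist "Zpow m" D0 by (rule twist_D0[OF addsub_Zpow])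
  let ?h = "\<lambda>(x :: ivec, c). x(m := c)"
  have "?h \<in> hom T.TG (addg (Zpow (Suc m)))"
  proof (rule homI)
    fix s assume "s \<in> carrier T.TG"
    then obtain x c where s: "s = (x, c)" "x \<in> Zpow m" by (cases s) simp
    then show "?h s \<in> carrier (addg (Zpow (Suc m)))" by (simp add: Zpow_iff)
    fix s' assume "s' \<in> carrier T.TG"
    then obtain x' c' where s': "s' = (x', c')" "x' \<in> Zpow m" by (cases s') simp
    have "(x + x')(m := c + c') = x(m := c) + x'(m := c')" by (rule ext) simp
    then show "?h (s \<otimes>\<^bsub>T.TG\<^esub> s') = ?h s \<otimes>\<^bsub>addg (Zpow (Suc m))\<^esub> ?h s'"
      unfolding s s' T.TG_simps addg_simps prod.case D0_def by (simp only: add_0_right)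
  qed
  moreover have "bij_betw ?h (carrier T.TG) (carrier (addg (Zpow (Suc m))))"
  proof (rule bij_betwI[of _ _ _ "\<lambda>f. (f(m := 0), f m)"])
    show "?h \<in> carrier T.TG \<rightarrow> carrier (addg (Zpow (Suc m)))"
      by (rule Pi_I) (auto simp: Zpow_iff)
    show "(\<lambda>f. (f(m := 0), f m)) \<in> carrier (addg (Zpow (Suc m))) \<rightarrow> carrier T.TG"
      by (rule Pi_I) (auto simp: Zpow_iff)
    show "(\<lambda>f. (f(m := 0), f m)) (?h s) = s" if s: "s \<in> carrier T.TG" for s
    proof -
      obtain x c where x: "s = (x, c)" by (cases s)
      then have "x m = 0" using s by (simp add: Zpow_iff)
      then show ?thesis unfolding x by (simp add: fun_upd_idem)
    qed
    show "?h ((\<lambda>f. (f(m := 0), f m)) f) = f" if "f \<in> carrier (addg (Zpow (Suc m)))" for f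
      by (simp add: fun_upd_idem)
  qed
  ultimately show ?thesis by (simp add: iso_def)
qed

text \<open>With \<open>z = p^(-s)\<close> this is the product of the
  \<open>\<zeta>_p(s - t - i)\<close> for \<open>i < m\<close>; the value \<open>t = 1\<close> gives
  the first \<open>n - 1\<close> factors of the theorem.\<close>

definition lattice_zeta :: "nat \<Rightarrow> nat \<Rightarrow> nat \<Rightarrow> complex \<Rightarrow> complex"
  where "lattice_zeta p m t z = (\<Prod>i<m. 1 / (1 - of_nat p ^ (t + i) * z))"

text \<open>Induction on the rank. In a pair \<open>(K, a)\<close> the number of cosets raises the
  shift for \<open>K\<close> from \<open>t\<close> to \<open>t + 1\<close>, while the exponent
  \<open>a\<close> sums to the factor with shift \<open>t\<close>; hence \<open>t\<close> has to
  vary.\<close>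

lemma gen_fun_lattices:
  assumes p: "prime p"
  shows "real p ^ (t + m) * r \<le> 1 \<Longrightarrow>
    gen_fun r (p_sub p (Zpow m)) (\<lambda>N. real p ^ (t * log_idx p (Zpow m) N)) (log_idx p (Zpow m)) (lattice_zeta p m t)"
proof (induction m arbitrary: t)
  case 0
  have L0: "Zpow 0 = {0}" by (auto simp: Zpow_def zero_fun_def)
  have "p_sub p (Zpow 0) = {Zpow 0}"
  proof -
    have "K = Zpow 0" if "K \<in> p_sub p (Zpow 0)" for K
      using p_sub_D(2)[OF that] addsub_zero[OF p_sub_D(1)[OF that]] unfolding L0 by blast
    then show ?thesis using p_sub_self[OF addsub_Zpow, of 0 p] by blast
  qed
  moreover have "log_idx p (Zpow 0) (Zpow 0) = 0" using idx_self[OF addsub_Zpow, of 0] by (simp add: log_idx_def)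
  ultimately show ?case by (simp add: gen_fun_def lattice_zeta_def has_sum_finite_iff)
next
  case (Suc m)
  have r: "real p ^ (t + i) * r \<le> 1" if "i \<le> Suc m" for i
  proof (cases "r \<ge> 0")
    case True
    have "real p ^ (t + i) \<le> real p ^ (t + Suc m)"
      using that prime_gt_1_nat[OF p] by (intro power_increasing) auto
    then have "real p ^ (t + i) * r \<le> real p ^ (t + Suc m) * r" using True by (intro mult_right_mono)
    then show ?thesis using Suc.prems by linarith
  next
    case False
    then have "real p ^ (t + i) * r \<le> 0" by (intro mult_nonneg_nonpos) auto
    then show ?thesis by simp
  qed
  interpret T: twist "Zpow m" D0 by (rule twist_D0[OF addsub_Zpow])
  have pairs: "T.pairs p = p_sub p (Zpow m) \<times> UNIV"
    using addsub_zero p_sub_D(1)[of _ p "Zpow m"] by (auto simp: T.pairs_def T.stable_def D0_def)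
  have "gen_fun r (p_sub p (Zpow m) \<times> UNIV) (\<lambda>(K, a). real p ^ (t * (log_idx p (Zpow m) K + a)) * real p ^ log_idx p (Zpow m) K)
      (\<lambda>(K, a). log_idx p (Zpow m) K + a) (\<lambda>z. lattice_zeta p m (Suc t) z * (1 / (1 - of_real (real p ^ t) * z)))"
  proof (rule gen_fun_Sigma)
    show "gen_fun r (p_sub p (Zpow m)) (\<lambda>N. real p ^ (Suc t * log_idx p (Zpow m) N)) (log_idx p (Zpow m)) (lattice_zeta p m (Suc t))"
      by (rule Suc.IH) (use Suc.prems in simp)
    fix K
    have g: "gen_fun r UNIV (\<lambda>a. (real p ^ t) ^ a) (\<lambda>a. a) (\<lambda>z. 1 / (1 - of_real (real p ^ t) * z))"
      using r[of 0] by (intro gen_fun_powers) auto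
    let ?k = "log_idx p (Zpow m) K"
    show "gen_fun r UNIV (\<lambda>a. (\<lambda>(K, a). real p ^ (t * (log_idx p (Zpow m) K + a)) * real p ^ log_idx p (Zpow m) K) (K, a))
      (\<lambda>a. (\<lambda>(K, a). log_idx p (Zpow m) K + a) (K, a))
      (\<lambda>z. of_real (real p ^ (Suc t * ?k)) * z ^ ?k * (1 / (1 - of_real (real p ^ t) * z)))"
      unfolding gen_fun_def
    proof (intro conjI ballI allI impI)
      fix z :: complex assume "norm z < r"
      from has_sum_cmult_right[OF gfsD[OF g this], of "of_real (real p ^ (Suc t * ?k)) * z ^ ?k"]
      show "((\<lambda>a. of_real ((\<lambda>(K, a). real p ^ (t * (log_idx p (Zpow m) K + a)) * real p ^ log_idx p (Zpow m) K) (K, a))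
          * z ^ ((\<lambda>(K, a). log_idx p (Zpow m) K + a) (K, a))) has_sum
          of_real (real p ^ (Suc t * ?k)) * z ^ ?k * (1 / (1 - of_real (real p ^ t) * z))) UNIV"
        by (rule has_sum_cong[THEN iffD1, rotated])
           (simp add: power_add power_mult_distrib distrib_left mult_ac flip: power_mult)
    qed simp
  qed
  then have "gen_fun r (T.pairs p) (\<lambda>(K, a). real p ^ (t * (log_idx p (Zpow m) K + a)) * real p ^ log_idx p (Zpow m) K)
      (\<lambda>(K, a). log_idx p (Zpow m) K + a) (lattice_zeta p (Suc m) t)"
    unfolding pairs
  proof (rule gen_fun_cong)
    fix z :: complex
    show "lattice_zeta p m (Suc t) z * (1 / (1 - of_real (real p ^ t) * z)) = lattice_zeta p (Suc m) t z"
      unfolding lattice_zeta_def prod.lessThan_Suc_shift by (simp add: mult.commute)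
  qed auto
  note T = T.gen_fun_TG[OF p this]
  let ?h = "\<lambda>(x :: ivec, c). x(m := c)"
  note isoh = Zpow_Suc_iso[of m] T.group_TG group_addg[OF addsub_Zpow, of "Suc m"]
  have bij: "bij_betw ((`) ?h) (p_power_index_subgroups T.TG p) (p_sub p (Zpow (Suc m)))"
    using iso_PPI[OF isoh, of p] unfolding PPI_addg[OF addsub_Zpow] .
  have lg: "log_idx p (Zpow (Suc m)) (?h ` H) = multiplicity p (subgroup_index T.TG H)"
    if "H \<in> p_power_index_subgroups T.TG p" for H
    using iso_subgroup_index(2)[OF isoh, of H] that
    by (simp add: p_power_index_subgroups_def subgroup_index_addg log_idx_def)
  show ?case
    by (rule gen_fun_reindex[OF bij], rule gen_fun_cong[OF T]) (simp_all add: lg)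
qed

section \<open>Subgroups of \<open>\<int>\<^sup>m \<times> \<int>\<^sup>m\<close>\<close>

text \<open>\<open>vert_part K\<close> and \<open>base_part K\<close> are the lattices
  \<open>M\<close> and \<open>N\<close> of the overview.\<close>

definition vert_part :: "(ivec \<times> ivec) set \<Rightarrow> ivec set" where "vert_part K = {w. (0, w) \<in> K}"
definition base_part :: "(ivec \<times> ivec) set \<Rightarrow> ivec set" where "base_part K = fst ` K"

lemma additive_Pair0: "Modules.additive (\<lambda>w::ivec. (0::ivec, w))"
  by (rule Modules.additive.intro) (simp only: add_Pair add_0_right)

lemma additive_fst: "Modules.additive (fst :: ivec \<times> ivec \<Rightarrow> ivec)"
  by (rule Modules.additive.intro) (rule fst_add)

lemma addsub_vert_part: "addsub K \<Longrightarrow> addsub (vert_part K)"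
  using addsub_vimage[OF additive_Pair0, of K] by (simp add: vert_part_def vimage_def)

lemma addsub_base_part: "addsub K \<Longrightarrow> addsub (base_part K)"
  unfolding base_part_def by (rule addsub_image[OF additive_fst])

lemma vert_part_subset: "K \<subseteq> Zpow2 m \<Longrightarrow> vert_part K \<subseteq> Zpow m" by (auto simp: vert_part_def Zpow2_def)
lemma base_part_subset: "K \<subseteq> Zpow2 m \<Longrightarrow> base_part K \<subseteq> Zpow m" by (auto simp: base_part_def Zpow2_def)

lemma addsub_Zpow2: "addsub (Zpow2 m)"
  unfolding Zpow2_def by (rule addsub_Times[OF addsub_Zpow addsub_Zpow])

text \<open>The intermediate group is \<open>N \<times> L\<close>. Its own index is that of
  \<open>N\<close> in \<open>L\<close>; and it equals \<open>K\<close> plus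
  \<open>0 \<times> L\<close>, so the index of \<open>K\<close> in it is that of
  \<open>0 \<times> M\<close> in \<open>0 \<times> L\<close>.\<close>

lemma idx_Zpow2:
  assumes K: "addsub K" "K \<subseteq> Zpow2 m"
  shows "idx (Zpow2 m) K = idx (Zpow m) (base_part K) * idx (Zpow m) (vert_part K)"
proof -
  let ?L = "Zpow m" and ?N = "base_part K" and ?M = "vert_part K"
  let ?S = "?N \<times> ?L" and ?Z = "(\<lambda>w::ivec. (0::ivec, w)) ` ?L"
  have S: "addsub ?S" by (rule addsub_Times[OF addsub_base_part[OF K(1)] addsub_Zpow])
  have KS: "K \<subseteq> ?S" using K(2) by (force simp: base_part_def Zpow2_def)
  have SB: "?S \<subseteq> Zpow2 m" using base_part_subset[OF K(2)] by (auto simp: Zpow2_def)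
  have 1: "idx (Zpow2 m) ?S = idx ?L ?N"
  proof -
    have "idx (Zpow2 m) ?S = card ((\<lambda>x. (+) (fst x) ` ?N) ` Zpow2 m)"
      unfolding idx_def cosets_def
    proof (rule card_image_cong_iff)
      fix x y assume xy: "x \<in> Zpow2 m" "y \<in> Zpow2 m"
      then have "snd x - snd y \<in> ?L" by (intro addsub_diff[OF addsub_Zpow]) (auto simp: Zpow2_def)
      then have "x - y \<in> ?S \<longleftrightarrow> fst x - fst y \<in> ?N"
        unfolding mem_Times_iff fst_diff snd_diff by simp
      then show "(+) x ` ?S = (+) y ` ?S \<longleftrightarrow> (+) (fst x) ` ?N = (+) (fst y) ` ?N"
        unfolding coset_eq_iff[OF S] coset_eq_iff[OF addsub_base_part[OF K(1)]] .
    qed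
    also have "(\<lambda>x. (+) (fst x) ` ?N) ` Zpow2 m = (\<lambda>u. (+) u ` ?N) ` fst ` Zpow2 m"
      unfolding image_image ..
    also have "fst ` Zpow2 m = ?L" using addsub_zero[OF addsub_Zpow, of m] by (auto simp: Zpow2_def)
    finally show ?thesis by (simp only: idx_def cosets_def)
  qed
  have Z: "addsub ?Z" by (rule addsub_image[OF additive_Pair0 addsub_Zpow])
  have ZS: "ssum ?Z K = ?S"
  proof (intro equalityI subsetI)
    fix x assume "x \<in> ssum ?Z K"
    then obtain w k where x: "w \<in> ?L" "k \<in> K" "x = (0, w) + k" unfolding in_ssum by blast
    have "(0, w) \<in> ?S" using x(1) addsub_zero[OF addsub_base_part[OF K(1)]] by simp
    then show "x \<in> ?S" unfolding x(3) using KS x(2) by (intro addsub_add[OF S]) blast+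
  next
    fix x assume x: "x \<in> ?S"
    then obtain k where k: "k \<in> K" "fst x = fst k" unfolding base_part_def by fastforce
    have "snd k \<in> ?L" "snd x \<in> ?L" using k(1) KS x by auto
    then have "snd x - snd k \<in> ?L" by (intro addsub_diff[OF addsub_Zpow])
    moreover have "x = (0, snd x - snd k) + k" using k(2) by (simp add: prod_eq_iff)
    ultimately show "x \<in> ssum ?Z K" unfolding in_ssum using k(1) by blast
  qed
  have ZK: "?Z \<inter> K = (\<lambda>w. (0, w)) ` ?M" using vert_part_subset[OF K(2)] by (auto simp: vert_part_def)
  have "idx ?S K = idx ?Z (?Z \<inter> K)" using idx_ssum[OF Z K(1)] unfolding ZS .
  also have "\<dots> = idx ?L ?M"
    unfolding ZK by (rule idx_image[OF additive_Pair0 _ addsub_Zpow addsub_vert_part[OF K(1)] vert_part_subset[OF K(2)]])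
      (simp add: inj_on_def)
  finally have 2: "idx ?S K = idx ?L ?M" .
  show ?thesis using idx_mult[OF K(1) S addsub_Zpow2 KS SB] unfolding 1 2 .
qed

lemma p_sub_Zpow2:
  assumes p: "prime p" and K: "K \<in> p_sub p (Zpow2 m)"
  shows "vert_part K \<in> p_sub p (Zpow m)" "base_part K \<in> p_sub p (Zpow m)"
    "log_idx p (Zpow2 m) K = log_idx p (Zpow m) (vert_part K) + log_idx p (Zpow m) (base_part K)"
proof -
  note K' = p_sub_D[OF K]
  have eq: "idx (Zpow m) (base_part K) * idx (Zpow m) (vert_part K) = p ^ log_idx p (Zpow2 m) K"
    using idx_Zpow2[OF K'] idx_log_idx[OF p K] by simp
  show M: "vert_part K \<in> p_sub p (Zpow m)"
    using power_prime_factors(2)[OF p eq] addsub_vert_part[OF K'(1)] vert_part_subset[OF K'(2)] by (simp add: p_sub_def)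
  show N: "base_part K \<in> p_sub p (Zpow m)"
    using power_prime_factors(1)[OF p eq] addsub_base_part[OF K'(1)] base_part_subset[OF K'(2)] by (simp add: p_sub_def)
  have "p ^ (log_idx p (Zpow m) (base_part K) + log_idx p (Zpow m) (vert_part K)) = p ^ log_idx p (Zpow2 m) K"
    using eq unfolding idx_log_idx[OF p M] idx_log_idx[OF p N] power_add .
  then show "log_idx p (Zpow2 m) K = log_idx p (Zpow m) (vert_part K) + log_idx p (Zpow m) (base_part K)"
    using prime_gt_1_nat[OF p] by (simp add: power_inject_exp)
qed

lemma p_sub_basisE:
  assumes p: "prime p" and N: "N \<in> p_sub p (Zpow m)"
  obtains F where "Modules.additive F" "inj_on F (Zpow m)" "F ` Zpow m = N"
proof -
  note N' = p_sub_D[OF N]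
  have pos: "idx (Zpow m) N > 0" using idx_log_idx[OF p N] prime_gt_0_nat[OF p] by simp
  then have q: "int (idx (Zpow m) N) > 0" by simp
  have "scale (int (idx (Zpow m) N)) ` Zpow m \<subseteq> N" using scale_idx_mem[OF addsub_Zpow N' pos] by blast
  from sublattice_basis[OF N' q this] show thesis using that by blast
qed

lemma slice_eq_coset:
  assumes K: "addsub K" and w0: "(u, w0) \<in> K"
  shows "{w. (u, w) \<in> K} = (+) w0 ` vert_part K"
proof (intro equalityI subsetI)
  fix w assume "w \<in> {w. (u, w) \<in> K}"
  then have "(u, w) - (u, w0) \<in> K" using addsub_diff[OF K _ w0] by blast
  then have "w - w0 \<in> vert_part K" by (simp add: vert_part_def zero_prod_def)
  then show "w \<in> (+) w0 ` vert_part K" by (simp only: coset_mem)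
next
  fix w assume "w \<in> (+) w0 ` vert_part K"
  then have "(0, w - w0) \<in> K" by (simp only: coset_mem vert_part_def mem_Collect_eq)
  from addsub_add[OF K this w0] show "w \<in> {w. (u, w) \<in> K}" by simp
qed

text \<open>Such a \<open>K\<close> is the graph of a homomorphism from \<open>N\<close> to
  \<open>L/M\<close>. As \<open>N\<close> is free with basis \<open>F (std_vec i)\<close>, it
  amounts to a free choice of \<open>m\<close> cosets of \<open>M\<close>.\<close>

lemma card_fibre_MN:
  assumes p: "prime p" and M: "M \<in> p_sub p (Zpow m)" and N: "N \<in> p_sub p (Zpow m)"
  shows "finite {K \<in> p_sub p (Zpow2 m). vert_part K = M \<and> base_part K = N}" (is "finite ?F")
    and "card {K \<in> p_sub p (Zpow2 m). vert_part K = M \<and> base_part K = N} = p ^ (m * log_idx p (Zpow m) M)"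
proof -
  note M' = p_sub_D[OF M] and N' = p_sub_D[OF N]
  obtain F where F: "Modules.additive F" "inj_on F (Zpow m)" "F ` Zpow m = N"
    using p_sub_basisE[OF p N] .
  have F0: "F 0 = 0" by (rule Modules.additive.zero[OF F(1)])
  \<comment> \<open>The linear map with value \<open>c i\<close> at the \<open>i\<close>-th standard
    vector. In \<open>KK c\<close> below, the coset of \<open>M\<close> over \<open>F f\<close> is
    that of \<open>S c f\<close>.\<close>
  define S where "S c f = (\<Sum>i<m. scale (f i) (c i))" for c :: "nat \<Rightarrow> ivec" and f :: ivec
  have addS: "Modules.additive (S c)" for c
    by (rule Modules.additive.intro) (simp only: S_def plus_fun_apply scale_add sum.distrib)
  have Sdl: "S c (std_vec i) = c i" if i: "i < m" for c i
  proof -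
    have "S c (std_vec i) = (\<Sum>j<m. if j = i then c j else 0)"
      unfolding S_def by (intro sum.cong refl) (simp add: std_vec_def)
    also have "\<dots> = c i" using i by simp
    finally show ?thesis .
  qed
  have SL: "S c f \<in> Zpow m" if "\<And>i. i < m \<Longrightarrow> c i \<in> Zpow m" for c f
    unfolding S_def using that by (intro addsub_sum[OF addsub_Zpow] scale_closed[OF addsub_Zpow]) auto
  define KK where "KK c = (\<lambda>x. (F (fst x), S c (fst x) + snd x)) ` (Zpow m \<times> M)" for c
  have addKK: "addsub (KK c)" for c
    unfolding KK_def
  proof (rule addsub_image[OF _ addsub_Times[OF addsub_Zpow M'(1)]])
    show "Modules.additive (\<lambda>x. (F (fst x), S c (fst x) + snd x))"
      by (rule Modules.additive.intro)
        (simp only: fst_add snd_add Modules.additive.add[OF F(1)] Modules.additive.add[OF addS] add_Pair ac_simps)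
  qed
  have memKK: "(F f, S c f + w) \<in> KK c" if "f \<in> Zpow m" "w \<in> M" for f w c
    unfolding KK_def using that by (intro image_eqI[of _ _ "(f, w)"]) simp_all
  have KK: "KK c \<in> ?F" if c: "\<And>i. i < m \<Longrightarrow> c i \<in> Zpow m" for c
  proof -
    have sub: "KK c \<subseteq> Zpow2 m"
    proof
      fix y assume "y \<in> KK c"
      then obtain f w where y: "f \<in> Zpow m" "w \<in> M" "y = (F f, S c f + w)" unfolding KK_def by auto
      have "F f \<in> Zpow m" using F(3) N'(2) y(1) by blast
      moreover have "S c f + w \<in> Zpow m"
      proof (rule addsub_add[OF addsub_Zpow])
        show "S c f \<in> Zpow m" by (rule SL) (rule c)
        show "w \<in> Zpow m" using M'(2) y(2) by blast
      qed
      ultimately show "y \<in> Zpow2 m" unfolding y(3) by (simp add: Zpow2_iff)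
    qed
    have NKK: "base_part (KK c) = N"
    proof -
      have "base_part (KK c) = F ` fst ` (Zpow m \<times> M)" unfolding base_part_def KK_def image_image by simp
      also have "fst ` (Zpow m \<times> M) = Zpow m" using addsub_zero[OF M'(1)] by force
      finally show ?thesis using F(3) by simp
    qed
    have MKK: "vert_part (KK c) = M"
    proof (intro equalityI subsetI)
      fix w' assume "w' \<in> vert_part (KK c)"
      then have "(0, w') \<in> KK c" by (simp only: vert_part_def mem_Collect_eq)
      then obtain f w where f: "f \<in> Zpow m" "w \<in> M" "0 = F f" "w' = S c f + w" unfolding KK_def by auto
      have "f = 0" using inj_onD[OF F(2) _ f(1) addsub_zero[OF addsub_Zpow]] f(3) F0 by simp
      then show "w' \<in> M" using f Modules.additive.zero[OF addS] by simp
    next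
      fix w assume "w \<in> M"
      from memKK[OF addsub_zero[OF addsub_Zpow] this, of c] show "w \<in> vert_part (KK c)"
        unfolding F0 Modules.additive.zero[OF addS] add_0_left by (simp only: vert_part_def mem_Collect_eq)
    qed
    have "idx (Zpow2 m) (KK c) = p ^ (log_idx p (Zpow m) N + log_idx p (Zpow m) M)"
      unfolding idx_Zpow2[OF addKK sub] NKK MKK idx_log_idx[OF p M] idx_log_idx[OF p N] power_add ..
    then show ?thesis using addKK sub NKK MKK unfolding p_sub_def by blast
  qed
  have det: "K = KK c" if K: "K \<in> ?F" and c: "\<And>i. i < m \<Longrightarrow> (F (std_vec i), c i) \<in> K" for K c
  proof -
    have KP: "K \<in> p_sub p (Zpow2 m)" and aK2: "vert_part K = M" "base_part K = N" using K by simp_all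
    note aK = p_sub_D(1)[OF KP] aK2
    have addh: "Modules.additive (\<lambda>f. (F f, S c f))"
      by (rule Modules.additive.intro)
        (simp only: Modules.additive.add[OF F(1)] Modules.additive.add[OF addS] add_Pair)
    have "Zpow m \<subseteq> (\<lambda>f. (F f, S c f)) -` K"
    proof (rule Zpow_subset_if_std_vec[OF addsub_vimage[OF addh aK(1)]])
      fix i assume i: "i < m"
      show "std_vec i \<in> (\<lambda>f. (F f, S c f)) -` K" unfolding vimage_eq Sdl[OF i] by (rule c[OF i])
    qed
    then have hK: "(F f, S c f) \<in> K" if "f \<in> Zpow m" for f using that by (rule subsetD[THEN vimageD])
    show "K = KK c"
    proof (intro equalityI subsetI)
      fix x assume x: "x \<in> K"
      have "fst x \<in> fst ` K" using x by (rule imageI)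
      then have "fst x \<in> F ` Zpow m" using aK(3) F(3) unfolding base_part_def by simp
      then obtain f where f: "f \<in> Zpow m" "fst x = F f" by (elim imageE)
      have "x - (F f, S c f) \<in> K" by (rule addsub_diff[OF aK(1) x hK[OF f(1)]])
      moreover have "x - (F f, S c f) = (0, snd x - S c f)" using f(2) by (simp add: prod_eq_iff)
      ultimately have "snd x - S c f \<in> M" unfolding aK(2)[symmetric] vert_part_def by simp
      note memKK[OF f(1) this, of c]
      moreover have "x = (F f, S c f + (snd x - S c f))" using f(2) by (simp add: prod_eq_iff)
      ultimately show "x \<in> KK c" by (simp only:)
    next
      fix x assume "x \<in> KK c"
      then obtain f w where x: "f \<in> Zpow m" "w \<in> M" "x = (F f, S c f + w)" unfolding KK_def by auto
      have "(0, w) \<in> K" using x(2) unfolding aK(2)[symmetric] vert_part_def by simp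
      from addsub_add[OF aK(1) hK[OF x(1)] this] show "x \<in> K" unfolding x(3) by simp
    qed
  qed
  \<comment> \<open>The values of the homomorphism on the basis of \<open>N\<close>, as the cosets
    of \<open>M\<close> that lie over the basis vectors.\<close>
  define \<Psi> where "\<Psi> K = restrict (\<lambda>i. {w. (F (std_vec i), w) \<in> K}) {..<m}" for K :: "(ivec \<times> ivec) set"
  have exc: "\<exists>c. (\<forall>i<m. (F (std_vec i), c i) \<in> K)" if K: "K \<in> ?F" for K
  proof -
    have "\<exists>w. (F (std_vec i), w) \<in> K" if i: "i < m" for i
    proof -
      have "F (std_vec i) \<in> N" using F(3) std_vec_Zpow[OF i] by blast
      then have "F (std_vec i) \<in> fst ` K" using K by (simp add: base_part_def)
      then show ?thesis by (metis imageE prod.collapse)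
    qed
    then show ?thesis by metis
  qed
  have bij: "bij_betw \<Psi> ?F (PiE {..<m} (\<lambda>_. cosets (Zpow m) M))"
    unfolding bij_betw_def
  proof
    show "inj_on \<Psi> ?F"
    proof (rule inj_onI)
      fix K K' assume K: "K \<in> ?F" and K': "K' \<in> ?F" and eq: "\<Psi> K = \<Psi> K'"
      obtain c where c: "\<And>i. i < m \<Longrightarrow> (F (std_vec i), c i) \<in> K" using exc[OF K] by blast
      have c': "(F (std_vec i), c i) \<in> K'" if i: "i < m" for i
      proof -
        have "{w. (F (std_vec i), w) \<in> K} = {w. (F (std_vec i), w) \<in> K'}"
          using fun_cong[OF eq, of i] i by (simp add: \<Psi>_def)
        then show ?thesis using c[OF i] by blast
      qed
      have "K = KK c" by (rule det[OF K c])
      moreover have "K' = KK c" by (rule det[OF K' c'])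
      ultimately show "K = K'" by simp
    qed
    show "\<Psi> ` ?F = PiE {..<m} (\<lambda>_. cosets (Zpow m) M)"
    proof (intro equalityI subsetI)
      fix C assume "C \<in> \<Psi> ` ?F"
      then obtain K where K: "K \<in> ?F" "C = \<Psi> K" by (elim imageE)
      obtain c where c: "\<And>i. i < m \<Longrightarrow> (F (std_vec i), c i) \<in> K" using exc[OF K(1)] by blast
      have KP: "K \<in> p_sub p (Zpow2 m)" and aK2: "vert_part K = M" using K(1) by simp_all
      note aK = p_sub_D(1)[OF KP] aK2 p_sub_D(2)[OF KP]
      have "{w. (F (std_vec i), w) \<in> K} \<in> cosets (Zpow m) M" if i: "i < m" for i
      proof -
        have "c i \<in> Zpow m" using c[OF i] aK(3) by (auto simp: Zpow2_iff)
        then show ?thesis unfolding slice_eq_coset[OF aK(1) c[OF i]] aK(2) cosets_def by blast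
      qed
      then show "C \<in> PiE {..<m} (\<lambda>_. cosets (Zpow m) M)"
        unfolding K(2) \<Psi>_def by (simp add: restrict_PiE_iff)
    next
      fix C assume C: "C \<in> PiE {..<m} (\<lambda>_. cosets (Zpow m) M)"
      have "\<exists>w\<in>Zpow m. C i = (+) w ` M" if i: "i < m" for i
        using PiE_mem[OF C, of i] i by (auto simp: cosets_def)
      then obtain c where c: "\<And>i. i < m \<Longrightarrow> c i \<in> Zpow m \<and> C i = (+) (c i) ` M" by metis
      have K: "KK c \<in> ?F" by (rule KK) (use c in blast)
      have "\<Psi> (KK c) = C"
      proof
        fix i show "\<Psi> (KK c) i = C i"
        proof (cases "i < m")
          case True
          have "(F (std_vec i), S c (std_vec i) + 0) \<in> KK c" by (rule memKK[OF std_vec_Zpow[OF True] addsub_zero[OF M'(1)]])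
          then have "(F (std_vec i), c i) \<in> KK c" unfolding Sdl[OF True] add_0_right .
          note slice_eq_coset[OF addKK this]
          moreover have "vert_part (KK c) = M" using K by blast
          ultimately have "{w. (F (std_vec i), w) \<in> KK c} = C i" using c[OF True] by (simp only:)
          then show ?thesis using True by (simp only: \<Psi>_def restrict_apply lessThan_iff if_True)
        next
          case False
          then show ?thesis using PiE_arb[OF C, of i] by (simp only: \<Psi>_def restrict_apply lessThan_iff if_False not_False_eq_True)
        qed
      qed
      then show "C \<in> \<Psi> ` ?F" using K by (intro image_eqI[where f = \<Psi> and x = "KK c"]) (rule sym)
    qed
  qed
  have idx: "idx (Zpow m) M = p ^ log_idx p (Zpow m) M" by (rule idx_log_idx[OF p M])
  have fin: "finite (cosets (Zpow m) M)" using idx prime_gt_0_nat[OF p] by (intro idx_pos_finite) simp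
  have "finite (PiE {..<m} (\<lambda>_. cosets (Zpow m) M))" using fin by (intro finite_PiE) auto
  then show "finite ?F" unfolding bij_betw_finite[OF bij] .
  have "card ?F = card (PiE {..<m} (\<lambda>_. cosets (Zpow m) M))" by (rule bij_betw_same_card[OF bij])
  also have "\<dots> = card (cosets (Zpow m) M) ^ m" by (simp add: card_PiE)
  also have "card (cosets (Zpow m) M) = p ^ log_idx p (Zpow m) M" using idx unfolding idx_def .
  finally show "card ?F = p ^ (m * log_idx p (Zpow m) M)" by (simp add: power_mult[symmetric] mult.commute)
qed

lemma stable_iff:
  assumes K: "K \<in> p_sub p (Zpow2 m)"
  shows "twist.stable twist_map p K a \<longleftrightarrow> base_part K \<subseteq> colon p m a (vert_part K)"
proof -
  interpret T: twist "Zpow2 m" twist_map by (rule twist_Zpow2)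
  note K' = p_sub_D[OF K]
  have "twist_map (int (p ^ a)) k \<in> K \<longleftrightarrow> scale (int (p ^ a)) (fst k) \<in> vert_part K" for k
  proof -
    have "twist_map (int (p ^ a)) k \<in> K \<longleftrightarrow> - scale (int (p ^ a)) (fst k) \<in> vert_part K"
      by (simp only: twist_map_def vert_part_def mem_Collect_eq)
    also have "\<dots> \<longleftrightarrow> scale (int (p ^ a)) (fst k) \<in> vert_part K"
      using addsub_uminus[OF addsub_vert_part[OF K'(1)]] by (metis minus_minus)
    finally show ?thesis .
  qed
  then have "T.stable p K a \<longleftrightarrow> (\<forall>u\<in>base_part K. scale (int (p ^ a)) u \<in> vert_part K)"
    unfolding T.stable_def base_part_def by simp
  also have "\<dots> \<longleftrightarrow> base_part K \<subseteq> colon p m a (vert_part K)"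
    using base_part_subset[OF K'(2)] unfolding colon_def by blast
  finally show ?thesis .
qed

text \<open>A basis of \<open>U\<close> carries the sublattices of \<open>L\<close> to those of
  \<open>U\<close> and adds the exponent of \<open>U\<close> to theirs, so the sum is a monomial
  times the zeta function of the full lattice. The constants \<open>c0\<close> and \<open>e0\<close>
  carry the weight of the outer pair \<open>(M, a)\<close>.\<close>

lemma gen_fun_sublattices:
  assumes p: "prime p" and U: "U \<in> p_sub p (Zpow m)" and r: "real p ^ (1 + m) * r \<le> 1"
    and c0: "c0 \<ge> 0"
  shows "gen_fun r {N \<in> p_sub p (Zpow m). N \<subseteq> U} (\<lambda>N. c0 * real p ^ log_idx p (Zpow m) N) (\<lambda>N. log_idx p (Zpow m) N + e0)
    (\<lambda>z. of_real (c0 * real p ^ log_idx p (Zpow m) U) * z ^ (log_idx p (Zpow m) U + e0) * lattice_zeta p m 1 z)"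
proof -
  note U' = p_sub_D[OF U]
  obtain F where F: "Modules.additive F" "inj_on F (Zpow m)" "F ` Zpow m = U"
    using p_sub_basisE[OF p U] .
  let ?u = "log_idx p (Zpow m) U"
  have idxF: "idx U (F ` N) = idx (Zpow m) N" if "addsub N" "N \<subseteq> Zpow m" for N
    using idx_image[OF F(1,2) addsub_Zpow that] unfolding F(3) .
  have FPS: "F ` N \<in> p_sub p U" "F ` N \<subseteq> U" if N: "N \<in> p_sub p (Zpow m)" for N
  proof -
    have 1: "addsub (F ` N)" by (rule addsub_image[OF F(1) p_sub_D(1)[OF N]])
    show 2: "F ` N \<subseteq> U" using image_mono[OF p_sub_D(2)[OF N], of F] unfolding F(3) .
    have "idx U (F ` N) = p ^ log_idx p (Zpow m) N" unfolding idxF[OF p_sub_D[OF N]] by (rule idx_log_idx[OF p N])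
    then show "F ` N \<in> p_sub p U" using 1 2 unfolding p_sub_def by blast
  qed
  have lg: "log_idx p (Zpow m) (F ` N) = ?u + log_idx p (Zpow m) N" if N: "N \<in> p_sub p (Zpow m)" for N
  proof -
    have "F ` N \<in> p_sub p (Zpow m)" by (rule p_sub_trans[OF p addsub_Zpow U FPS(1)[OF N]])
    then have "log_idx p (Zpow m) (F ` N) = ?u + log_idx p U (F ` N)"
      using p_sub_between(3)[OF p addsub_Zpow _ U'(1) FPS(2)[OF N] U'(2)] by blast
    then show ?thesis using idxF[OF p_sub_D[OF N]] by (simp add: log_idx_def)
  qed
  have bij: "bij_betw ((`) F) (p_sub p (Zpow m)) {N \<in> p_sub p (Zpow m). N \<subseteq> U}"
    unfolding bij_betw_def
  proof
    show "inj_on ((`) F) (p_sub p (Zpow m))"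
    proof (rule inj_onI)
      fix N N' assume "N \<in> p_sub p (Zpow m)" "N' \<in> p_sub p (Zpow m)" "F ` N = F ` N'"
      then show "N = N'" using inj_on_image_eq_iff[OF F(2) p_sub_D(2)[of N p] p_sub_D(2)[of N' p]] by simp
    qed
    show "(`) F ` p_sub p (Zpow m) = {N \<in> p_sub p (Zpow m). N \<subseteq> U}"
    proof (intro equalityI subsetI)
      fix N assume "N \<in> (`) F ` p_sub p (Zpow m)"
      then obtain N0 where N0: "N0 \<in> p_sub p (Zpow m)" "N = F ` N0" by (elim imageE)
      show "N \<in> {N \<in> p_sub p (Zpow m). N \<subseteq> U}"
        unfolding N0(2) using p_sub_trans[OF p addsub_Zpow U FPS(1)[OF N0(1)]] FPS(2)[OF N0(1)] by simp
    next
      fix N assume "N \<in> {N \<in> p_sub p (Zpow m). N \<subseteq> U}"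
      then have N: "N \<in> p_sub p (Zpow m)" "N \<subseteq> U" by auto
      define N0 where "N0 = Zpow m \<inter> F -` N"
      have N0: "addsub N0" "N0 \<subseteq> Zpow m"
        unfolding N0_def using addsub_Int[OF addsub_Zpow addsub_vimage[OF F(1) p_sub_D(1)[OF N(1)]]] by auto
      have FN0: "F ` N0 = N" unfolding N0_def using N(2) F(3) by auto
      have "N \<in> p_sub p U" by (rule p_sub_between(2)[OF p addsub_Zpow N(1) U'(1) N(2) U'(2)])
      then have "\<exists>k. idx (Zpow m) N0 = p ^ k" using idxF[OF N0] unfolding FN0 p_sub_def by auto
      then have "N0 \<in> p_sub p (Zpow m)" using N0 unfolding p_sub_def by blast
      then show "N \<in> (`) F ` p_sub p (Zpow m)" using FN0 by (intro image_eqI[where f = "(`) F" and x = N0]) (rule sym)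
    qed
  qed
  show ?thesis
  proof (rule gen_fun_reindex[OF bij])
    have g: "gen_fun r (p_sub p (Zpow m)) (\<lambda>N. real p ^ (1 * log_idx p (Zpow m) N)) (log_idx p (Zpow m)) (lattice_zeta p m 1)"
      by (rule gen_fun_lattices[OF p r])
    show "gen_fun r (p_sub p (Zpow m)) (\<lambda>N. c0 * real p ^ log_idx p (Zpow m) (F ` N)) (\<lambda>N. log_idx p (Zpow m) (F ` N) + e0)
      (\<lambda>z. of_real (c0 * real p ^ ?u) * z ^ (?u + e0) * lattice_zeta p m 1 z)"
      unfolding gen_fun_def
    proof (intro conjI ballI allI impI)
      show "0 \<le> c0 * real p ^ log_idx p (Zpow m) (F ` N)" for N using c0 by simp
      fix z :: complex assume z: "norm z < r"
      from has_sum_cmult_right[OF gfsD[OF g z], of "of_real (c0 * real p ^ ?u) * z ^ (?u + e0)"]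
      show "((\<lambda>N. of_real (c0 * real p ^ log_idx p (Zpow m) (F ` N)) * z ^ (log_idx p (Zpow m) (F ` N) + e0)) has_sum
        of_real (c0 * real p ^ ?u) * z ^ (?u + e0) * lattice_zeta p m 1 z) (p_sub p (Zpow m))"
        by (rule has_sum_cong[THEN iffD1, rotated]) (simp add: lg power_add)
    qed
  qed
qed

text \<open>Of the exponent \<open>Suc m\<close> of \<open>M\<close>, the part \<open>m\<close>
  counts homomorphisms and 1 is the share of \<open>M\<close> in the number of cosets of
  \<open>K\<close>. The share of \<open>N\<close> is summed by \<open>gen_fun_sublattices\<close>,
  which leaves the weight of \<open>(M : p^a)\<close> in its place.\<close>

lemma gen_fun_pairs:
  assumes p: "prime p" and r: "real p ^ (1 + m) * r \<le> 1"
    and outer: "gen_fun r (p_sub p (Zpow m) \<times> UNIV)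
      (\<lambda>(M, a). real p ^ (Suc m * log_idx p (Zpow m) M + log_idx p (Zpow m) (colon p m a M)))
      (\<lambda>(M, a). log_idx p (Zpow m) M + log_idx p (Zpow m) (colon p m a M) + a) \<Psi>"
  shows "gen_fun r (twist.pairs (Zpow2 m) twist_map p) (\<lambda>(K, a). real p ^ log_idx p (Zpow2 m) K)
    (\<lambda>(K, a). log_idx p (Zpow2 m) K + a) (\<lambda>z. \<Psi> z * lattice_zeta p m 1 z)"
proof -
  interpret T: twist "Zpow2 m" twist_map by (rule twist_Zpow2)
  let ?l = "log_idx p (Zpow m)"
  let ?T = "Sigma (p_sub p (Zpow m) \<times> UNIV) (\<lambda>(M, a). {N \<in> p_sub p (Zpow m). N \<subseteq> colon p m a M})"
  have triples: "gen_fun r ?T (\<lambda>((M, a), N). real p ^ (Suc m * ?l M) * real p ^ ?l N)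
      (\<lambda>((M, a), N). ?l N + (?l M + a)) (\<lambda>z. \<Psi> z * lattice_zeta p m 1 z)"
  proof (rule gen_fun_Sigma[OF outer])
    fix x assume x: "x \<in> p_sub p (Zpow m) \<times> (UNIV :: nat set)"
    obtain M a where Ma: "x = (M, a)" "M \<in> p_sub p (Zpow m)" using x by (cases x) auto
    show "gen_fun r ((\<lambda>(M, a). {N \<in> p_sub p (Zpow m). N \<subseteq> colon p m a M}) x)
      (\<lambda>N. (\<lambda>((M, a), N). real p ^ (Suc m * ?l M) * real p ^ ?l N) (x, N))
      (\<lambda>N. (\<lambda>((M, a), N). ?l N + (?l M + a)) (x, N))
      (\<lambda>z. of_real ((\<lambda>(M, a). real p ^ (Suc m * ?l M + ?l (colon p m a M))) x)
        * z ^ ((\<lambda>(M, a). ?l M + ?l (colon p m a M) + a) x) * lattice_zeta p m 1 z)"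
      unfolding Ma(1) prod.case
    proof (rule gen_fun_cong)
      show "gen_fun r {N \<in> p_sub p (Zpow m). N \<subseteq> colon p m a M}
        (\<lambda>N. real p ^ (Suc m * ?l M) * real p ^ ?l N) (\<lambda>N. ?l N + (?l M + a))
        (\<lambda>z. of_real (real p ^ (Suc m * ?l M) * real p ^ ?l (colon p m a M))
          * z ^ (?l (colon p m a M) + (?l M + a)) * lattice_zeta p m 1 z)"
        by (rule gen_fun_sublattices[OF p colon_p_sub[OF p Ma(2)] r]) simp
      show "of_real (real p ^ (Suc m * ?l M) * real p ^ ?l (colon p m a M))
          * z ^ (?l (colon p m a M) + (?l M + a)) * lattice_zeta p m 1 z
        = of_real (real p ^ (Suc m * ?l M + ?l (colon p m a M)))
          * z ^ (?l M + ?l (colon p m a M) + a) * lattice_zeta p m 1 z" for z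
        by (simp only: power_add add_ac)
    qed (rule refl)+
  qed
  show ?thesis
  proof (rule gen_fun_finite_fibres[where f = "\<lambda>(K, a). ((vert_part K, a), base_part K)", OF _ triples])
    show "(\<lambda>(K, a). ((vert_part K, a), base_part K)) ` T.pairs p \<subseteq> ?T"
    proof (rule image_subsetI)
      fix x assume "x \<in> T.pairs p"
      then obtain K a where x: "x = (K, a)" "K \<in> p_sub p (Zpow2 m)" "T.stable p K a"
        unfolding T.pairs_def by blast
      show "(\<lambda>(K, a). ((vert_part K, a), base_part K)) x \<in> ?T"
        using p_sub_Zpow2(1,2)[OF p x(2)] x(3) unfolding x(1) stable_iff[OF x(2)] by simp
    qed
    show "(\<lambda>(K, a). real p ^ log_idx p (Zpow2 m) K) x
        = (\<lambda>((M, a), N). real p ^ (?l M + ?l N)) ((\<lambda>(K, a). ((vert_part K, a), base_part K)) x)"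
      if "x \<in> T.pairs p" for x
      using that p_sub_Zpow2(3)[OF p] by (auto simp: T.pairs_def)
    show "(\<lambda>(K, a). log_idx p (Zpow2 m) K + a) x
        = (\<lambda>((M, a), N). ?l N + (?l M + a)) ((\<lambda>(K, a). ((vert_part K, a), base_part K)) x)"
      if "x \<in> T.pairs p" for x
      using that p_sub_Zpow2(3)[OF p] by (auto simp: T.pairs_def)
    show "0 \<le> (\<lambda>((M, a), N). real p ^ (?l M + ?l N)) x" for x :: "(ivec set \<times> nat) \<times> ivec set"
      by (cases x) (auto split: prod.splits)
    fix x assume x: "x \<in> ?T"
    obtain M a N where xe: "x = ((M, a), N)" by (cases x) force
    have MN: "M \<in> p_sub p (Zpow m)" "N \<in> p_sub p (Zpow m)" "N \<subseteq> colon p m a M"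
      using x unfolding xe by simp_all
    have eq: "{y \<in> T.pairs p. (\<lambda>(K, a). ((vert_part K, a), base_part K)) y = x}
        = (\<lambda>K. (K, a)) ` {K \<in> p_sub p (Zpow2 m). vert_part K = M \<and> base_part K = N}"
    proof (intro equalityI subsetI)
      fix y assume "y \<in> {y \<in> T.pairs p. (\<lambda>(K, a). ((vert_part K, a), base_part K)) y = x}"
      then show "y \<in> (\<lambda>K. (K, a)) ` {K \<in> p_sub p (Zpow2 m). vert_part K = M \<and> base_part K = N}"
        by (auto simp: xe T.pairs_def)
    next
      fix y assume "y \<in> (\<lambda>K. (K, a)) ` {K \<in> p_sub p (Zpow2 m). vert_part K = M \<and> base_part K = N}"
      then obtain K where K: "K \<in> p_sub p (Zpow2 m)" "vert_part K = M" "base_part K = N" "y = (K, a)" by blast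
      have "T.stable p K a" unfolding stable_iff[OF K(1)] K(2,3) by (rule MN(3))
      then show "y \<in> {y \<in> T.pairs p. (\<lambda>(K, a). ((vert_part K, a), base_part K)) y = x}"
        using K by (simp add: xe T.pairs_def)
    qed
    have inj: "inj_on (\<lambda>K. (K, a)) Z" for Z :: "(ivec \<times> ivec) set set" by (simp add: inj_on_def)
    show "finite {y \<in> T.pairs p. (\<lambda>(K, a). ((vert_part K, a), base_part K)) y = x}"
      unfolding eq by (rule finite_imageI[OF card_fibre_MN(1)[OF p MN(1,2)]])
    have "card {y \<in> T.pairs p. (\<lambda>(K, a). ((vert_part K, a), base_part K)) y = x} = p ^ (m * ?l M)"
      unfolding eq card_image[OF inj] by (rule card_fibre_MN(2)[OF p MN(1,2)])
    then show "real (card {y \<in> T.pairs p. (\<lambda>(K, a). ((vert_part K, a), base_part K)) y = x})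
        * (\<lambda>((M, a), N). real p ^ (?l M + ?l N)) x
        = (\<lambda>((M, a), N). real p ^ (Suc m * ?l M) * real p ^ ?l N) x"
      by (simp add: xe power_add)
  qed
qed

section \<open>The zeta function\<close>

lemma prime_complex_pow_neq_1: "prime p \<Longrightarrow> i > 0 \<Longrightarrow> (of_nat p :: complex) ^ i \<noteq> 1"
  using prime_gt_1_nat[of p] power_gt1_lemma[of p] one_less_power[of p i]
  unfolding of_nat_power[symmetric] of_nat_eq_1_iff by simp

text \<open>With \<open>h\<close> the next letter, passing to \<open>1/p\<close> turns
  \<open>gauss_binom h j p\<close> into \<open>p^(j(h-j))\<close> times its value there. Combined
  with \<open>p^(j(m-h))\<close> this gives \<open>p^(j(m-j))\<close>, from which the neighbour
  \<open>h\<close> has disappeared, so the power of \<open>p\<close> is a product over single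
  letters.\<close>

lemma of_nat_type_count:
  assumes p: "prime p"
  shows "sorted js \<Longrightarrow> set js \<subseteq> {..<m} \<Longrightarrow>
    (of_nat (type_count p m js) :: complex)
      = flag_binom m (set js) (inverse (of_nat p)) * of_nat p ^ (\<Sum>j\<leftarrow>js. j * (m - j))"
proof (induction js)
  case (Cons j js)
  let ?P = "of_nat p :: complex" and ?h = "hd (js @ [m])"
  have IH: "of_nat (type_count p m js) = flag_binom m (set js) (inverse ?P) * ?P ^ (\<Sum>j\<leftarrow>js. j * (m - j))"
    using Cons by simp
  have srt: "sorted js" "\<And>l. l \<in> set js \<Longrightarrow> j \<le> l" and jm: "j < m" and jsm: "set js \<subseteq> {..<m}"
    using Cons.prems by auto
  have hMin: "Min (insert m (set js)) = ?h"
  proof (cases js)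
    case (Cons k ks)
    then show ?thesis using srt jsm by (intro Min_eqI) auto
  qed simp
  have jh: "j \<le> ?h" and hm: "?h \<le> m" using srt jm jsm by (cases js; auto)+
  have 1: "gauss_binom ?h j ?P = ?P ^ (j * (?h - j)) * gauss_binom ?h j (inverse ?P)"
    by (rule gauss_binom_inverse[OF _ prime_complex_pow_neq_1[OF p] jh]) (use prime_gt_0_nat[OF p] in auto)
  have "j * (m - ?h) + j * (?h - j) = j * (m - j)" using jh hm by (simp add: distrib_left[symmetric])
  then have 2: "?P ^ (j * (m - ?h)) * ?P ^ (j * (?h - j)) = ?P ^ (j * (m - j))"
    by (simp add: power_add[symmetric])
  have 3: "flag_binom m (set (j # js)) (inverse ?P) = gauss_binom ?h j (inverse ?P) * flag_binom m (set js) (inverse ?P)"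
  proof (cases "j \<in> set js")
    \<comment> \<open>A repeated letter contributes \<open>gauss_binom j j\<close>, which is 1; the
      flag number thus depends only on the set of letters.\<close>
    case True
    then obtain k ks where js: "js = k # ks" by (cases js) auto
    have "j \<le> k" using srt(2)[of k] unfolding js by simp
    moreover have "k \<le> j" using True srt(1) unfolding js by auto
    ultimately have "?h = j" unfolding js by simp
    then show ?thesis using True by (simp add: insert_absorb)
  next
    case False
    have "flag_binom m (insert j (set js)) (inverse ?P) = gauss_binom (Min (insert m (set js))) j (inverse ?P) * flag_binom m (set js) (inverse ?P)"
      by (rule flag_binom_insert_min) (use False srt in \<open>auto simp: le_less\<close>)
    then show ?thesis unfolding hMin by simp
  qed
  have "(of_nat (type_count p m (j # js)) :: complex)
      = flag_binom m (set js) (inverse ?P) * ?P ^ (\<Sum>j\<leftarrow>js. j * (m - j))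
        * (?P ^ (j * (m - ?h)) * (?P ^ (j * (?h - j)) * gauss_binom ?h j (inverse ?P)))"
    unfolding type_count.simps of_nat_mult of_nat_power IH of_nat_gauss_binom 1 ..
  also have "\<dots> = gauss_binom ?h j (inverse ?P) * flag_binom m (set js) (inverse ?P)
      * ((?P ^ (j * (m - ?h)) * ?P ^ (j * (?h - j))) * ?P ^ (\<Sum>j\<leftarrow>js. j * (m - j)))"
    by (simp only: mult_ac)
  also have "\<dots> = flag_binom m (set (j # js)) (inverse ?P) * ?P ^ (\<Sum>j\<leftarrow>j # js. j * (m - j))"
    unfolding 2 3 by (simp add: power_add)
  finally show ?case .
qed simp

text \<open>The numerical data of the theorem as monomials in \<open>z = p^(-s)\<close>, with
  \<open>m = n - 1\<close>; \<open>X_mon\<close> is the companion.\<close>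

definition Y_mon :: "nat \<Rightarrow> nat \<Rightarrow> complex \<Rightarrow> nat \<Rightarrow> complex"
  where "Y_mon p m z j = z ^ (Suc m - j) * of_nat p ^ ((Suc m + j) * (m - j))"

definition X_mon :: "nat \<Rightarrow> nat \<Rightarrow> complex \<Rightarrow> nat \<Rightarrow> complex"
  where "X_mon p m z j = (z ^ 2 * of_nat p ^ (Suc m + 1 + j)) ^ (m - j)"

text \<open>A letter \<open>j\<close> among the first \<open>a\<close> collects \<open>p\<close> to
  the power \<open>j(m-j) + (m+1)(m-j)\<close> and \<open>z^(m-j)\<close>, together with one
  \<open>z\<close> from \<open>z^a\<close>. A later letter is counted a second time through
  \<open>(M : p^a)\<close> and collects \<open>p^(m-j) z^(m-j)\<close> more, but no part of
  \<open>z^a\<close>.\<close>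

lemma word_monomial:
  fixes z :: complex
  assumes "set js \<subseteq> {..<m}"
  shows "of_nat p ^ (\<Sum>j\<leftarrow>js. j * (m - j))
      * (of_nat p ^ (Suc m * (\<Sum>j\<leftarrow>js. m - j) + (\<Sum>j\<leftarrow>drop a js. m - j))
         * z ^ ((\<Sum>j\<leftarrow>js. m - j) + (\<Sum>j\<leftarrow>drop a js. m - j) + a))
    = prod_list (map (Y_mon p m z) (take a js)) * prod_list (map (X_mon p m z) (drop a js)) * z ^ (a - length js)"
  using assms
proof (induction js arbitrary: a)
  case Nil
  then show ?case by simp
next
  case (Cons j js)
  then have j: "j < m" and js: "set js \<subseteq> {..<m}" by auto
  obtain d where d: "m = j + d" using j by (metis less_imp_add_positive)
  let ?P = "of_nat p :: complex"
  show ?case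
  proof (cases a)
    case 0
    have X: "X_mon p m z j = ?P ^ (j * d) * (?P ^ (Suc m * d) * ?P ^ d) * (z ^ d * z ^ d)"
    proof -
      have "(Suc m + 1 + j) * d = j * d + (Suc m * d + d)" by (simp add: algebra_simps)
      then have "?P ^ ((Suc m + 1 + j) * d) = ?P ^ (j * d) * (?P ^ (Suc m * d) * ?P ^ d)"
        by (simp only: power_add)
      moreover have "(z ^ 2) ^ d = z ^ d * z ^ d" by (simp only: power_mult_distrib power2_eq_square)
      moreover have "m - j = d" using d by simp
      ultimately show ?thesis
        unfolding X_mon_def by (simp only: power_mult_distrib power_mult[symmetric] mult_ac)
    qed
    have IH: "?P ^ (\<Sum>j\<leftarrow>js. j * (m - j))
      * (?P ^ (Suc m * (\<Sum>j\<leftarrow>js. m - j) + (\<Sum>j\<leftarrow>js. m - j))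
         * z ^ ((\<Sum>j\<leftarrow>js. m - j) + (\<Sum>j\<leftarrow>js. m - j))) = prod_list (map (X_mon p m z) js)"
      using Cons.IH[OF js, of 0] by simp
    have md: "m - j = d" using d by simp
    show ?thesis
      unfolding 0 drop_0 take_0 list.map prod_list.Cons prod_list.Nil sum_list.Cons X IH[symmetric] md
      by (simp add: power_add distrib_left mult_ac)
  next
    case (Suc b)
    have Y: "Y_mon p m z j = ?P ^ (j * d) * ?P ^ (Suc m * d) * (z ^ d * z)"
    proof -
      have "(Suc m + j) * d = j * d + Suc m * d" by (simp add: algebra_simps)
      then have "?P ^ ((Suc m + j) * d) = ?P ^ (j * d) * ?P ^ (Suc m * d)" by (simp only: power_add)
      moreover have "Suc m - j = Suc d" "m - j = d" using d by simp_all
      ultimately show ?thesis unfolding Y_mon_def by (simp only: power_Suc mult_ac)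
    qed
    have md: "m - j = d" using d by simp
    show ?thesis
      unfolding Suc drop_Suc_Cons take_Suc_Cons list.map prod_list.Cons sum_list.Cons Y md
        length_Cons diff_Suc_Suc
      using Cons.IH[OF js, of b] by (simp add: power_add distrib_left mult_ac)
  qed
qed

lemma Y_mon_top [simp]: "Y_mon p m z m = z"
  by (simp add: Y_mon_def)

text \<open>Used with \<open>n = 2 * Suc m\<close>, a crude common bound for the ratio of the
  exponent of \<open>p\<close> to that of \<open>z\<close> in all monomials of the data.\<close>

lemma norm_monomial_less_1:
  fixes z :: complex
  assumes p: "p \<ge> 1" and z: "norm z < 1 / real p ^ n" and e: "e > 0" and k: "k \<le> n * e"
  shows "norm (z ^ e * of_nat p ^ k) < 1"
proof -
  have "norm (z ^ e * of_nat p ^ k) = norm z ^ e * real p ^ k"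
    by (simp add: norm_mult norm_power)
  also have "\<dots> \<le> norm z ^ e * real p ^ (n * e)"
    using p k by (intro mult_left_mono power_increasing) auto
  also have "\<dots> = (norm z * real p ^ n) ^ e" by (simp add: power_mult_distrib power_mult)
  also have "\<dots> < 1"
    using z p e by (intro power_less_one_iff[THEN iffD2]) (auto simp: field_simps)
  finally show ?thesis .
qed

lemma norm_Y_mon:
  assumes p: "p \<ge> 1" and z: "norm z < 1 / real p ^ (2 * Suc m)" and j: "j \<le> m"
  shows "norm (Y_mon p m z j) < 1"
  unfolding Y_mon_def
proof (rule norm_monomial_less_1[OF p z])
  show "(Suc m + j) * (m - j) \<le> 2 * Suc m * (Suc m - j)" using j by (intro mult_le_mono) auto
qed (use j in simp)

lemma norm_X_mon:
  assumes p: "p \<ge> 1" and z: "norm z < 1 / real p ^ (2 * Suc m)" and j: "j < m"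
  shows "norm (X_mon p m z j) < 1"
proof -
  have "norm (z ^ 2 * of_nat p ^ (Suc m + 1 + j)) < 1"
    by (rule norm_monomial_less_1[OF p z]) (use j in auto)
  then show ?thesis unfolding X_mon_def norm_power using j by (simp add: power_less_one_iff)
qed

text \<open>The sum over the pairs \<open>(M, a)\<close>: the first factor is
  \<open>\<zeta>_p(ns - n(n-1))\<close>, the geometric series of the letter 0, and the second is
  \<open>W\<close>.\<close>

definition chain_gf :: "nat \<Rightarrow> nat \<Rightarrow> complex \<Rightarrow> complex"
  where "chain_gf p m z = 1 / (1 - Y_mon p m z 0) * (\<Sum>I\<in>Pow {1..m-1}.
    flag_binom m I (inverse (of_nat p)) * W_I m I (X_mon p m z) (Y_mon p m z))"

lemma gen_fun_words:
  assumes p: "prime p" and m: "m \<ge> 1"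
  shows "gen_fun (1 / real p ^ (2 * Suc m)) (words_idx m)
    (\<lambda>(js, a). real (type_count p m js) * real p ^ (Suc m * (\<Sum>j\<leftarrow>js. m - j) + (\<Sum>j\<leftarrow>drop a js. m - j)))
    (\<lambda>(js, a). (\<Sum>j\<leftarrow>js. m - j) + (\<Sum>j\<leftarrow>drop a js. m - j) + a) (chain_gf p m)"
  unfolding gen_fun_def
proof (intro conjI ballI allI impI)
  have p1: "p \<ge> 1" using prime_gt_0_nat[OF p] by simp
  fix z :: complex assume z: "norm z < 1 / real p ^ (2 * Suc m)"
  let ?\<beta> = "\<lambda>J. flag_binom m J (inverse (of_nat p)) :: complex"
  have \<beta>0: "?\<beta> (insert 0 J) = ?\<beta> J" if "J \<subseteq> {1..m-1}" for J
    using that finite_subset[of J "{1..m-1}"] by (intro flag_binom_insert_0) simp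
  have chain_gf: "(\<Sum>(A, B)\<in>cuts {..<m}. ?\<beta> (A \<union> B)
        * ((\<Prod>i\<in>A. geo (Y_mon p m z i)) * (\<Prod>i\<in>B. geo (X_mon p m z i))))
      + (\<Sum>A\<in>Pow {..<m}. ?\<beta> A * ((\<Prod>i\<in>A. geo (Y_mon p m z i)) * geo (Y_mon p m z m))) = chain_gf p m z"
    unfolding chain_gf_def by (rule sum_words_eq_W[OF m]) (rule \<beta>0, assumption, rule norm_Y_mon[OF p1 z le0])
  have "(word_wt m ?\<beta> (X_mon p m z) (Y_mon p m z) has_sum chain_gf p m z) (words_idx m)"
    unfolding chain_gf[symmetric] by (rule has_sum_words) (rule norm_Y_mon[OF p1 z], assumption, rule norm_X_mon[OF p1 z], assumption)
  then show "((\<lambda>x. of_real ((\<lambda>(js, a). real (type_count p m js)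
        * real p ^ (Suc m * (\<Sum>j\<leftarrow>js. m - j) + (\<Sum>j\<leftarrow>drop a js. m - j))) x)
      * z ^ ((\<lambda>(js, a). (\<Sum>j\<leftarrow>js. m - j) + (\<Sum>j\<leftarrow>drop a js. m - j) + a) x)) has_sum chain_gf p m z)
      (words_idx m)"
  proof (rule has_sum_cong[THEN iffD1, rotated])
    fix x assume x: "x \<in> words_idx m"
    obtain js a where xe: "x = (js, a)" by (cases x)
    have js: "sorted js" "set js \<subseteq> {..<m}" using x unfolding xe words_idx_def by auto
    let ?s = "\<Sum>j\<leftarrow>js. m - j" and ?d = "\<Sum>j\<leftarrow>drop a js. m - j"
    have "of_real (real (type_count p m js) * real p ^ (Suc m * ?s + ?d)) * z ^ (?s + ?d + a)
        = of_nat (type_count p m js) * (of_nat p ^ (Suc m * ?s + ?d) * z ^ (?s + ?d + a))"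
      by (simp only: of_real_mult of_real_power of_real_of_nat_eq mult.assoc)
    also have "\<dots> = ?\<beta> (set js) * (prod_list (map (Y_mon p m z) (take a js))
        * prod_list (map (X_mon p m z) (drop a js)) * z ^ (a - length js))"
      unfolding of_nat_type_count[OF p js] word_monomial[OF js(2), of p a z, symmetric] by (simp only: mult.assoc)
    finally show "word_wt m ?\<beta> (X_mon p m z) (Y_mon p m z) x
      = of_real ((\<lambda>(js, a). real (type_count p m js)
        * real p ^ (Suc m * (\<Sum>j\<leftarrow>js. m - j) + (\<Sum>j\<leftarrow>drop a js. m - j))) x)
      * z ^ ((\<lambda>(js, a). (\<Sum>j\<leftarrow>js. m - j) + (\<Sum>j\<leftarrow>drop a js. m - j) + a) x)"
      unfolding xe word_wt_def prod.case Y_mon_top by (simp only: mult.assoc)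
  qed
qed auto

lemma gen_fun_sublattice_chain:
  assumes p: "prime p" and m: "m \<ge> 1"
  shows "gen_fun (1 / real p ^ (2 * Suc m)) (p_sub p (Zpow m) \<times> UNIV)
    (\<lambda>(M, a). real p ^ (Suc m * log_idx p (Zpow m) M + log_idx p (Zpow m) (colon p m a M)))
    (\<lambda>(M, a). log_idx p (Zpow m) M + log_idx p (Zpow m) (colon p m a M) + a) (chain_gf p m)"
proof -
  define jt where "jt M = (THE js. M \<in> of_type p m js)" for M
  have jt: "jt M = js" if "M \<in> of_type p m js" for M js
    unfolding jt_def using that of_type_unique[OF p _ that] by (intro the_equality)
  have jtM: "M \<in> of_type p m (jt M)" if M: "M \<in> p_sub p (Zpow m)" for M
  proof -
    obtain js where js: "M \<in> of_type p m js" using of_type_exists[OF p M] by (elim exE)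
    then show ?thesis unfolding jt[OF js] .
  qed
  have lM: "log_idx p (Zpow m) M = (\<Sum>j\<leftarrow>jt M. m - j)" if M: "M \<in> p_sub p (Zpow m)" for M
    by (rule of_type_log_idx[OF p jtM[OF M]])
  have lU: "log_idx p (Zpow m) (colon p m a M) = (\<Sum>j\<leftarrow>drop a (jt M). m - j)" if M: "M \<in> p_sub p (Zpow m)" for a M
    by (rule of_type_log_idx[OF p of_type_colon[OF jtM[OF M]]])
  show ?thesis
  proof (rule gen_fun_finite_fibres[where f = "\<lambda>(M, a). (jt M, a)", OF _ gen_fun_words[OF p m]])
    show "(\<lambda>(M, a). (jt M, a)) ` (p_sub p (Zpow m) \<times> UNIV) \<subseteq> words_idx m"
      using of_type_sorted[OF p jtM] by (auto simp: words_idx_def)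
    show "(\<lambda>(M, a). real p ^ (Suc m * log_idx p (Zpow m) M + log_idx p (Zpow m) (colon p m a M))) x
        = (\<lambda>(js, a). real p ^ (Suc m * (\<Sum>j\<leftarrow>js. m - j) + (\<Sum>j\<leftarrow>drop a js. m - j)))
            ((\<lambda>(M, a). (jt M, a)) x)"
      if "x \<in> p_sub p (Zpow m) \<times> UNIV" for x
      using that lM lU by auto
    show "(\<lambda>(M, a). log_idx p (Zpow m) M + log_idx p (Zpow m) (colon p m a M) + a) x
        = (\<lambda>(js, a). (\<Sum>j\<leftarrow>js. m - j) + (\<Sum>j\<leftarrow>drop a js. m - j) + a) ((\<lambda>(M, a). (jt M, a)) x)"
      if "x \<in> p_sub p (Zpow m) \<times> UNIV" for x
      using that lM lU by auto
    show "0 \<le> (\<lambda>(js, a). real p ^ (Suc m * (\<Sum>j\<leftarrow>js. m - j) + (\<Sum>j\<leftarrow>drop a js. m - j))) x"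
      for x :: "nat list \<times> nat"
      by (cases x) simp
    fix x assume x: "x \<in> words_idx m"
    obtain js a where xe: "x = (js, a)" by (cases x)
    have js: "set js \<subseteq> {..<m}" using x unfolding xe words_idx_def by auto
    have eq: "{y \<in> p_sub p (Zpow m) \<times> UNIV. (\<lambda>(M, a). (jt M, a)) y = x} = (\<lambda>M. (M, a)) ` of_type p m js"
    proof (intro equalityI subsetI)
      fix y assume y: "y \<in> {y \<in> p_sub p (Zpow m) \<times> UNIV. (\<lambda>(M, a). (jt M, a)) y = x}"
      obtain M b where ye: "y = (M, b)" by (cases y)
      have "M \<in> p_sub p (Zpow m)" "jt M = js" "b = a" using y unfolding ye xe by auto
      then show "y \<in> (\<lambda>M. (M, a)) ` of_type p m js" unfolding ye using jtM[of M] by auto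
    next
      fix y assume "y \<in> (\<lambda>M. (M, a)) ` of_type p m js"
      then obtain M where M: "y = (M, a)" "M \<in> of_type p m js" by (elim imageE)
      show "y \<in> {y \<in> p_sub p (Zpow m) \<times> UNIV. (\<lambda>(M, a). (jt M, a)) y = x}"
        using of_type_p_sub[OF M(2)] jt[OF M(2)] unfolding M(1) xe by simp
    qed
    have fin: "finite (of_type p m js)" and cd: "card (of_type p m js) = type_count p m js"
      using card_of_type[OF p js] by simp_all
    show "finite {y \<in> p_sub p (Zpow m) \<times> UNIV. (\<lambda>(M, a). (jt M, a)) y = x}"
      unfolding eq by (rule finite_imageI[OF fin])
    have inj: "inj_on (\<lambda>M. (M, a)) Z" for Z :: "ivec set set" by (simp add: inj_on_def)
    have "card {y \<in> p_sub p (Zpow m) \<times> UNIV. (\<lambda>(M, a). (jt M, a)) y = x} = type_count p m js"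
      unfolding eq card_image[OF inj] by (rule cd)
    then show "real (card {y \<in> p_sub p (Zpow m) \<times> UNIV. (\<lambda>(M, a). (jt M, a)) y = x})
        * (\<lambda>(js, a). real p ^ (Suc m * (\<Sum>j\<leftarrow>js. m - j) + (\<Sum>j\<leftarrow>drop a js. m - j))) x
      = (\<lambda>(js, a). real (type_count p m js)
        * real p ^ (Suc m * (\<Sum>j\<leftarrow>js. m - j) + (\<Sum>j\<leftarrow>drop a js. m - j))) x"
      unfolding xe prod.case by (simp only:)
  qed
qed

section \<open>From power series in \<open>z\<close> to Dirichlet series in \<open>s\<close>\<close>

lemma powr_of_nat_power:
  assumes p: "p > 0"
  shows "(of_nat (p ^ k) :: complex) powr (- s) = (of_nat p powr (- s)) ^ k"
proof -
  have "(of_nat p powr (- s)) ^ k = (of_nat p :: complex) powr (of_nat k * - s)"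
    using p by (simp add: powr_power mult.commute)
  also have "\<dots> = exp (- s * (of_nat k * Ln (of_nat p)))"
    using p by (simp add: powr_def mult_ac)
  also have "of_nat k * Ln (of_nat p :: complex) = Ln (of_nat (p ^ k))"
  proof -
    have "Ln (of_nat (p ^ k) :: complex) = of_real (ln (real p ^ k))"
      using p by (metis Ln_of_nat of_nat_0_less_iff of_nat_power zero_less_power)
    also have "\<dots> = of_nat k * of_real (ln (real p))" using p by (simp add: ln_realpow)
    also have "of_real (ln (real p)) = (Ln (of_nat p) :: complex)" using p by (simp add: Ln_of_nat)
    finally show ?thesis by simp
  qed
  finally show ?thesis using p by (simp add: powr_def)
qed

lemma zeta_p_eq:
  assumes p: "p > 0" and u: "of_nat p powr (- s) = u" and n: "norm u < 1"
  shows "zeta_p p s = 1 / (1 - u)"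
proof -
  have "(\<lambda>i. of_nat p powr (- (of_nat i * s)) :: complex) = (\<lambda>i. u ^ i)"
  proof
    fix i
    show "of_nat p powr (- (of_nat i * s)) = u ^ i"
      unfolding u[symmetric] using p by (simp add: powr_power mult.commute)
  qed
  then show ?thesis unfolding zeta_p_def using suminf_geometric[OF n] by simp
qed

lemma powr_affine:
  assumes p: "p > 0"
  shows "(of_nat p :: complex) powr (of_nat k * (- s) + of_nat l) = (of_nat p powr (- s)) ^ k * of_nat p ^ l"
proof -
  have "(of_nat p :: complex) powr (of_nat k * (- s) + of_nat l)
      = of_nat p powr (of_nat k * (- s)) * of_nat p powr of_nat l"
    by (rule powr_add)
  also have "(of_nat p :: complex) powr (of_nat k * (- s)) = (of_nat p powr (- s)) ^ k"
    using p by (simp add: powr_power mult.commute)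
  also have "(of_nat p :: complex) powr of_nat l = of_nat p ^ l"
    using p by (simp add: powr_nat)
  finally show ?thesis .
qed

lemma gen_fun_G:
  assumes p: "prime p" and m: "m \<ge> 1"
  shows "gen_fun (1 / real p ^ (2 * Suc m)) (p_power_index_subgroups (G (Suc m)) p) (\<lambda>_. 1)
    (\<lambda>H. multiplicity p (subgroup_index (G (Suc m)) H)) (\<lambda>z. chain_gf p m z * lattice_zeta p m 1 z)"
proof -
  interpret T: twist "Zpow2 m" twist_map by (rule twist_Zpow2)
  interpret Gn m by unfold_locales (rule m)
  let ?r = "1 / real p ^ (2 * Suc m)"
  have p1: "real p \<ge> 1" using prime_gt_0_nat[OF p] by simp
  have "real p ^ (1 + m) \<le> real p ^ (2 * Suc m)" by (rule power_increasing[OF _ p1]) simp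
  then have r: "real p ^ (1 + m) * ?r \<le> 1" using p1 by (simp add: divide_le_eq)
  \<comment> \<open>The shift is \<open>t = 0\<close>: each subgroup of \<open>G n\<close> counts
    once.\<close>
  have "gen_fun ?r (T.pairs p) (\<lambda>(K, a). real p ^ (0 * (log_idx p (Zpow2 m) K + a)) * real p ^ log_idx p (Zpow2 m) K)
      (\<lambda>(K, a). log_idx p (Zpow2 m) K + a) (\<lambda>z. chain_gf p m z * lattice_zeta p m 1 z)"
    by (rule gen_fun_cong[OF gen_fun_pairs[OF p r gen_fun_sublattice_chain[OF p m]]]) auto
  from T.gen_fun_TG[OF p this]
  have TG: "gen_fun ?r (p_power_index_subgroups T.TG p) (\<lambda>H. real p ^ (0 * multiplicity p (subgroup_index T.TG H)))
      (\<lambda>H. multiplicity p (subgroup_index T.TG H)) (\<lambda>z. chain_gf p m z * lattice_zeta p m 1 z)" .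
  have grp: "group (G (Suc m))" by (rule group_G) simp
  have bij: "bij_betw ((`) phi) (p_power_index_subgroups (G (Suc m)) p) (p_power_index_subgroups T.TG p)"
    by (rule iso_PPI[OF phi_iso grp T.group_TG])
  let ?f = "inv_into (p_power_index_subgroups (G (Suc m)) p) ((`) phi)"
  have bij': "bij_betw ?f (p_power_index_subgroups T.TG p) (p_power_index_subgroups (G (Suc m)) p)"
    by (rule bij_betw_inv_into[OF bij])
  show ?thesis
  proof (rule gen_fun_reindex[OF bij'], rule gen_fun_cong[OF TG])
    fix H assume H: "H \<in> p_power_index_subgroups T.TG p"
    have "?f H \<in> p_power_index_subgroups (G (Suc m)) p" by (rule bij_betwE[OF bij', THEN bspec, OF H])
    then have "subgroup (?f H) (G (Suc m))" by (simp add: p_power_index_subgroups_def)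
    from iso_subgroup_index(2)[OF phi_iso grp T.group_TG this]
    show "multiplicity p (subgroup_index T.TG H) = multiplicity p (subgroup_index (G (Suc m)) (?f H))"
      unfolding bij_betw_inv_into_right[OF bij H] by simp
  qed simp_all
qed

theorem theorem1:
  fixes n p :: nat
  assumes "n \<ge> 2" and "prime p"
  shows "\<exists>\<sigma>::real. \<forall>s::complex. Re s > \<sigma> \<longrightarrow>
    (\<lambda>H. of_nat (subgroup_index (G n) H) powr (- s) :: complex)
      summable_on p_power_index_subgroups (G n) p \<and>
    local_subgroup_zeta (G n) p s =
      (\<Prod>i = 1..n - 1. zeta_p p (s - of_nat i)) *
      zeta_p p (of_nat n * s - of_nat (n * (n - 1))) *
      W (n - 1) p (X_data n p s) (Y_data n p s)"
proof -
  obtain m where nm: "n = Suc m" and m: "m \<ge> 1" using assms(1) by (cases n) auto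
  note p = assms(2)
  have p0: "p > 0" and rp: "real p > 0" and p1: "real p > 1" using prime_gt_1_nat[OF p] by simp_all
  show ?thesis unfolding nm diff_Suc_1
  \<comment> \<open>The abscissa \<open>2n\<close> corresponds to the radius \<open>p^(-2n)\<close>
    under \<open>z = p^(-s)\<close>.\<close>
  proof (intro exI[of _ "real (2 * Suc m)"] allI impI)
    fix s :: complex assume s: "Re s > real (2 * Suc m)"
    define z where "z = (of_nat p :: complex) powr (- s)"
    have "norm z = real p powr (- Re s)" unfolding z_def using p0 by (simp add: norm_powr_real_powr)
    also have "\<dots> < real p powr (- real (2 * Suc m))" using s p1 by (intro powr_less_mono) auto
    also have "\<dots> = 1 / real p ^ (2 * Suc m)"
      unfolding powr_minus powr_realpow[OF rp] by (simp only: inverse_eq_divide)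
    finally have z: "norm z < 1 / real p ^ (2 * Suc m)" .
    let ?PP = "p_power_index_subgroups (G (Suc m)) p"
    have hs: "((\<lambda>H. of_nat (subgroup_index (G (Suc m)) H) powr (- s)) has_sum (chain_gf p m z * lattice_zeta p m 1 z)) ?PP"
      using gfsD[OF gen_fun_G[OF p m] z]
    proof (rule has_sum_cong[THEN iffD1, rotated])
      fix H assume "H \<in> ?PP"
      then obtain k where k: "subgroup_index (G (Suc m)) H = p ^ k"
        by (auto simp: p_power_index_subgroups_def)
      have "multiplicity p (p ^ k) = k" using p prime_gt_1_nat[OF p] by simp
      then show "of_real 1 * z ^ multiplicity p (subgroup_index (G (Suc m)) H)
          = of_nat (subgroup_index (G (Suc m)) H) powr (- s)"
        unfolding k z_def using powr_of_nat_power[OF p0, of k s] by simp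
    qed
    have 1: "(\<Prod>i = 1..m. zeta_p p (s - of_nat i)) = lattice_zeta p m 1 z"
    proof -
      have "zeta_p p (s - of_nat (Suc i)) = 1 / (1 - of_nat p ^ (1 + i) * z)" if i: "i < m" for i
      proof (rule zeta_p_eq[OF p0])
        show "(of_nat p :: complex) powr (- (s - of_nat (Suc i))) = of_nat p ^ (1 + i) * z"
          using powr_affine[OF p0, of 1 s "Suc i"] unfolding z_def by (simp add: mult.commute)
        have "norm (z ^ 1 * of_nat p ^ (1 + i)) < 1"
          by (rule norm_monomial_less_1[OF _ z]) (use p0 i in auto)
        then show "norm (of_nat p ^ (1 + i) * z) < 1" by (simp only: power_one_right mult.commute)
      qed
      then have "(\<Prod>i<m. zeta_p p (s - of_nat (Suc i))) = lattice_zeta p m 1 z"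
        unfolding lattice_zeta_def by (intro prod.cong) auto
      then show ?thesis
        by (simp only: One_nat_def prod.atLeast1_atMost_eq)
    qed
    \<comment> \<open>The argument is chosen so that its power of \<open>p\<close> is
      \<open>Y_0 = p^(-ns + n(n-1))\<close>, the weight of a letter 0 among the first
      \<open>a\<close>.\<close>
    have 2: "zeta_p p (of_nat (Suc m) * s - of_nat (Suc m * m)) = 1 / (1 - Y_mon p m z 0)"
    proof (rule zeta_p_eq[OF p0])
      show "(of_nat p :: complex) powr (- (of_nat (Suc m) * s - of_nat (Suc m * m))) = Y_mon p m z 0"
      proof -
        have "- (of_nat (Suc m) * s - of_nat (Suc m * m)) = of_nat (Suc m) * (- s) + of_nat (Suc m * m)"
          by (simp only: minus_diff_eq mult_minus_right) simp
        then show ?thesis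
          using powr_affine[OF p0, of "Suc m" s "Suc m * m"] unfolding z_def Y_mon_def
          by (simp only: diff_zero add_0_right)
      qed
      show "norm (Y_mon p m z 0) < 1" using p0 by (intro norm_Y_mon[OF _ z]) auto
    qed
    have Y: "Y_data (Suc m) p s = Y_mon p m z"
    proof
      fix j
      show "Y_data (Suc m) p s j = Y_mon p m z j"
        using powr_affine[OF p0, of "Suc m - j" s "(Suc m + j) * (m - j)"]
        unfolding Y_data_def Y_mon_def z_def diff_Suc_1 diff_Suc_eq_diff_pred
        by (simp only: mult_minus_left mult_minus_right diff_Suc_1 diff_Suc_eq_diff_pred)
    qed
    have X: "X_data (Suc m) p s = X_mon p m z"
    proof
      fix j
      have "(of_nat p :: complex) powr (- 2 * s + of_nat (Suc m + 1 + j)) = z ^ 2 * of_nat p ^ (Suc m + 1 + j)"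
        using powr_affine[OF p0, of 2 s "Suc m + 1 + j"] unfolding z_def
        by (simp only: mult_minus_left mult_minus_right of_nat_numeral)
      then show "X_data (Suc m) p s j = X_mon p m z j"
        unfolding X_data_def X_mon_def by (simp only: diff_Suc_1)
    qed
    have 3: "W m p (X_data (Suc m) p s) (Y_data (Suc m) p s)
        = (\<Sum>I\<in>Pow {1..m-1}. flag_binom m I (inverse (of_nat p)) * W_I m I (X_mon p m z) (Y_mon p m z))"
      unfolding W_def X Y
    proof (intro sum.cong refl)
      fix I assume "I \<in> Pow {1..m-1}"
      then have "I \<subseteq> {1..m-1}" by blast
      moreover have "{1..m-1} \<subseteq> {..<m}" using m by auto
      ultimately have "I \<subseteq> {..<m}" by blast
      then show "poly (flag_poly m I) (inverse (of_nat p)) * W_I m I (X_mon p m z) (Y_mon p m z)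
          = flag_binom m I (inverse (of_nat p)) * W_I m I (X_mon p m z) (Y_mon p m z)"
        by (simp only: poly_flag_poly)
    qed
    have val: "chain_gf p m z * lattice_zeta p m 1 z = (\<Prod>i = 1..m. zeta_p p (s - of_nat i))
        * zeta_p p (of_nat (Suc m) * s - of_nat (Suc m * m)) * W m p (X_data (Suc m) p s) (Y_data (Suc m) p s)"
      unfolding 1 2 3 chain_gf_def by (simp only: mult_ac)
    show "(\<lambda>H. of_nat (subgroup_index (G (Suc m)) H) powr (- s) :: complex) summable_on ?PP \<and>
      local_subgroup_zeta (G (Suc m)) p s = (\<Prod>i = 1..m. zeta_p p (s - of_nat i))
        * zeta_p p (of_nat (Suc m) * s - of_nat (Suc m * m)) * W m p (X_data (Suc m) p s) (Y_data (Suc m) p s)"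
      unfolding local_subgroup_zeta_def val[symmetric]
      using has_sum_imp_summable[OF hs] infsumI[OF hs] by (rule conjI)
  qed
qed

end
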